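(* Let $G$ be a connected plane embedded graph whose external boundary is a simple cycle $C$. The following are equivalent: (a) $G$ is convex embeddable; (b) every convex combination map of $G$ is an embedding; (c) some convex combination map of $G$ is an embedding.
   Context: A face is a path-connected component of the complement of the image of $G$ in $\mathbb{R}^2$; exactly one face is unbounded (the external face); vertices on its boundary are external, the others internal; an external edge is an edge of the external boundary cycle $C$. A convex combination map of $G$ is a map $f$ from vertices to $\mathbb{R}^2$ such that: the external vertices are mapped bijectively, in cyclic order along $C$, to the corners of a convex polygon $P$; and there are coefficients $\lambda_{uv}\ge 0$ with $\sum_v\lambda_{uv}=1$, $\lambda_{uv}>0$ whenever $u$ is internal and $v$ is a neighbour of $u$, $\lambda_{uv}=0$ otherwise for internal $u$, such that $f(u)=\sum_v\lambda_{uv}f(v)$ for every internal vertex $u$. The map $f$ is an embedding if the vertex images are distinct and the straight segments $[f(u),f(v)]$, $\{u,v\}$ an edge, form a straight-edge plane embedding (relative interiors pairwise disjoint and containing no vertex image). An inverted subgraph exists if some bounded face $F$ has both endpoints of some external edge $e$ on $\partial F$ but $e\notin\partial F$. $G$ is convex embeddable if it is nonempty, every face boundary is a simple cycle, the intersection $\partial F_1\cap\partial F_2$ is connected for every two bounded faces $F_1,F_2$, and $G$ has no inverted subgraph. *)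

theory Defs
  imports "HOL-Analysis.Analysis"
begin

text \<open>A plane embedded graph: finite simple graph (V, E) with edges as 2-element
vertex sets, a vertex placement pos, and for each edge an arc c e between the
images of its endpoints; arcs meet only in common endpoints and contain no other
vertex images.\<close>

definition plane_graph ::
  "'v set \<Rightarrow> 'v set set \<Rightarrow> ('v \<Rightarrow> real^2) \<Rightarrow> ('v set \<Rightarrow> real \<Rightarrow> real^2) \<Rightarrow> bool" where
  "plane_graph V E pos c \<longleftrightarrow>
     finite V \<and>
     (\<forall>e\<in>E. \<exists>u v. u \<in> V \<and> v \<in> V \<and> u \<noteq> v \<and> e = {u, v}) \<and>
     inj_on pos V \<and>
     (\<forall>e\<in>E. arc (c e) \<and> {pathstart (c e), pathfinish (c e)} = pos ` e) \<and>
     (\<forall>e\<in>E. \<forall>w\<in>V. pos w \<in> path_image (c e) \<longrightarrow> w \<in> e) \<and>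
     (\<forall>e1\<in>E. \<forall>e2\<in>E. e1 \<noteq> e2 \<longrightarrow>
        path_image (c e1) \<inter> path_image (c e2) \<subseteq> pos ` (e1 \<inter> e2))"

definition graph_image ::
  "'v set \<Rightarrow> 'v set set \<Rightarrow> ('v \<Rightarrow> real^2) \<Rightarrow> ('v set \<Rightarrow> real \<Rightarrow> real^2) \<Rightarrow> (real^2) set" where
  "graph_image V E pos c = pos ` V \<union> (\<Union>e\<in>E. path_image (c e))"

text \<open>Faces: path-connected components of the complement of the image.\<close>
definition is_face ::
  "'v set \<Rightarrow> 'v set set \<Rightarrow> ('v \<Rightarrow> real^2) \<Rightarrow> ('v set \<Rightarrow> real \<Rightarrow> real^2) \<Rightarrow> (real^2) set \<Rightarrow> bool" where
  "is_face V E pos c F \<longleftrightarrow>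
     (\<exists>x. x \<notin> graph_image V E pos c \<and> F = path_component_set (- graph_image V E pos c) x)"

text \<open>Vertices and edges lying on the boundary of a face.\<close>
definition bd_vertices ::
  "'v set \<Rightarrow> ('v \<Rightarrow> real^2) \<Rightarrow> (real^2) set \<Rightarrow> 'v set" where
  "bd_vertices V pos F = {v\<in>V. pos v \<in> frontier F}"

definition bd_edges ::
  "'v set set \<Rightarrow> ('v set \<Rightarrow> real \<Rightarrow> real^2) \<Rightarrow> (real^2) set \<Rightarrow> 'v set set" where
  "bd_edges E c F = {e\<in>E. path_image (c e) \<subseteq> frontier F}"

text \<open>A list of vertices traversing the simple cycle with vertex set VS and edge set ES
in cyclic order.\<close>
definition cycle_list :: "'v set \<Rightarrow> 'v set set \<Rightarrow> 'v list \<Rightarrow> bool" where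
  "cycle_list VS ES vs \<longleftrightarrow>
     distinct vs \<and> length vs \<ge> 3 \<and> set vs = VS \<and>
     ES = {{vs ! i, vs ! ((i + 1) mod length vs)} | i. i < length vs}"

definition simple_cycle :: "'v set \<Rightarrow> 'v set set \<Rightarrow> bool" where
  "simple_cycle VS ES \<longleftrightarrow> (\<exists>vs. cycle_list VS ES vs)"

definition graph_connected :: "'v set \<Rightarrow> 'v set set \<Rightarrow> bool" where
  "graph_connected V E \<longleftrightarrow>
     (\<forall>u\<in>V. \<forall>v\<in>V. (u, v) \<in> {(x, y). {x, y} \<in> E}\<^sup>*)"

text \<open>External vertices / edges: those on the boundary of the unbounded face.\<close>
definition ext_vertices ::
  "'v set \<Rightarrow> 'v set set \<Rightarrow> ('v \<Rightarrow> real^2) \<Rightarrow> ('v set \<Rightarrow> real \<Rightarrow> real^2) \<Rightarrow> 'v set" where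
  "ext_vertices V E pos c =
     {v. \<exists>F. is_face V E pos c F \<and> \<not> bounded F \<and> v \<in> bd_vertices V pos F}"

definition ext_edges ::
  "'v set \<Rightarrow> 'v set set \<Rightarrow> ('v \<Rightarrow> real^2) \<Rightarrow> ('v set \<Rightarrow> real \<Rightarrow> real^2) \<Rightarrow> 'v set set" where
  "ext_edges V E pos c =
     {e. \<exists>F. is_face V E pos c F \<and> \<not> bounded F \<and> e \<in> bd_edges E c F}"

text \<open>ps lists the corners of a convex polygon in cyclic order.\<close>
definition convex_polygon_corners :: "(real^2) list \<Rightarrow> bool" where
  "convex_polygon_corners ps \<longleftrightarrow>
     distinct ps \<and> length ps \<ge> 3 \<and>
     (\<forall>p\<in>set ps. p extreme_point_of (convex hull (set ps))) \<and>
     (\<forall>i<length ps. closed_segment (ps ! i) (ps ! ((i + 1) mod length ps))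
                      face_of (convex hull (set ps)))"

definition convex_combination_map ::
  "'v set \<Rightarrow> 'v set set \<Rightarrow> ('v \<Rightarrow> real^2) \<Rightarrow> ('v set \<Rightarrow> real \<Rightarrow> real^2) \<Rightarrow> ('v \<Rightarrow> real^2) \<Rightarrow> bool" where
  "convex_combination_map V E pos c f \<longleftrightarrow>
     (\<exists>cs. cycle_list (ext_vertices V E pos c) (ext_edges V E pos c) cs \<and>
           convex_polygon_corners (map f cs)) \<and>
     (\<exists>lam :: 'v \<Rightarrow> 'v \<Rightarrow> real.
        \<forall>u \<in> V - ext_vertices V E pos c.
          (\<forall>v\<in>V. lam u v \<ge> 0) \<and> (\<Sum>v\<in>V. lam u v) = 1 \<and>
          (\<forall>v\<in>V. {u, v} \<in> E \<longrightarrow> lam u v > 0) \<and>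
          (\<forall>v\<in>V. {u, v} \<notin> E \<longrightarrow> lam u v = 0) \<and>
          f u = (\<Sum>v\<in>V. lam u v *\<^sub>R f v))"

definition is_straight_embedding ::
  "'v set \<Rightarrow> 'v set set \<Rightarrow> ('v \<Rightarrow> real^2) \<Rightarrow> bool" where
  "is_straight_embedding V E f \<longleftrightarrow>
     inj_on f V \<and>
     (\<forall>u v u' v'. {u, v} \<in> E \<longrightarrow> {u', v'} \<in> E \<longrightarrow> {u, v} \<noteq> {u', v'} \<longrightarrow>
        open_segment (f u) (f v) \<inter> open_segment (f u') (f v') = {}) \<and>
     (\<forall>u v. {u, v} \<in> E \<longrightarrow> (\<forall>w\<in>V. f w \<notin> open_segment (f u) (f v)))"

definition has_inverted_subgraph ::
  "'v set \<Rightarrow> 'v set set \<Rightarrow> ('v \<Rightarrow> real^2) \<Rightarrow> ('v set \<Rightarrow> real \<Rightarrow> real^2) \<Rightarrow> bool" where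
  "has_inverted_subgraph V E pos c \<longleftrightarrow>
     (\<exists>F e. is_face V E pos c F \<and> bounded F \<and> e \<in> ext_edges V E pos c \<and>
            e \<subseteq> bd_vertices V pos F \<and> e \<notin> bd_edges E c F)"

definition convex_embeddable ::
  "'v set \<Rightarrow> 'v set set \<Rightarrow> ('v \<Rightarrow> real^2) \<Rightarrow> ('v set \<Rightarrow> real \<Rightarrow> real^2) \<Rightarrow> bool" where
  "convex_embeddable V E pos c \<longleftrightarrow>
     V \<noteq> {} \<and>
     (\<forall>F. is_face V E pos c F \<longrightarrow> simple_cycle (bd_vertices V pos F) (bd_edges E c F)) \<and>
     (\<forall>F1 F2. is_face V E pos c F1 \<longrightarrow> bounded F1 \<longrightarrow> is_face V E pos c F2 \<longrightarrow> bounded F2 \<longrightarrow>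
        connected (frontier F1 \<inter> frontier F2)) \<and>
     \<not> has_inverted_subgraph V E pos c"

end

theory Submission
  imports Defs
begin

text \<open>
  If \<open>G\<close> is convex embeddable, Tutte's argument applies to any convex combination map \<open>f\<close>. Every
  internal vertex with a neighbour off its level has a strictly higher one, so the vertices above a
  level span a connected subgraph, and so do the vertices below. By planarity no level crosses a face
  boundary three times; hence bounded faces become simple polygons and the two faces at an inner edge
  lie on opposite sides of it. Therefore the edges crossing a generic level appear on it in the order
  in which the faces chain them together, without coincidences, and letting the level tend to a
  supposed collision of two edges or vertices shows that there is none.

  Conversely, let some convex combination map \<open>f\<close> be an embedding. A set of internal vertices attached
  to the rest of the graph at a single vertex would be collapsed by the maximum principle, which makes
  all face boundaries simple cycles. If two bounded faces share vertices \<open>a\<close> and \<open>b\<close>, a loop through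
  both separates their boundary arcs, so some arc lies in a set of internal vertices attached at \<open>a\<close> and
  \<open>b\<close> only. The maximum principle puts the images of these vertices on the segment from \<open>f a\<close> to
  \<open>f b\<close>, so they form a path that lies on both face boundaries. The same squeezing excludes inverted
  subgraphs.

  All topology is drawn from Janiszewski's theorem and the Jordan curve theorem.
\<close>

section \<open>Separation in the plane\<close>

text \<open>The definitions know a face only as a component of an open set, so no cyclic order of
  the edges at a vertex is available. Its place is taken by the connectedness of small punctured
  discs: whenever the edges at a vertex are split into two nonempty parts, some face borders edges
  of both parts, and at least two faces do once boundaries are simple cycles.

  The delicate point of the forward direction is degeneracy. A whole face or edge might be mapped
  into a line, where a level argument says nothing; excluding this consumes the connected
  intersections and the absence of inverted subgraphs. Coincidences on a level that contains
  vertices are inspected on a slightly higher level, where the crossing edges are strictly ordered.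

  The step from (b) to (c) requires that some convex combination map exists. It is found
  coordinatewise as a discrete Dirichlet problem with uniform weights, the external cycle being
  placed on a parabola.\<close>

lemma connected_component_injective_image:
  assumes "connected_component (- S) a b" "continuous_on UNIV f" "inj f"
  shows "connected_component (- (f ` S)) (f a) (f b)"
proof -
  obtain T where T: "connected T" "T \<subseteq> - S" "a \<in> T" "b \<in> T"
    using assms(1) unfolding connected_component_def by blast
  have "connected (f ` T)"
    by (meson T(1) assms(2) connected_continuous_image continuous_on_subset subset_UNIV)
  moreover have "f ` T \<subseteq> - (f ` S)"
    using T(2) assms(3) by (auto dest: injD)
  ultimately show ?thesis
    using T unfolding connected_component_def by blast
qed

text \<open>The theorem for complex numbers, transported along a linear isomorphism. The separation
  arguments below are assembled with it from pieces that do not separate.\<close>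

lemma Janiszewski_plane:
  fixes a b :: "real^2"
  assumes "compact S" "closed T" "connected (S \<inter> T)"
    and "connected_component (- S) a b" "connected_component (- T) a b"
  shows "connected_component (- (S \<union> T)) a b"
proof -
  have "DIM(real^2) = DIM(complex)" by simp
  then obtain f :: "real^2 \<Rightarrow> complex" and g where fg: "linear f" "linear g" "\<And>x. g (f x) = x" "\<And>y. f (g y) = y"
    using isomorphisms_UNIV_UNIV by metis
  have cf: "continuous_on UNIV f" and cg: "continuous_on UNIV g"
    using fg linear_continuous_on linear_conv_bounded_linear by blast+
  have inj: "inj f" "inj g" using fg by (metis injI)+
  \<comment> \<open>The image under \<open>f\<close> is the preimage under its inverse, so that
    closedness of the image follows from continuity of \<open>g\<close>.\<close>
  have eq: "f ` X = g -` X" for X using fg by (auto simp: image_def) metis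
  have "connected_component (- (f ` S \<union> f ` T)) (f a) (f b)"
  proof (rule Janiszewski)
    show "compact (f ` S)" using assms(1) cf compact_continuous_image continuous_on_subset by blast
    show "closed (f ` T)" unfolding eq using assms(2) cg
      by (simp add: continuous_closed_vimage continuous_on_eq_continuous_at)
    have "f ` S \<inter> f ` T = f ` (S \<inter> T)" using inj by (simp add: image_Int)
    then show "connected (f ` S \<inter> f ` T)"
      using assms(3) cf by (metis connected_continuous_image continuous_on_subset subset_UNIV)
  qed (use assms connected_component_injective_image cf inj in auto)
  then have "connected_component (- (g ` (f ` S \<union> f ` T))) (g (f a)) (g (f b))"
    using connected_component_injective_image cg inj by blast
  moreover have "g ` (f ` S \<union> f ` T) = S \<union> T" using fg by (auto simp: image_Un image_image)
  ultimately show ?thesis using fg by simp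
qed

lemma connected_insert_closure:
  assumes "connected Q" "q \<in> closure Q"
  shows "connected (insert q Q)"
  by (rule connected_intermediate_closure[OF assms(1)]) (use assms(2) closure_subset[of Q] in auto)

text \<open>Adding one point of the closure keeps a set connected. This is how faces, which avoid
  the graph, are linked to points on their boundary.\<close>

lemma connected_component_touch:
  assumes "connected Q" "Q \<inter> Y = {}" "q \<in> closure Q" "q \<notin> Y" "u \<in> Q"
  shows "connected_component (- Y) u q"
  unfolding connected_component_def
  using connected_insert_closure[OF assms(1,3)] assms by (intro exI[of _ "insert q Q"]) auto

text \<open>A limit point off \<open>H\<close> has an open component of its own, which would meet
  the given component and hence equal it.\<close>

lemma connected_component_closure_Diff:
  fixes H :: "'a::real_normed_vector set"
  assumes "closed H"
  shows "closure (connected_component_set (- H) x) - connected_component_set (- H) x \<subseteq> H"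
proof
  fix y assume y: "y \<in> closure (connected_component_set (- H) x) - connected_component_set (- H) x"
  show "y \<in> H"
  proof (rule ccontr)
    assume "y \<notin> H"
    then have "y \<in> connected_component_set (- H) y" by simp
    moreover have "open (connected_component_set (- H) y)"
      using assms by (simp add: open_Compl open_connected_component)
    ultimately obtain z where "z \<in> connected_component_set (- H) x" "z \<in> connected_component_set (- H) y"
      using y by (metis DiffD1 open_Int_closure_eq_empty disjoint_iff)
    then have "y \<in> connected_component_set (- H) x"
      by (metis connected_component_sym connected_component_trans mem_Collect_eq)
    then show False using y by blast
  qed
qed

text \<open>The set splits into its part in \<open>U\<close> and its part outside the closure of
  \<open>U\<close>, both relatively open.\<close>

lemma connected_subset_open_closure:
  assumes "connected C" "open U" "C \<inter> closure U \<subseteq> U" "C \<inter> U \<noteq> {}"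
  shows "C \<subseteq> U"
proof (rule ccontr)
  assume "\<not> C \<subseteq> U"
  then have "C \<inter> (- closure U) \<noteq> {}" using assms(3) by blast
  then show False
    using connectedD[OF assms(1,2), of "- closure U"] assms(3,4) closure_subset[of U]
    by (auto simp: open_Compl Int_commute)
qed

lemma arc_subset_connected:
  assumes "arc g" "0 \<le> a" "a \<le> b" "b \<le> 1"
  shows "connected (g ` {a..b})" "compact (g ` {a..b})"
proof -
  have "continuous_on {a..b} g"
    using assms by (meson arc_imp_path atLeastatMost_subset_iff continuous_on_subset path_def)
  then show "connected (g ` {a..b})" "compact (g ` {a..b})"
    by (auto intro: connected_continuous_image compact_continuous_image)
qed

lemma arc_interior_connected:
  assumes "arc g"
  shows "connected (g ` {0<..<1})"
proof -
  have "continuous_on {0<..<1} g"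
    using assms by (meson arc_imp_path continuous_on_subset greaterThanLessThan_subseteq_atLeastAtMost_iff order_refl path_def)
  then show ?thesis by (auto intro: connected_continuous_image)
qed

lemma arc_image_interior:
  assumes "arc g"
  shows "g ` {0<..<1} = path_image g - {pathstart g, pathfinish g}"
proof -
  have "g x = g 0 \<Longrightarrow> x = 0" "g x = g 1 \<Longrightarrow> x = 1" if "0 \<le> x" "x \<le> 1" for x
    using assms that by (auto simp: arc_def inj_on_def)
  note * = this
  show ?thesis
  proof (intro equalityI subsetI)
    fix y assume "y \<in> g ` {0<..<1}"
    then obtain x where x: "y = g x" "0 < x" "x < 1" by auto
    then show "y \<in> path_image g - {pathstart g, pathfinish g}"
      using *[of x] by (auto simp: path_image_def pathstart_def pathfinish_def)
  next
    fix y assume y: "y \<in> path_image g - {pathstart g, pathfinish g}"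
    then obtain x where x: "y = g x" "0 \<le> x" "x \<le> 1" by (auto simp: path_image_def)
    moreover have "x \<noteq> 0" "x \<noteq> 1" using y x by (auto simp: pathstart_def pathfinish_def)
    ultimately show "y \<in> g ` {0<..<1}" by auto
  qed
qed

lemma connected_complement_subarc:
  fixes g :: "real \<Rightarrow> real^2"
  assumes "arc g" "0 \<le> a" "a < b" "b \<le> 1"
  shows "connected (- (g ` {a..b}))"
proof -
  have "arc (subpath a b g)" using assms by (simp add: arc_subpath_arc)
  then have "connected (- path_image (subpath a b g))" by (simp add: connected_arc_complement)
  then show ?thesis using assms by (simp add: path_image_subpath)
qed

lemma connected_component_connected:
  "connected S \<Longrightarrow> x \<in> S \<Longrightarrow> y \<in> S \<Longrightarrow> connected_component S x y"
  unfolding connected_component_def by blast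

lemma connected_component_sym_trans:
  "connected_component S x z \<Longrightarrow> connected_component S y z \<Longrightarrow> connected_component S x y"
  by (rule connected_component_trans[OF _ connected_component_sym])

text \<open>If the closure missed a point of the arc, it would miss a short subarc around it. The
  two remaining pieces of the arc can be added to \<open>Y\<close> one at a time, each along a
  single point, so Janiszewski still joins \<open>x\<close> to that point; but such a connection
  could leave the component only through the missed subarc.\<close>

lemma closure_side_of_arc:
  fixes g :: "real \<Rightarrow> real^2"
  assumes Y: "compact Y" and g: "arc g" "path_image g \<inter> Y = {pathstart g, pathfinish g}"
    and s: "0 < s" "s < 1" and x: "x \<notin> Y \<union> path_image g" "connected_component (- Y) x (g s)"
  shows "g s \<in> closure (connected_component_set (- (Y \<union> path_image g)) x)"
proof (rule ccontr)
  define U where "U = connected_component_set (- (Y \<union> path_image g)) x"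
  assume "g s \<notin> closure (connected_component_set (- (Y \<union> path_image g)) x)"
  then have gs: "g s \<in> - closure U" by (simp add: U_def)
  have inj: "inj_on g {0..1}" and cont: "continuous_on {0..1} g"
    using g by (auto simp: arc_def path_def)
  have "continuous_on {0<..<1} g" using cont continuous_on_subset greaterThanLessThan_subseteq_atLeastAtMost_iff by blast
  then have "open (g -` (- closure U) \<inter> {0<..<1})"
    by (simp add: continuous_on_open_vimage open_Compl)
  then obtain e where e: "e > 0" "cball s e \<subseteq> g -` (- closure U) \<inter> {0<..<1}"
    using gs s by (metis IntI greaterThanLessThan_iff open_contains_cball vimageI)
  define a b where "a = s - e" and "b = s + e"
  have ab: "0 < a" "a < s" "s < b" "b < 1"
    and gab: "\<And>t. a \<le> t \<Longrightarrow> t \<le> b \<Longrightarrow> g t \<notin> closure U"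
  proof -
    have *: "g t \<notin> closure U \<and> 0 < t \<and> t < 1" if "s - e \<le> t" "t \<le> s + e" for t
    proof -
      have "t \<in> cball s e" using that by (auto simp: cball_def dist_real_def abs_le_iff)
      then show ?thesis using e(2) by auto
    qed
    have "0 < s - e" "s + e < 1" using *[of "s - e"] *[of "s + e"] e(1) by linarith+
    then show "0 < a" "a < s" "s < b" "b < 1"
      using e(1) by (auto simp: a_def b_def)
    show "\<And>t. a \<le> t \<Longrightarrow> t \<le> b \<Longrightarrow> g t \<notin> closure U"
      using * by (auto simp: a_def b_def)
  qed
  have meet: "g t \<in> Y \<Longrightarrow> t = 0 \<or> t = 1" if "0 \<le> t" "t \<le> 1" for t
  proof -
    assume "g t \<in> Y"
    moreover have "g t \<in> path_image g" using that by (auto simp: path_image_def)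
    ultimately have "g t = g 0 \<or> g t = g 1" using g(2) by (auto simp: pathstart_def pathfinish_def)
    then show "t = 0 \<or> t = 1" using inj that by (auto simp: inj_on_def)
  qed
  have ends: "g 0 \<in> Y" "g 1 \<in> Y" using g(2) by (auto simp: pathstart_def pathfinish_def)
  define \<alpha> \<beta> where "\<alpha> = g ` {0..a}" and "\<beta> = g ` {b..1}"
  have cl: "compact \<alpha>" "compact \<beta>"
    unfolding \<alpha>_def \<beta>_def using arc_subset_connected(2)[OF g(1)] ab by simp_all
  have x': "x \<notin> g ` {0..1}" using x(1) by (simp add: path_image_def)
  have gs': "g s \<notin> \<alpha>" "g s \<notin> \<beta>"
    unfolding \<alpha>_def \<beta>_def
    using ab inj_on_image_mem_iff[OF inj, of s "{0..a}"] inj_on_image_mem_iff[OF inj, of s "{b..1}"] by auto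
  have Yo: "Y \<inter> \<alpha> = {g 0}" unfolding \<alpha>_def using meet ends ab by force
  have "(Y \<union> \<alpha>) \<inter> \<beta> = {g 1}"
  proof -
    have "t = 1" if "b \<le> t" "t \<le> 1" "g t \<in> Y" for t using meet[of t] that ab by auto
    then have "Y \<inter> \<beta> \<subseteq> {g 1}" unfolding \<beta>_def by fastforce
    moreover have "g 1 \<in> Y \<inter> \<beta>" unfolding \<beta>_def using ends ab by auto
    ultimately have "Y \<inter> \<beta> = {g 1}" by blast
    moreover have "\<alpha> \<inter> \<beta> = {}" unfolding \<alpha>_def \<beta>_def
      using ab inj_on_image_Int[OF inj, of "{0..a}" "{b..1}"] by auto
    ultimately show ?thesis by blast
  qed
  note Yb = this
  have "connected_component (- \<alpha>) x (g s)"
    by (rule connected_component_connected)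
       (use connected_complement_subarc[OF g(1), of 0 a] ab x' gs' in \<open>auto simp: \<alpha>_def\<close>)
  then have "connected_component (- (Y \<union> \<alpha>)) x (g s)"
    using Janiszewski_plane[of Y \<alpha> x "g s"] Y cl Yo x(2) by (simp add: compact_imp_closed)
  moreover have "connected_component (- \<beta>) x (g s)"
    by (rule connected_component_connected)
       (use connected_complement_subarc[OF g(1), of b 1] ab x' gs' in \<open>auto simp: \<beta>_def\<close>)
  ultimately have cc: "connected_component (- (Y \<union> \<alpha> \<union> \<beta>)) x (g s)"
    using Janiszewski_plane[of "Y \<union> \<alpha>" \<beta> x "g s"] Y cl Yb by (simp add: compact_imp_closed compact_Un)
  define C where "C = connected_component_set (- (Y \<union> \<alpha> \<union> \<beta>)) x"
  have H: "closed (Y \<union> path_image g)" using Y g(1) by (simp add: compact_imp_closed closed_Un closed_arc_image)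
  \<comment> \<open>Within \<open>C\<close> the component \<open>U\<close> could end only on the
    middle subarc, which is disjoint from the closure of \<open>U\<close>.\<close>
  have "C \<subseteq> U"
  proof (rule connected_subset_open_closure)
    show "connected C" by (simp add: C_def)
    show "open U" unfolding U_def using H by (intro open_connected_component) (rule open_Compl)
    show "C \<inter> U \<noteq> {}" using cc x(1) unfolding C_def U_def
      by (metis (mono_tags, lifting) ComplI IntI connected_component_refl connected_component_in empty_iff mem_Collect_eq)
    show "C \<inter> closure U \<subseteq> U"
    proof
      fix y assume y: "y \<in> C \<inter> closure U"
      show "y \<in> U"
      proof (rule ccontr)
        assume "y \<notin> U"
        then have "y \<in> Y \<union> path_image g" using connected_component_closure_Diff[OF H, of x] y U_def by blast
        moreover have "y \<notin> Y \<union> \<alpha> \<union> \<beta>" using y connected_component_subset unfolding C_def by blast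
        ultimately have "y \<in> path_image g" "y \<notin> \<alpha>" "y \<notin> \<beta>" by auto
        then obtain t where t: "0 \<le> t" "t \<le> 1" "y = g t" unfolding path_image_def by auto
        then have "a \<le> t" "t \<le> b"
          using \<open>y \<notin> \<alpha>\<close> \<open>y \<notin> \<beta>\<close> unfolding \<alpha>_def \<beta>_def by (force, force)
        then show False using gab[of t] t y by auto
      qed
    qed
  qed
  moreover have "g s \<in> C" using cc by (simp add: C_def)
  ultimately have "g s \<in> U" by blast
  then have "g s \<notin> path_image g" using connected_component_subset unfolding U_def by blast
  then show False using s by (auto simp: path_image_def)
qed

text \<open>Each component of the complement of a Jordan curve has the whole curve as frontier, so
  any disc around \<open>q\<close> contains points of two components; a disc that misses
  \<open>Y\<close> provides both connections to \<open>q\<close>.\<close>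

lemma separated_near_arc:
  fixes g :: "real \<Rightarrow> real^2"
  assumes Y: "closed Y" and q: "q \<in> path_image g" "q \<notin> Y"
    and j: "simple_path j" "pathfinish j = pathstart j" "path_image g \<subseteq> path_image j"
  obtains x y where "x \<notin> Y \<union> path_image g" "y \<notin> Y \<union> path_image g"
    "connected_component (- Y) x q" "connected_component (- Y) y q"
    "\<not> connected_component (- path_image j) x y"
proof -
  have "path_image j homeomorphic sphere (0::complex) 1"
    by (simp add: homeomorphic_simple_path_image_circle j)
  moreover have "sphere (0::complex) 1 homeomorphic sphere (0::real^2) 1"
    by (rule homeomorphic_spheres_gen) auto
  ultimately have hom: "path_image j homeomorphic sphere (0::real^2) 1"
    using homeomorphic_trans by blast
  then have "\<not> connected (- path_image j)"
    using Jordan_Brouwer_separation[of "path_image j" 0 1] by simp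
  then obtain C1 C2 where C: "C1 \<in> components (- path_image j)" "C2 \<in> components (- path_image j)" "C1 \<noteq> C2"
    using connected_iff_eq_connected_component_set connected_eq_connected_components_eq by metis
  have fr: "frontier C1 = path_image j" "frontier C2 = path_image j"
    using Jordan_Brouwer_frontier[OF hom] C by auto
  have qj: "q \<in> path_image j" using q j by blast
  obtain e where e: "e > 0" "ball q e \<subseteq> - Y"
    using q Y open_contains_ball_eq[of "- Y" q] by (auto simp: open_Compl)
  have "q \<in> closure C1" "q \<in> closure C2" using fr qj by (auto simp: frontier_def)
  then obtain x y where xy: "x \<in> C1" "x \<in> ball q e" "y \<in> C2" "y \<in> ball q e"
    by (metis closure_approachable e(1) mem_ball dist_commute)
  have "x \<notin> path_image j" "y \<notin> path_image j"
    using C xy in_components_subset by blast+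
  have near: "connected_component (- Y) z q" if "z \<in> ball q e" for z
    unfolding connected_component_def using that e by (intro exI[of _ "ball q e"]) auto
  have "\<not> connected_component (- path_image j) x y"
  proof
    assume "connected_component (- path_image j) x y"
    moreover have "C1 = connected_component_set (- path_image j) x" "C2 = connected_component_set (- path_image j) y"
      using C xy by (metis components_iff connected_component_eq)+
    ultimately show False using C(3) connected_component_eq by (metis mem_Collect_eq)
  qed
  then show ?thesis using that[of x y] near xy e \<open>x \<notin> path_image j\<close> \<open>y \<notin> path_image j\<close> j(3) by blast
qed

text \<open>In the complex plane the complement of the curve is a union of two connected sets, so
  two of any three points share a side.\<close>

lemma Jordan_curve_at_most_two_sides:
  fixes j :: "real \<Rightarrow> real^2"
  assumes j: "simple_path j" "pathfinish j = pathstart j"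
    and "x \<notin> path_image j" "y \<notin> path_image j" "z \<notin> path_image j"
  shows "connected_component (- path_image j) x y \<or> connected_component (- path_image j) x z
    \<or> connected_component (- path_image j) y z"
proof -
  have "DIM(real^2) = DIM(complex)" by simp
  then obtain f :: "real^2 \<Rightarrow> complex" and g where fg: "linear f" "linear g" "\<And>x. g (f x) = x" "\<And>y. f (g y) = y"
    using isomorphisms_UNIV_UNIV by metis
  have cg: "continuous_on UNIV g" using fg linear_continuous_on linear_conv_bounded_linear by blast
  have inj: "inj f" "inj g" using fg by (metis injI)+
  have sp: "simple_path (f \<circ> j)" using fg(1) inj(1) j(1) by (simp add: simple_path_linear_image_eq)
  have lp: "pathfinish (f \<circ> j) = pathstart (f \<circ> j)" using j(2) by (simp add: pathstart_compose pathfinish_compose)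
  define J where "J = path_image (f \<circ> j)"
  have J: "J = f ` path_image j" by (simp add: J_def path_image_compose)
  have io: "inside J \<union> outside J = - J" "connected (inside J)" "connected (outside J)"
    using Jordan_inside_outside[OF sp lp] by (auto simp: J_def)
  have gJ: "g ` J = path_image j" by (simp add: J image_image fg)
  have cc: "connected_component (- path_image j) p q" if "connected_component (- J) (f p) (f q)" for p q
    using connected_component_injective_image[OF that cg inj(2)] by (simp add: gJ fg)
  have "f p \<in> inside J \<union> outside J" if "p \<notin> path_image j" for p
    unfolding io(1) J using that inj(1) by (auto dest: injD)
  then have m: "f x \<in> inside J \<union> outside J" "f y \<in> inside J \<union> outside J" "f z \<in> inside J \<union> outside J"
    using assms by blast+
  have io2: "connected_component (- J) p q" if "p \<in> S" "q \<in> S" "S = inside J \<or> S = outside J" for p q S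
    using that io unfolding connected_component_def by (intro exI[of _ S]) blast
  show ?thesis using m io2 cc by blast
qed

lemma arc_extend_finish:
  fixes g :: "real \<Rightarrow> real^2"
  assumes A: "path_connected A" and g: "arc g" "path_image g \<inter> A = {pathfinish g}" and x: "x \<in> A"
  obtains h where "arc h" "pathstart h = pathstart g" "pathfinish h = x"
    "path_image g \<subseteq> path_image h" "path_image h \<subseteq> A \<union> path_image g"
proof (cases "x = pathfinish g")
  case True then show ?thesis using g that by auto
next
  case False
  have "pathfinish g \<in> A" using g by blast
  then obtain k where k: "arc k" "path_image k \<subseteq> A" "pathstart k = pathfinish g" "pathfinish k = x"
    using A x False unfolding path_connected_arcwise by metis
  have "arc (g +++ k)" by (rule arc_join) (use k g in auto)
  then show ?thesis using that[of "g +++ k"] k by (auto simp: path_image_join)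
qed

text \<open>The arc leads back from the finish of \<open>g1\<close> through \<open>B\<close>,
  \<open>g2\<close> and \<open>A\<close>; closing \<open>g1\<close> with it yields the Jordan curves
  of the next proof.\<close>

lemma arc_return:
  fixes g1 g2 :: "real \<Rightarrow> real^2"
  assumes A: "path_connected A" and B: "path_connected B" and AB: "A \<inter> B = {}"
    and g1: "pathstart g1 \<in> A" "pathfinish g1 \<in> B"
    and g2: "arc g2" "path_image g2 \<inter> A = {pathstart g2}" "path_image g2 \<inter> B = {pathfinish g2}"
  obtains h where "arc h" "pathstart h = pathfinish g1" "pathfinish h = pathstart g1"
    "path_image g2 \<subseteq> path_image h" "path_image h \<subseteq> A \<union> B \<union> path_image g2"
proof -
  obtain h1 where h1: "arc h1" "pathstart h1 = pathstart (reversepath g2)" "pathfinish h1 = pathstart g1"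
    "path_image (reversepath g2) \<subseteq> path_image h1" "path_image h1 \<subseteq> A \<union> path_image (reversepath g2)"
    using arc_extend_finish[OF A, of "reversepath g2" "pathstart g1"] g1 g2 by (auto simp: arc_reversepath)
  have *: "path_image (reversepath h1) \<inter> B = {pathfinish (reversepath h1)}"
  proof -
    have "path_image h1 \<inter> B \<subseteq> {pathfinish g2}" using h1(5) g2(3) AB by auto
    moreover have "pathfinish g2 \<in> path_image h1 \<inter> B" using h1(4) g2(3) by auto
    ultimately show ?thesis using h1(2) by auto
  qed
  obtain h2 where h2: "arc h2" "pathstart h2 = pathstart (reversepath h1)" "pathfinish h2 = pathfinish g1"
    "path_image (reversepath h1) \<subseteq> path_image h2" "path_image h2 \<subseteq> B \<union> path_image (reversepath h1)"
    using arc_extend_finish[OF B, of "reversepath h1" "pathfinish g1"] g1 h1 * by (auto simp: arc_reversepath)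
  show ?thesis
    by (rule that[of "reversepath h2"]) (use h1 h2 in \<open>auto simp: arc_reversepath\<close>)
qed

text \<open>The sets \<open>A\<close>, \<open>B\<close>, \<open>Q\<close> and the three arcs would form a plane drawing of the complete
  bipartite graph with parts of size three.\<close>

lemma not_touch_three_arcs:
  fixes A B Q :: "(real^2) set"
  assumes A: "compact A" "path_connected A" and B: "compact B" "path_connected B" and AB: "A \<inter> B = {}"
    and g1: "arc g1" "path_image g1 \<inter> A = {pathstart g1}" "path_image g1 \<inter> B = {pathfinish g1}"
    and g2: "arc g2" "path_image g2 \<inter> A = {pathstart g2}" "path_image g2 \<inter> B = {pathfinish g2}"
    and g3: "arc g3" "path_image g3 \<inter> A = {pathstart g3}" "path_image g3 \<inter> B = {pathfinish g3}"
    and dis: "path_image g1 \<inter> path_image g2 \<subseteq> A \<union> B" "path_image g1 \<inter> path_image g3 \<subseteq> A \<union> B"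
      "path_image g2 \<inter> path_image g3 \<subseteq> A \<union> B"
    and Q: "connected Q" "Q \<inter> (A \<union> B \<union> path_image g1 \<union> path_image g2 \<union> path_image g3) = {}"
    and q: "q1 \<in> closure Q \<inter> path_image g1 - (A \<union> B)" "q2 \<in> closure Q \<inter> path_image g2 - (A \<union> B)"
      "q3 \<in> closure Q \<inter> path_image g3 - (A \<union> B)"
  shows False
proof -
  define L1 L2 L3 where L: "L1 = path_image g1" "L2 = path_image g2" "L3 = path_image g3"
  have cL: "compact L1" "compact L2" "compact L3"
    using g1 g2 g3 by (auto simp: L compact_arc_image)
  have conL: "connected (L1 - (A \<union> B))" "connected (L2 - (A \<union> B))" "connected (L3 - (A \<union> B))"
  proof -
    have "path_image g - (A \<union> B) = g ` {0<..<1}"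
      if "arc g" "path_image g \<inter> A = {pathstart g}" "path_image g \<inter> B = {pathfinish g}" for g
      using arc_image_interior[OF that(1)] that(2,3) by auto
    then show "connected (L1 - (A \<union> B))" "connected (L2 - (A \<union> B))" "connected (L3 - (A \<union> B))"
      using arc_interior_connected g1 g2 g3 by (auto simp: L)
  qed
  define Y where "Y = A \<union> B \<union> L2 \<union> L3"
  have Y: "compact Y" using A B cL by (auto simp: Y_def)
  define M where "M = Y \<union> L1"
  have M: "compact M" using Y cL by (auto simp: M_def)
  have YL: "L1 \<inter> Y = {pathstart g1, pathfinish g1}"
    using g1 dis by (auto simp: Y_def L)
  obtain u where u: "u \<in> Q" using q by fastforce
  have QM: "Q \<inter> M = {}" using Q by (auto simp: M_def Y_def L)
  have q': "q1 \<in> closure Q" "q1 \<in> L1" "q1 \<notin> Y" "q2 \<in> closure Q" "q2 \<in> L2 - (A \<union> B)" "q2 \<notin> L1 \<union> L3"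
    "q3 \<in> closure Q" "q3 \<in> L3 - (A \<union> B)" "q3 \<notin> L1 \<union> L2"
    using q dis by (auto simp: L Y_def)
  have uq1: "connected_component (- Y) u q1"
    by (rule connected_component_touch[of Q]) (use Q QM q' u in \<open>auto simp: M_def\<close>)
  have ends1: "pathstart g1 \<in> A" "pathfinish g1 \<in> B" using g1 by auto
  obtain h2 where h2: "arc h2" "pathstart h2 = pathfinish g1" "pathfinish h2 = pathstart g1"
    "L2 \<subseteq> path_image h2" "path_image h2 \<subseteq> A \<union> B \<union> L2"
    using arc_return[OF A(2) B(2) AB ends1 g2] L by metis
  obtain h3 where h3: "arc h3" "pathstart h3 = pathfinish g1" "pathfinish h3 = pathstart g1"
    "L3 \<subseteq> path_image h3" "path_image h3 \<subseteq> A \<union> B \<union> L3"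
    using arc_return[OF A(2) B(2) AB ends1 g3] L by metis
  have sp: "simple_path (g1 +++ h2)"
  proof (rule simple_path_join_loop)
    show "path_image g1 \<inter> path_image h2 \<subseteq> {pathstart g1, pathstart h2}"
    proof
      fix x assume x: "x \<in> path_image g1 \<inter> path_image h2"
      then have "x \<in> A \<union> B" using h2(5) dis(1) L(2) by blast
      then have "x \<in> path_image g1 \<inter> A \<or> x \<in> path_image g1 \<inter> B" using x by blast
      then show "x \<in> {pathstart g1, pathstart h2}" using g1(2,3) h2(2) by simp
    qed
  qed (simp_all add: g1(1) h2(1-3))
  have J2: "path_image (g1 +++ h2) = L1 \<union> path_image h2"
    using path_image_join[OF h2(2)[symmetric]] L(1) by simp
  have clY: "closed Y" using Y compact_imp_closed by blast
  have lp: "pathfinish (g1 +++ h2) = pathstart (g1 +++ h2)" using h2(3) by simp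
  have sub: "path_image g1 \<subseteq> path_image (g1 +++ h2)" using J2 L by auto
  \<comment> \<open>Two points near \<open>q1\<close> on different sides of the curve through
    \<open>L1\<close> and \<open>L2\<close> cannot both be joined to \<open>u\<close> off
    \<open>M\<close>; one that cannot becomes \<open>w\<close>.\<close>
  obtain x y where xy: "x \<notin> Y \<union> L1" "y \<notin> Y \<union> L1"
    "connected_component (- Y) x q1" "connected_component (- Y) y q1"
    "\<not> connected_component (- (L1 \<union> path_image h2)) x y"
    using separated_near_arc[OF clY q'(2)[unfolded L] q'(3) sp lp sub, folded L, unfolded J2] by metis
  have J2M: "L1 \<union> path_image h2 \<subseteq> M" using h2 by (auto simp: M_def Y_def)
  have "\<not> connected_component (- M) u x \<or> \<not> connected_component (- M) u y"
  proof (rule ccontr)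
    assume "\<not> ?thesis"
    then have "connected_component (- M) x y"
      by (blast intro: connected_component_sym connected_component_sym_trans)
    then have "connected_component (- (L1 \<union> path_image h2)) x y"
      using J2M by (meson Compl_subset_Compl_iff connected_component_of_subset)
    then show False using xy by blast
  qed
  then obtain w where w: "w \<notin> Y \<union> L1" "connected_component (- Y) w q1" "\<not> connected_component (- M) u w"
    using xy by blast
  have uw: "connected_component (- Y) u w"
    using uq1 w by (blast intro: connected_component_sym_trans)
  \<comment> \<open>\<open>Y\<close> alone does not separate \<open>u\<close> from \<open>w\<close>,
    and it meets the closed curve in the arc \<open>H\<close>. If the curve did not separate them
    either, Janiszewski would join them off \<open>M\<close>.\<close>
  have sep: "\<not> connected_component (- (L1 \<union> H)) u w"
    if H: "H = path_image h" "arc h" "pathstart h = pathfinish g1" "pathfinish h = pathstart g1" "H \<subseteq> Y" for h H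
  proof
    assume a: "connected_component (- (L1 \<union> H)) u w"
    have "L1 \<inter> Y \<subseteq> H"
      using YL H(3,4) pathstart_in_path_image[of h] pathfinish_in_path_image[of h] unfolding H(1) by auto
    then have "Y \<inter> (L1 \<union> H) = H" using H(5) by blast
    then have "connected (Y \<inter> (L1 \<union> H))" using H by (simp add: connected_arc_image)
    then have "connected_component (- (Y \<union> (L1 \<union> H))) u w"
      using Janiszewski_plane[of Y "L1 \<union> H" u w] Y a uw cL H
      by (simp add: compact_imp_closed closed_Un closed_arc_image)
    moreover have "Y \<union> (L1 \<union> H) = M" using H by (auto simp: M_def)
    ultimately show False using w by simp
  qed
  have sep2: "\<not> connected_component (- (L1 \<union> path_image h2)) u w"
    by (rule sep) (use h2 in \<open>auto simp: Y_def\<close>)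
  have sep3: "\<not> connected_component (- (L1 \<union> path_image h3)) u w"
    by (rule sep) (use h3 in \<open>auto simp: Y_def\<close>)
  define W where "W = connected_component_set (- M) w"
  have wW: "w \<in> W" using w by (auto simp: W_def M_def)
  have WM: "W \<inter> M = {}" using connected_component_subset unfolding W_def by blast
  have conW: "connected W" by (simp add: W_def)
  \<comment> \<open>\<open>Q\<close> touches both \<open>L2\<close> and \<open>L3\<close>. If
    \<open>W\<close> touched one of them too, that arc would join \<open>u\<close> to
    \<open>w\<close> without meeting the closed curve through the other.\<close>
  have no: "closure W \<inter> L - (A \<union> B) = {}"
    if L: "connected (L - (A \<union> B))" "qq \<in> closure Q" "qq \<in> L - (A \<union> B)" "L \<inter> J \<subseteq> A \<union> B" "J \<subseteq> M"
      "\<not> connected_component (- J) u w" for L J qq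
  proof (rule ccontr)
    assume "closure W \<inter> L - (A \<union> B) \<noteq> {}"
    then obtain z where z: "z \<in> closure W" "z \<in> L - (A \<union> B)" by blast
    have "connected_component (- J) u qq"
      by (rule connected_component_touch[of Q]) (use L Q QM u in auto)
    moreover have "connected_component (- J) qq z"
      by (rule connected_component_of_subset[OF connected_component_connected[OF L(1)]])
         (use L z in auto)
    moreover have "connected_component (- J) w z"
      by (rule connected_component_touch[of W]) (use L z WM conW wW in auto)
    ultimately show False using L(6) by (blast intro: connected_component_trans connected_component_sym_trans)
  qed
  have n2: "closure W \<inter> L2 - (A \<union> B) = {}"
    by (rule no[of _ q2 "L1 \<union> path_image h3"])
       (use conL q' h3 sep3 dis in \<open>auto simp: M_def Y_def L\<close>)
  have n3: "closure W \<inter> L3 - (A \<union> B) = {}"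
    by (rule no[of _ q3 "L1 \<union> path_image h2"])
       (use conL q' h2 sep2 dis in \<open>auto simp: M_def Y_def L\<close>)
  define N where "N = A \<union> (B \<union> L1)"
  have ccY: "connected_component (- K) u w" if "K \<subseteq> Y" for K
    using uw that connected_component_of_subset by (meson Compl_subset_Compl_iff)
  \<comment> \<open>Once \<open>L2\<close> and \<open>L3\<close> are dropped, \<open>A\<close>,
    \<open>L1\<close> and \<open>B\<close> hang together at single points and do not separate
    \<open>u\<close> from \<open>w\<close>, so some connected \<open>C\<close> joins them. As
    \<open>W\<close> can end only on these three sets, \<open>C\<close> stays inside
    \<open>W\<close>, which does not contain \<open>u\<close>.\<close>
  have "connected_component (- (B \<union> L1)) u w"
  proof (rule Janiszewski_plane)
    have "B \<inter> L1 = {pathfinish g1}" using g1 by (auto simp: L)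
    then show "connected (B \<inter> L1)" by simp
    show "connected_component (- L1) u w"
      by (rule connected_component_connected)
        (use connected_arc_complement[OF g1(1)] QM u w in \<open>auto simp: L M_def\<close>)
  qed (use B cL ccY in \<open>auto simp: compact_imp_closed Y_def\<close>)
  moreover have "connected (A \<inter> (B \<union> L1))"
  proof -
    have "A \<inter> (B \<union> L1) = {pathstart g1}" using g1 AB by (auto simp: L)
    then show ?thesis by simp
  qed
  moreover have "connected_component (- A) u w" by (rule ccY) (auto simp: Y_def)
  ultimately have "connected_component (- N) u w"
    unfolding N_def using A(1) compact_imp_closed[OF compact_Un[OF B(1) cL(1)]]
    by (rule_tac Janiszewski_plane)
  then obtain C where C: "connected C" "C \<subseteq> - N" "u \<in> C" "w \<in> C"
    unfolding connected_component_def by blast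
  have clM: "closed M" using M compact_imp_closed by blast
  have "C \<subseteq> W"
  proof (rule connected_subset_open_closure[OF C(1)])
    show "open W" unfolding W_def using clM by (intro open_connected_component) (rule open_Compl)
    show "C \<inter> W \<noteq> {}" using C wW by blast
    have "closure W - W \<subseteq> M" using connected_component_closure_Diff[OF clM] W_def by blast
    then show "C \<inter> closure W \<subseteq> W" using n2 n3 C(2) unfolding M_def Y_def N_def by blast
  qed
  then have "u \<in> W" using C by blast
  then show False using w connected_component_sym unfolding W_def by blast
qed

text \<open>Passing through \<open>b2\<close> avoids \<open>A\<close> and \<open>P1\<close>, passing
  through \<open>b1\<close> avoids \<open>A\<close> and \<open>P2\<close>. These two unions meet in
  the connected set \<open>A\<close>, so Janiszewski combines the passages. In the application
  \<open>P1\<close> and \<open>P2\<close> make up a face boundary, and the conclusion is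
  absurd.\<close>

lemma not_crossing_cycle:
  fixes A P1 P2 F Q :: "(real^2) set"
  assumes "compact A" "connected A" "compact P1" "compact P2" "P1 \<inter> P2 \<subseteq> A"
    and F: "connected F" "F \<inter> (A \<union> P1 \<union> P2) = {}" and Q: "connected Q" "Q \<inter> (A \<union> P1 \<union> P2) = {}"
    and b: "b1 \<in> closure F \<inter> closure Q" "b1 \<notin> A \<union> P2" "b2 \<in> closure F \<inter> closure Q" "b2 \<notin> A \<union> P1"
    and z: "z \<in> F" "w \<in> Q"
  shows "connected_component (- (A \<union> P1 \<union> P2)) z w"
proof -
  have cc: "connected_component (- K) z w" if "K \<subseteq> A \<union> P1 \<union> P2" "b \<notin> K" "b \<in> closure F \<inter> closure Q" for K b
  proof -
    have "connected_component (- K) z b"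
      by (rule connected_component_touch[of F]) (use that F z in auto)
    moreover have "connected_component (- K) w b"
      by (rule connected_component_touch[of Q]) (use that Q z in auto)
    ultimately show ?thesis by (rule connected_component_sym_trans)
  qed
  have "connected_component (- ((A \<union> P1) \<union> (A \<union> P2))) z w"
  proof (rule Janiszewski_plane)
    have "(A \<union> P1) \<inter> (A \<union> P2) = A" using assms by auto
    then show "connected ((A \<union> P1) \<inter> (A \<union> P2))" using assms by simp
    show "connected_component (- (A \<union> P1)) z w" using cc[of "A \<union> P1" b2] b by auto
    show "connected_component (- (A \<union> P2)) z w" using cc[of "A \<union> P2" b1] b by auto
  qed (use assms in \<open>auto simp: compact_imp_closed closed_Un compact_Un\<close>)
  then show ?thesis by (simp add: Un_ac)
qed

text \<open>Apart from an initial piece the arc keeps a positive distance from its start. That piece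
  and the rest, enlarged by the exterior of the disc, meet in one point, so Janiszewski works inside
  the disc.\<close>

lemma arc_end_not_separating:
  fixes g :: "real \<Rightarrow> real^2"
  assumes g: "arc g" and r: "r > 0"
  obtains r' where "0 < r'" "r' \<le> r"
    "\<And>x y. x \<in> ball (pathstart g) r' - path_image g \<Longrightarrow> y \<in> ball (pathstart g) r' - path_image g \<Longrightarrow>
       connected_component (ball (pathstart g) r - path_image g) x y"
proof -
  define v where "v = pathstart g"
  have inj: "inj_on g {0..1}" and cont: "continuous_on {0..1} g"
    using g by (auto simp: arc_def path_def)
  have v0: "v = g 0" by (simp add: v_def pathstart_def)
  obtain d where d: "d > 0" "\<And>t. t \<in> {0..1} \<Longrightarrow> dist t 0 < d \<Longrightarrow> dist (g t) (g 0) < r"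
    using cont r unfolding continuous_on_iff by (metis atLeastAtMost_iff order_refl zero_le_one)
  define s where "s = min (d/2) (1/2)"
  have s: "0 < s" "s < 1" and gs: "\<And>t. 0 \<le> t \<Longrightarrow> t \<le> s \<Longrightarrow> g t \<in> ball v r"
    using d by (auto simp: s_def v0 dist_commute)
  have "v \<notin> g ` {s..1}"
  proof
    assume "v \<in> g ` {s..1}"
    then obtain t where "t \<in> {s..1}" "g t = g 0" by (auto simp: v0)
    then show False using inj s inj_onD[OF inj, of t 0] by auto
  qed
  moreover have "closed (g ` {s..1})" using arc_subset_connected[OF g, of s 1] s by (simp add: compact_imp_closed)
  ultimately obtain e where e: "e > 0" "ball v e \<subseteq> - g ` {s..1}"
    using open_contains_ball_eq[of "- g ` {s..1}" v] by (auto simp: open_Compl)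
  define r' where "r' = min e r"
  have c2: "closed (- ball v r \<union> g ` {s..1})"
    using \<open>closed (g ` {s..1})\<close> by (intro closed_Un closed_Compl) auto
  have split: "path_image g = g ` {0..s} \<union> g ` {s..1}"
    using s by (auto simp: path_image_def image_Un[symmetric] ivl_disj_un)
  have "connected_component (ball v r - path_image g) x y"
    if xy: "x \<in> ball v r' - path_image g" "y \<in> ball v r' - path_image g" for x y
  proof -
    have "connected_component (- (g ` {0..s} \<union> (- ball v r \<union> g ` {s..1}))) x y"
    proof (rule Janiszewski_plane)
      have "g ` {0..s} \<inter> (- ball v r \<union> g ` {s..1}) = {g s}"
      proof -
        have "g ` {0..s} \<inter> g ` {s..1} = g ` ({0..s} \<inter> {s..1})"
          using s by (intro inj_on_image_Int[OF inj, symmetric]) auto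
        also have "{0..s} \<inter> {s..1} = {s}" using s by auto
        finally show ?thesis using gs s by auto
      qed
      then show "connected (g ` {0..s} \<inter> (- ball v r \<union> g ` {s..1}))" by simp
      show "connected_component (- (g ` {0..s})) x y"
        by (rule connected_component_connected[OF connected_complement_subarc[OF g]])
           (use s xy split in auto)
      show "connected_component (- (- ball v r \<union> g ` {s..1})) x y"
        unfolding connected_component_def
        by (rule exI[of _ "ball v r'"]) (use xy e in \<open>auto simp: r'_def\<close>)
    qed (use arc_subset_connected[OF g, of 0 s] s c2 in auto)
    moreover have "- (g ` {0..s} \<union> (- ball v r \<union> g ` {s..1})) = ball v r - path_image g"
      using split by auto
    ultimately show ?thesis by simp
  qed
  then show ?thesis using that[of r'] e r by (auto simp: r'_def v_def)
qed

section \<open>Plane embedded graphs and their faces\<close>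

fun path_edges :: "'v list \<Rightarrow> 'v set set" where
  "path_edges (x # y # zs) = insert {x, y} (path_edges (y # zs))"
| "path_edges _ = {}"

lemma path_edges_subset: "e \<in> path_edges xs \<Longrightarrow> e \<subseteq> set xs"
  by (induction xs rule: path_edges.induct) auto

lemma path_edges_Cons: "path_edges xs \<subseteq> path_edges (x # xs)"
  by (cases xs) auto

lemma path_edges_append: "path_edges ys \<subseteq> path_edges (xs @ ys)"
proof (induction xs)
  case (Cons a xs)
  then show ?case using path_edges_Cons[of "xs @ ys" a] by auto
qed auto

definition steps :: "'v set set \<Rightarrow> ('v \<times> 'v) set" where
  "steps D = {(x, y). {x, y} \<in> D}"

lemma steps_iff [simp]: "(x, y) \<in> steps D \<longleftrightarrow> {x, y} \<in> D"
  by (simp add: steps_def)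

lemma sym_steps: "sym (steps D)"
  by (auto simp: sym_def steps_def insert_commute)

lemma steps_rtrancl_sym: "(x, y) \<in> (steps D)\<^sup>* \<Longrightarrow> (y, x) \<in> (steps D)\<^sup>*"
  using sym_rtrancl[OF sym_steps] by (meson symD)

lemma steps_mono: "D \<subseteq> D' \<Longrightarrow> (x, y) \<in> (steps D)\<^sup>* \<Longrightarrow> (x, y) \<in> (steps D')\<^sup>*"
  by (rule subsetD[OF rtrancl_mono]) (auto simp: steps_def)

lemma rtrancl_distinct_list:
  assumes "(x, y) \<in> (steps D)\<^sup>*" "x \<noteq> y"
  obtains xs where "distinct xs" "length xs \<ge> 2" "hd xs = x" "last xs = y" "path_edges xs \<subseteq> D"
proof -
  have "\<exists>xs. distinct xs \<and> xs \<noteq> [] \<and> hd xs = x \<and> last xs = y \<and> path_edges xs \<subseteq> D"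
    using assms(1)
  proof (induction rule: converse_rtrancl_induct)
    case base
    then show ?case by (intro exI[of _ "[y]"]) auto
  next
    case (step a b)
    then obtain xs where xs: "distinct xs" "xs \<noteq> []" "hd xs = b" "last xs = y" "path_edges xs \<subseteq> D" by blast
    show ?case
    proof (cases "a \<in> set xs")
      case True
      then obtain ys zs where yz: "xs = ys @ a # zs" by (meson split_list)
      have "path_edges (a # zs) \<subseteq> path_edges (ys @ a # zs)"
        by (rule path_edges_append)
      then show ?thesis using xs yz by (intro exI[of _ "a # zs"]) auto
    next
      case False
      obtain ys where "xs = b # ys" using xs by (cases xs) auto
      then show ?thesis using xs False step by (intro exI[of _ "a # xs"]) auto
    qed
  qed
  then obtain xs where xs: "distinct xs" "xs \<noteq> []" "hd xs = x" "last xs = y" "path_edges xs \<subseteq> D" by blast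
  moreover have "length xs \<ge> 2" using xs assms(2) by (cases xs rule: path_edges.cases) auto
  ultimately show ?thesis using that by blast
qed

definition inner_edges :: "'v set set \<Rightarrow> 'v set \<Rightarrow> 'v set set" where
  "inner_edges E W = {e \<in> E. e \<subseteq> W}"

definition conn :: "'v set set \<Rightarrow> 'v set \<Rightarrow> bool" where
  "conn E W \<longleftrightarrow> (\<forall>u\<in>W. \<forall>v\<in>W. (u, v) \<in> (steps (inner_edges E W))\<^sup>*)"

definition nbrs :: "'v set set \<Rightarrow> 'v set \<Rightarrow> 'v set" where
  "nbrs E K = {y. y \<notin> K \<and> (\<exists>x\<in>K. {x, y} \<in> E)}"

lemma closure_meets_ball: "p \<in> closure S \<Longrightarrow> r > 0 \<Longrightarrow> \<exists>x\<in>S. x \<in> ball p r"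
  by (auto simp: closure_approachable dist_commute)

section \<open>Vertices, edges and subgraphs as point sets\<close>

locale plane_embedded =
  fixes V :: "'v set" and E :: "'v set set"
    and pos :: "'v \<Rightarrow> real^2" and c :: "'v set \<Rightarrow> real \<Rightarrow> real^2"
  assumes plane: "plane_graph V E pos c"
begin

abbreviation "X \<equiv> graph_image V E pos c"
abbreviation "FV \<equiv> bd_vertices V pos"
abbreviation "FE \<equiv> bd_edges E c"
abbreviation "face \<equiv> is_face V E pos c"
abbreviation "ext \<equiv> ext_vertices V E pos c"
abbreviation P where "P e \<equiv> path_image (c e)"

text \<open>The open arc of an edge. Its two ends are removed as a set because the orientation of
  \<open>c e\<close> is arbitrary.\<close>

definition op :: "'v set \<Rightarrow> (real^2) set" where
  "op e = P e - pos ` e"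

text \<open>The drawing of the subgraph induced by \<open>W\<close>.\<close>

definition img :: "'v set \<Rightarrow> (real^2) set" where
  "img W = pos ` W \<union> (\<Union>e\<in>inner_edges E W. P e)"

lemma finite_V: "finite V" and inj_pos: "inj_on pos V"
  and arc_c: "e \<in> E \<Longrightarrow> arc (c e)"
  and ends_c: "e \<in> E \<Longrightarrow> {pathstart (c e), pathfinish (c e)} = pos ` e"
  and pos_on_edge: "e \<in> E \<Longrightarrow> w \<in> V \<Longrightarrow> pos w \<in> P e \<Longrightarrow> w \<in> e"
  and edges_meet: "e1 \<in> E \<Longrightarrow> e2 \<in> E \<Longrightarrow> e1 \<noteq> e2 \<Longrightarrow> P e1 \<inter> P e2 \<subseteq> pos ` (e1 \<inter> e2)"
  using plane by (simp_all add: plane_graph_def)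

lemma edgeE:
  assumes "e \<in> E" obtains u v where "u \<in> V" "v \<in> V" "u \<noteq> v" "e = {u, v}"
  using plane assms unfolding plane_graph_def by meson

lemma edge_subset: "e \<in> E \<Longrightarrow> e \<subseteq> V"
  by (erule edgeE) simp

lemma edge_ends: "{u, v} \<in> E \<Longrightarrow> u \<in> V \<and> v \<in> V \<and> u \<noteq> v"
  by (erule edgeE) (auto simp: doubleton_eq_iff)

lemma edge_other:
  assumes "e \<in> E" "v \<in> e" obtains w where "e = {v, w}" "w \<noteq> v" "w \<in> V"
proof -
  obtain x y where "x \<in> V" "y \<in> V" "x \<noteq> y" "e = {x, y}" using edgeE[OF assms(1)] .
  then show ?thesis using that[of x] that[of y] assms(2) by (auto simp: insert_commute)
qed

lemma finite_E: "finite E"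
  by (rule finite_subset[of _ "Pow V"]) (use finite_V edge_subset in auto)

lemma pos_eq_iff: "u \<in> V \<Longrightarrow> v \<in> V \<Longrightarrow> pos u = pos v \<longleftrightarrow> u = v"
  using inj_pos by (auto simp: inj_on_def)

lemma pos_in_edge: "e \<in> E \<Longrightarrow> w \<in> e \<Longrightarrow> pos w \<in> P e"
proof -
  assume "e \<in> E" "w \<in> e"
  then have "pos w \<in> {pathstart (c e), pathfinish (c e)}" using ends_c[of e] by blast
  then show ?thesis using pathstart_in_path_image[of "c e"] pathfinish_in_path_image[of "c e"] by auto
qed

lemma compact_P: "e \<in> E \<Longrightarrow> compact (P e)" and connected_P: "e \<in> E \<Longrightarrow> connected (P e)"
  and path_connected_P: "e \<in> E \<Longrightarrow> path_connected (P e)"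
  using arc_c by (auto simp: compact_arc_image connected_arc_image arc_imp_path path_connected_path_image)

lemma op_eq: "e \<in> E \<Longrightarrow> op e = c e ` {0<..<1}"
  unfolding op_def using arc_image_interior[OF arc_c] ends_c by simp

lemma connected_op: "e \<in> E \<Longrightarrow> connected (op e)"
  by (simp add: op_eq arc_interior_connected arc_c)

lemma closure_op: assumes "e \<in> E" shows "P e \<subseteq> closure (op e)"
proof -
  have c: "continuous_on {0..1} (c e)" using arc_c[OF assms] by (auto simp: arc_def path_def)
  have "c e ` closure {0<..<1} \<subseteq> closure (c e ` {0<..<1})"
    by (rule continuous_image_closure_subset) (use c in auto)
  then show ?thesis using assms by (simp add: op_eq path_image_def)
qed

lemma op_nonempty: "e \<in> E \<Longrightarrow> op e \<noteq> {}"
  by (simp add: op_eq)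

lemma op_not_pos: "e \<in> E \<Longrightarrow> v \<in> V \<Longrightarrow> pos v \<notin> op e"
  by (auto simp: op_def dest: pos_on_edge)

lemma op_disjoint: "e1 \<in> E \<Longrightarrow> e2 \<in> E \<Longrightarrow> e1 \<noteq> e2 \<Longrightarrow> op e1 \<inter> P e2 = {}"
  using edges_meet[of e1 e2] by (auto simp: op_def)

lemma P_split: "e \<in> E \<Longrightarrow> P e = op e \<union> pos ` e"
  by (auto simp: op_def intro: pos_in_edge)

lemma edge_arc:
  assumes "{u, v} \<in> E"
  obtains g where "arc g" "path_image g = P {u, v}" "pathstart g = pos u" "pathfinish g = pos v"
proof -
  have uv: "u \<in> V" "v \<in> V" "u \<noteq> v" using edge_ends assms by auto
  then have ne: "pos u \<noteq> pos v" by (simp add: pos_eq_iff)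
  have e: "{pathstart (c {u, v}), pathfinish (c {u, v})} = {pos u, pos v}" using ends_c[OF assms] by simp
  consider "pathstart (c {u, v}) = pos u" "pathfinish (c {u, v}) = pos v"
    | "pathstart (c {u, v}) = pos v" "pathfinish (c {u, v}) = pos u"
    using e ne by (metis doubleton_eq_iff)
  then show ?thesis
  proof cases
    case 1 then show ?thesis using that arc_c[OF assms] by blast
  next
    case 2 then show ?thesis
      using that[of "reversepath (c {u, v})"] arc_c[OF assms] by (simp add: arc_reversepath)
  qed
qed

lemma compact_X: "compact X"
  unfolding graph_image_def using finite_V finite_E compact_P
  by (intro compact_Un compact_UN) (auto intro: finite_imp_compact)

lemma closed_X: "closed X" using compact_X compact_imp_closed by blast

lemma P_subset_X: "e \<in> E \<Longrightarrow> P e \<subseteq> X" and pos_in_X: "v \<in> V \<Longrightarrow> pos v \<in> X"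
  by (auto simp: graph_image_def)

lemma compact_img: "W \<subseteq> V \<Longrightarrow> compact (img W)"
  unfolding img_def inner_edges_def using finite_V finite_E compact_P
  by (intro compact_Un compact_UN) (auto intro: finite_imp_compact finite_subset)

lemma img_subset_X: "W \<subseteq> V \<Longrightarrow> img W \<subseteq> X"
  by (auto simp: img_def graph_image_def inner_edges_def)

lemma pos_in_img: "w \<in> V \<Longrightarrow> W \<subseteq> V \<Longrightarrow> pos w \<in> img W \<longleftrightarrow> w \<in> W"
  by (auto simp: img_def inner_edges_def pos_eq_iff dest: pos_on_edge)

lemma path_connected_img:
  assumes "conn E W" "W \<subseteq> V"
  shows "path_connected (img W)"
proof -
  have 1: "path_component (img W) (pos u) (pos v)" if "(u, v) \<in> (steps (inner_edges E W))\<^sup>*" "u \<in> W" for u v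
    using that
  proof (induction rule: rtrancl_induct)
    case base then show ?case by (simp add: img_def path_component_refl)
  next
    case (step y z)
    then have e: "{y, z} \<in> E" "{y, z} \<subseteq> W" by (auto simp: inner_edges_def)
    then have "path_component (img W) (pos y) (pos z)"
    proof -
      obtain g where g: "arc g" "path_image g = P {y, z}" "pathstart g = pos y" "pathfinish g = pos z"
        using edge_arc[OF e(1)] .
      moreover have "P {y, z} \<subseteq> img W" using e by (auto simp: img_def inner_edges_def)
      ultimately show ?thesis unfolding path_component_def using arc_imp_path by metis
    qed
    then show ?case using step path_component_trans by blast
  qed
  have 2: "\<exists>w\<in>W. path_component (img W) (pos w) x" if x: "x \<in> img W" for x
  proof (cases "x \<in> pos ` W")
    case True
    then show ?thesis using x path_component_refl by blast
  next
    case False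
    then obtain e where e: "e \<in> E" "e \<subseteq> W" "x \<in> P e" using x by (auto simp: img_def inner_edges_def)
    obtain w where w: "w \<in> e" using edgeE[OF e(1)] by blast
    have "path_component (P e) (pos w) x"
      using path_connected_P[OF e(1)] pos_in_edge[OF e(1) w] e(3) by (simp add: path_connected_component)
    moreover have "P e \<subseteq> img W" using e by (auto simp: img_def inner_edges_def)
    ultimately show ?thesis using w e path_component_of_subset by blast
  qed
  show ?thesis unfolding path_connected_component
  proof (intro ballI)
    fix x y assume "x \<in> img W" "y \<in> img W"
    then obtain u v where uv: "u \<in> W" "v \<in> W" "path_component (img W) (pos u) x" "path_component (img W) (pos v) y"
      using 2 by metis
    moreover have "path_component (img W) (pos u) (pos v)" using 1 uv assms by (auto simp: conn_def)
    ultimately show "path_component (img W) x y" by (meson path_component_sym path_component_trans)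
  qed
qed

lemma edge_Int_img:
  assumes "{a, n} \<in> E" "a \<in> A" "n \<notin> A" "A \<subseteq> V"
  shows "P {a, n} \<inter> img A = {pos a}"
proof -
  have "x = pos a" if xx: "x \<in> P {a, n}" "x \<in> img A" for x
  proof -
    consider w where "w \<in> A" "x = pos w" | e where "e \<in> E" "e \<subseteq> A" "x \<in> P e"
      using xx(2) by (auto simp: img_def inner_edges_def)
    then show ?thesis
    proof cases
      case 1 then show ?thesis using pos_on_edge[OF assms(1), of w] xx assms by auto
    next
      case 2
      then have "x \<in> pos ` ({a, n} \<inter> e)" using edges_meet[of "{a, n}" e] assms xx by blast
      then show ?thesis using 2 assms by auto
    qed
  qed
  moreover have "pos a \<in> P {a, n}" "pos a \<in> img A"
    using pos_in_edge[OF assms(1), of a] assms(2) by (auto simp: img_def)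
  ultimately show ?thesis by blast
qed

lemma edge_Int_img_empty:
  assumes "e \<in> E" "e \<inter> A = {}" "A \<subseteq> V"
  shows "P e \<inter> img A = {}"
proof -
  have False if xx: "x \<in> P e" "x \<in> img A" for x
  proof -
    consider w where "w \<in> A" "x = pos w" | e' where "e' \<in> E" "e' \<subseteq> A" "x \<in> P e'"
      using xx(2) by (auto simp: img_def inner_edges_def)
    then show ?thesis
    proof cases
      case 1 then show ?thesis using pos_on_edge[OF assms(1), of w] xx assms by auto
    next
      case 2
      moreover have "e \<noteq> e'" using 2 assms edgeE by blast
      ultimately show ?thesis using edges_meet[of e e'] assms xx by blast
    qed
  qed
  then show ?thesis by blast
qed

lemma op_Int_img:
  assumes "e \<in> E" "\<not> e \<subseteq> A" "A \<subseteq> V"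
  shows "op e \<inter> img A = {}"
proof -
  have False if xx: "x \<in> op e" "x \<in> img A" for x
  proof -
    consider w where "w \<in> A" "x = pos w" | e' where "e' \<in> E" "e' \<subseteq> A" "x \<in> P e'"
      using xx(2) by (auto simp: img_def inner_edges_def)
    then show ?thesis
    proof cases
      case 1 then show ?thesis using op_not_pos assms xx by blast
    next
      case 2 then show ?thesis using op_disjoint[of e e'] assms xx by blast
    qed
  qed
  then show ?thesis by blast
qed

lemma img_disjoint:
  assumes "A \<inter> B = {}" "A \<subseteq> V" "B \<subseteq> V"
  shows "img A \<inter> img B = {}"
proof -
  have "P e \<inter> img B = {}" if "e \<in> inner_edges E A" for e
    using that assms edge_Int_img_empty[of e B] by (auto simp: inner_edges_def)
  moreover have "pos ` A \<inter> img B = {}" using assms pos_in_img[of _ B] by blast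
  ultimately show ?thesis unfolding img_def[of A] by blast
qed

text \<open>All vertices are kept, so that the arc of the edge \<open>e\<close> meets this set in
  its two ends and nowhere else.\<close>

definition without :: "'v set \<Rightarrow> (real^2) set" where
  "without e = pos ` V \<union> (\<Union>e'\<in>E - {e}. P e')"

lemma compact_without: "compact (without e)"
  unfolding without_def using finite_V finite_E compact_P
  by (intro compact_Un compact_UN) (auto intro: finite_imp_compact)

lemma without_Un: "e \<in> E \<Longrightarrow> without e \<union> P e = X"
  by (auto simp: without_def graph_image_def)

lemma without_subset_X: "without e \<subseteq> X"
  by (auto simp: without_def graph_image_def)

lemma op_without: "e \<in> E \<Longrightarrow> op e \<inter> without e = {}"
  using op_not_pos op_disjoint unfolding without_def by blast

lemma P_without: "e \<in> E \<Longrightarrow> P e \<inter> without e = pos ` e"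
  using op_without[of e] P_split[of e] edge_subset[of e] unfolding without_def by blast

lemma X_cases:
  assumes "x \<in> X"
  obtains v where "v \<in> V" "x = pos v" | e where "e \<in> E" "x \<in> op e"
proof -
  consider v where "v \<in> V" "x = pos v" | e where "e \<in> E" "x \<in> P e"
    using assms by (auto simp: graph_image_def)
  then show ?thesis
  proof cases
    case (2 e)
    then have "x \<in> op e \<or> x \<in> pos ` e" using P_split by blast
    then show ?thesis using that 2 edge_subset[OF 2(1)] by auto
  qed (rule that(1))
qed

section \<open>Faces and the sides of an edge\<close>

lemma face_iff: "face F \<longleftrightarrow> (\<exists>x. x \<notin> X \<and> F = connected_component_set (- X) x)"
proof -
  have "path_component_set (- X) x = connected_component_set (- X) x" for x
    using closed_X open_path_connected_component_set by (metis open_Compl)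
  then show ?thesis by (simp add: is_face_def)
qed

lemma face_component: "face F \<longleftrightarrow> F \<in> components (- X)"
  by (auto simp: face_iff components_def)

lemma face_of_point: "x \<notin> X \<Longrightarrow> face (connected_component_set (- X) x) \<and> x \<in> connected_component_set (- X) x"
  by (auto simp: face_iff)

lemma face_open: "face F \<Longrightarrow> open F"
  using closed_X by (metis face_component open_Compl open_components)

lemma face_connected: "face F \<Longrightarrow> connected F"
  using face_component in_components_connected by blast

lemma face_disjoint_X: "face F \<Longrightarrow> F \<inter> X = {}"
  using face_component in_components_subset by blast

lemma face_nonempty: "face F \<Longrightarrow> F \<noteq> {}"
  using face_component in_components_nonempty by blast

lemma face_eq: "face F \<Longrightarrow> face G \<Longrightarrow> F \<inter> G \<noteq> {} \<Longrightarrow> F = G"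
  using face_component components_eq by blast

lemma face_same: "face F \<Longrightarrow> x \<in> F \<Longrightarrow> connected_component (- X) x y \<Longrightarrow> y \<in> F"
  by (auto simp: face_iff) (metis connected_component_trans)

lemma frontier_face: "face F \<Longrightarrow> frontier F = closure F - F"
  by (simp add: face_open frontier_def interior_open)

lemma frontier_face_subset: "face F \<Longrightarrow> frontier F \<subseteq> X"
  using connected_component_closure_Diff[OF closed_X] by (auto simp: frontier_face) (auto simp: face_iff)

lemma FV_iff: "face F \<Longrightarrow> v \<in> FV F \<longleftrightarrow> v \<in> V \<and> pos v \<in> closure F"
  using face_disjoint_X pos_in_X by (auto simp: bd_vertices_def frontier_face)

lemma FE_iff: "face F \<Longrightarrow> e \<in> FE F \<longleftrightarrow> e \<in> E \<and> P e \<subseteq> closure F"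
  using face_disjoint_X P_subset_X by (auto simp: bd_edges_def frontier_face)

lemma FE_subset_FV: "face F \<Longrightarrow> e \<in> FE F \<Longrightarrow> e \<subseteq> FV F"
  using edge_subset[of e] pos_in_edge[of e] by (auto simp: FE_iff FV_iff subset_iff)

text \<open>\<open>closure_side_of_arc\<close> handles a single point. Since the open edge is
  connected and misses the rest of the drawing, reaching one of its points means reaching all of
  them.\<close>

lemma edge_side:
  assumes "e \<in> E" "x \<notin> X" "connected_component (- without e) x q" "q \<in> op e"
  shows "P e \<subseteq> closure (connected_component_set (- X) x)"
proof -
  have eq: "without e \<union> P e = X" using without_Un assms by blast
  have "op e \<subseteq> closure (connected_component_set (- X) x)"
  proof
    fix z assume "z \<in> op e"
    then obtain s where s: "0 < s" "s < 1" "z = c e s" using op_eq assms by auto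
    have "connected_component (- without e) q z"
      by (rule connected_component_of_subset[OF connected_component_connected[OF connected_op]])
         (use assms \<open>z \<in> op e\<close> op_without in auto)
    then have "connected_component (- without e) x (c e s)"
      using assms(3) s connected_component_trans by blast
    moreover have "P e \<inter> without e = {pathstart (c e), pathfinish (c e)}"
      using P_without ends_c assms by simp
    ultimately show "z \<in> closure (connected_component_set (- X) x)"
      using closure_side_of_arc[OF compact_without arc_c[OF assms(1)] _ s(1,2), of e x] eq assms(2) s(3) by simp
  qed
  then have "closure (op e) \<subseteq> closure (connected_component_set (- X) x)"
    by (rule closure_minimal) simp
  then show ?thesis using closure_op[OF assms(1)] by blast
qed

text \<open>A point of \<open>F\<close> reaches \<open>z\<close> off the other edges, so
  \<open>edge_side\<close> yields the whole edge. This turns face boundaries into combinatorial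
  objects.\<close>

lemma FE_if_touch:
  assumes "face F" "e \<in> E" "z \<in> closure F" "z \<in> op e"
  shows "e \<in> FE F"
proof -
  obtain x where x: "x \<in> F" using face_nonempty assms by blast
  have xX: "x \<notin> X" using x face_disjoint_X assms by blast
  have "F \<inter> without e = {}" using face_disjoint_X[OF assms(1)] without_subset_X by blast
  moreover have "z \<notin> without e" using op_without[OF assms(2)] assms(4) by blast
  ultimately have "connected_component (- without e) x z"
    using connected_component_touch[OF face_connected[OF assms(1)]] assms(3) x by blast
  then have "P e \<subseteq> closure (connected_component_set (- X) x)"
    using edge_side assms xX by blast
  moreover have "connected_component_set (- X) x = F"
    using face_eq[OF assms(1)] face_of_point[OF xX] x by blast
  ultimately show ?thesis using assms by (simp add: FE_iff)
qed

lemma closure_face_op: "face F \<Longrightarrow> e \<in> FE F \<Longrightarrow> op e \<subseteq> closure F"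
  by (auto simp: FE_iff op_def)

lemma frontier_eq_edges:
  assumes "face F" "\<And>v. v \<in> FV F \<Longrightarrow> \<exists>e\<in>FE F. v \<in> e"
  shows "frontier F = (\<Union>e\<in>FE F. P e)"
proof (intro equalityI subsetI)
  fix x assume x: "x \<in> frontier F"
  then have "x \<in> X" using frontier_face_subset assms by blast
  then show "x \<in> (\<Union>e\<in>FE F. P e)"
  proof (cases rule: X_cases)
    case (1 v)
    then have "v \<in> FV F" using x by (simp add: bd_vertices_def)
    then obtain e where "e \<in> FE F" "v \<in> e" using assms by blast
    then show ?thesis using 1 pos_in_edge by (auto simp: bd_edges_def)
  next
    case (2 e)
    then have "e \<in> FE F" using FE_if_touch[OF assms(1), of e x] x by (simp add: frontier_def)
    then show ?thesis using 2 by (auto simp: op_def)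
  qed
qed (auto simp: bd_edges_def)

text \<open>Near the edge the curve \<open>j\<close> has points on either side, which gives two
  faces. A third bordering face would share a side of \<open>j\<close> with one of them, and the
  connected remainder of \<open>j\<close> in \<open>con\<close> lets Janiszewski turn a common side
  into a common face.\<close>

lemma two_faces_of_edge:
  assumes e: "e \<in> E" and j: "simple_path j" "pathfinish j = pathstart j" "P e \<subseteq> path_image j" "path_image j \<subseteq> X"
    and con: "connected (path_image j \<inter> without e)"
  obtains F1 F2 where "face F1" "face F2" "F1 \<noteq> F2" "\<And>F. face F \<Longrightarrow> e \<in> FE F \<longleftrightarrow> F = F1 \<or> F = F2"
    "\<And>x y. x \<in> F1 \<Longrightarrow> y \<in> F2 \<Longrightarrow> \<not> connected_component (- path_image j) x y"
proof -
  let ?Y = "without e"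
  have eq: "?Y \<union> P e = X" using without_Un e by blast
  obtain q where q: "q \<in> op e" using op_nonempty e by blast
  have qY: "q \<notin> ?Y" "q \<in> P e" using q op_without e by (auto simp: op_def)
  have clY: "closed ?Y" using compact_without compact_imp_closed by blast
  obtain x y where xy: "x \<notin> X" "y \<notin> X" "connected_component (- ?Y) x q" "connected_component (- ?Y) y q"
    "\<not> connected_component (- path_image j) x y"
    using separated_near_arc[OF clY qY(2,1) j(1-3)] unfolding eq by metis
  define F1 F2 where "F1 = connected_component_set (- X) x" and "F2 = connected_component_set (- X) y"
  have F: "face F1" "face F2" "x \<in> F1" "y \<in> F2" using face_of_point xy by (auto simp: F1_def F2_def)
  have sub: "connected_component (- path_image j) u v" if "connected_component (- X) u v" for u v
    using that j(4) by (meson Compl_subset_Compl_iff connected_component_of_subset)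
  have inF: "connected_component (- path_image j) u v" if "face F" "u \<in> F" "v \<in> F" for F u v
    by (rule sub) (use that face_connected face_disjoint_X in \<open>auto simp: connected_component_def intro!: exI[of _ F]\<close>)
  have F12: "e \<in> FE F1" "e \<in> FE F2"
    using edge_side[OF e] xy q F e by (auto simp: FE_iff F1_def F2_def)
  have sep: "\<not> connected_component (- path_image j) x' y'" if "x' \<in> F1" "y' \<in> F2" for x' y'
    using inF[OF F(1) F(3) that(1)] inF[OF F(2) F(4) that(2)] xy(5)
    by (blast intro: connected_component_trans connected_component_sym)
  have cJ: "closed (path_image j)" using j(1) by (simp add: closed_simple_path_image)
  have "F = F1 \<or> F = F2" if fF: "face F" "e \<in> FE F" for F
  proof -
    obtain z where z: "z \<in> F" using face_nonempty fF by blast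
    have zX: "z \<notin> X" using z fF face_disjoint_X by blast
    have "F \<inter> ?Y = {}" using face_disjoint_X[OF fF(1)] without_subset_X by blast
    moreover have "q \<in> closure F" using closure_face_op[OF fF] q by blast
    ultimately have zq: "connected_component (- ?Y) z q"
      using connected_component_touch[OF face_connected[OF fF(1)]] qY(1) z by blast
    have *: "connected_component (- X) z p" if "connected_component (- path_image j) z p" "connected_component (- ?Y) p q" for p
    proof -
      have "connected (?Y \<inter> path_image j)" using con by (simp add: Int_commute)
      then have "connected_component (- (?Y \<union> path_image j)) z p"
        using Janiszewski_plane[of ?Y "path_image j" z p] compact_without cJ that zq
          connected_component_sym_trans by blast
      moreover have "?Y \<union> path_image j = X" using eq j by blast
      ultimately show ?thesis by simp
    qed
    have nj: "x \<notin> path_image j" "y \<notin> path_image j" "z \<notin> path_image j" using xy zX j(4) by blast+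
    then consider "connected_component (- path_image j) x z" | "connected_component (- path_image j) y z"
      using Jordan_curve_at_most_two_sides[OF j(1,2) nj] xy(5) by blast
    then show ?thesis
    proof cases
      case 1
      then have "connected_component (- X) z x" using * xy(3) connected_component_sym by blast
      then have "x \<in> F" using face_same fF z by blast
      then show ?thesis using face_eq fF F by blast
    next
      case 2
      then have "connected_component (- X) z y" using * xy(4) connected_component_sym by blast
      then have "y \<in> F" using face_same fF z by blast
      then show ?thesis using face_eq fF F by blast
    qed
  qed
  moreover have "F1 \<noteq> F2" using sep F inF by blast
  ultimately show ?thesis using that[of F1 F2] F F12 sep by blast
qed

section \<open>Arcs, closed curves and forbidden configurations\<close>

lemma path_arc:
  assumes "distinct xs" "length xs \<ge> 2" "path_edges xs \<subseteq> E"
  shows "\<exists>g. arc g \<and> pathstart g = pos (hd xs) \<and> pathfinish g = pos (last xs) \<and> path_image g = (\<Union>e\<in>path_edges xs. P e)"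
  using assms
proof (induction xs rule: path_edges.induct)
  case (1 x y zs)
  obtain g where g: "arc g" "path_image g = P {x, y}" "pathstart g = pos x" "pathfinish g = pos y"
    using edge_arc[of x y] 1 by auto
  show ?case
  proof (cases zs)
    case Nil
    then show ?thesis using g by (intro exI[of _ g]) auto
  next
    case (Cons z zs')
    then obtain h where h: "arc h" "pathstart h = pos y" "pathfinish h = pos (last (y # zs))"
      "path_image h = (\<Union>e\<in>path_edges (y # zs). P e)"
      using 1 by auto
    have "P {x, y} \<inter> P e \<subseteq> {pos y}" if e: "e \<in> path_edges (y # zs)" for e
    proof -
      have "x \<notin> e" using path_edges_subset[OF e] 1 by auto
      moreover have "P {x, y} \<inter> P e \<subseteq> pos ` ({x, y} \<inter> e)"
        by (rule edges_meet) (use e 1 \<open>x \<notin> e\<close> in auto)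
      ultimately show ?thesis by auto
    qed
    then have "path_image g \<inter> path_image h \<subseteq> {pathstart h}" using g h by auto
    then have "arc (g +++ h)" using arc_join[of g h] g h by simp
    then show ?thesis using g h Cons by (intro exI[of _ "g +++ h"]) (simp add: path_image_join)
  qed
qed auto

text \<open>The closing path avoids the edge, hence the curve without the open edge is a single arc;
  the last clause keeps this fact for \<open>two_faces_of_edge\<close>.\<close>

lemma cycle_curve:
  assumes e: "{u, v} \<in> E" and p: "(v, u) \<in> (steps D)\<^sup>*" "D \<subseteq> E - {{u, v}}"
  obtains j where "simple_path j" "pathfinish j = pathstart j" "P {u, v} \<subseteq> path_image j"
    "path_image j \<subseteq> P {u, v} \<union> (\<Union>e\<in>D. P e)" "connected (path_image j \<inter> without {u, v})"
proof -
  have "v \<noteq> u" using edge_ends e by blast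
  then obtain xs where xs: "distinct xs" "length xs \<ge> 2" "hd xs = v" "last xs = u" "path_edges xs \<subseteq> D"
    using rtrancl_distinct_list[OF p(1)] by metis
  then obtain h where h: "arc h" "pathstart h = pos v" "pathfinish h = pos u" "path_image h = (\<Union>e\<in>path_edges xs. P e)"
    using path_arc[of xs] p by auto
  obtain g where g: "arc g" "path_image g = P {u, v}" "pathstart g = pos u" "pathfinish g = pos v"
    using edge_arc e by blast
  have hY: "path_image h \<subseteq> without {u, v}" using h xs p by (auto simp: without_def)
  have "path_image g \<inter> path_image h \<subseteq> {pos u, pos v}"
    using hY P_without[OF e] g(2) by auto
  then have sp: "simple_path (g +++ h)" using simple_path_join_loop[of g h] g h by simp
  have im: "path_image (g +++ h) = P {u, v} \<union> path_image h" using g h by (simp add: path_image_join)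
  have "pos u \<in> path_image h" "pos v \<in> path_image h"
    using h(2,3) pathstart_in_path_image[of h] pathfinish_in_path_image[of h] by auto
  moreover have "P {u, v} \<inter> without {u, v} = {pos u, pos v}" using P_without[OF e] by simp
  ultimately have "path_image (g +++ h) \<inter> without {u, v} = path_image h"
    unfolding im Int_Un_distrib2 using hY by (simp add: Int_absorb2 insert_absorb)
  then have con: "connected (path_image (g +++ h) \<inter> without {u, v})" using connected_arc_image[OF h(1)] by simp
  have lp: "pathfinish (g +++ h) = pathstart (g +++ h)" using g(3) h(3) by simp
  have "path_image (g +++ h) \<subseteq> P {u, v} \<union> (\<Union>e\<in>D. P e)" unfolding im h(4) using xs(5) by blast
  moreover have "P {u, v} \<subseteq> path_image (g +++ h)" unfolding im by blast
  ultimately show ?thesis using that[OF sp lp _ _ con] by blast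
qed

text \<open>\<open>A\<close>, \<open>B\<close> and the face, each linked to the same three edges,
  would realise the complete bipartite graph with parts of size three.\<close>

lemma not_three_crossing_edges:
  assumes A: "A \<subseteq> V" "conn E A" and B: "B \<subseteq> V" "conn E B" and AB: "A \<inter> B = {}"
    and e1: "{a1, b1} \<in> FE F" "a1 \<in> A" "b1 \<in> B" and e2: "{a2, b2} \<in> FE F" "a2 \<in> A" "b2 \<in> B"
    and e3: "{a3, b3} \<in> FE F" "a3 \<in> A" "b3 \<in> B"
    and ne: "{a1, b1} \<noteq> {a2, b2}" "{a1, b1} \<noteq> {a3, b3}" "{a2, b2} \<noteq> {a3, b3}" and F: "face F"
  shows False
proof -
  have E: "{a1, b1} \<in> E" "{a2, b2} \<in> E" "{a3, b3} \<in> E" using e1 e2 e3 by (auto simp: bd_edges_def)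
  obtain g1 where g1: "arc g1" "path_image g1 = P {a1, b1}" "pathstart g1 = pos a1" "pathfinish g1 = pos b1"
    using edge_arc E by blast
  obtain g2 where g2: "arc g2" "path_image g2 = P {a2, b2}" "pathstart g2 = pos a2" "pathfinish g2 = pos b2"
    using edge_arc E by blast
  obtain g3 where g3: "arc g3" "path_image g3 = P {a3, b3}" "pathstart g3 = pos a3" "pathfinish g3 = pos b3"
    using edge_arc E by blast
  have im: "P {a, b} \<inter> img A = {pos a}" "P {a, b} \<inter> img B = {pos b}"
    if "{a, b} \<in> E" "a \<in> A" "b \<in> B" for a b
    using edge_Int_img[of a b A] edge_Int_img[of b a B] that A B AB by (auto simp: insert_commute)
  have meet: "P {a, b} \<inter> P {a', b'} \<subseteq> img A \<union> img B"
    if "{a, b} \<in> E" "{a', b'} \<in> E" "{a, b} \<noteq> {a', b'}" "a \<in> A" "b \<in> B" for a b a' b'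
    using edges_meet[OF that(1,2,3)] that(4,5) by (auto simp: img_def)
  have q: "\<exists>q. q \<in> closure F \<inter> P {a, b} - (img A \<union> img B)" if "{a, b} \<in> FE F" "a \<in> A" "b \<in> B" for a b
  proof -
    have E: "{a, b} \<in> E" using that by (auto simp: bd_edges_def)
    obtain q where q: "q \<in> op {a, b}" using op_nonempty E by blast
    then have "q \<in> closure F" using closure_face_op F that by blast
    moreover have "q \<notin> img A" "q \<notin> img B" using q op_Int_img[OF E] that A B AB by auto
    ultimately show ?thesis using q by (auto simp: op_def)
  qed
  obtain q1 q2 q3 where q: "q1 \<in> closure F \<inter> P {a1, b1} - (img A \<union> img B)"
     "q2 \<in> closure F \<inter> P {a2, b2} - (img A \<union> img B)" "q3 \<in> closure F \<inter> P {a3, b3} - (img A \<union> img B)"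
    using q e1 e2 e3 by metis
  have FX: "F \<inter> (img A \<union> img B \<union> P {a1, b1} \<union> P {a2, b2} \<union> P {a3, b3}) = {}"
    using face_disjoint_X[OF F] img_subset_X A B P_subset_X E by blast
  show False
    by (rule not_touch_three_arcs[of "img A" "img B" g1 g2 g3 F q1 q2 q3])
      (use A B AB compact_img path_connected_img img_disjoint g1 g2 g3 im e1 e2 e3 E meet ne face_connected[OF F] FX q
       in simp_all)
qed

lemma two_edge_arc:
  assumes "{a, n} \<in> E" "{n, b} \<in> E" "a \<noteq> b"
  obtains g where "arc g" "path_image g = P {a, n} \<union> P {n, b}" "pathstart g = pos a" "pathfinish g = pos b"
proof -
  have "distinct [a, n, b]" using assms edge_ends by force
  then show ?thesis using path_arc[of "[a, n, b]"] assms that by auto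
qed

text \<open>Variant of \<open>not_three_crossing_edges\<close> with links of length two that are
  touched at their middle vertices. \<open>Q\<close> may contain parts of the graph;
  \<open>QX\<close> keeps these parts at vertices that the links do not use.\<close>

lemma not_touch_three_links:
  assumes A: "A \<subseteq> V" "conn E A" and B: "B \<subseteq> V" "conn E B" and AB: "A \<inter> B = {}"
    and n1: "{a1, n1} \<in> E" "{n1, b1} \<in> E" "a1 \<in> A" "b1 \<in> B" "n1 \<notin> A \<union> B"
    and n2: "{a2, n2} \<in> E" "{n2, b2} \<in> E" "a2 \<in> A" "b2 \<in> B" "n2 \<notin> A \<union> B"
    and n3: "{a3, n3} \<in> E" "{n3, b3} \<in> E" "a3 \<in> A" "b3 \<in> B" "n3 \<notin> A \<union> B"
    and ne: "n1 \<noteq> n2" "n1 \<noteq> n3" "n2 \<noteq> n3" and Q: "connected Q"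
    and QX: "\<And>x. x \<in> Q \<Longrightarrow> x \<in> X \<Longrightarrow> \<exists>w e. e \<in> E \<and> w \<in> e \<and> w \<notin> insert n1 (insert n2 (insert n3 (A \<union> B))) \<and> x \<in> insert (pos w) (op e)"
    and cl: "pos n1 \<in> closure Q" "pos n2 \<in> closure Q" "pos n3 \<in> closure Q"
  shows False
proof -
  have ab: "a1 \<noteq> b1" "a2 \<noteq> b2" "a3 \<noteq> b3" using AB n1 n2 n3 by auto
  obtain g1 where g1: "arc g1" "path_image g1 = P {a1, n1} \<union> P {n1, b1}" "pathstart g1 = pos a1" "pathfinish g1 = pos b1"
    using two_edge_arc[OF n1(1,2) ab(1)] by blast
  obtain g2 where g2: "arc g2" "path_image g2 = P {a2, n2} \<union> P {n2, b2}" "pathstart g2 = pos a2" "pathfinish g2 = pos b2"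
    using two_edge_arc[OF n2(1,2) ab(2)] by blast
  obtain g3 where g3: "arc g3" "path_image g3 = P {a3, n3} \<union> P {n3, b3}" "pathstart g3 = pos a3" "pathfinish g3 = pos b3"
    using two_edge_arc[OF n3(1,2) ab(3)] by blast
  have im: "(P {a, n} \<union> P {n, b}) \<inter> img A = {pos a}" "(P {a, n} \<union> P {n, b}) \<inter> img B = {pos b}"
    if "{a, n} \<in> E" "{n, b} \<in> E" "a \<in> A" "b \<in> B" "n \<notin> A \<union> B" for a n b
  proof -
    have "P {a, n} \<inter> img A = {pos a}" "P {b, n} \<inter> img B = {pos b}"
      using edge_Int_img that A B by (auto simp: insert_commute)
    moreover have "P {n, b} \<inter> img A = {}" "P {a, n} \<inter> img B = {}"
      by (rule edge_Int_img_empty; use that A B AB in auto)+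
    ultimately show "(P {a, n} \<union> P {n, b}) \<inter> img A = {pos a}" "(P {a, n} \<union> P {n, b}) \<inter> img B = {pos b}"
      by (auto simp: insert_commute)
  qed
  have meet1: "P e \<inter> P e' \<subseteq> img A \<union> img B" if "e \<in> E" "e' \<in> E" "e \<inter> e' \<subseteq> A \<union> B" "e \<noteq> e'" for e e'
  proof -
    have "pos ` (e \<inter> e') \<subseteq> pos ` (A \<union> B)" using that(3) by blast
    also have "pos ` (A \<union> B) \<subseteq> img A \<union> img B" by (auto simp: img_def)
    finally show ?thesis using edges_meet[OF that(1,2,4)] by blast
  qed
  have meet: "(P {a, n} \<union> P {n, b}) \<inter> (P {a', n'} \<union> P {n', b'}) \<subseteq> img A \<union> img B"
    if "{a, n} \<in> E" "{n, b} \<in> E" "a \<in> A" "b \<in> B" "n \<notin> A \<union> B" "{a', n'} \<in> E" "{n', b'} \<in> E" "a' \<in> A" "b' \<in> B" "n' \<notin> A \<union> B"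
      "n \<noteq> n'" for a n b a' n' b'
  proof -
    have "P {a, n} \<inter> P {a', n'} \<subseteq> img A \<union> img B" "P {a, n} \<inter> P {n', b'} \<subseteq> img A \<union> img B"
      "P {n, b} \<inter> P {a', n'} \<subseteq> img A \<union> img B" "P {n, b} \<inter> P {n', b'} \<subseteq> img A \<union> img B"
      by (rule meet1; use that in \<open>auto simp: doubleton_eq_iff\<close>)+
    then show ?thesis by blast
  qed
  have out: "pos n \<notin> img A \<union> img B" if "{a, n} \<in> E" "n \<notin> A \<union> B" for a n
    using pos_in_img[of n A] pos_in_img[of n B] edge_ends[OF that(1)] that A B by auto
  have im': "pos n \<in> P {a, n}" if "{a, n} \<in> E" for a n
    using pos_in_edge[OF that] by simp
  have QM: "Q \<inter> (img A \<union> img B \<union> path_image g1 \<union> path_image g2 \<union> path_image g3) = {}"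
  proof (rule ccontr)
    assume "\<not> ?thesis"
    then obtain x where x: "x \<in> Q" "x \<in> img A \<union> img B \<union> path_image g1 \<union> path_image g2 \<union> path_image g3" by blast
    have 1: "path_image g1 \<union> path_image g2 \<union> path_image g3 \<subseteq> X"
      unfolding g1(2) g2(2) g3(2) using P_subset_X n1(1,2) n2(1,2) n3(1,2) by simp
    then have "x \<in> X" using x(2) img_subset_X[OF A(1)] img_subset_X[OF B(1)] by blast
    then obtain w e where w: "e \<in> E" "w \<in> e" "w \<notin> insert n1 (insert n2 (insert n3 (A \<union> B)))" "x \<in> insert (pos w) (op e)"
      using QX[OF x(1) \<open>x \<in> X\<close>] by blast
    have wV: "w \<in> V" using edge_subset[OF w(1)] w(2) by blast
    have nA: "x \<notin> img A" "x \<notin> img B"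
      using w op_Int_img[OF w(1)] A B pos_in_img[OF wV] by auto
    have nP: "x \<notin> P e'" if e': "e' \<in> E" "w \<notin> e'" for e'
    proof -
      have "e \<noteq> e'" using w(2) e' by blast
      then show ?thesis using w(4) op_disjoint[OF w(1) e'(1)] pos_on_edge[OF e'(1) wV] e'(2) by blast
    qed
    have "x \<notin> path_image g1" "x \<notin> path_image g2" "x \<notin> path_image g3"
      unfolding g1(2) g2(2) g3(2)
      using nP[OF n1(1)] nP[OF n1(2)] nP[OF n2(1)] nP[OF n2(2)] nP[OF n3(1)] nP[OF n3(2)] w(3)
        n1(3,4) n2(3,4) n3(3,4) by auto
    then show False using x nA by blast
  qed
  show False
    by (rule not_touch_three_arcs[of "img A" "img B" g1 g2 g3 Q "pos n1" "pos n2" "pos n3"])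
      (use A B AB compact_img path_connected_img img_disjoint g1 g2 g3 im n1 n2 n3 meet ne Q QM out im' cl
       in simp_all)
qed

section \<open>Faces around a vertex\<close>

definition star :: "'v \<Rightarrow> 'v set set" where
  "star v = {e \<in> E. v \<in> e}"

lemma small_ball:
  assumes "v \<in> V"
  obtains r where "r > 0" "ball (pos v) r \<inter> X \<subseteq> insert (pos v) (\<Union>e\<in>star v. op e)"
proof -
  define Z where "Z = pos ` (V - {v}) \<union> (\<Union>e\<in>E - star v. P e)"
  have "compact Z" unfolding Z_def using finite_V finite_E compact_P
    by (intro compact_Un compact_UN) (auto intro: finite_imp_compact)
  then have "open (- Z)" by (simp add: compact_imp_closed open_Compl)
  moreover have "pos v \<notin> Z"
    using assms pos_on_edge pos_eq_iff by (auto simp: Z_def star_def)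
  ultimately obtain r where r: "r > 0" "ball (pos v) r \<subseteq> - Z"
    using open_contains_ball_eq by (metis ComplI)
  have "X - Z \<subseteq> insert (pos v) (\<Union>e\<in>star v. op e)"
  proof
    fix x assume x: "x \<in> X - Z"
    then have "x \<in> X" by blast
    then show "x \<in> insert (pos v) (\<Union>e\<in>star v. op e)"
    proof (cases rule: X_cases)
      case (1 w) then show ?thesis using x by (auto simp: Z_def)
    next
      case (2 e) then show ?thesis using x by (auto simp: Z_def op_def)
    qed
  qed
  then show ?thesis using that[of r] r by blast
qed

lemma frontier_crossing:
  assumes "face F" "connected C" "C \<inter> F \<noteq> {}" "\<not> C \<subseteq> F"
  shows "\<exists>z. z \<in> C \<and> z \<in> X \<and> z \<in> closure F"
proof -
  have "C \<inter> frontier F \<noteq> {}" using assms connected_Int_frontier[of C F] by blast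
  then show ?thesis using frontier_face_subset[OF assms(1)] by (auto simp: frontier_def)
qed

text \<open>An open set in the role of an angular sector at a vertex: the open edges of
  \<open>S\<close> glued to all faces that they border.\<close>

definition sector :: "'v set set \<Rightarrow> (real^2) set" where
  "sector S = (\<Union>e\<in>S. op e) \<union> \<Union>{F. face F \<and> FE F \<inter> S \<noteq> {}}"

text \<open>Around a point of an open edge some disc misses the rest of the drawing, so a face that
  enters this disc without filling it can end only on that edge.\<close>

lemma open_sector:
  assumes "S \<subseteq> E"
  shows "open (sector S)"
  unfolding open_contains_ball
proof
  fix x assume "x \<in> sector S"
  then consider e where "e \<in> S" "x \<in> op e" | F where "face F" "FE F \<inter> S \<noteq> {}" "x \<in> F"
    by (auto simp: sector_def)
  then show "\<exists>r>0. ball x r \<subseteq> sector S"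
  proof cases
    case 1
    then have e: "e \<in> E" using assms by blast
    have "open (- without e)" using compact_without by (simp add: compact_imp_closed open_Compl)
    moreover have "x \<in> - without e" using 1 op_without e by blast
    ultimately obtain r where r: "r > 0" "ball x r \<subseteq> - without e" using open_contains_ball by blast
    have "y \<in> sector S" if y: "y \<in> ball x r" for y
    proof (cases "y \<in> X")
      case True
      then have "y \<in> P e" using y r without_Un[OF e] by blast
      moreover have "y \<notin> without e" using y r by blast
      ultimately have "y \<in> op e" using P_without[OF e] unfolding op_def by blast
      then show ?thesis using 1 by (auto simp: sector_def)
    next
      case False
      let ?G = "connected_component_set (- X) y"
      have G: "face ?G" "y \<in> ?G" using face_of_point False by auto
      have "x \<in> X" using 1 e P_subset_X by (auto simp: op_def)
      then have nsub: "\<not> ball x r \<subseteq> ?G" using face_disjoint_X[OF G(1)] r centre_in_ball by blast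
      have "ball x r \<inter> ?G \<noteq> {}" using G y by blast
      then obtain z where z: "z \<in> ball x r" "z \<in> X" "z \<in> closure ?G"
        using frontier_crossing[OF G(1) connected_ball _ nsub] by blast
      then have "z \<in> P e" using r(2) without_Un[OF e] by blast
      moreover have "z \<notin> without e" using z r by blast
      ultimately have "z \<in> op e" using P_without[OF e] unfolding op_def by blast
      then have "e \<in> FE ?G" using FE_if_touch[OF G(1) e] z by blast
      then show ?thesis using G 1 by (auto simp: sector_def)
    qed
    then show ?thesis using r by blast
  next
    case 2
    then obtain r where "r > 0" "ball x r \<subseteq> F" using face_open open_contains_ball by blast
    moreover have "F \<subseteq> sector S" using 2 by (auto simp: sector_def)
    ultimately show ?thesis by blast
  qed
qed

lemma near_op:
  assumes "e \<in> star v" "r > 0"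
  shows "op e \<inter> ball (pos v) r \<noteq> {}"
proof -
  have "pos v \<in> closure (op e)" using assms closure_op pos_in_edge by (auto simp: star_def)
  then show ?thesis using assms(2) closure_iff_nhds_not_empty
    by (metis Int_commute centre_in_ball open_ball open_Int_closure_eq_empty disjoint_iff)
qed

text \<open>If no face had edges from both parts, the sectors of \<open>S\<close> and of its
  complement would disconnect a small punctured disc at \<open>v\<close>.\<close>

lemma face_at_star_transition:
  assumes v: "v \<in> V" and S: "S \<noteq> {}" "S \<subseteq> star v" "star v - S \<noteq> {}"
  shows "\<exists>F e e'. face F \<and> e \<in> S \<and> e' \<in> star v - S \<and> e \<in> FE F \<and> e' \<in> FE F"
proof (rule ccontr)
  assume "\<nexists>F e e'. face F \<and> e \<in> S \<and> e' \<in> star v - S \<and> e \<in> FE F \<and> e' \<in> FE F"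
  then have none: "False" if "face F" "e \<in> S" "e' \<in> star v - S" "e \<in> FE F" "e' \<in> FE F" for F e e'
    using that by blast
  let ?T = "star v - S"
  have sE: "star v \<subseteq> E" by (auto simp: star_def)
  obtain r where r: "r > 0" "ball (pos v) r \<inter> X \<subseteq> insert (pos v) (\<Union>e\<in>star v. op e)"
    using small_ball v by blast
  define N where "N = ball (pos v) r - {pos v}"
  have cN: "connected N" unfolding N_def by (rule connected_punctured_ball) simp
  have near: "op e \<inter> N \<noteq> {}" if "e \<in> star v" for e
    using near_op[OF that r(1)] op_not_pos[of e v] that v sE by (auto simp: N_def)
  have cover: "N \<subseteq> sector S \<union> sector ?T"
  proof
    fix x assume x: "x \<in> N"
    show "x \<in> sector S \<union> sector ?T"
    proof (cases "x \<in> X")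
      case True
      then obtain e where "e \<in> star v" "x \<in> op e" using x r(2) unfolding N_def by blast
      then show ?thesis unfolding sector_def by blast
    next
      case False
      let ?G = "connected_component_set (- X) x"
      have G: "face ?G" "x \<in> ?G" using face_of_point False by auto
      obtain e0 where e0: "e0 \<in> star v" using S by blast
      have "\<not> N \<subseteq> ?G"
        using near[OF e0] face_disjoint_X[OF G(1)] P_subset_X[of e0] e0 sE by (auto simp: op_def)
      then obtain z where z: "z \<in> N" "z \<in> X" "z \<in> closure ?G"
        using frontier_crossing[OF G(1) cN] G x by blast
      then obtain e where e: "e \<in> star v" "z \<in> op e" using r by (auto simp: N_def)
      then have "e \<in> FE ?G" using FE_if_touch[OF G(1)] z sE by blast
      then show ?thesis using G e(1) unfolding sector_def by blast
    qed
  qed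
  have "sector S \<inter> sector ?T = {}"
  proof -
    have opF: False if "e \<in> star v" "x \<in> op e" "face F" "x \<in> F" for e F x
      using face_disjoint_X[OF that(3)] P_subset_X[of e] that sE by (auto simp: op_def)
    have False if x: "x \<in> sector S" "x \<in> sector ?T" for x
    proof -
      have a: "(\<exists>e\<in>S. x \<in> op e) \<or> (\<exists>F. face F \<and> FE F \<inter> S \<noteq> {} \<and> x \<in> F)"
        using x(1) unfolding sector_def by blast
      have b: "(\<exists>e\<in>?T. x \<in> op e) \<or> (\<exists>F. face F \<and> FE F \<inter> ?T \<noteq> {} \<and> x \<in> F)"
        using x(2) unfolding sector_def by blast
      show False using a
      proof (elim disjE bexE exE conjE)
        fix e assume e: "e \<in> S" "x \<in> op e"
        show False using b
        proof (elim disjE bexE exE conjE)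
          fix e' assume e': "e' \<in> ?T" "x \<in> op e'"
          then have "e \<in> E" "e' \<in> E" "e \<noteq> e'" using e S(2) sE by auto
          then show False using op_disjoint[of e e'] e e' by (auto simp: op_def)
        qed (use opF[of e x] e S(2) in blast)
      next
        fix F assume F: "face F" "FE F \<inter> S \<noteq> {}" "x \<in> F"
        show False using b
        proof (elim disjE bexE exE conjE)
          fix G assume G: "face G" "FE G \<inter> ?T \<noteq> {}" "x \<in> G"
          then have "F = G" using face_eq[OF F(1) G(1)] F(3) by blast
          then show False using none[OF F(1)] F(2) G(2) by blast
        qed (use opF[of _ x F] F in blast)
      qed
    qed
    then show ?thesis by blast
  qed
  moreover have "open (sector S)" "open (sector ?T)"
    using open_sector[of S] open_sector[of ?T] S(2) sE by blast+
  moreover have meets: "sector R \<inter> N \<noteq> {}" if R: "R \<subseteq> star v" "R \<noteq> {}" for R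
  proof -
    obtain e where e: "e \<in> R" using R(2) by blast
    then have "op e \<subseteq> sector R" by (auto simp: sector_def)
    then show ?thesis using near[of e] e R(1) by blast
  qed
  moreover have "sector S \<inter> N \<noteq> {}" by (rule meets) (use S in auto)
  moreover have "sector ?T \<inter> N \<noteq> {}" by (rule meets) (use S in auto)
  ultimately show False using connectedD[OF cN, of "sector S" "sector ?T"] cover by blast
qed

text \<open>A small punctured disc at \<open>v\<close> is connected and contains points of edges, so
  a face that enters it must end inside it, on an edge at \<open>v\<close>.\<close>

lemma face_edge_at_vertex:
  assumes F: "face F" "v \<in> FV F" and "star v \<noteq> {}"
  shows "star v \<inter> FE F \<noteq> {}"
proof -
  have v: "v \<in> V" "pos v \<in> closure F" using F by (auto simp: FV_iff)
  obtain r where r: "r > 0" "ball (pos v) r \<inter> X \<subseteq> insert (pos v) (\<Union>e\<in>star v. op e)"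
    using small_ball v by blast
  define N where "N = ball (pos v) r - {pos v}"
  have cN: "connected N" unfolding N_def by (rule connected_punctured_ball) simp
  obtain x where x: "x \<in> F" "x \<in> ball (pos v) r"
    using closure_meets_ball[OF v(2) r(1)] by blast
  have "x \<in> N" using x face_disjoint_X[OF F(1)] pos_in_X[OF v(1)] by (auto simp: N_def)
  obtain e0 where e0: "e0 \<in> star v" using assms by blast
  have "op e0 \<inter> N \<noteq> {}" using near_op[OF e0 r(1)] op_not_pos[of e0 v] e0 v by (auto simp: N_def star_def)
  then have "\<not> N \<subseteq> F" using face_disjoint_X[OF F(1)] P_subset_X[of e0] e0 by (auto simp: op_def star_def)
  then obtain z where z: "z \<in> N" "z \<in> X" "z \<in> closure F"
    using frontier_crossing[OF F(1) cN] \<open>x \<in> N\<close> x by blast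
  then obtain e where e: "e \<in> star v" "z \<in> op e" using r by (auto simp: N_def)
  then have "e \<in> FE F" using FE_if_touch[OF F(1)] z by (auto simp: star_def)
  then show ?thesis using e by blast
qed

text \<open>By \<open>arc_end_not_separating\<close>, removing \<open>e\<close> alone does not cut
  the disc at \<open>v\<close>. A connection off \<open>e\<close> from the face to a point of
  \<open>e'\<close> therefore leaves the face across an edge different from
  \<open>e\<close>.\<close>

lemma face_second_edge_at_vertex:
  assumes F: "face F" "v \<in> FV F" and e: "e \<in> star v" and e': "e' \<in> star v" "e' \<noteq> e"
  obtains e'' where "e'' \<in> star v \<inter> FE F" "e'' \<noteq> e"
proof -
  have v: "v \<in> V" "pos v \<in> closure F" using F by (auto simp: FV_iff)
  have eE: "e \<in> E" "e' \<in> E" "v \<in> e" using e e' by (auto simp: star_def)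
  obtain w where w: "e = {v, w}" "w \<noteq> v" "w \<in> V" using edge_other[OF eE(1,3)] .
  obtain g where g: "arc g" "path_image g = P e" "pathstart g = pos v"
    using edge_arc eE(1) unfolding w(1) by blast
  obtain r where r: "r > 0" "ball (pos v) r \<inter> X \<subseteq> insert (pos v) (\<Union>e\<in>star v. op e)"
    using small_ball v by blast
  obtain r' where r': "0 < r'" "r' \<le> r" and
    cc: "\<And>x y. x \<in> ball (pos v) r' - P e \<Longrightarrow> y \<in> ball (pos v) r' - P e \<Longrightarrow>
       connected_component (ball (pos v) r - P e) x y"
    using arc_end_not_separating[OF g(1) r(1)] unfolding g(2,3) by metis
  obtain x where x: "x \<in> F" "x \<in> ball (pos v) r'"
    using closure_meets_ball[OF v(2) r'(1)] by blast
  obtain y where y: "y \<in> op e'" "y \<in> ball (pos v) r'" using near_op[OF e'(1) r'(1)] by blast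
  have "x \<notin> P e" using x face_disjoint_X[OF F(1)] P_subset_X[OF eE(1)] by blast
  moreover have "y \<notin> P e" using y op_disjoint[OF eE(2,1)] e' by blast
  ultimately obtain C where C: "connected C" "C \<subseteq> ball (pos v) r - P e" "x \<in> C" "y \<in> C"
    using cc[of x y] x y unfolding connected_component_def by blast
  have "y \<notin> F" using y face_disjoint_X[OF F(1)] P_subset_X[OF eE(2)] by (auto simp: op_def)
  then obtain z where z: "z \<in> C" "z \<in> X" "z \<in> closure F"
    using frontier_crossing[OF F(1) C(1)] C x by blast
  have "z \<noteq> pos v" using z C pos_in_edge[OF eE(1)] e by (auto simp: star_def)
  then obtain e'' where e'': "e'' \<in> star v" "z \<in> op e''" using r z C by blast
  have "e'' \<in> FE F" using FE_if_touch[OF F(1)] z e'' by (auto simp: star_def)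
  moreover have "e'' \<noteq> e" using e'' z C by (auto simp: op_def)
  ultimately show ?thesis using that e'' by blast
qed

end

section \<open>Cycles and cuts\<close>

lemma nat_last_true:
  fixes a b :: nat
  assumes "Q a" "\<not> Q b" "a < b"
  obtains i where "a \<le> i" "i < b" "Q i" "\<not> Q (Suc i)"
proof -
  define j where "j = (LEAST j. a \<le> j \<and> \<not> Q j)"
  have j: "a \<le> j" "\<not> Q j" using LeastI[of "\<lambda>j. a \<le> j \<and> \<not> Q j" b] assms by (auto simp: j_def)
  have jb: "j \<le> b" unfolding j_def by (rule Least_le) (use assms in auto)
  have "j \<noteq> a" using assms j by auto
  then have "a \<le> j - 1" "j - 1 < j" "Suc (j - 1) = j" using j by auto
  then have "Q (j - 1)" using not_less_Least[of "j - 1" "\<lambda>j. a \<le> j \<and> \<not> Q j"] by (auto simp: j_def)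
  then show ?thesis using that[of "j - 1"] \<open>a \<le> j - 1\<close> \<open>Suc (j - 1) = j\<close> j jb by auto
qed

lemma path_edges_nth: "Suc i < length xs \<Longrightarrow> {xs ! i, xs ! Suc i} \<in> path_edges xs"
proof (induction xs arbitrary: i rule: path_edges.induct)
  case (1 x y zs)
  show ?case
  proof (cases i)
    case (Suc j)
    then have "{(y # zs) ! j, (y # zs) ! Suc j} \<in> path_edges (y # zs)" using 1 by auto
    then show ?thesis using Suc by auto
  qed auto
qed auto

lemma cycle_list_rotate:
  assumes "cycle_list VS ES vs"
  shows "cycle_list VS ES (rotate k vs)"
proof -
  define n where "n = length vs"
  have n: "n \<ge> 3" using assms by (simp add: cycle_list_def n_def)
  then have n0: "0 < n" by simp
  have nth: "rotate k vs ! i = vs ! ((k + i) mod n)" if "i < n" for i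
    using that nth_rotate[of i vs k] by (simp add: n_def)
  have edge: "{rotate k vs ! i, rotate k vs ! ((i + 1) mod n)} = {vs ! ((k + i) mod n), vs ! (((k + i) mod n + 1) mod n)}"
    if "i < n" for i
  proof -
    have "(i + 1) mod n < n" using n0 by simp
    then show ?thesis using nth[OF that] nth[of "(i + 1) mod n"] by (simp add: mod_simps add.assoc)
  qed
  have "{{rotate k vs ! i, rotate k vs ! ((i + 1) mod n)} | i. i < n} = {{vs ! i, vs ! ((i + 1) mod n)} | i. i < n}"
    (is "?A = ?B")
  proof (intro equalityI subsetI)
    fix e assume "e \<in> ?A"
    then obtain i where "i < n" "e = {rotate k vs ! i, rotate k vs ! ((i + 1) mod n)}" by blast
    then have "e = {vs ! ((k + i) mod n), vs ! (((k + i) mod n + 1) mod n)}" using edge by simp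
    moreover have "(k + i) mod n < n" using n0 by simp
    ultimately show "e \<in> ?B" by blast
  next
    fix e assume "e \<in> ?B"
    then obtain i where i: "i < n" "e = {vs ! i, vs ! ((i + 1) mod n)}" by blast
    \<comment> \<open>The inverse rotation; \<open>n - k mod n\<close> keeps the subtraction of
      natural numbers exact.\<close>
    define i' where "i' = (i + (n - k mod n)) mod n"
    have i'n: "i' < n" using n0 by (simp add: i'_def)
    have "(k + i') mod n = (k mod n + (i + (n - k mod n))) mod n"
      by (simp add: i'_def mod_simps)
    also have "k mod n + (i + (n - k mod n)) = i + n" using mod_less_divisor[OF n0, of k] by linarith
    finally have "(k + i') mod n = i" using i by simp
    then have "e = {rotate k vs ! i', rotate k vs ! ((i' + 1) mod n)}" using edge[OF i'n] i by simp
    then show "e \<in> ?A" using i'n by blast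
  qed
  then show ?thesis using assms by (auto simp: cycle_list_def n_def)
qed

lemma cycle_list_start_at:
  assumes "cycle_list VS ES vs" "i < length vs"
  obtains ws where "cycle_list VS ES ws" "ws = rotate i vs" "ws ! 0 = vs ! i" "length ws = length vs"
proof
  show "cycle_list VS ES (rotate i vs)" by (rule cycle_list_rotate[OF assms(1)])
  have "0 < length vs" using assms by auto
  then show "rotate i vs ! 0 = vs ! i" using assms(2) nth_rotate[of 0 vs i] by simp
qed auto

lemma simple_cycle_start:
  assumes "simple_cycle VS ES" "a \<in> VS"
  obtains ws where "cycle_list VS ES ws" "ws ! 0 = a"
proof -
  obtain vs where vs: "cycle_list VS ES vs" using assms by (auto simp: simple_cycle_def)
  then obtain i where "i < length vs" "vs ! i = a"
    using assms(2) by (metis cycle_list_def in_set_conv_nth)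
  then show ?thesis using cycle_list_start_at[OF vs] that by metis
qed

lemma cycle_list_edge: "cycle_list VS ES vs \<Longrightarrow> Suc i < length vs \<Longrightarrow> {vs ! i, vs ! Suc i} \<in> ES"
  unfolding cycle_list_def by force

lemma cycle_list_edge_last:
  assumes "cycle_list VS ES vs" shows "{vs ! (length vs - 1), vs ! 0} \<in> ES"
proof -
  have "length vs \<ge> 3" using assms by (simp add: cycle_list_def)
  then have l: "length vs - 1 < length vs" "length vs - 1 + 1 = length vs" by auto
  have "{vs ! (length vs - 1), vs ! ((length vs - 1 + 1) mod length vs)} \<in> ES"
    using assms l(1) unfolding cycle_list_def by blast
  then show ?thesis unfolding l(2) by simp
qed

lemma cycle_list_edgeE:
  assumes "cycle_list VS ES vs" "e \<in> ES"
  obtains i where "Suc i < length vs" "e = {vs ! i, vs ! Suc i}" | "e = {vs ! (length vs - 1), vs ! 0}"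
proof -
  obtain i where i: "i < length vs" "e = {vs ! i, vs ! ((i + 1) mod length vs)}"
    using assms unfolding cycle_list_def by blast
  show ?thesis
  proof (cases "Suc i < length vs")
    case True then show ?thesis using that(1)[of i] i by simp
  next
    case False
    then have s: "i + 1 = length vs" using i by linarith
    then have "i = length vs - 1" by simp
    then show ?thesis using that(2) i(2) unfolding s by simp
  qed
qed

lemma cycle_list_edges_at_start:
  assumes c: "cycle_list VS ES ws"
  shows "e \<in> ES \<and> ws ! 0 \<in> e \<longleftrightarrow> e = {ws ! 0, ws ! 1} \<or> e = {ws ! 0, ws ! (length ws - 1)}"
    and "ws ! 1 \<noteq> ws ! (length ws - 1)" "ws ! 0 \<noteq> ws ! 1" "ws ! 0 \<noteq> ws ! (length ws - 1)"
    "ws ! 1 \<in> VS" "ws ! (length ws - 1) \<in> VS"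
proof -
  define n where "n = length ws"
  have n: "n \<ge> 3" and d: "distinct ws" and s: "set ws = VS" using c by (auto simp: cycle_list_def n_def)
  have eq: "ws ! i = ws ! j \<longleftrightarrow> i = j" if "i < n" "j < n" for i j
    using d that nth_eq_iff_index_eq n_def by blast
  have "n - 1 < n" "1 < n" "0 < n" "n - 1 \<noteq> 1" "n - 1 \<noteq> 0" using n by auto
  then show "ws ! 1 \<noteq> ws ! (length ws - 1)" "ws ! 0 \<noteq> ws ! 1" "ws ! 0 \<noteq> ws ! (length ws - 1)"
    "ws ! 1 \<in> VS" "ws ! (length ws - 1) \<in> VS"
    using eq s unfolding n_def[symmetric] by (auto simp: n_def)
  show "e \<in> ES \<and> ws ! 0 \<in> e \<longleftrightarrow> e = {ws ! 0, ws ! 1} \<or> e = {ws ! 0, ws ! (length ws - 1)}"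
  proof
    assume e: "e \<in> ES \<and> ws ! 0 \<in> e"
    then have eES: "e \<in> ES" by simp
    consider i where "Suc i < length ws" "e = {ws ! i, ws ! Suc i}" | "e = {ws ! (length ws - 1), ws ! 0}"
      using cycle_list_edgeE[OF c eES] .
    then show "e = {ws ! 0, ws ! 1} \<or> e = {ws ! 0, ws ! (length ws - 1)}"
    proof cases
      case (1 i)
      then have i: "i < n" "Suc i < n" "0 < n" by (auto simp: n_def)
      have "ws ! 0 = ws ! i \<or> ws ! 0 = ws ! Suc i" using e unfolding 1(2) by blast
      then have "i = 0" using eq[OF i(3,1)] eq[OF i(3,2)] by simp
      then show ?thesis using 1 by simp
    next
      case 2 then show ?thesis by (simp add: insert_commute)
    qed
  next
    have "{ws ! 0, ws ! 1} \<in> ES" using cycle_list_edge[OF c, of 0] n by (simp add: n_def)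
    moreover have "{ws ! 0, ws ! (length ws - 1)} \<in> ES" using cycle_list_edge_last[OF c] by (simp add: insert_commute)
    moreover assume "e = {ws ! 0, ws ! 1} \<or> e = {ws ! 0, ws ! (length ws - 1)}"
    ultimately show "e \<in> ES \<and> ws ! 0 \<in> e" by auto
  qed
qed

lemma simple_cycle_two_edges:
  assumes "simple_cycle VS ES" "a \<in> VS"
  shows "\<exists>x y. x \<noteq> y \<and> x \<noteq> a \<and> y \<noteq> a \<and> x \<in> VS \<and> y \<in> VS
    \<and> (\<forall>e. e \<in> ES \<and> a \<in> e \<longleftrightarrow> e = {a, x} \<or> e = {a, y})"
proof -
  obtain ws where ws: "cycle_list VS ES ws" "ws ! 0 = a" using simple_cycle_start[OF assms] .
  note c = cycle_list_edges_at_start[OF ws(1), unfolded ws(2)]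
  show ?thesis
    by (intro exI[of _ "ws ! 1"] exI[of _ "ws ! (length ws - 1)"] conjI allI c c(3,4)[symmetric])
qed

lemma simple_cycle_card: "simple_cycle VS ES \<Longrightarrow> finite VS \<and> card VS \<ge> 3"
  unfolding simple_cycle_def cycle_list_def by (metis List.finite_set distinct_card)

text \<open>Read from \<open>a\<close>, the cycle without \<open>a\<close> is a path between the two
  neighbours of \<open>a\<close>. One end lies inside \<open>K\<close> and one outside, so the path
  changes over on an edge that avoids \<open>a\<close>.\<close>

lemma simple_cycle_leaves:
  assumes c: "simple_cycle VS ES" and a: "{a, x} \<in> ES" "{a, y} \<in> ES" "x \<in> K" "y \<notin> K" "a \<notin> K" "a \<in> VS"
  obtains p q where "{p, q} \<in> ES" "p \<in> K" "q \<notin> K" "q \<noteq> a"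
proof -
  obtain ws where ws: "cycle_list VS ES ws" "ws ! 0 = a" using simple_cycle_start[OF c a(6)] .
  define n where "n = length ws"
  have n: "n \<ge> 3" and d: "distinct ws" using ws by (auto simp: cycle_list_def n_def)
  have xy: "{a, x} = {a, ws ! 1} \<or> {a, x} = {a, ws ! (n - 1)}" "{a, y} = {a, ws ! 1} \<or> {a, y} = {a, ws ! (n - 1)}"
    using cycle_list_edges_at_start(1)[OF ws(1), of "{a, x}"] cycle_list_edges_at_start(1)[OF ws(1), of "{a, y}"] a(1,2)
    unfolding ws(2) n_def by blast+
  have "x \<noteq> y" using a by auto
  have na: "ws ! i \<noteq> a" if "0 < i" "i < n" for i
  proof -
    have "i < length ws" "0 < length ws" using that by (auto simp: n_def)
    then show ?thesis using nth_eq_iff_index_eq[OF d] that(1) unfolding ws(2)[symmetric] by blast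
  qed
  have n1: "1 < n - 1" "n - 1 < n" using n by auto
  have edge: "{ws ! i, ws ! Suc i} \<in> ES" if "i < n - 1" for i
    using cycle_list_edge[OF ws(1), of i] that by (simp add: n_def)
  consider "x = ws ! 1" "y = ws ! (n - 1)" | "y = ws ! 1" "x = ws ! (n - 1)"
    using xy \<open>x \<noteq> y\<close> by (auto simp: doubleton_eq_iff)
  then show ?thesis
  proof cases
    case 1
    obtain i where i: "1 \<le> i" "i < n - 1" "ws ! i \<in> K" "ws ! Suc i \<notin> K"
      using nat_last_true[of "\<lambda>i. ws ! i \<in> K" 1 "n - 1"] a 1 n1 by auto
    have "ws ! Suc i \<noteq> a" using na[of "Suc i"] i by auto
    then show ?thesis using that[of "ws ! i" "ws ! Suc i"] edge[of i] i by auto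
  next
    case 2
    obtain i where i: "1 \<le> i" "i < n - 1" "ws ! i \<notin> K" "ws ! Suc i \<in> K"
      using nat_last_true[of "\<lambda>i. ws ! i \<notin> K" 1 "n - 1"] a 2 n1 by auto
    have "ws ! i \<noteq> a" using na[of i] i by auto
    then show ?thesis using that[of "ws ! Suc i" "ws ! i"] edge[of i] i by (auto simp: insert_commute)
  qed
qed

lemma nth_steps:
  assumes "i \<le> j" "\<And>k. i \<le> k \<Longrightarrow> k < j \<Longrightarrow> {ws ! k, ws ! Suc k} \<in> D"
  shows "(ws ! i, ws ! j) \<in> (steps D)\<^sup>*"
  using assms
proof (induction j rule: dec_induct)
  case (step m)
  have "(ws ! i, ws ! m) \<in> (steps D)\<^sup>*" by (rule step.IH) (use step.prems in auto)
  moreover have "(ws ! m, ws ! Suc m) \<in> steps D" using step by auto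
  ultimately show ?case by (rule rtrancl_into_rtrancl)
qed auto

lemma cycle_minus_edge:
  assumes c: "simple_cycle VS ES" and e: "{u, v} \<in> ES"
  shows "(u, v) \<in> (steps (ES - {{u, v}}))\<^sup>*"
proof -
  have main: "(ws ! 0, ws ! (length ws - 1)) \<in> (steps (ES - {{ws ! (length ws - 1), ws ! 0}}))\<^sup>*"
    if ws: "cycle_list VS ES ws" for ws
  proof (rule nth_steps)
    fix k assume k: "0 \<le> k" "k < length ws - 1"
    have d: "distinct ws" "length ws \<ge> 3" using ws by (auto simp: cycle_list_def)
    have "Suc k < length ws" "length ws - 1 < length ws" "0 < length ws" using k by auto
    then have ne: "{ws ! k, ws ! Suc k} \<noteq> {ws ! (length ws - 1), ws ! 0}"
      using nth_eq_iff_index_eq[OF d(1)] k d(2) by (auto simp: doubleton_eq_iff)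
    then show "{ws ! k, ws ! Suc k} \<in> ES - {{ws ! (length ws - 1), ws ! 0}}"
      using cycle_list_edge[OF ws, of k] k by auto
  qed simp
  obtain vs where vs: "cycle_list VS ES vs" using c by (auto simp: simple_cycle_def)
  obtain ws where ws: "cycle_list VS ES ws" "{u, v} = {ws ! (length ws - 1), ws ! 0}"
  proof -
    consider i where "Suc i < length vs" "{u, v} = {vs ! i, vs ! Suc i}" | "{u, v} = {vs ! (length vs - 1), vs ! 0}"
      using cycle_list_edgeE[OF vs e] .
    then show ?thesis
    proof cases
    case (1 i)
    obtain ws where w: "cycle_list VS ES ws" "ws = rotate (Suc i) vs" "ws ! 0 = vs ! Suc i" "length ws = length vs"
      using cycle_list_start_at[OF vs 1(1)] .
    have "ws ! (length vs - 1) = vs ! ((Suc i + (length vs - 1)) mod length vs)"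
      using nth_rotate[of "length vs - 1" vs "Suc i"] w 1 by simp
    also have "Suc i + (length vs - 1) = i + length vs" using 1 by simp
    finally have "ws ! (length ws - 1) = vs ! i" using 1 w by simp
    then show ?thesis using that[of ws] w 1 by simp
  next
    case 2 then show ?thesis using that vs by blast
    qed
  qed
  have "u = ws ! 0 \<and> v = ws ! (length ws - 1) \<or> v = ws ! 0 \<and> u = ws ! (length ws - 1)"
    using ws(2) by (auto simp: doubleton_eq_iff)
  then show ?thesis
    using main[OF ws(1)] steps_rtrancl_sym[OF main[OF ws(1)]] ws(2) by auto
qed

section \<open>The external face and cut sets\<close>

locale plane_connected = plane_embedded V E pos c
  for V :: "'v set" and E :: "'v set set" and pos c +
  assumes conG: "graph_connected V E"
    and ext_cycle: "simple_cycle (ext_vertices V E pos c) (ext_edges V E pos c)"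
begin

text \<open>Chosen by \<open>SOME\<close> but unique, since the complement of a bounded plane set
  has only one unbounded component.\<close>

definition Fo :: "(real^2) set" where
  "Fo = (SOME F. face F \<and> \<not> bounded F)"

lemma face_Fo: "face Fo" and unbounded_Fo: "\<not> bounded Fo"
proof -
  have "bounded (- (- X))" using compact_X by (simp add: compact_imp_bounded)
  then have "\<exists>F. face F \<and> \<not> bounded F"
    using cobounded_unbounded_components[of "- X"] face_component by blast
  then have "face Fo \<and> \<not> bounded Fo" unfolding Fo_def by (rule someI_ex)
  then show "face Fo" "\<not> bounded Fo" by auto
qed

lemma bounded_iff: "face F \<Longrightarrow> bounded F \<longleftrightarrow> F \<noteq> Fo"
proof
  assume F: "face F" "F \<noteq> Fo"
  show "bounded F"
  proof (rule ccontr)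
    assume nb: "\<not> bounded F"
    have "bounded (- (- X))" using compact_X by (simp add: compact_imp_bounded)
    then have "Fo = F"
      using cobounded_unique_unbounded_components[of "- X" F Fo] F(1) face_Fo nb unbounded_Fo face_component by auto
    then show False using F by simp
  qed
qed (use unbounded_Fo in auto)

lemma ext_eq: "ext = FV Fo" and ext_edges_eq: "ext_edges V E pos c = FE Fo"
proof -
  have *: "face F \<and> \<not> bounded F \<longleftrightarrow> F = Fo" for F
    using bounded_iff face_Fo unbounded_Fo by blast
  have "ext = {v. \<exists>F. (face F \<and> \<not> bounded F) \<and> v \<in> FV F}" by (simp add: ext_vertices_def)
  then show "ext = FV Fo" unfolding * by simp
  have "ext_edges V E pos c = {e. \<exists>F. (face F \<and> \<not> bounded F) \<and> e \<in> FE F}" by (simp add: ext_edges_def)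
  then show "ext_edges V E pos c = FE Fo" unfolding * by simp
qed

lemma Fo_cycle: "simple_cycle (FV Fo) (FE Fo)"
  using ext_cycle by (simp add: ext_eq ext_edges_eq)

lemma ext_subset: "ext \<subseteq> V"
  by (auto simp: ext_eq bd_vertices_def)

lemma ext_card: "finite ext" "card ext \<ge> 3"
  using simple_cycle_card[OF ext_cycle] by auto

lemma ext_not_small: "\<not> ext \<subseteq> {a, b}"
proof
  assume "ext \<subseteq> {a, b}"
  then have "card ext \<le> card {a, b}" by (intro card_mono) auto
  also have "\<dots> \<le> 2" by (simp add: card_insert_if)
  finally show False using ext_card by simp
qed

lemma closed_eq_V:
  assumes "W \<subseteq> V" "w \<in> W" "\<And>x y. x \<in> W \<Longrightarrow> {x, y} \<in> E \<Longrightarrow> y \<in> W"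
  shows "W = V"
proof -
  have "y \<in> W" if "(w, y) \<in> {(x, y). {x, y} \<in> E}\<^sup>*" for y
    using that by (induction rule: rtrancl_induct) (use assms in auto)
  then show ?thesis using conG assms(1,2) unfolding graph_connected_def by blast
qed

lemma nbrs_subset_V: "nbrs E K \<subseteq> V"
  using edge_ends by (auto simp: nbrs_def)

lemma nbrs_nonempty:
  assumes "K \<subseteq> V" "K \<noteq> {}" "K \<noteq> V"
  shows "nbrs E K \<noteq> {}"
proof
  assume n: "nbrs E K = {}"
  obtain w where "w \<in> K" using assms by blast
  then have "K = V" using closed_eq_V[OF assms(1)] n unfolding nbrs_def by blast
  then show False using assms by blast
qed

lemma star_edge: "e \<in> star v \<Longrightarrow> \<exists>w. e = {v, w} \<and> w \<noteq> v \<and> w \<in> V"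
  using edge_other[of e v] unfolding star_def by (metis (no_types, lifting) mem_Collect_eq)

lemma star_doubleton: "{v, w} \<in> star v \<longleftrightarrow> {v, w} \<in> E"
  by (simp add: star_def)

end

text \<open>The common ground of both directions: the assumption is part of convex embeddability,
  and it is derived from an embedding in \<open>straight_map\<close>.\<close>

locale simple_faces = plane_connected V E pos c
  for V :: "'v set" and E :: "'v set set" and pos c +
  assumes face_cycle: "is_face V E pos c F \<Longrightarrow> simple_cycle (bd_vertices V pos F) (bd_edges E c F)"
begin

lemma face_two_edges:
  assumes "face F" "a \<in> FV F"
  shows "\<exists>x y. x \<noteq> y \<and> x \<noteq> a \<and> y \<noteq> a \<and> x \<in> FV F \<and> y \<in> FV F \<and> star a \<inter> FE F = {{a, x}, {a, y}}"
proof -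
  obtain x y where xy: "x \<noteq> y" "x \<noteq> a" "y \<noteq> a" "x \<in> FV F" "y \<in> FV F"
    "\<forall>e. e \<in> FE F \<and> a \<in> e \<longleftrightarrow> e = {a, x} \<or> e = {a, y}"
    using simple_cycle_two_edges[OF face_cycle[OF assms(1)] assms(2)] by blast
  have "star a \<inter> FE F = {e. e \<in> FE F \<and> a \<in> e}" by (auto simp: star_def bd_edges_def)
  also have "\<dots> = {{a, x}, {a, y}}" using xy(6) by blast
  finally show ?thesis using xy(1-5) by blast
qed

lemma face_star_eq:
  assumes "face F" "a \<in> FV F" "e1 \<in> star a \<inter> FE F" "e2 \<in> star a \<inter> FE F" "e1 \<noteq> e2"
  shows "star a \<inter> FE F = {e1, e2}"
proof -
  obtain x y where "star a \<inter> FE F = {{a, x}, {a, y}}" using face_two_edges[OF assms(1,2)] by blast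
  then show ?thesis using assms(3-5) by auto
qed

lemma frontier_face_edges: "face F \<Longrightarrow> frontier F = (\<Union>e\<in>FE F. P e)"
proof (rule frontier_eq_edges)
  fix v assume "face F" "v \<in> FV F"
  then obtain x y where "star v \<inter> FE F = {{v, x}, {v, y}}" using face_two_edges by blast
  then show "\<exists>e\<in>FE F. v \<in> e" by blast
qed

lemma face_leaves:
  assumes F: "face F" and a: "{a, x} \<in> FE F" "{a, y} \<in> FE F" "x \<in> K" "y \<notin> K" "a \<notin> K"
  shows "\<exists>z. z \<in> nbrs E K \<and> z \<noteq> a \<and> z \<in> FV F"
proof -
  have aF: "a \<in> FV F" using FE_subset_FV[OF F a(1)] by simp
  obtain p q where pq: "{p, q} \<in> FE F" "p \<in> K" "q \<notin> K" "q \<noteq> a"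
    using simple_cycle_leaves[OF face_cycle[OF F] a aF] .
  have "q \<in> nbrs E K" using pq by (auto simp: nbrs_def bd_edges_def)
  moreover have "q \<in> FV F" using FE_subset_FV[OF F pq(1)] by simp
  ultimately show ?thesis using pq by blast
qed

text \<open>Some edges at \<open>a\<close> lead into \<open>K\<close> and some do not, or else
  \<open>K\<close> and \<open>a\<close> would be the whole graph. A face between both kinds has a
  boundary cycle that must leave \<open>K\<close> at a vertex other than \<open>a\<close>.\<close>

lemma cut_at_least_two:
  assumes K: "K \<subseteq> V - ext" "K \<noteq> {}"
  shows "\<not> nbrs E K \<subseteq> {a}"
proof
  assume n: "nbrs E K \<subseteq> {a}"
  have KV: "K \<subseteq> V" "K \<noteq> V" using K ext_subset ext_not_small by blast+
  then have nb: "nbrs E K = {a}" using nbrs_nonempty[OF KV(1) K(2) KV(2)] n by blast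
  then have aK: "a \<notin> K" "a \<in> V" using nbrs_subset_V unfolding nbrs_def by blast+
  define S where "S = {e \<in> star a. \<exists>x\<in>K. e = {a, x}}"
  obtain x0 where x0: "x0 \<in> K" "{x0, a} \<in> E" using nb unfolding nbrs_def by blast
  then have S: "{a, x0} \<in> S" by (auto simp: S_def star_def insert_commute)
  have "star a - S \<noteq> {}"
  proof
    assume e: "star a - S = {}"
    have "insert a K = V"
    proof (rule closed_eq_V)
      fix x y assume xy: "x \<in> insert a K" "{x, y} \<in> E"
      show "y \<in> insert a K"
      proof (cases "x = a")
        case True
        then have "{a, y} \<in> S" using xy e by (auto simp: star_def)
        then show ?thesis by (auto simp: S_def doubleton_eq_iff)
      next
        case False
        then show ?thesis using xy nb unfolding nbrs_def by blast
      qed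
    qed (use aK KV in auto)
    then show False using K ext_subset ext_not_small[of a a] by blast
  qed
  then obtain F e e' where F: "face F" "e \<in> S" "e' \<in> star a - S" "e \<in> FE F" "e' \<in> FE F"
    using face_at_star_transition[OF aK(2), of S] S by (auto simp: S_def) blast
  obtain x where x: "x \<in> K" "e = {a, x}" using F(2) by (auto simp: S_def)
  obtain y where y: "e' = {a, y}" using F(3) star_edge by blast
  have "y \<notin> K" using F(3) y by (auto simp: S_def)
  then obtain z where "z \<in> nbrs E K" "z \<noteq> a"
    using face_leaves[OF F(1), of a x y K] F x y aK by blast
  then show False using n by blast
qed

text \<open>At an end of degree at least two some face lies between this edge and the others. If
  both ends had degree one, the edge would be the whole graph, too small for the external
  cycle.\<close>

lemma edge_on_face:
  assumes "e \<in> E" shows "\<exists>F. face F \<and> e \<in> FE F"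
proof -
  have main: "\<exists>F. face F \<and> e \<in> FE F" if "v \<in> V" "e \<in> star v" "star v \<noteq> {e}" for v
    using face_at_star_transition[OF that(1), of "{e}"] that by auto
  obtain u v where uv: "u \<in> V" "v \<in> V" "u \<noteq> v" "e = {u, v}" using edgeE[OF assms] .
  have e: "e \<in> star u" "e \<in> star v" using assms uv by (auto simp: star_def)
  have "star u \<noteq> {e} \<or> star v \<noteq> {e}"
  proof (rule ccontr)
    assume "\<not> ?thesis"
    then have s: "star u = {e}" "star v = {e}" by auto
    have "{u, v} = V"
    proof (rule closed_eq_V)
      fix x y assume "x \<in> {u, v}" "{x, y} \<in> E"
      then have "{x, y} \<in> star x" "x = u \<or> x = v" by (auto simp: star_def)
      then have "{x, y} = e" using s by auto
      then show "y \<in> {u, v}" using uv by auto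
    qed (use uv in auto)
    then show False using ext_subset ext_not_small by blast
  qed
  then show ?thesis using main[OF uv(1) e(1)] main[OF uv(2) e(2)] by blast
qed

text \<open>The boundary cycle of one bordering face closes the edge to a Jordan curve of the kind
  that \<open>two_faces_of_edge\<close> asks for.\<close>

lemma edge_two_faces:
  assumes "e \<in> E"
  shows "\<exists>F1 F2. face F1 \<and> face F2 \<and> F1 \<noteq> F2 \<and> (\<forall>F. face F \<longrightarrow> (e \<in> FE F \<longleftrightarrow> F = F1 \<or> F = F2))"
proof -
  obtain F where F: "face F" "e \<in> FE F" using edge_on_face[OF assms] by blast
  obtain u v where uv: "u \<in> V" "v \<in> V" "u \<noteq> v" "e = {u, v}" using edgeE[OF assms] .
  have e: "{v, u} \<in> FE F" using F(2) uv by (simp add: insert_commute)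
  have "(v, u) \<in> (steps (FE F - {{u, v}}))\<^sup>*"
    using cycle_minus_edge[OF face_cycle[OF F(1)] e] by (simp add: insert_commute)
  moreover have sub: "FE F - {{u, v}} \<subseteq> E - {{u, v}}" by (auto simp: bd_edges_def)
  ultimately obtain j where j: "simple_path j" "pathfinish j = pathstart j" "P {u, v} \<subseteq> path_image j"
    "path_image j \<subseteq> P {u, v} \<union> (\<Union>e\<in>FE F - {{u, v}}. P e)" "connected (path_image j \<inter> without {u, v})"
    using cycle_curve[OF assms[unfolded uv(4)]] by metis
  have "path_image j \<subseteq> X" using j(4) P_subset_X sub assms uv(4) by blast
  then show ?thesis
    using two_faces_of_edge[OF assms j(1,2) j(3)[folded uv(4)] _ j(5)[folded uv(4)]] by metis
qed

lemma three_faces_False: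
  assumes "face F1" "face F2" "face F3" "e \<in> FE F1" "e \<in> FE F2" "e \<in> FE F3" "F1 \<noteq> F2" "F1 \<noteq> F3" "F2 \<noteq> F3"
  shows False
proof -
  have "e \<in> E" using assms(4) by (simp add: bd_edges_def)
  from edge_two_faces[OF this] obtain G1 G2
    where G: "\<forall>F. face F \<longrightarrow> (e \<in> FE F \<longleftrightarrow> F = G1 \<or> F = G2)" by blast
  have "F1 = G1 \<or> F1 = G2" "F2 = G1 \<or> F2 = G2" "F3 = G1 \<or> F3 = G2" 
    using G[THEN spec, THEN mp, OF assms(1)] G[THEN spec, THEN mp, OF assms(2)] G[THEN spec, THEN mp, OF assms(3)] assms(4-6)
    by auto
  then show False using assms(7-9) by blast
qed

text \<open>Double counting: every edge of \<open>S\<close> lies on two faces, and a face meeting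
  \<open>S\<close> contains two edges of \<open>S\<close>, or just one if its other edge at
  \<open>v\<close> is outside \<open>S\<close>. The number of faces of the latter kind is therefore
  even.\<close>

lemma two_star_transitions:
  assumes v: "v \<in> V" and S: "S \<noteq> {}" "S \<subseteq> star v" "star v - S \<noteq> {}"
  shows "\<exists>F1 F2. face F1 \<and> face F2 \<and> F1 \<noteq> F2 \<and> S \<inter> FE F1 \<noteq> {} \<and> (star v - S) \<inter> FE F1 \<noteq> {}
    \<and> S \<inter> FE F2 \<noteq> {} \<and> (star v - S) \<inter> FE F2 \<noteq> {}"
proof -
  define tr where "tr F \<longleftrightarrow> face F \<and> S \<inter> FE F \<noteq> {} \<and> (star v - S) \<inter> FE F \<noteq> {}" for F
  obtain F0 where F0: "tr F0" using face_at_star_transition[OF v S] unfolding tr_def by blast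
  have "\<exists>F. tr F \<and> F \<noteq> F0"
  proof (rule ccontr)
    assume "\<not> ?thesis"
    then have only: "tr F \<Longrightarrow> F = F0" for F by blast
    define \<Phi> where "\<Phi> = {F. face F \<and> FE F \<inter> S \<noteq> {}}"
    have SE: "S \<subseteq> E" using S by (auto simp: star_def)
    have two: "card {F. face F \<and> e \<in> FE F} = 2" "finite {F. face F \<and> e \<in> FE F}" if e: "e \<in> S" for e
    proof -
      have eE: "e \<in> E" using e SE by blast
      obtain F1 F2 where "face F1" "face F2" "F1 \<noteq> F2" "\<forall>F. face F \<longrightarrow> (e \<in> FE F \<longleftrightarrow> F = F1 \<or> F = F2)"
        using edge_two_faces[OF eE] by blast
      then have "{F. face F \<and> e \<in> FE F} = {F1, F2}" "F1 \<noteq> F2" by auto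
      then show "card {F. face F \<and> e \<in> FE F} = 2" "finite {F. face F \<and> e \<in> FE F}" by auto
    qed
    have finS: "finite S" using SE finite_E finite_subset by blast
    have fin: "finite \<Phi>"
    proof -
      have "\<Phi> = (\<Union>e\<in>S. {F. face F \<and> e \<in> FE F})" by (auto simp: \<Phi>_def)
      then show ?thesis using two finS by simp
    qed
    have cnt: "card {e \<in> S. e \<in> FE F} = (if F = F0 then 1 else 2)" if F: "F \<in> \<Phi>" for F
    proof -
      have fF: "face F" using F by (simp add: \<Phi>_def)
      obtain e where e: "e \<in> S" "e \<in> FE F" using F by (auto simp: \<Phi>_def)
      have "v \<in> FV F" using FE_subset_FV[OF fF e(2)] e S by (auto simp: star_def)
      then obtain x y where xy: "x \<noteq> y" "x \<noteq> v" "y \<noteq> v" "star v \<inter> FE F = {{v, x}, {v, y}}"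
        using face_two_edges[OF fF] by blast
      have ne: "{v, x} \<noteq> {v, y}" using xy by (auto simp: doubleton_eq_iff)
      have eq: "{e \<in> S. e \<in> FE F} = S \<inter> (star v \<inter> FE F)" using S by blast
      have "(star v - S) \<inter> FE F = (star v \<inter> FE F) - S" by blast
      then have tr_iff: "tr F \<longleftrightarrow> S \<inter> (star v \<inter> FE F) \<noteq> {} \<and> (star v \<inter> FE F) - S \<noteq> {}"
        unfolding tr_def using fF S(2) by blast
      show ?thesis
      proof (cases "F = F0")
        case True
        then have "S \<inter> {{v, x}, {v, y}} \<noteq> {}" "{{v, x}, {v, y}} - S \<noteq> {}" using F0 tr_iff xy(4) by auto
        then have "S \<inter> {{v, x}, {v, y}} = {{v, x}} \<or> S \<inter> {{v, x}, {v, y}} = {{v, y}}" by auto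
        then show ?thesis using eq xy(4) True by auto
      next
        case False
        then have "(star v \<inter> FE F) - S = {}" using tr_iff only e S(2) by blast
        then have "S \<inter> (star v \<inter> FE F) = {{v, x}, {v, y}}" using xy(4) by blast
        then show ?thesis using eq ne False by simp
      qed
    qed
    have F0\<Phi>: "F0 \<in> \<Phi>" using F0 by (auto simp: tr_def \<Phi>_def)
    have "(\<Sum>e\<in>S. card {F \<in> \<Phi>. e \<in> FE F}) = sum (\<lambda>F. if F = F0 then 1 else 2) \<Phi>"
      by (rule sum_multicount_gen[OF finS fin]) (use cnt in auto)
    moreover have "{F \<in> \<Phi>. e \<in> FE F} = {F. face F \<and> e \<in> FE F}" if "e \<in> S" for e
      using that by (auto simp: \<Phi>_def)
    ultimately have "2 * card S = sum (\<lambda>F. if F = F0 then 1 else 2) \<Phi>" using two by simp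
    also have "\<dots> = 1 + sum (\<lambda>F. if F = F0 then 1 else 2) (\<Phi> - {F0})"
      using sum.remove[OF fin F0\<Phi>, of "\<lambda>F. if F = F0 then 1 else 2 :: nat"] by (simp only: if_True simp_thms)
    also have "sum (\<lambda>F. if F = F0 then 1 else 2) (\<Phi> - {F0}) = sum (\<lambda>F. 2) (\<Phi> - {F0})"
      by (rule sum.cong) auto
    also have "\<dots> = 2 * card (\<Phi> - {F0})" by simp
    finally show False by presburger
  qed
  then show ?thesis using F0 unfolding tr_def by blast
qed

end

section \<open>Consequences of convex embeddability\<close>

locale convex_embeddable_graph = plane_connected V E pos c
  for V :: "'v set" and E :: "'v set set" and pos c +
  assumes ce: "convex_embeddable V E pos c"
begin

sublocale simple_faces
  by unfold_locales (use ce in \<open>auto simp: convex_embeddable_def\<close>)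

text \<open>Otherwise the connected intersection of the frontiers would split into two disjoint
  closed sets: the common vertices and edges reachable from \<open>a\<close>, and the
  others.\<close>

lemma common_path:
  assumes F: "face F1" "face F2" "F1 \<noteq> Fo" "F2 \<noteq> Fo" and ab: "a \<in> FV F1" "a \<in> FV F2" "b \<in> FV F1" "b \<in> FV F2"
  shows "(a, b) \<in> (steps (FE F1 \<inter> FE F2))\<^sup>*"
proof (rule ccontr)
  assume nab: "(a, b) \<notin> (steps (FE F1 \<inter> FE F2))\<^sup>*"
  define W where "W = FV F1 \<inter> FV F2"
  define I where "I = FE F1 \<inter> FE F2"
  define Z where "Z = {z \<in> W. (a, z) \<in> (steps I)\<^sup>*}"
  have IE: "I \<subseteq> E" "finite I" using finite_E by (auto simp: I_def bd_edges_def intro: finite_subset)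
  have WV: "W \<subseteq> V" by (auto simp: W_def bd_vertices_def)
  have IW: "e \<subseteq> W" if "e \<in> I" for e
    using that FE_subset_FV[OF F(1)] FE_subset_FV[OF F(2)] by (auto simp: I_def W_def)
  have side: "e \<subseteq> W - Z" if e: "e \<in> I" "\<not> e \<subseteq> Z" for e
  proof -
    obtain x y where xy: "e = {x, y}" using edgeE[of e] e IE by blast
    have st: "(x, y) \<in> steps I" "(y, x) \<in> steps I" using e xy by (auto simp: insert_commute)
    have "x \<in> Z \<longleftrightarrow> y \<in> Z"
      using IW[OF e(1)] xy st unfolding Z_def by (auto intro: rtrancl_into_rtrancl)
    then show ?thesis using e IW[OF e(1)] xy by auto
  qed
  define A B where "A = pos ` Z \<union> (\<Union>e\<in>{e\<in>I. e \<subseteq> Z}. P e)"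
    and "B = pos ` (W - Z) \<union> (\<Union>e\<in>{e\<in>I. \<not> e \<subseteq> Z}. P e)"
  have fin: "finite W" using WV finite_V finite_subset by blast
  have clA: "closed A" unfolding A_def
  proof (intro closed_Un closed_UN)
    show "closed (pos ` Z)" using fin by (auto simp: Z_def intro: finite_imp_closed)
  qed (use IE compact_P compact_imp_closed in auto)
  have clB: "closed B" unfolding B_def
  proof (intro closed_Un closed_UN)
    show "closed (pos ` (W - Z))" using fin by (auto intro: finite_imp_closed)
  qed (use IE compact_P compact_imp_closed in auto)
  have "A \<subseteq> img Z" using IE by (auto simp: A_def img_def inner_edges_def)
  moreover have "B \<subseteq> img (W - Z)"
  proof -
    have "{e \<in> I. \<not> e \<subseteq> Z} \<subseteq> inner_edges E (W - Z)" using IE side unfolding inner_edges_def by blast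
    then show ?thesis unfolding B_def img_def by blast
  qed
  moreover have "img Z \<inter> img (W - Z) = {}" by (rule img_disjoint) (use WV in \<open>auto simp: Z_def\<close>)
  ultimately have AB: "A \<inter> B = {}" by blast
  have sub: "frontier F1 \<inter> frontier F2 \<subseteq> A \<union> B"
  proof
    fix x assume "x \<in> frontier F1 \<inter> frontier F2"
    then obtain e1 e2 where e: "e1 \<in> FE F1" "e2 \<in> FE F2" "x \<in> P e1" "x \<in> P e2"
      using frontier_face_edges F by auto
    show "x \<in> A \<union> B"
    proof (cases "e1 = e2")
      case True
      then have "e1 \<in> I" using e by (simp add: I_def)
      then show ?thesis using e by (auto simp: A_def B_def)
    next
      case False
      have "e1 \<in> E" "e2 \<in> E" using e by (auto simp: bd_edges_def)
      then obtain w where w: "w \<in> e1 \<inter> e2" "x = pos w" using edges_meet[of e1 e2] False e by blast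
      then have "w \<in> W" using e FE_subset_FV[OF F(1) e(1)] FE_subset_FV[OF F(2) e(2)] by (auto simp: W_def)
      then show ?thesis using w by (auto simp: A_def B_def)
    qed
  qed
  have con: "connected (frontier F1 \<inter> frontier F2)"
    using ce F bounded_iff unfolding convex_embeddable_def by blast
  have a: "pos a \<in> A \<inter> (frontier F1 \<inter> frontier F2)"
    using ab by (auto simp: A_def Z_def W_def bd_vertices_def)
  have b: "pos b \<in> B \<inter> (frontier F1 \<inter> frontier F2)"
    using ab nab by (auto simp: B_def Z_def W_def I_def bd_vertices_def)
  show False
    using connected_closedD[OF con, of A B] clA clB AB sub a b by blast
qed

text \<open>Two faces at \<open>p\<close> lie between edges into \<open>K\<close> and other edges.
  Both are bounded and pass through \<open>q\<close>, so without inverted subgraphs both border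
  \<open>{p, q}\<close>, which borders the external face as well.\<close>

lemma external_edge_not_cut_pair:
  assumes K: "K \<subseteq> V - ext" "K \<noteq> {}" "nbrs E K \<subseteq> {p, q}" and pq: "{p, q} \<in> FE Fo"
  shows False
proof -
  have KV: "K \<subseteq> V" using K by blast
  have n: "nbrs E K = {p, q}"
    using cut_at_least_two[OF K(1,2), of p] cut_at_least_two[OF K(1,2), of q] K(3) by blast
  have pe: "p \<in> ext" "q \<in> ext" "{p, q} \<in> E" using FE_subset_FV[OF face_Fo pq] pq by (auto simp: ext_eq bd_edges_def)
  have pV: "p \<in> V" using pe ext_subset by blast
  have pK: "p \<notin> K" "q \<notin> K" using n by (auto simp: nbrs_def)
  define S where "S = {e \<in> star p. \<exists>x\<in>K. e = {p, x}}"
  obtain x0 where x0: "x0 \<in> K" "{x0, p} \<in> E" using n unfolding nbrs_def by blast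
  then have S0: "{p, x0} \<in> S" by (auto simp: S_def star_def insert_commute)
  have S1: "{p, q} \<in> star p - S" using pe pK by (auto simp: S_def star_def doubleton_eq_iff)
  obtain F1 F2 where F: "face F1" "face F2" "F1 \<noteq> F2" "S \<inter> FE F1 \<noteq> {}" "(star p - S) \<inter> FE F1 \<noteq> {}"
    "S \<inter> FE F2 \<noteq> {}" "(star p - S) \<inter> FE F2 \<noteq> {}"
  proof -
    have "S \<noteq> {}" "S \<subseteq> star p" "star p - S \<noteq> {}" using S0 S1 by (auto simp: S_def)
    then show ?thesis using two_star_transitions[OF pV, of S] that by blast
  qed
  have *: "F \<noteq> Fo \<and> {p, q} \<in> FE F" if F: "face F" "S \<inter> FE F \<noteq> {}" "(star p - S) \<inter> FE F \<noteq> {}" for F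
  proof -
    obtain x where x: "x \<in> K" "{p, x} \<in> FE F" using F(2) by (auto simp: S_def)
    obtain y where y: "{p, y} \<in> star p - S" "{p, y} \<in> FE F" using F(3) star_edge by blast
    have "y \<notin> K" using y by (auto simp: S_def)
    then obtain z where "z \<in> nbrs E K" "z \<noteq> p" "z \<in> FV F"
      using face_leaves[OF F(1) x(2) y(2)] x pK by blast
    then have q: "q \<in> FV F" using n by blast
    have px: "p \<in> FV F" "x \<in> FV F" using FE_subset_FV[OF F(1) x(2)] by auto
    then have "F \<noteq> Fo" using x K by (auto simp: ext_eq)
    moreover have "\<not> has_inverted_subgraph V E pos c" using ce by (simp add: convex_embeddable_def)
    ultimately show ?thesis
      using F(1) q px pq unfolding has_inverted_subgraph_def ext_edges_eq by (auto simp: bounded_iff)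
  qed
  show False
    using three_faces_False[OF F(1,2) face_Fo, of "{p, q}"] *[OF F(1,4,5)] *[OF F(2,6,7)] pq F(3) by blast
qed

text \<open>The edges at \<open>a\<close> on the side of the blob \<open>K\<close>; a chord
  \<open>{a, b}\<close> is counted among them.\<close>

definition hedges :: "'v \<Rightarrow> 'v \<Rightarrow> 'v set \<Rightarrow> 'v set set" where
  "hedges a b K = {e \<in> star a. \<exists>x\<in>insert b K. e = {a, x}}"

text \<open>Faces at \<open>a\<close> between the \<open>hedges\<close> and the remaining edges pass
  through \<open>b\<close> too, so by \<open>common_path\<close> any two of them share an edge at
  \<open>a\<close>. Because no edge borders three faces, the shared edge is not one of the
  \<open>hedges\<close>, and it is the only edge outside them.\<close>

lemma blob_outer_edge:
  assumes K: "K \<subseteq> V - ext" "K \<noteq> {}" "nbrs E K = {a, b}" "a \<noteq> b" and ab: "{a, b} \<notin> FE Fo"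
    and h: "h1 \<in> hedges a b K" "h2 \<in> hedges a b K" "h1 \<noteq> h2"
  obtains r T1 T2 where "star a - hedges a b K = {r}" "face T1" "face T2" "T1 \<noteq> T2" "T1 \<noteq> Fo" "T2 \<noteq> Fo"
    "r \<in> FE T1" "r \<in> FE T2" "a \<in> FV T1" "a \<in> FV T2" "b \<in> FV T1" "b \<in> FV T2"
    "\<forall>e\<in>hedges a b K. \<not> (e \<in> FE T1 \<and> e \<in> FE T2)"
proof -
  define S where "S = hedges a b K"
  define R where "R = star a - S"
  have "a \<in> nbrs E K" "b \<in> nbrs E K" using K(3) by auto
  then have aV: "a \<in> V" "a \<notin> K" "b \<notin> K" using nbrs_subset_V[of K] by (auto simp: nbrs_def)
  have SS: "S \<subseteq> star a" by (auto simp: S_def hedges_def)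
  have SR: "S \<inter> R = {}" by (auto simp: R_def)
  have Sy: "{a, y} \<in> S \<Longrightarrow> y = b \<or> y \<in> K" for y
    by (auto simp: S_def hedges_def doubleton_eq_iff)
  have Ry: "{a, y} \<in> R \<Longrightarrow> y \<noteq> b \<and> y \<notin> K" for y
    by (auto simp: R_def S_def hedges_def)
  have Rne: "R \<noteq> {}"
  proof
    assume "R = {}"
    then have all: "{a, y} \<in> E \<Longrightarrow> y = b \<or> y \<in> K" for y
      using Sy[of y] by (auto simp: R_def star_def)
    show False
    proof (cases "a \<in> ext")
      case False
      have "nbrs E (insert a K) \<subseteq> {b}"
      proof
        fix y assume y: "y \<in> nbrs E (insert a K)"
        then obtain x where x: "x \<in> insert a K" "{x, y} \<in> E" "y \<notin> insert a K" by (auto simp: nbrs_def)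
        show "y \<in> {b}"
        proof (cases "x = a")
          case True then show ?thesis using all[of y] x by auto
        next
          case False
          then have "y \<in> nbrs E K" using x by (auto simp: nbrs_def)
          then show ?thesis using K x by auto
        qed
      qed
      moreover have "insert a K \<subseteq> V - ext" using False K aV by auto
      ultimately show False using cut_at_least_two[of "insert a K" b] by blast
    next
      case True
      then obtain x y where xy: "x \<noteq> y" "x \<in> FV Fo" "y \<in> FV Fo" "star a \<inter> FE Fo = {{a, x}, {a, y}}"
        using face_two_edges[OF face_Fo, of a] unfolding ext_eq by blast
      then have "{a, x} \<in> star a" "{a, y} \<in> star a" by blast+
      then have "{a, x} \<in> E" "{a, y} \<in> E" by (simp_all add: star_def)
      then have "x = b" "y = b" using all[of x] all[of y] xy K by (auto simp: ext_eq)
      then show False using xy by simp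
    qed
  qed
  define tr where "tr F \<longleftrightarrow> face F \<and> S \<inter> FE F \<noteq> {} \<and> R \<inter> FE F \<noteq> {}" for F
  have trE: "\<exists>h r. h \<in> S \<and> r \<in> R \<and> star a \<inter> FE F = {h, r} \<and> a \<in> FV F \<and> b \<in> FV F \<and> F \<noteq> Fo" if t: "tr F" for F
  proof -
    have F: "face F" using t by (simp add: tr_def)
    obtain h r where hr: "h \<in> S" "h \<in> FE F" "r \<in> R" "r \<in> FE F" using t by (auto simp: tr_def)
    have hs: "h \<in> star a" "r \<in> star a" using hr SS by (auto simp: R_def)
    have aF: "a \<in> FV F" using FE_subset_FV[OF F hr(2)] hs by (auto simp: star_def)
    have eq: "star a \<inter> FE F = {h, r}"
      using face_star_eq[OF F aF, of h r] hr hs SR by blast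
    obtain x where x: "h = {a, x}" using star_edge[OF hs(1)] by blast
    obtain y where y: "r = {a, y}" using star_edge[OF hs(2)] by blast
    have bF: "b \<in> FV F"
    proof (cases "x = b")
      case True then show ?thesis using FE_subset_FV[OF F hr(2)] x by auto
    next
      case False
      then have "x \<in> K" using Sy hr x by auto
      moreover have "y \<notin> K" using Ry hr y by auto
      ultimately obtain z where "z \<in> nbrs E K" "z \<noteq> a" "z \<in> FV F"
        using face_leaves[OF F, of a x y K] hr x y aV by auto
      then show ?thesis using K by auto
    qed
    have "F \<noteq> Fo"
    proof
      assume Fo: "F = Fo"
      have "x \<in> FV Fo" using FE_subset_FV[OF F hr(2)] x Fo by auto
      then have "x = b" using Sy[of x] hr x K by (auto simp: ext_eq)
      then show False using hr x ab Fo by simp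
    qed
    then show ?thesis using hr eq aF bF by blast
  qed
  have trS: "\<exists>r\<in>R. star a \<inter> FE F = {h, r}" if t: "tr F" and h: "h \<in> S" "h \<in> FE F" for F h
  proof -
    obtain h' r where hr: "h' \<in> S" "r \<in> R" "star a \<inter> FE F = {h', r}" using trE[OF t] by metis
    have "h \<in> star a \<inter> FE F" using h SS by blast
    then have "h = h' \<or> h = r" unfolding hr(3) by simp
    moreover have "h \<noteq> r" using h(1) hr(2) SR by blast
    ultimately show ?thesis using hr by metis
  qed
  have trR: "e = r" if "star a \<inter> FE F = {h, r}" "h \<in> S" "e \<in> R" "e \<in> FE F" for F h r e
  proof -
    have "e \<in> star a \<inter> FE F" using that(3,4) by (simp add: R_def)
    then have "e = h \<or> e = r" unfolding that(1) by simp
    then show ?thesis using that(2,3) SR by blast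
  qed
  have trF: "face F" if "tr F" for F using that by (simp add: tr_def)
  have share: "\<exists>e\<in>star a. e \<in> FE F1 \<and> e \<in> FE F2" if t: "tr F1" "tr F2" for F1 F2
  proof -
    have "(a, b) \<in> (steps (FE F1 \<inter> FE F2))\<^sup>*"
      using common_path[of F1 F2 a b] trE[OF t(1)] trE[OF t(2)] t by (auto simp: tr_def)
    then obtain z where "(a, z) \<in> steps (FE F1 \<inter> FE F2)" using K(4) by (metis converse_rtranclE)
    then show ?thesis by (intro bexI[of _ "{a, z}"]) (auto simp: star_def bd_edges_def)
  qed
  \<comment> \<open>With \<open>h\<close> on both faces, a second edge of \<open>S\<close> leads to
    a third transition face \<open>T\<close> that does not border \<open>h\<close>. What
    \<open>T\<close> shares with each of the two must then be one and the same edge, on three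
    faces.\<close>
  have noS: "\<not> (h \<in> S \<and> h \<in> FE F1 \<and> h \<in> FE F2)" if t: "tr F1" "tr F2" "F1 \<noteq> F2" for F1 F2 h
  proof
    assume h: "h \<in> S \<and> h \<in> FE F1 \<and> h \<in> FE F2"
    obtain r1 where r1: "r1 \<in> R" "star a \<inter> FE F1 = {h, r1}" using trS[OF t(1)] h by metis
    obtain r2 where r2: "r2 \<in> R" "star a \<inter> FE F2 = {h, r2}" using trS[OF t(2)] h by metis
    have ne: "S - {h} \<noteq> {}" using assms(6-8) unfolding S_def by blast
    have "S - {h} \<subseteq> star a" "star a - (S - {h}) \<noteq> {}" using SS Rne unfolding R_def by blast+
    then obtain T e e' where T: "face T" "e \<in> S - {h}" "e' \<in> star a - (S - {h})" "e \<in> FE T" "e' \<in> FE T"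
      using face_at_star_transition[OF aV(1) ne] by blast
    have nin: "e \<notin> {h, r}" if "r \<in> R" for r using T(2) SR that by blast
    have "e \<in> star a \<inter> FE T" using T SS by blast
    then have Tne: "T \<noteq> F1" "T \<noteq> F2" using nin[OF r1(1)] nin[OF r2(1)] unfolding r1(2)[symmetric] r2(2)[symmetric] by auto
    have "h \<notin> FE T" using three_faces_False[of F1 F2 T h] trF t h T(1) Tne by blast
    then have "e' \<in> R" using T(3,5) unfolding R_def by blast
    then have trT: "tr T" using T by (auto simp: tr_def)
    obtain r3 where r3: "r3 \<in> R" "star a \<inter> FE T = {e, r3}" using trS[OF trT _ T(4)] T(2) by (metis DiffD1)
    have shared: "r = r3" if q: "tr F" "r \<in> R" "star a \<inter> FE F = {h, r}" for F r
    proof -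
      obtain g where g: "g \<in> star a" "g \<in> FE F" "g \<in> FE T" using share[OF q(1) trT] by blast
      have "g \<noteq> h" using g(3) \<open>h \<notin> FE T\<close> by blast
      moreover have "g = h \<or> g = r" using IntI[OF g(1,2)] unfolding q(3) by simp
      ultimately have "g = r" by blast
      moreover have "g = e \<or> g = r3" using IntI[OF g(1,3)] unfolding r3(2) by simp
      moreover have "r \<noteq> e" using nin[OF q(2)] by blast
      ultimately show ?thesis by blast
    qed
    have rr: "r1 = r3" "r2 = r3" using shared[OF t(1) r1] shared[OF t(2) r2] by auto
    have "r3 \<in> star a \<inter> FE F1" "r3 \<in> star a \<inter> FE F2" "r3 \<in> star a \<inter> FE T"
      unfolding r1(2) r2(2) r3(2) using rr by simp_all
    then show False using three_faces_False[of F1 F2 T r3] trF t T(1) Tne by blast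
  qed
  obtain T1 T2 where T: "tr T1" "tr T2" "T1 \<noteq> T2"
  proof -
    have "S \<noteq> {}" using h by (auto simp: S_def)
    then obtain F1 F2 where "face F1" "face F2" "F1 \<noteq> F2" "S \<inter> FE F1 \<noteq> {}" "(star a - S) \<inter> FE F1 \<noteq> {}"
      "S \<inter> FE F2 \<noteq> {}" "(star a - S) \<inter> FE F2 \<noteq> {}"
      using two_star_transitions[OF aV(1) _ SS] Rne unfolding R_def by blast
    then show ?thesis using that[of F1 F2] by (auto simp: tr_def R_def)
  qed
  obtain h1' r1 where 1: "h1' \<in> S" "r1 \<in> R" "star a \<inter> FE T1 = {h1', r1}" "a \<in> FV T1" "b \<in> FV T1" "T1 \<noteq> Fo"
    using trE[OF T(1)] by metis
  obtain h2' r2 where 2: "h2' \<in> S" "r2 \<in> R" "star a \<inter> FE T2 = {h2', r2}" "a \<in> FV T2" "b \<in> FV T2" "T2 \<noteq> Fo"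
    using trE[OF T(2)] by metis
  obtain e where e: "e \<in> star a" "e \<in> FE T1" "e \<in> FE T2" using share[OF T(1,2)] by blast
  then have "e \<notin> S" using noS[OF T] by blast
  then have eR: "e \<in> R" using e(1) by (simp add: R_def)
  have er: "e = r1" "e = r2" using trR[OF 1(3,1) eR e(2)] trR[OF 2(3,1) eR e(3)] by auto
  \<comment> \<open>Another edge in \<open>R\<close> would lead to a further transition face, which
    has to share \<open>r1\<close> with \<open>T1\<close> and would be the third face at
    \<open>r1\<close>.\<close>
  have Req: "R = {r1}"
  proof (rule ccontr)
    assume "R \<noteq> {r1}"
    then have "R - {r1} \<noteq> {}" "R - {r1} \<subseteq> star a" "star a - (R - {r1}) \<noteq> {}"
      using 1(1,2) SS SR unfolding R_def by blast+
    then obtain T3 g g' where T3: "face T3" "g \<in> R - {r1}" "g' \<in> star a - (R - {r1})" "g \<in> FE T3" "g' \<in> FE T3"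
      using face_at_star_transition[OF aV(1), of "R - {r1}"] by blast
    have gne: "g \<noteq> r1" "g \<noteq> r2" "g \<in> R" using T3(2) er by auto
    have Tne: "T3 \<noteq> T1" "T3 \<noteq> T2" using trR[OF 1(3,1) gne(3)] trR[OF 2(3,1) gne(3)] gne T3(4) by auto
    have "r1 \<notin> FE T3" using three_faces_False[of T1 T2 T3 r1] trF T T3(1) Tne e er by blast
    then have "g' \<in> S" using T3(3,5) by (auto simp: R_def)
    then have t3: "tr T3" using T3(1,4,5) gne(3) by (auto simp: tr_def)
    obtain e3 where e3: "e3 \<in> star a" "e3 \<in> FE T1" "e3 \<in> FE T3" using share[OF T(1) t3] by blast
    have "e3 \<notin> S" using noS[OF T(1) t3] Tne e3 by blast
    then have "e3 \<in> R" using e3(1) by (simp add: R_def)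
    then have "e3 = r1" using trR[OF 1(3,1) _ e3(2)] by blast
    then show False using e3(3) \<open>r1 \<notin> FE T3\<close> by blast
  qed
  have f: "\<not> (h \<in> FE T1 \<and> h \<in> FE T2)" if "h \<in> hedges a b K" for h
    using noS[OF T] that unfolding S_def by blast
  have "star a - hedges a b K = {r1}" using Req by (simp add: R_def S_def)
  moreover have "r1 \<in> FE T1" "r1 \<in> FE T2" using e er by auto
  ultimately show ?thesis
    using that[of r1 T1 T2] trF[OF T(1)] trF[OF T(2)] T(3) 1(4-6) 2(4-6) f by blast
qed

text \<open>An end with a single edge into the blob lets the blob be shrunk past that edge.
  Otherwise each end has just one outer edge, and the two faces along it share a whole path from
  \<open>a\<close> to \<open>b\<close>. The inner vertices of this path have degree two, so the
  graph ends there and leaves no room for the external face.\<close>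

lemma no_blob:
  assumes "K \<subseteq> V - ext" "K \<noteq> {}" "nbrs E K = {a, b}" "a \<noteq> b" "{a, b} \<notin> FE Fo"
    and "face F" "FV F \<subseteq> insert a (insert b K)"
  shows False
  using assms
proof (induction "card K" arbitrary: K a b rule: less_induct)
  case less
  note K = less.prems(1-5) and F = less.prems(6,7)
  have finK: "finite K" using K(1) finite_V finite_subset by blast
  have "a \<in> nbrs E K" "b \<in> nbrs E K" using K(3) by auto
  then have ab: "a \<in> V" "b \<in> V" "a \<notin> K" "b \<notin> K" using nbrs_subset_V[of K] by (auto simp: nbrs_def)
  have cF: "card (FV F) \<ge> 3" "finite (FV F)" using simple_cycle_card[OF face_cycle[OF F(1)]] by auto
  \<comment> \<open>If \<open>u\<close> has only one edge into the blob, its end \<open>h\<close>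
    takes over the role of \<open>u\<close>: the face cannot pass through \<open>u\<close>, which
    lacks a second edge for it, and the blob without \<open>h\<close> is attached at
    \<open>h\<close> and \<open>w\<close>.\<close>
  have two: "\<exists>h1\<in>hedges u w K. \<exists>h2\<in>hedges u w K. h1 \<noteq> h2"
    if uw: "{u, w} = {a, b}" "u \<noteq> w" for u w
  proof (rule ccontr)
    assume "\<not> ?thesis"
    then have no: "\<forall>p\<in>hedges u w K. \<forall>q\<in>hedges u w K. p = q" by simp
    have nK: "nbrs E K = {u, w}" using K(3) uw by simp
    have uK: "u \<notin> K" "w \<notin> K" "u \<in> V" using uw ab by (auto simp: doubleton_eq_iff)
    have "u \<in> nbrs E K" using nK by simp
    then obtain h where h: "h \<in> K" "{h, u} \<in> E" by (auto simp: nbrs_def)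
    have hh: "{u, h} \<in> hedges u w K" using h by (auto simp: hedges_def star_def insert_commute)
    have uniq: "x = h" if "{u, x} \<in> E" "x \<in> insert w K" for x
    proof -
      have "{u, x} \<in> hedges u w K" using that by (auto simp: hedges_def star_def)
      then have "{u, x} = {u, h}" using no[THEN bspec, THEN bspec, OF _ hh] by simp
      then show ?thesis using edge_ends[OF that(1)] by (auto simp: doubleton_eq_iff)
    qed
    have sub: "FV F \<subseteq> insert u (insert w K)" using F(2) uw by (auto simp: doubleton_eq_iff)
    have "u \<notin> FV F"
    proof
      assume "u \<in> FV F"
      from face_two_edges[OF F(1) this]
      obtain x y where xy: "x \<noteq> y" "x \<noteq> u" "y \<noteq> u" "x \<in> FV F" "y \<in> FV F" "star u \<inter> FE F = {{u, x}, {u, y}}"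
        by metis
      have "{u, x} \<in> star u \<inter> FE F" "{u, y} \<in> star u \<inter> FE F" unfolding xy(6) by simp_all
      then have "{u, x} \<in> E" "{u, y} \<in> E" by (simp_all add: star_def)
      then have "x = h" "y = h" using uniq[of x] uniq[of y] xy(2-5) sub by auto
      then show False using xy(1) by simp
    qed
    then have sub': "FV F \<subseteq> insert h (insert w (K - {h}))" using sub by blast
    have ne: "K - {h} \<noteq> {}"
    proof
      assume "K - {h} = {}"
      then have "FV F \<subseteq> {h, w}" using sub' by blast
      then have "card (FV F) \<le> card {h, w}" by (intro card_mono) auto
      also have "card {h, w} \<le> 2" by (simp add: card_insert_if)
      finally show False using cF by simp
    qed
    have "nbrs E (K - {h}) \<subseteq> {h, w}"
    proof
      fix y assume y: "y \<in> nbrs E (K - {h})"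
      then obtain x where x: "x \<in> K - {h}" "{x, y} \<in> E" "y \<notin> K - {h}" by (auto simp: nbrs_def)
      show "y \<in> {h, w}"
      proof (cases "y \<in> K")
        case True then show ?thesis using x by auto
      next
        case False
        then have "y \<in> nbrs E K" using x by (auto simp: nbrs_def)
        then have "y = u \<or> y = w" using nK by simp
        moreover have "y \<noteq> u" using uniq[of x] x by (auto simp: insert_commute)
        ultimately show ?thesis by simp
      qed
    qed
    moreover have K': "K - {h} \<subseteq> V - ext" using K(1) by blast
    ultimately have n': "nbrs E (K - {h}) = {h, w}"
      using cut_at_least_two[OF K' ne, of h] cut_at_least_two[OF K' ne, of w] by blast
    have "{h, w} \<notin> FE Fo"
    proof
      assume "{h, w} \<in> FE Fo"
      then have "h \<in> ext" using FE_subset_FV[OF face_Fo] by (auto simp: ext_eq)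
      then show False using K(1) h by blast
    qed
    moreover have "h \<noteq> w" using h uK by blast
    moreover have "card (K - {h}) < card K" using h finK by (intro psubset_card_mono) auto
    ultimately show False using less.hyps[OF _ K' ne n' _ _ F(1) sub'] by blast
  qed
  obtain h1 h2 where h: "h1 \<in> hedges a b K" "h2 \<in> hedges a b K" "h1 \<noteq> h2" using two[of a b] K(4) by blast
  obtain k1 k2 where k: "k1 \<in> hedges b a K" "k2 \<in> hedges b a K" "k1 \<noteq> k2"
    using two[of b a] K(4) by (auto simp: insert_commute)
  obtain r T1 T2 where T: "star a - hedges a b K = {r}" "face T1" "face T2" "T1 \<noteq> T2" "T1 \<noteq> Fo" "T2 \<noteq> Fo"
    "r \<in> FE T1" "r \<in> FE T2" "a \<in> FV T1" "a \<in> FV T2" "b \<in> FV T1" "b \<in> FV T2"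
    "\<forall>e\<in>hedges a b K. \<not> (e \<in> FE T1 \<and> e \<in> FE T2)"
    using blob_outer_edge[OF K h] .
  obtain rb where rb: "star b - hedges b a K = {rb}"
    using blob_outer_edge[of K b a k1 k2] K k by (metis insert_commute)
  have Ra: "x = y" if "{a, x} \<in> E" "{a, y} \<in> E" "x \<notin> insert b K" "y \<notin> insert b K" for x y
  proof -
    have "{a, x} \<in> star a - hedges a b K" "{a, y} \<in> star a - hedges a b K"
      using that by (auto simp: star_def hedges_def doubleton_eq_iff)
    then have "{a, x} = {a, y}" unfolding T(1) by simp
    then show ?thesis by (auto simp: doubleton_eq_iff)
  qed
  have Rb: "x = y" if "{b, x} \<in> E" "{b, y} \<in> E" "x \<notin> insert a K" "y \<notin> insert a K" for x y
  proof -
    have "{b, x} \<in> star b - hedges b a K" "{b, y} \<in> star b - hedges b a K"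
      using that by (auto simp: star_def hedges_def doubleton_eq_iff)
    then have "{b, x} = {b, y}" unfolding rb by simp
    then show ?thesis by (auto simp: doubleton_eq_iff)
  qed
  define I where "I = FE T1 \<inter> FE T2"
  have IE: "I \<subseteq> E" by (auto simp: I_def bd_edges_def)
  have "(a, b) \<in> (steps I)\<^sup>*" unfolding I_def by (rule common_path) (use T in auto)
  then obtain xs where xs: "distinct xs" "length xs \<ge> 2" "hd xs = a" "last xs = b" "path_edges xs \<subseteq> I"
    using rtrancl_distinct_list K(4) by metis
  define m where "m = length xs - 1"
  have m: "length xs = Suc m" "m \<ge> 1" using xs(2) by (auto simp: m_def)
  have x0: "xs ! 0 = a" and xm: "xs ! m = b"
  proof -
    have "xs \<noteq> []" using xs(2) by auto
    then show "xs ! 0 = a" "xs ! m = b"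
      using xs(3,4) hd_conv_nth[of xs] last_conv_nth[of xs] by (auto simp: m_def)
  qed
  have edge: "{xs ! i, xs ! Suc i} \<in> I" if "i < m" for i
    using path_edges_nth[of i xs] that xs(5) m by auto
  have inj: "xs ! i = xs ! j \<longleftrightarrow> i = j" if "i \<le> m" "j \<le> m" for i j
    using nth_eq_iff_index_eq[OF xs(1), of i j] that m by auto
  have y1: "xs ! 1 \<notin> insert b K"
  proof
    assume a: "xs ! 1 \<in> insert b K"
    have e: "{a, xs ! 1} \<in> I" using edge[of 0] m x0 by simp
    then have "{a, xs ! 1} \<in> hedges a b K" using a IE by (auto simp: hedges_def star_def)
    then show False using T(13) e by (auto simp: I_def)
  qed
  then have m2: "1 < m" using m xm by (cases "m = 1") auto
  have inner: "xs ! i \<notin> K" if "1 \<le> i" "i < m" for i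
    using that
  proof (induction i rule: dec_induct)
    case base then show ?case using y1 by simp
  next
    case (step i)
    show ?case
    proof
      assume s: "xs ! Suc i \<in> K"
      have "{xs ! Suc i, xs ! i} \<in> E" using edge[of i] step IE by (auto simp: insert_commute)
      moreover have "xs ! i \<notin> K" using step by simp
      ultimately have "xs ! i \<in> nbrs E K" using s by (auto simp: nbrs_def)
      then have "xs ! i = xs ! 0 \<or> xs ! i = xs ! m" using K(3) x0 xm by simp
      then show False using inj[of i 0] inj[of i m] step by auto
    qed
  qed
  define Y where "Y = (\<lambda>i. xs ! i) ` {1..<m}"
  have Yab: "xs ! i \<noteq> a" "xs ! i \<noteq> b" if "i \<in> {1..<m}" for i
    using inj[of i 0] inj[of i m] that x0 xm by auto
  \<comment> \<open>Both faces use the same two edges at this vertex. A face between these and a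
    third edge would have to be one of the two faces, which have no third edge here.\<close>
  have starY: "star (xs ! i) = {{xs ! i, xs ! (i - 1)}, {xs ! i, xs ! Suc i}}" if i: "1 \<le> i" "i < m" for i
  proof -
    define e1 e2 where "e1 = {xs ! i, xs ! (i - 1)}" and "e2 = {xs ! i, xs ! Suc i}"
    have e: "e1 \<in> I" "e2 \<in> I" using edge[of "i - 1"] edge[of i] i by (auto simp: e1_def e2_def insert_commute)
    have "xs ! (i - 1) \<noteq> xs ! Suc i" using inj[of "i - 1" "Suc i"] i by auto
    then have ne: "e1 \<noteq> e2" by (auto simp: e1_def e2_def doubleton_eq_iff)
    have es: "e1 \<in> star (xs ! i)" "e2 \<in> star (xs ! i)" using e IE by (auto simp: star_def e1_def e2_def)
    have yV: "xs ! i \<in> V" using es(1) edge_subset[of e1] by (auto simp: star_def)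
    have "star (xs ! i) - {e1, e2} = {}"
    proof (rule ccontr)
      assume "star (xs ! i) - {e1, e2} \<noteq> {}"
      then obtain T3 e e' where T3: "face T3" "e \<in> {e1, e2}" "e' \<in> star (xs ! i) - {e1, e2}" "e \<in> FE T3" "e' \<in> FE T3"
        using face_at_star_transition[OF yV, of "{e1, e2}"] es by blast
      have "e \<in> FE T1" "e \<in> FE T2" using T3(2) e by (auto simp: I_def)
      then have "T3 = T1 \<or> T3 = T2" using three_faces_False[OF T(2,3) T3(1) _ _ T3(4) T(4)] by blast
      then have "e1 \<in> FE T3" "e2 \<in> FE T3" using e by (auto simp: I_def)
      then have "star (xs ! i) \<inter> FE T3 = {e1, e2}"
        using face_star_eq[OF T3(1), of "xs ! i" e1 e2] FE_subset_FV[OF T3(1), of e1] es ne by (auto simp: star_def)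
      moreover have "e' \<in> star (xs ! i) \<inter> FE T3" using T3 by blast
      ultimately show False using T3(3) by simp
    qed
    then show ?thesis using es unfolding e1_def e2_def by blast
  qed
  have Ynb: "z \<in> set xs" if "y \<in> Y" "{y, z} \<in> E" for y z
  proof -
    obtain i where i: "1 \<le> i" "i < m" "y = xs ! i" using \<open>y \<in> Y\<close> by (auto simp: Y_def)
    have "{xs ! i, z} \<in> star (xs ! i)" using that i by (auto simp: star_def)
    then have "z = xs ! (i - 1) \<or> z = xs ! Suc i" unfolding starY[OF i(1,2)] by (auto simp: doubleton_eq_iff)
    then show ?thesis using i m by auto
  qed
  have setxs: "set xs = insert a (insert b Y)"
  proof -
    have "set xs = (\<lambda>i. xs ! i) ` {0..m}" using m by (auto simp: set_conv_nth image_def less_Suc_eq_le)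
    also have "{0..m} = insert 0 (insert m {1..<m})" using m by auto
    finally show ?thesis by (simp add: Y_def x0 xm)
  qed
  \<comment> \<open>What lies outside the blob, its ends and the path. No edge enters it:
    \<open>a\<close> and \<open>b\<close> have spent their only outer edges on the path, and the
    inner path vertices have no others.\<close>
  define R where "R = V - K - {a, b} - Y"
  have RE: "R = {}"
  proof (rule ccontr)
    assume "R \<noteq> {}"
    then obtain w where w: "w \<in> R" by blast
    have "R = V"
    proof (rule closed_eq_V[OF _ w])
      fix x z assume xz: "x \<in> R" "{x, z} \<in> E"
      have x: "x \<notin> K" "x \<noteq> a" "x \<noteq> b" "x \<notin> Y" using xz by (auto simp: R_def)
      have zx: "{z, x} \<in> E" using xz by (simp add: insert_commute)
      have "z \<notin> K"
      proof
        assume "z \<in> K"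
        then have "x \<in> nbrs E K" using zx x by (auto simp: nbrs_def)
        then show False using K(3) x by simp
      qed
      moreover have "z \<noteq> a"
      proof
        assume "z = a"
        moreover have "{a, xs ! 1} \<in> E" using edge[of 0] m x0 IE by auto
        ultimately have "x = xs ! 1" using Ra[of x "xs ! 1"] zx x y1 by auto
        then show False using x m2 by (auto simp: Y_def)
      qed
      moreover have "z \<noteq> b"
      proof
        assume "z = b"
        moreover have "{b, xs ! (m - 1)} \<in> E" using edge[of "m - 1"] m xm IE by (auto simp: insert_commute)
        moreover have "xs ! (m - 1) \<notin> insert a K" using inner[of "m - 1"] inj[of "m - 1" 0] m2 x0 by auto
        ultimately have "x = xs ! (m - 1)" using Rb[of x "xs ! (m - 1)"] zx x by auto
        then show False using x m2 by (auto simp: Y_def)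
      qed
      moreover have "z \<notin> Y" using Ynb[OF _ zx] x setxs by auto
      ultimately show "z \<in> R" using edge_ends[OF xz(2)] by (auto simp: R_def)
    qed (auto simp: R_def)
    then show False using ab by (auto simp: R_def)
  qed
  \<comment> \<open>An external vertex other than \<open>a\<close> and \<open>b\<close> must lie on
    the path, and then an external edge at it borders \<open>T1\<close>, \<open>T2\<close> and
    \<open>Fo\<close>.\<close>
  obtain x where x: "x \<in> ext" "x \<noteq> a" "x \<noteq> b" using ext_not_small[of a b] by blast
  then have "x \<in> Y" using RE ext_subset K(1) by (auto simp: R_def)
  then obtain i where i: "1 \<le> i" "i < m" "x = xs ! i" by (auto simp: Y_def)
  obtain u v where "star x \<inter> FE Fo = {{x, u}, {x, v}}" using face_two_edges[OF face_Fo, of x] x ext_eq by metis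
  then have e: "{x, u} \<in> star x" "{x, u} \<in> FE Fo" by (metis IntD1 IntD2 insertI1)+
  have "{x, u} \<in> I"
    using e(1) starY[OF i(1,2)] edge[of "i - 1"] edge[of i] i by (auto simp: insert_commute)
  then show False using three_faces_False[OF T(2,3) face_Fo _ _ e(2) T(4,5,6)] by (auto simp: I_def)
qed

end

section \<open>Convex combination maps\<close>

text \<open>\<open>A\<close> and \<open>B\<close> form, up to scaling, the basis dual to
  \<open>w2\<close> and \<open>w1\<close>. The coefficients serve as cone coordinates at a polygon
  corner.\<close>

lemma plane_basis:
  fixes w1 w2 A B z :: "real^2"
  assumes "w1 \<bullet> A = 0" "w1 \<bullet> B \<noteq> 0" "w2 \<bullet> B = 0" "w2 \<bullet> A \<noteq> 0"
  shows "z = ((w2 \<bullet> z) / (w2 \<bullet> A)) *\<^sub>R A + ((w1 \<bullet> z) / (w1 \<bullet> B)) *\<^sub>R B"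
proof -
  define r where "r = z - (((w2 \<bullet> z) / (w2 \<bullet> A)) *\<^sub>R A + ((w1 \<bullet> z) / (w1 \<bullet> B)) *\<^sub>R B)"
  have r: "w1 \<bullet> r = 0" "w2 \<bullet> r = 0"
    using assms by (simp_all add: r_def inner_diff_right inner_add_right)
  \<comment> \<open>The determinant of \<open>w1\<close> and \<open>w2\<close>; the identities below
    are Cramer's rule.\<close>
  define D where "D = w1$1 * w2$2 - w1$2 * w2$1"
  have B: "D * B$1 = (w1 \<bullet> B) * w2$2 - (w2 \<bullet> B) * w1$2" "D * B$2 = (w2 \<bullet> B) * w1$1 - (w1 \<bullet> B) * w2$1"
    by (simp_all add: D_def inner_vec_def sum_2 algebra_simps)
  have "D \<noteq> 0"
  proof
    assume "D = 0"
    then have "w2$1 = 0" "w2$2 = 0" using B assms by auto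
    then show False using assms(4) by (simp add: inner_vec_def sum_2)
  qed
  moreover have "D * r$1 = (w1 \<bullet> r) * w2$2 - (w2 \<bullet> r) * w1$2" "D * r$2 = (w2 \<bullet> r) * w1$1 - (w1 \<bullet> r) * w2$1"
    by (simp_all add: D_def inner_vec_def sum_2 algebra_simps)
  ultimately have "r$1 = 0" "r$2 = 0" using r by auto
  then have "r = 0" by (simp add: vec_eq_iff forall_2)
  then show ?thesis by (simp add: r_def)
qed

lemma finite_maximizer:
  fixes g :: "'a \<Rightarrow> real"
  assumes "finite S" "S \<noteq> {}"
  shows "\<exists>a\<in>S. \<forall>z\<in>S. g z \<le> g a"
proof -
  have "Max (g ` S) \<in> g ` S" using assms by (intro Max_in) auto
  then obtain a where "a \<in> S" "g a = Max (g ` S)" by auto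
  then show ?thesis using assms(1) by (intro bexI[of _ a]) auto
qed

section \<open>Averages, corners and ascent\<close>

locale convex_combination = plane_connected V E pos c
  for V :: "'v set" and E :: "'v set set" and pos c +
  fixes f :: "'v \<Rightarrow> real^2"
  assumes ccm: "convex_combination_map V E pos c f"
begin

text \<open>The differences \<open>d \<bullet> f u - d \<bullet> f v\<close> have weighted sum zero
  and are nonnegative wherever the weight is positive, so they vanish at all neighbours.\<close>

lemma average:
  assumes u: "u \<in> V - ext" and le: "\<And>v. {u, v} \<in> E \<Longrightarrow> d \<bullet> f v \<le> d \<bullet> f u" and v: "{u, v} \<in> E"
  shows "d \<bullet> f v = d \<bullet> f u"
proof -
  obtain lam :: "'v \<Rightarrow> 'v \<Rightarrow> real" where lam: "\<forall>v\<in>V. lam u v \<ge> 0" "(\<Sum>v\<in>V. lam u v) = 1"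
    "\<forall>v\<in>V. {u, v} \<in> E \<longrightarrow> lam u v > 0" "\<forall>v\<in>V. {u, v} \<notin> E \<longrightarrow> lam u v = 0"
    "f u = (\<Sum>v\<in>V. lam u v *\<^sub>R f v)"
    using ccm u unfolding convex_combination_map_def by blast
  have "d \<bullet> f u = (\<Sum>v\<in>V. lam u v * (d \<bullet> f v))"
    by (subst lam(5)) (simp add: inner_sum_right)
  moreover have "d \<bullet> f u = (\<Sum>v\<in>V. lam u v * (d \<bullet> f u))"
    using lam(2) by (simp flip: sum_distrib_right)
  ultimately have "(\<Sum>v\<in>V. lam u v * (d \<bullet> f u - d \<bullet> f v)) = 0"
    by (simp add: right_diff_distrib sum_subtractf)
  moreover have "lam u v * (d \<bullet> f u - d \<bullet> f v) \<ge> 0" if "v \<in> V" for v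
    using lam(1,4) le[of v] that by (cases "{u, v} \<in> E") auto
  moreover have vV: "v \<in> V" using edge_ends[OF v] by blast
  ultimately have "lam u v * (d \<bullet> f u - d \<bullet> f v) = 0"
    using sum_nonneg_0[OF finite_V, of "\<lambda>v. lam u v * (d \<bullet> f u - d \<bullet> f v)"] by blast
  moreover have "lam u v > 0" using lam(3) v vV by blast
  ultimately show ?thesis by simp
qed

lemma higher_neighbour_internal:
  assumes u: "u \<in> V - ext" and v: "{u, v} \<in> E" "d \<bullet> f v \<noteq> d \<bullet> f u"
  shows "\<exists>w. {u, w} \<in> E \<and> d \<bullet> f w > d \<bullet> f u"
proof (rule ccontr)
  assume "\<not> ?thesis"
  then have "d \<bullet> f w \<le> d \<bullet> f u" if "{u, w} \<in> E" for w using that by force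
  then show False using average[OF u _ v(1), of d] v(2) by blast
qed

text \<open>A side is an exposed face of the polygon, which supplies the normal \<open>w\<close>. A
  third corner on the supporting line would be interior to the side, against extremality.\<close>

lemma inj_ext: "inj_on f ext"
  and side_normal: "{u, v} \<in> FE Fo \<Longrightarrow> \<exists>w. \<forall>z\<in>ext. w \<bullet> f z \<le> w \<bullet> f u \<and> (w \<bullet> f z = w \<bullet> f u \<longleftrightarrow> z = u \<or> z = v)"
proof -
  obtain cs where cs: "cycle_list ext (FE Fo) cs" "convex_polygon_corners (map f cs)"
    using ccm unfolding convex_combination_map_def ext_edges_eq by blast
  have set: "set cs = ext" and n: "length cs \<ge> 3" using cs(1) by (auto simp: cycle_list_def)
  show inj: "inj_on f ext"
    using cs(2) set by (auto simp: convex_polygon_corners_def distinct_map)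
  define H where "H = convex hull (f ` ext)"
  have H: "convex hull (set (map f cs)) = H" by (simp add: H_def set)
  have extr: "f z extreme_point_of H" if "z \<in> ext" for z
    using cs(2) that set unfolding convex_polygon_corners_def H by auto
  have side: "\<exists>w. \<forall>z\<in>ext. w \<bullet> f z \<le> w \<bullet> f u \<and> (w \<bullet> f z = w \<bullet> f u \<longleftrightarrow> z = u \<or> z = v)"
    if seg: "closed_segment (f u) (f v) face_of H" and uv: "u \<in> ext" "v \<in> ext" for u v
  proof -
    have "polyhedron H" unfolding H_def using ext_card by (simp add: polyhedron_convex_hull)
    then have "closed_segment (f u) (f v) exposed_face_of H"
      using seg by (simp add: exposed_face_of_polyhedron)
    then obtain w b where wb: "H \<subseteq> {x. w \<bullet> x \<le> b}" "closed_segment (f u) (f v) = H \<inter> {x. w \<bullet> x = b}"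
      unfolding exposed_face_of_def by blast
    have "f u \<in> closed_segment (f u) (f v)" "f v \<in> closed_segment (f u) (f v)" by auto
    then have b: "w \<bullet> f u = b" "w \<bullet> f v = b" unfolding wb(2) by auto
    have fH: "f z \<in> H" if "z \<in> ext" for z using that by (simp add: H_def hull_inc)
    have "w \<bullet> f z \<le> b \<and> (w \<bullet> f z = b \<longleftrightarrow> z = u \<or> z = v)" if z: "z \<in> ext" for z
    proof -
      have "z = u \<or> z = v" if "w \<bullet> f z = b"
      proof (rule ccontr)
        assume nz: "\<not> (z = u \<or> z = v)"
        then have "f z \<noteq> f u" "f z \<noteq> f v" using inj z uv by (auto simp: inj_on_def)
        moreover have "f z \<in> closed_segment (f u) (f v)" unfolding wb(2) using fH[OF z] that by simp
        ultimately have "f z \<in> open_segment (f u) (f v)" by (simp add: open_segment_def)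
        then show False using extr[OF z] fH[OF uv(1)] fH[OF uv(2)] unfolding extreme_point_of_def by blast
      qed
      then show ?thesis using fH[OF z] wb(1) b by auto
    qed
    then show ?thesis unfolding b(1)[symmetric] by (intro exI[of _ w]) blast
  qed
  assume "{u, v} \<in> FE Fo"
  then obtain i where i: "i < length cs" "{u, v} = {cs ! i, cs ! ((i + 1) mod length cs)}"
    using cs(1) unfolding cycle_list_def by auto
  have j: "(i + 1) mod length cs < length cs" using i(1) by (intro mod_less_divisor) linarith
  have "closed_segment (map f cs ! i) (map f cs ! ((i + 1) mod length (map f cs))) face_of H"
    using cs(2) i(1) unfolding convex_polygon_corners_def H by auto
  then have "closed_segment (f (cs ! i)) (f (cs ! ((i + 1) mod length cs))) face_of H"
    using i(1) j by simp
  moreover have "u = cs ! i \<and> v = cs ! ((i + 1) mod length cs) \<or> v = cs ! i \<and> u = cs ! ((i + 1) mod length cs)"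
    using i(2) by (auto simp: doubleton_eq_iff)
  ultimately have "closed_segment (f u) (f v) face_of H" by (auto simp: closed_segment_commute)
  moreover have "u \<in> ext" "v \<in> ext" using FE_subset_FV[OF face_Fo \<open>{u, v} \<in> FE Fo\<close>] by (auto simp: ext_eq)
  ultimately show "\<exists>w. \<forall>z\<in>ext. w \<bullet> f z \<le> w \<bullet> f u \<and> (w \<bullet> f z = w \<bullet> f u \<longleftrightarrow> z = u \<or> z = v)"
    by (rule side)
qed

lemma ext_neighbours:
  assumes "a \<in> ext"
  shows "\<exists>x y. x \<noteq> y \<and> x \<noteq> a \<and> y \<noteq> a \<and> x \<in> ext \<and> y \<in> ext \<and> {a, x} \<in> FE Fo \<and> {a, y} \<in> FE Fo"
proof -
  have "a \<in> FV Fo" using assms by (simp add: ext_eq)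
  from simple_cycle_two_edges[OF Fo_cycle this]
  obtain x y where xy: "x \<noteq> y" "x \<noteq> a" "y \<noteq> a" "x \<in> FV Fo" "y \<in> FV Fo"
    and e: "\<forall>e. e \<in> FE Fo \<and> a \<in> e \<longleftrightarrow> e = {a, x} \<or> e = {a, y}"
    by metis
  have "{a, x} \<in> FE Fo" "{a, y} \<in> FE Fo" using e[THEN spec, of "{a, x}"] e[THEN spec, of "{a, y}"] by simp_all
  then show ?thesis using xy unfolding ext_eq by metis
qed

lemma local_max_corner:
  assumes d: "d \<noteq> 0" and a: "{a, x} \<in> FE Fo" "{a, y} \<in> FE Fo" "x \<noteq> y"
    and le: "d \<bullet> f x \<le> d \<bullet> f a" "d \<bullet> f y \<le> d \<bullet> f a"
  shows "d \<bullet> f x < d \<bullet> f a \<or> d \<bullet> f y < d \<bullet> f a"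
    and "z \<in> ext \<Longrightarrow> d \<bullet> f z \<le> d \<bullet> f a"
    and "z \<in> ext \<Longrightarrow> d \<bullet> f z = d \<bullet> f a \<Longrightarrow> z = a \<or> {a, z} \<in> FE Fo"
proof -
  have E: "{a, x} \<in> E" "{a, y} \<in> E" using a by (auto simp: bd_edges_def)
  have ext: "a \<in> ext" "x \<in> ext" "y \<in> ext"
    using FE_subset_FV[OF face_Fo a(1)] FE_subset_FV[OF face_Fo a(2)] by (auto simp: ext_eq)
  have ne: "x \<noteq> a" "y \<noteq> a" using edge_ends E by blast+
  obtain w1 where w1: "\<forall>z\<in>ext. w1 \<bullet> f z \<le> w1 \<bullet> f a \<and> (w1 \<bullet> f z = w1 \<bullet> f a \<longleftrightarrow> z = a \<or> z = x)"
    using side_normal[OF a(1)] by blast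
  obtain w2 where w2: "\<forall>z\<in>ext. w2 \<bullet> f z \<le> w2 \<bullet> f a \<and> (w2 \<bullet> f z = w2 \<bullet> f a \<longleftrightarrow> z = a \<or> z = y)"
    using side_normal[OF a(2)] by blast
  define A B where "A = f x - f a" and "B = f y - f a"
  have w: "w1 \<bullet> A = 0" "w1 \<bullet> B < 0" "w2 \<bullet> B = 0" "w2 \<bullet> A < 0"
    using w1[THEN bspec, OF ext(2)] w1[THEN bspec, OF ext(3)] w2[THEN bspec, OF ext(2)] w2[THEN bspec, OF ext(3)] a(3) ne
    by (auto simp: A_def B_def inner_diff_right less_le)
  note basis = plane_basis[OF w(1) less_imp_neq[OF w(2)] w(3) less_imp_neq[OF w(4)]]
  have dAB: "d \<bullet> A \<le> 0" "d \<bullet> B \<le> 0" using le by (auto simp: A_def B_def inner_diff_right)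
  have nz: "\<not> (d \<bullet> A = 0 \<and> d \<bullet> B = 0)"
  proof
    assume 0: "d \<bullet> A = 0 \<and> d \<bullet> B = 0"
    have "d \<bullet> d = d \<bullet> (((w2 \<bullet> d) / (w2 \<bullet> A)) *\<^sub>R A + ((w1 \<bullet> d) / (w1 \<bullet> B)) *\<^sub>R B)" using basis[of d] by simp
    also have "\<dots> = 0" using 0 by (simp add: inner_add_right)
    finally show False using d by simp
  qed
  then show "d \<bullet> f x < d \<bullet> f a \<or> d \<bullet> f y < d \<bullet> f a"
    using dAB by (auto simp: A_def B_def inner_diff_right)
  have dec: "\<exists>s t. s \<ge> 0 \<and> t \<ge> 0 \<and> d \<bullet> f z - d \<bullet> f a = s * (d \<bullet> A) + t * (d \<bullet> B) \<and> (s = 0 \<longrightarrow> z = a \<or> z = y) \<and> (t = 0 \<longrightarrow> z = a \<or> z = x)"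
    if z: "z \<in> ext" for z
  proof -
    define s t where "s = (w2 \<bullet> (f z - f a)) / (w2 \<bullet> A)" and "t = (w1 \<bullet> (f z - f a)) / (w1 \<bullet> B)"
    have eq: "f z - f a = s *\<^sub>R A + t *\<^sub>R B" using basis[of "f z - f a"] by (simp add: s_def t_def)
    have l: "w1 \<bullet> (f z - f a) \<le> 0" "w2 \<bullet> (f z - f a) \<le> 0"
      using w1 w2 z by (auto simp: inner_diff_right)
    then have "s \<ge> 0" "t \<ge> 0" using w by (auto simp: s_def t_def divide_nonpos_neg)
    moreover have "d \<bullet> f z - d \<bullet> f a = s * (d \<bullet> A) + t * (d \<bullet> B)"
      using arg_cong[OF eq, of "\<lambda>v. d \<bullet> v"] by (simp add: inner_diff_right inner_add_right)
    moreover have "s = 0 \<longrightarrow> z = a \<or> z = y" using w2[THEN bspec, OF z] w by (auto simp: s_def inner_diff_right)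
    moreover have "t = 0 \<longrightarrow> z = a \<or> z = x" using w1[THEN bspec, OF z] w by (auto simp: t_def inner_diff_right)
    ultimately show ?thesis by blast
  qed
  show "d \<bullet> f z \<le> d \<bullet> f a" if "z \<in> ext" for z
  proof -
    obtain s t where st: "s \<ge> 0" "t \<ge> 0" "d \<bullet> f z - d \<bullet> f a = s * (d \<bullet> A) + t * (d \<bullet> B)" using dec[OF \<open>z \<in> ext\<close>] by blast
    have "s * (d \<bullet> A) \<le> 0" "t * (d \<bullet> B) \<le> 0" using st dAB by (auto simp: mult_nonneg_nonpos)
    then show ?thesis using st(3) by linarith
  qed
  show "z = a \<or> {a, z} \<in> FE Fo" if z: "z \<in> ext" "d \<bullet> f z = d \<bullet> f a" for z
  proof -
    obtain s t where st: "s \<ge> 0" "t \<ge> 0" "d \<bullet> f z - d \<bullet> f a = s * (d \<bullet> A) + t * (d \<bullet> B)"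
      "s = 0 \<longrightarrow> z = a \<or> z = y" "t = 0 \<longrightarrow> z = a \<or> z = x" using dec[OF z(1)] by blast
    have le0: "s * (d \<bullet> A) \<le> 0" "t * (d \<bullet> B) \<le> 0" using st dAB by (auto simp: mult_nonneg_nonpos)
    then have "s * (d \<bullet> A) = 0" "t * (d \<bullet> B) = 0" using st(3) z(2) by linarith+
    then have "s = 0 \<or> t = 0" using nz by auto
    then show ?thesis using st a by auto
  qed
qed

lemma higher_neighbour_ext:
  assumes d: "d \<noteq> 0" and a: "a \<in> ext" and z: "z \<in> ext" "d \<bullet> f z > d \<bullet> f a"
  shows "\<exists>w\<in>ext. {a, w} \<in> FE Fo \<and> d \<bullet> f w > d \<bullet> f a"
proof (rule ccontr)
  assume no: "\<not> ?thesis"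
  obtain x y where xy: "x \<noteq> y" "x \<in> ext" "y \<in> ext" "{a, x} \<in> FE Fo" "{a, y} \<in> FE Fo"
    using ext_neighbours[OF a] by blast
  then have "d \<bullet> f x \<le> d \<bullet> f a" "d \<bullet> f y \<le> d \<bullet> f a" using no by (auto simp: not_less)
  then have "d \<bullet> f z \<le> d \<bullet> f a" using local_max_corner(2)[OF d xy(4,5,1)] z(1) by blast
  then show False using z by simp
qed

definition top_corner :: "real^2 \<Rightarrow> 'v \<Rightarrow> bool" where
  "top_corner d a \<longleftrightarrow> a \<in> ext \<and> (\<forall>z\<in>ext. d \<bullet> f z \<le> d \<bullet> f a)"

lemma top_corner_ex: "\<exists>a. top_corner d a"
proof -
  have "ext \<noteq> {}" using ext_not_small by blast
  then show ?thesis using finite_maximizer[OF ext_card(1), of "\<lambda>v. d \<bullet> f v"] by (auto simp: top_corner_def)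
qed

lemma top_corners_adjacent:
  assumes d: "d \<noteq> 0" and a: "top_corner d a" and b: "b \<in> ext" "d \<bullet> f b = d \<bullet> f a"
  shows "b = a \<or> {a, b} \<in> FE Fo"
proof -
  have "a \<in> ext" using a by (simp add: top_corner_def)
  from ext_neighbours[OF this] obtain x y
    where xy: "x \<noteq> y" "x \<in> ext" "y \<in> ext" "{a, x} \<in> FE Fo" "{a, y} \<in> FE Fo" by blast
  then have "d \<bullet> f x \<le> d \<bullet> f a" "d \<bullet> f y \<le> d \<bullet> f a" using a by (auto simp: top_corner_def)
  then show ?thesis using local_max_corner(3)[OF d xy(4,5,1) _ _ b] by blast
qed

text \<open>Among the vertices reachable without descending below \<open>v\<close>, take the
  highest. If none of these were external, averaging would spread their level to all neighbours and
  so to the whole graph; an external one is a local, hence global, maximum on the polygon.\<close>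

lemma ascent:
  assumes d: "d \<noteq> 0" and v: "v \<in> V"
  shows "\<exists>a. top_corner d a \<and> d \<bullet> f v \<le> d \<bullet> f a \<and> (v, a) \<in> (steps (inner_edges E {w\<in>V. d \<bullet> f v \<le> d \<bullet> f w}))\<^sup>*"
proof -
  let ?h = "\<lambda>w. d \<bullet> f w"
  define D where "D = inner_edges E {w\<in>V. ?h v \<le> ?h w}"
  define R where "R = {w. (v, w) \<in> (steps D)\<^sup>*}"
  have ge: "w \<in> V \<and> ?h v \<le> ?h w" if "w \<in> R" for w
  proof -
    have "(v, w) \<in> (steps D)\<^sup>*" using that by (simp add: R_def)
    then show ?thesis
      by (cases rule: rtranclE) (use v in \<open>auto simp: D_def inner_edges_def\<close>)
  qed
  have ext_R: "y \<in> R" if "x \<in> R" "{x, y} \<in> E" "?h x \<le> ?h y" for x y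
  proof -
    have "(x, y) \<in> steps D" using that ge[OF that(1)] edge_ends[OF that(2)] by (auto simp: D_def inner_edges_def)
    then show ?thesis using that(1) unfolding R_def by (simp add: rtrancl_into_rtrancl)
  qed
  have "finite R" using ge finite_V by (meson finite_subset subsetI)
  moreover have "v \<in> R" by (simp add: R_def)
  ultimately obtain m where mR: "m \<in> R" and mx: "\<And>w. w \<in> R \<Longrightarrow> ?h w \<le> ?h m"
    using finite_maximizer[of R ?h] by blast
  define T where "T = {w \<in> R. ?h w = ?h m}"
  have up: "?h y \<le> ?h x" if "x \<in> T" "{x, y} \<in> E" for x y
  proof (rule ccontr)
    assume "\<not> ?h y \<le> ?h x"
    then have "y \<in> R" using ext_R[of x y] that by (auto simp: T_def)
    then show False using mx[of y] that \<open>\<not> ?h y \<le> ?h x\<close> by (auto simp: T_def)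
  qed
  have "T \<inter> ext \<noteq> {}"
  proof
    assume no: "T \<inter> ext = {}"
    have "T = V"
    proof (rule closed_eq_V)
      show "T \<subseteq> V" using ge by (auto simp: T_def)
      show "m \<in> T" using mR by (simp add: T_def)
      fix x y assume xy: "x \<in> T" "{x, y} \<in> E"
      have "x \<in> V - ext" using xy(1) no ge by (auto simp: T_def)
      then have "?h y = ?h x" using average[of x d y] up[OF xy(1)] xy(2) by blast
      then show "y \<in> T" using ext_R[of x y] xy by (auto simp: T_def)
    qed
    then show False using no ext_subset ext_not_small[of v v] by blast
  qed
  then obtain a where a: "a \<in> T" "a \<in> ext" by blast
  obtain x y where xy: "x \<noteq> y" "{a, x} \<in> FE Fo" "{a, y} \<in> FE Fo" using ext_neighbours[OF a(2)] by blast
  then have "?h x \<le> ?h a" "?h y \<le> ?h a" using up[OF a(1)] by (auto simp: bd_edges_def)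
  then have "top_corner d a" using local_max_corner(2)[OF d xy(2,3,1)] a(2) by (simp add: top_corner_def)
  moreover have "a \<in> R" using a by (simp add: T_def)
  ultimately show ?thesis using ge[of a] unfolding R_def D_def by blast
qed

lemma le_top_corner: "d \<noteq> 0 \<Longrightarrow> v \<in> V \<Longrightarrow> top_corner d a \<Longrightarrow> d \<bullet> f v \<le> d \<bullet> f a"
  using ascent[of d v] unfolding top_corner_def by (meson order_trans)

definition upper :: "real^2 \<Rightarrow> real \<Rightarrow> 'v set" where
  "upper d t = {v \<in> V. d \<bullet> f v > t}"

lemma upper_subset: "upper d t \<subseteq> V"
  by (auto simp: upper_def)

text \<open>Both vertices climb to a top corner inside the set, and two top corners coincide or span
  a side of the polygon.\<close>

lemma conn_upper:
  assumes d: "d \<noteq> 0"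
  shows "conn E (upper d t)"
  unfolding conn_def
proof (intro ballI)
  fix u v assume uv: "u \<in> upper d t" "v \<in> upper d t"
  let ?D = "inner_edges E (upper d t)"
  have asc: "\<exists>a. top_corner d a \<and> a \<in> upper d t \<and> (w, a) \<in> (steps ?D)\<^sup>*" if w: "w \<in> upper d t" for w
  proof -
    have wV: "w \<in> V" "t < d \<bullet> f w" using w by (auto simp: upper_def)
    obtain a where a: "top_corner d a" "d \<bullet> f w \<le> d \<bullet> f a"
      "(w, a) \<in> (steps (inner_edges E {x\<in>V. d \<bullet> f w \<le> d \<bullet> f x}))\<^sup>*"
      using ascent[OF d wV(1)] by blast
    have "inner_edges E {x\<in>V. d \<bullet> f w \<le> d \<bullet> f x} \<subseteq> ?D"
      using wV(2) by (auto simp: inner_edges_def upper_def)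
    then have "(w, a) \<in> (steps ?D)\<^sup>*" using a(3) by (rule steps_mono)
    moreover have "a \<in> upper d t" using a(1,2) wV(2) ext_subset by (auto simp: upper_def top_corner_def)
    ultimately show ?thesis using a(1) by blast
  qed
  obtain a where a: "top_corner d a" "a \<in> upper d t" "(u, a) \<in> (steps ?D)\<^sup>*" using asc[OF uv(1)] by blast
  obtain b where b: "top_corner d b" "b \<in> upper d t" "(v, b) \<in> (steps ?D)\<^sup>*" using asc[OF uv(2)] by blast
  have "d \<bullet> f b = d \<bullet> f a" "b \<in> ext" using a(1) b(1) by (auto simp: top_corner_def intro: antisym)
  then have "b = a \<or> {a, b} \<in> FE Fo" using top_corners_adjacent[OF d a(1)] by blast
  then have "(a, b) \<in> (steps ?D)\<^sup>*"
  proof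
    assume "{a, b} \<in> FE Fo"
    then have "(a, b) \<in> steps ?D" using a(2) b(2) by (auto simp: inner_edges_def bd_edges_def)
    then show ?thesis by blast
  qed simp
  then show "(u, v) \<in> (steps ?D)\<^sup>*" using a(3) steps_rtrancl_sym[OF b(3)] by (meson rtrancl_trans)
qed

definition lower :: "real^2 \<Rightarrow> real \<Rightarrow> 'v set" where
  "lower d t = {v \<in> V. d \<bullet> f v < t}"

lemma lower_eq: "lower d t = upper (- d) (- t)"
  by (auto simp: lower_def upper_def)

lemma conn_lower: "d \<noteq> 0 \<Longrightarrow> conn E (lower d t)"
  by (simp add: lower_eq conn_upper)

end

section \<open>Levels and faces\<close>

lemma perpendicular_exists:
  fixes a :: "real^2"
  obtains n where "n \<bullet> a = 0" "n \<noteq> 0"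
proof (cases "a = 0")
  case True
  have "axis 1 1 \<noteq> (0 :: real^2)" by (simp add: axis_eq_0_iff)
  then show ?thesis using that True by auto
next
  case False
  define n :: "real^2" where "n = vector [- (a$2), a$1]"
  have "n \<bullet> a = 0" by (simp add: n_def inner_vec_def sum_2)
  moreover have "n \<noteq> 0"
  proof
    assume "n = 0"
    then have "n$1 = 0" "n$2 = 0" by simp_all
    then have "a$1 = 0" "a$2 = 0" by (simp_all add: n_def)
    then show False using False by (simp add: vec_eq_iff forall_2)
  qed
  ultimately show ?thesis using that by blast
qed

lemma two_positive_direction:
  fixes a b n :: "real^2"
  assumes "a \<noteq> 0" "n \<bullet> a = 0" "n \<bullet> b \<noteq> 0"
  obtains d where "d \<bullet> a > 0" "d \<bullet> b > 0"
proof -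
  \<comment> \<open>Adding a multiple of \<open>n\<close> does not change the product with
    \<open>a\<close>; this \<open>l\<close> makes the product with \<open>b\<close> equal to
    one.\<close>
  define l where "l = (1 - a \<bullet> b) / (n \<bullet> b)"
  have "(a + l *\<^sub>R n) \<bullet> a > 0" using assms by (simp add: inner_add_left)
  moreover have "(a + l *\<^sub>R n) \<bullet> b = 1" using assms by (simp add: inner_add_left l_def)
  ultimately show ?thesis using that[of "a + l *\<^sub>R n"] by simp
qed

lemma generic_direction:
  fixes S :: "(real^2) set"
  assumes "finite S"
  obtains d where "d \<noteq> 0" "\<And>a. a \<in> S \<Longrightarrow> a \<noteq> 0 \<Longrightarrow> d \<bullet> a \<noteq> 0"
proof -
  \<comment> \<open>The direction \<open>(1, s)\<close> is orthogonal to a nonzero \<open>a\<close>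
    only if \<open>s\<close> is this quotient, so finitely many values of \<open>s\<close> are to be
    avoided.\<close>
  have "finite ((\<lambda>a. - a$1 / a$2) ` S)" using assms by simp
  then obtain s :: real where s: "s \<notin> (\<lambda>a. - a$1 / a$2) ` S" using ex_new_if_finite infinite_UNIV_char_0 by blast
  define d :: "real^2" where "d = vector [1, s]"
  have di: "d \<bullet> a = a$1 + s * a$2" for a by (simp add: d_def inner_vec_def sum_2)
  have "d$1 = 1" by (simp add: d_def)
  then have "d \<noteq> 0" by auto
  moreover have "d \<bullet> a \<noteq> 0" if a: "a \<in> S" "a \<noteq> 0" for a
  proof
    assume 0: "d \<bullet> a = 0"
    have "a$2 \<noteq> 0"
    proof
      assume "a$2 = 0"
      then have "a = 0" using 0 di by (simp add: vec_eq_iff forall_2)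
      then show False using a by simp
    qed
    then have "s = - a$1 / a$2" using 0 di by (simp add: field_simps)
    then show False using s a by blast
  qed
  ultimately show ?thesis using that by blast
qed

lemma avoid_finite:
  fixes a b :: real
  assumes "a < b" "finite S"
  obtains t where "a < t" "t < b" "t \<notin> S"
proof -
  have "infinite ({a<..<b} - S)" using assms by (simp add: infinite_Ioo)
  then have "{a<..<b} - S \<noteq> {}" by (metis finite.emptyI)
  then obtain t where "t \<in> {a<..<b} - S" by blast
  then show ?thesis using that[of t] by simp
qed

section \<open>Flat faces and level edges\<close>

locale tutte = convex_embeddable_graph V E pos c + convex_combination V E pos c f
  for V :: "'v set" and E :: "'v set set" and pos c f
begin

text \<open>Internal vertices on the top level would form a set attached only to top corners. There
  are at most two of those, and two are joined by an external edge, so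
  \<open>external_edge_not_cut_pair\<close> applies.\<close>

lemma internal_not_top:
  assumes v: "v \<in> V - ext" and d: "d \<noteq> 0"
  shows "\<exists>z\<in>ext. d \<bullet> f z > d \<bullet> f v"
proof (rule ccontr)
  assume no: "\<not> ?thesis"
  obtain a where a: "top_corner d a" using top_corner_ex by blast
  have ae: "a \<in> ext" using a by (simp add: top_corner_def)
  define M where "M = d \<bullet> f a"
  have le: "d \<bullet> f x \<le> M" if "x \<in> V" for x using le_top_corner[OF d that a] by (simp add: M_def)
  have "d \<bullet> f v = M" using no ae le[of v] v by (force simp: M_def)
  define K where "K = {x \<in> V - ext. d \<bullet> f x = M}"
  have K: "K \<subseteq> V - ext" "K \<noteq> {}" using v \<open>d \<bullet> f v = M\<close> by (auto simp: K_def)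
  have nb: "y \<in> ext \<and> d \<bullet> f y = M" if y: "y \<in> nbrs E K" for y
  proof -
    obtain x where x: "x \<in> K" "{x, y} \<in> E" "y \<notin> K" using y by (auto simp: nbrs_def)
    have "d \<bullet> f y = d \<bullet> f x"
      by (rule average[of x]) (use x le edge_ends in \<open>auto simp: K_def\<close>)
    then show ?thesis using x edge_ends[OF x(2)] by (auto simp: K_def)
  qed
  obtain p where p: "p \<in> nbrs E K" using cut_at_least_two[OF K] by blast
  then obtain q where q: "q \<in> nbrs E K" "q \<noteq> p" using cut_at_least_two[OF K, of p] by blast
  have top: "top_corner d p" using nb[OF p] le ext_subset by (auto simp: top_corner_def)
  have adj: "{p, x} \<in> FE Fo" if "x \<in> nbrs E K" "x \<noteq> p" for x
    using top_corners_adjacent[OF d top, of x] nb[OF that(1)] nb[OF p] that(2) by auto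
  have "nbrs E K \<subseteq> {p, q}"
  proof
    fix x assume x: "x \<in> nbrs E K"
    show "x \<in> {p, q}"
    proof (rule ccontr)
      assume nx: "x \<notin> {p, q}"
      then have xe: "{p, x} \<in> FE Fo" "{p, q} \<in> FE Fo" "x \<noteq> q" using adj x q by auto
      show False using local_max_corner(1)[OF d xe] nb[OF x] nb[OF q(1)] nb[OF p] by simp
    qed
  qed
  then show False using external_edge_not_cut_pair[OF K] adj[OF q] by blast
qed

definition crosses :: "real^2 \<Rightarrow> real \<Rightarrow> 'v set \<Rightarrow> bool" where
  "crosses d t e \<longleftrightarrow> (\<exists>x y. e = {x, y} \<and> d \<bullet> f x < t \<and> t < d \<bullet> f y)"

text \<open>The vertices below and above the level are the two connected pieces of
  \<open>not_three_crossing_edges\<close>.\<close>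

lemma no_three_crossing:
  assumes "d \<noteq> 0" "face F" "e1 \<in> FE F" "e2 \<in> FE F" "e3 \<in> FE F" "crosses d t e1" "crosses d t e2" "crosses d t e3"
    "e1 \<noteq> e2" "e1 \<noteq> e3" "e2 \<noteq> e3"
  shows False
proof -
  have low: "\<exists>x y. e = {x, y} \<and> x \<in> lower d t \<and> y \<in> upper d t" if e: "e \<in> FE F" "crosses d t e" for e
  proof -
    obtain x y where xy: "e = {x, y}" "d \<bullet> f x < t" "t < d \<bullet> f y" using e(2) by (auto simp: crosses_def)
    then have "{x, y} \<in> E" using e(1) by (auto simp: bd_edges_def)
    then show ?thesis using xy edge_ends[of x y] by (auto simp: lower_def upper_def)
  qed
  obtain x1 y1 where 1: "e1 = {x1, y1}" "x1 \<in> lower d t" "y1 \<in> upper d t" using low assms(3,6) by blast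
  obtain x2 y2 where 2: "e2 = {x2, y2}" "x2 \<in> lower d t" "y2 \<in> upper d t" using low assms(4,7) by blast
  obtain x3 y3 where 3: "e3 = {x3, y3}" "x3 \<in> lower d t" "y3 \<in> upper d t" using low assms(5,8) by blast
  have lu: "lower d t \<inter> upper d t = {}" by (auto simp: lower_def upper_def)
  have lV: "lower d t \<subseteq> V" by (auto simp: lower_def)
  show False
    using not_three_crossing_edges[OF lV conn_lower[OF assms(1)] upper_subset conn_upper[OF assms(1)] lu
        _ 1(2,3) _ 2(2,3) _ 3(2,3) _ _ _ assms(2)] assms(3-5,9-11) unfolding 1(1) 2(1) 3(1) by blast
qed

lemma three_elements:
  assumes "finite S" "card S \<ge> 3"
  obtains x y z where "x \<in> S" "y \<in> S" "z \<in> S" "x \<noteq> y" "x \<noteq> z" "y \<noteq> z"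
proof -
  obtain T where T: "T \<subseteq> S" "card T = 3" using obtain_subset_with_card_n[OF assms(2)] by metis
  obtain x y z where "T = {x, y, z}" "x \<noteq> y" "y \<noteq> z" "x \<noteq> z" using T(2) card_3_iff by metis
  then show ?thesis using that T(1) by blast
qed

lemma star_nonempty: "v \<in> V \<Longrightarrow> star v \<noteq> {}"
proof
  assume v: "v \<in> V" "star v = {}"
  have "{v} = V" by (rule closed_eq_V) (use v in \<open>auto simp: star_def\<close>)
  then show False using ext_subset ext_not_small[of v v] by blast
qed

text \<open>Merge the face with the vertices near it whose neighbours are all on the level too, to a
  connected set \<open>Q\<close>. The vertices around \<open>Q\<close> have neighbours above and
  below, so three of them contradict \<open>not_touch_three_links\<close>; with two of them the face
  lies inside a blob, against \<open>no_blob\<close>.\<close>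

lemma face_not_flat:
  assumes F: "face F" "F \<noteq> Fo" and d: "d \<noteq> 0"
  shows "\<exists>v\<in>FV F. d \<bullet> f v \<noteq> t"
proof (rule ccontr)
  assume "\<not> ?thesis"
  then have lev: "\<And>v. v \<in> FV F \<Longrightarrow> d \<bullet> f v = t" by blast
  have FVV: "FV F \<subseteq> V" by (auto simp: bd_vertices_def)
  obtain x0 y0 z0 where xyz: "x0 \<in> FV F" "y0 \<in> FV F" "z0 \<in> FV F" "x0 \<noteq> y0" "x0 \<noteq> z0" "y0 \<noteq> z0"
  proof -
    have "finite (FV F)" "card (FV F) \<ge> 3" using simple_cycle_card[OF face_cycle[OF F(1)]] by auto
    then show ?thesis using three_elements[of "FV F"] that by metis
  qed
  \<comment> \<open>The level of the face is not extreme on the polygon: otherwise all vertices of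
    the face would be top corners, of which there are at most two.\<close>
  have mid: "\<exists>z\<in>ext. s \<bullet> f z > s \<bullet> f x0" if s: "s = d \<or> s = - d" for s
  proof (rule ccontr)
    assume no: "\<not> ?thesis"
    have s0: "s \<noteq> 0" using s d by auto
    have slev: "s \<bullet> f v = s \<bullet> f x0" if "v \<in> FV F" for v using lev[OF that] lev[OF xyz(1)] s by auto
    have "v \<in> ext" if v: "v \<in> FV F" for v
    proof (rule ccontr)
      assume "v \<notin> ext"
      then have "\<exists>z\<in>ext. s \<bullet> f z > s \<bullet> f v" using internal_not_top[OF _ s0, of v] v FVV by blast
      then show False using no slev[OF v] by auto
    qed
    then have e: "x0 \<in> ext" "y0 \<in> ext" "z0 \<in> ext" using xyz by auto
    have top: "top_corner s x0" using no e by (auto simp: top_corner_def not_less)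
    note sl = slev[OF xyz(2)] slev[OF xyz(3)]
    have xe: "{x0, y0} \<in> FE Fo" "{x0, z0} \<in> FE Fo"
      using top_corners_adjacent[OF s0 top e(2) sl(1)] top_corners_adjacent[OF s0 top e(3) sl(2)] xyz(4,5) by auto
    show False using local_max_corner(1)[OF s0 xe xyz(6)] sl by simp
  qed
  have tx: "d \<bullet> f x0 = t" by (rule lev[OF xyz(1)])
  obtain zu where zu: "zu \<in> ext" "d \<bullet> f zu > t" using mid[of d] tx by auto
  obtain zl where zl: "zl \<in> ext" "d \<bullet> f zl < t" using mid[of "- d"] tx by auto
  define flat where "flat v \<longleftrightarrow> v \<in> V \<and> d \<bullet> f v = t \<and> (\<forall>y. {v, y} \<in> E \<longrightarrow> d \<bullet> f y = t)" for v
  have updown: "(\<exists>a. {v, a} \<in> E \<and> a \<in> upper d t) \<and> (\<exists>b. {v, b} \<in> E \<and> b \<in> lower d t)"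
    if v: "v \<in> V" "d \<bullet> f v = t" "\<not> flat v" for v
  proof (cases "v \<in> ext")
    case True
    obtain a where a: "{v, a} \<in> FE Fo" "d \<bullet> f a > t" using higher_neighbour_ext[OF d True zu(1)] zu(2) v by auto
    obtain b where b: "{v, b} \<in> FE Fo" "d \<bullet> f b < t"
      using higher_neighbour_ext[of "- d", OF _ True zl(1)] zl(2) v d by auto
    have "{v, a} \<in> E" "{v, b} \<in> E" using a b by (auto simp: bd_edges_def)
    then show ?thesis using a b edge_ends[of v a] edge_ends[of v b] by (auto simp: upper_def lower_def)
  next
    case False
    then have vi: "v \<in> V - ext" using v by simp
    obtain y where y: "{v, y} \<in> E" "d \<bullet> f y \<noteq> d \<bullet> f v" using v by (auto simp: flat_def)
    obtain a where a: "{v, a} \<in> E" "d \<bullet> f a > t" using higher_neighbour_internal[OF vi y] v by auto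
    have "(- d) \<bullet> f y \<noteq> (- d) \<bullet> f v" using y by simp
    then obtain b where b: "{v, b} \<in> E" "d \<bullet> f b < t" using higher_neighbour_internal[OF vi y(1), of "- d"] v by auto
    show ?thesis using a b edge_ends[of v a] edge_ends[of v b] by (auto simp: upper_def lower_def)
  qed
  have flat_int: "v \<notin> ext" if fl: "flat v" for v
  proof
    assume ve: "v \<in> ext"
    have "d \<bullet> f zu > d \<bullet> f v" using zu(2) fl by (simp add: flat_def)
    then obtain a where a: "{v, a} \<in> FE Fo" "d \<bullet> f a > d \<bullet> f v"
      using higher_neighbour_ext[OF d ve zu(1)] by blast
    then show False using fl by (auto simp: flat_def bd_edges_def)
  qed
  \<comment> \<open>\<open>K\<close> collects the clusters of flat vertices that start on the
    boundary of \<open>F\<close>; edges out of \<open>K\<close> thus lead to vertices that are level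
    but not flat.\<close>
  define D where "D = {e \<in> E. \<forall>v\<in>e. flat v}"
  define K where "K = {y. \<exists>x\<in>FV F. flat x \<and> (x, y) \<in> (steps D)\<^sup>*}"
  have Kflat: "flat y" if "y \<in> K" for y
  proof -
    obtain x where x: "flat x" "(x, y) \<in> (steps D)\<^sup>*" using \<open>y \<in> K\<close> by (auto simp: K_def)
    show ?thesis using x(2) by (cases rule: rtranclE) (use x in \<open>auto simp: D_def\<close>)
  qed
  have Kstep: "y \<in> K" if "x \<in> K" "{x, y} \<in> E" "flat y" for x y
  proof -
    have "(x, y) \<in> steps D" using that Kflat[OF that(1)] by (auto simp: D_def)
    moreover obtain x0 where "x0 \<in> FV F" "flat x0" "(x0, x) \<in> (steps D)\<^sup>*"
      using \<open>x \<in> K\<close> unfolding K_def by blast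
    ultimately have "x0 \<in> FV F" "flat x0" "(x0, y) \<in> (steps D)\<^sup>*" by (simp_all add: rtrancl_into_rtrancl)
    then show ?thesis unfolding K_def by blast
  qed
  have KFV: "x \<in> K" if "x \<in> FV F" "flat x" for x using that unfolding K_def by blast
  have KV: "K \<subseteq> V - ext" using Kflat flat_int by (auto simp: flat_def)
  define N where "N = (FV F - K) \<union> nbrs E K"
  have N: "n \<in> V \<and> d \<bullet> f n = t \<and> \<not> flat n \<and> n \<notin> K" if "n \<in> N" for n
    using that unfolding N_def
  proof
    assume n: "n \<in> FV F - K"
    then have "\<not> flat n" using KFV by blast
    then show ?thesis using n lev FVV by blast
  next
    assume n: "n \<in> nbrs E K"
    then obtain x where x: "x \<in> K" "{x, n} \<in> E" "n \<notin> K" by (auto simp: nbrs_def)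
    then have "\<not> flat n" using Kstep by blast
    then show ?thesis using x edge_ends[OF x(2)] Kflat[OF x(1)] by (auto simp: flat_def)
  qed
  \<comment> \<open>The open edges at \<open>K\<close> are included so that every vertex of
    \<open>N\<close> lies in the closure of \<open>Q\<close>.\<close>
  define Q where "Q = F \<union> pos ` K \<union> (\<Union>e\<in>{e\<in>E. e \<inter> K \<noteq> {}}. op e)"
  obtain z where z: "z \<in> F" using face_nonempty F by blast
  have FQ: "F \<subseteq> Q" by (auto simp: Q_def)
  have ccK: "connected_component Q z (pos y)" if "y \<in> K" for y
  proof -
    obtain x where x: "x \<in> FV F" "flat x" "(x, y) \<in> (steps D)\<^sup>*" using \<open>y \<in> K\<close> by (auto simp: K_def)
    show ?thesis using x(3)
    proof (induction rule: rtrancl_induct)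
      case base
      have "connected (insert (pos x) F)"
        using connected_insert_closure[OF face_connected[OF F(1)]] x(1) FV_iff[OF F(1)] by blast
      moreover have "insert (pos x) F \<subseteq> Q" using KFV[OF x(1,2)] FQ by (auto simp: Q_def)
      ultimately show ?case using z unfolding connected_component_def by (intro exI[of _ "insert (pos x) F"]) auto
    next
      case (step u v)
      have uv: "{u, v} \<in> E" "flat u" "flat v" using step(2) by (auto simp: D_def)
      have uK: "u \<in> K" using step(1) x unfolding K_def by blast
      then have vK: "v \<in> K" using Kstep uv by blast
      have "P {u, v} \<subseteq> Q" using P_split[OF uv(1)] uK vK uv(1) by (auto simp: Q_def)
      then have "connected_component Q (pos u) (pos v)"
        using connected_P[OF uv(1)] pos_in_edge[OF uv(1), of u] pos_in_edge[OF uv(1), of v]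
        unfolding connected_component_def by (intro exI[of _ "P {u, v}"]) auto
      then show ?case using step.IH connected_component_trans by metis
    qed
  qed
  have conQ: "connected Q"
  proof -
    have "connected_component Q z x" if x: "x \<in> Q" for x
    proof -
      consider "x \<in> F" | y where "y \<in> K" "x = pos y" | e w where "e \<in> E" "w \<in> e" "w \<in> K" "x \<in> op e"
        using x by (auto simp: Q_def)
      then show ?thesis
      proof cases
        case 1
        then show ?thesis using z FQ face_connected[OF F(1)] unfolding connected_component_def by blast
      next
        case 2 then show ?thesis using ccK by blast
      next
        case 3
        have "connected (insert (pos w) (op e))"
          using connected_insert_closure[OF connected_op[OF 3(1)]] closure_op[OF 3(1)] pos_in_edge[OF 3(1,2)] by blast
        moreover have "insert (pos w) (op e) \<subseteq> Q" using 3 by (auto simp: Q_def)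
        ultimately have "connected_component Q (pos w) x"
          using 3(4) unfolding connected_component_def by (intro exI[of _ "insert (pos w) (op e)"]) auto
        then show ?thesis using ccK[OF 3(3)] connected_component_trans by metis
      qed
    qed
    then show ?thesis unfolding connected_iff_connected_component
      by (meson connected_component_sym connected_component_trans)
  qed
  have clN: "pos n \<in> closure Q" if n: "n \<in> N" for n
  proof (cases "n \<in> FV F")
    case True
    then have "pos n \<in> closure F" using FV_iff[OF F(1)] by blast
    then show ?thesis using closure_mono[OF FQ] by blast
  next
    case False
    then have "n \<in> nbrs E K" using n by (auto simp: N_def)
    then obtain x where x: "x \<in> K" "{x, n} \<in> E" by (auto simp: nbrs_def)
    have "pos n \<in> closure (op {x, n})" using closure_op[OF x(2)] pos_in_edge[OF x(2), of n] by auto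
    moreover have "op {x, n} \<subseteq> Q" using x by (auto simp: Q_def)
    ultimately show ?thesis using closure_mono by blast
  qed
  have QX: "\<exists>w e. e \<in> E \<and> w \<in> e \<and> w \<in> K \<and> x \<in> insert (pos w) (op e)" if x: "x \<in> Q" "x \<in> X" for x
  proof -
    have "x \<notin> F" using x face_disjoint_X[OF F(1)] by blast
    then consider y where "y \<in> K" "x = pos y" | e w where "e \<in> E" "w \<in> e" "w \<in> K" "x \<in> op e"
      using x by (auto simp: Q_def)
    then show ?thesis
    proof cases
      case 1
      then have "star y \<noteq> {}" using star_nonempty KV by blast
      then obtain e where "e \<in> E" "y \<in> e" by (auto simp: star_def)
      then show ?thesis using 1 by blast
    next
      case 2 then show ?thesis by blast
    qed
  qed
  have no3: False if n: "n1 \<in> N" "n2 \<in> N" "n3 \<in> N" and ne: "n1 \<noteq> n2" "n1 \<noteq> n3" "n2 \<noteq> n3" for n1 n2 n3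
  proof -
    have lk: "\<exists>a b. {a, n} \<in> E \<and> {n, b} \<in> E \<and> a \<in> upper d t \<and> b \<in> lower d t \<and> n \<notin> upper d t \<union> lower d t" if "n \<in> N" for n
      using updown[of n] N[OF that] by (auto simp: upper_def lower_def insert_commute)
    obtain a1 b1 where 1: "{a1, n1} \<in> E" "{n1, b1} \<in> E" "a1 \<in> upper d t" "b1 \<in> lower d t" "n1 \<notin> upper d t \<union> lower d t"
      using lk[OF n(1)] by blast
    obtain a2 b2 where 2: "{a2, n2} \<in> E" "{n2, b2} \<in> E" "a2 \<in> upper d t" "b2 \<in> lower d t" "n2 \<notin> upper d t \<union> lower d t"
      using lk[OF n(2)] by blast
    obtain a3 b3 where 3: "{a3, n3} \<in> E" "{n3, b3} \<in> E" "a3 \<in> upper d t" "b3 \<in> lower d t" "n3 \<notin> upper d t \<union> lower d t"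
      using lk[OF n(3)] by blast
    have lu: "upper d t \<inter> lower d t = {}" by (auto simp: lower_def upper_def)
    have lV: "lower d t \<subseteq> V" by (auto simp: lower_def)
    have QX': "\<exists>w e. e \<in> E \<and> w \<in> e \<and> w \<notin> insert n1 (insert n2 (insert n3 (upper d t \<union> lower d t))) \<and> x \<in> insert (pos w) (op e)"
      if "x \<in> Q" "x \<in> X" for x
    proof -
      obtain w e where w: "e \<in> E" "w \<in> e" "w \<in> K" "x \<in> insert (pos w) (op e)" using QX \<open>x \<in> Q\<close> \<open>x \<in> X\<close> by blast
      have "w \<notin> insert n1 (insert n2 (insert n3 (upper d t \<union> lower d t)))"
        using w(3) N[OF n(1)] N[OF n(2)] N[OF n(3)] Kflat[OF w(3)] by (auto simp: flat_def upper_def lower_def)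
      then show ?thesis using w by blast
    qed
    show False
      by (rule not_touch_three_links[OF upper_subset conn_upper[OF d] lV conn_lower[OF d] lu 1 2 3 ne conQ QX'
            clN[OF n(1)] clN[OF n(2)] clN[OF n(3)]])
  qed
  have Kne: "K \<noteq> {}"
  proof
    assume "K = {}"
    then have "x0 \<in> N" "y0 \<in> N" "z0 \<in> N" using xyz by (auto simp: N_def)
    then show False using no3 xyz by blast
  qed
  obtain a where a: "a \<in> nbrs E K" using cut_at_least_two[OF KV Kne] by blast
  then obtain b where b: "b \<in> nbrs E K" "b \<noteq> a" using cut_at_least_two[OF KV Kne, of a] by blast
  have Nab: "n = a \<or> n = b" if "n \<in> N" for n
    using no3[of a b n] a b that by (auto simp: N_def)
  then have nbK: "nbrs E K = {a, b}" using a b by (auto simp: N_def)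
  have FVab: "FV F \<subseteq> insert a (insert b K)" using Nab by (auto simp: N_def)
  \<comment> \<open>Were \<open>{a, b}\<close> a side, \<open>a\<close> would have three neighbours
    on the external cycle: one above the level, one below it, and \<open>b\<close> on it.\<close>
  have "{a, b} \<notin> FE Fo"
  proof
    assume ab: "{a, b} \<in> FE Fo"
    then have ae: "a \<in> ext" "b \<in> ext" using FE_subset_FV[OF face_Fo ab] by (auto simp: ext_eq)
    have lab: "d \<bullet> f a = t" "d \<bullet> f b = t" using N[of a] N[of b] a b by (auto simp: N_def)
    obtain u where u: "{a, u} \<in> FE Fo" "d \<bullet> f u > t" using higher_neighbour_ext[OF d ae(1) zu(1)] zu(2) lab by auto
    obtain w where w: "{a, w} \<in> FE Fo" "d \<bullet> f w < t"
      using higher_neighbour_ext[of "- d", OF _ ae(1) zl(1)] zl(2) lab d by auto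
    have "a \<in> FV Fo" using ae by (simp add: ext_eq)
    from simple_cycle_two_edges[OF Fo_cycle this]
    obtain x y where xy: "\<forall>e. e \<in> FE Fo \<and> a \<in> e \<longleftrightarrow> e = {a, x} \<or> e = {a, y}" by metis
    have "r = x \<or> r = y \<or> r = a" if "{a, r} \<in> FE Fo" for r
      using xy[THEN spec, of "{a, r}"] that by (auto simp: doubleton_eq_iff)
    then have "u = x \<or> u = y \<or> u = a" "w = x \<or> w = y \<or> w = a" "b = x \<or> b = y \<or> b = a"
      using u w ab by blast+
    then show False using u w lab b by auto
  qed
  then show False using no_blob[OF KV Kne nbK _ _ F(1) FVab] b by blast
qed

text \<open>Otherwise the vertices reached along level edges would have no lower neighbour. They
  would then be internal, and by averaging attached to the rest at \<open>y\<close> alone.\<close>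

lemma low_detour:
  assumes d: "d \<noteq> 0" and e: "{x, y} \<in> E" "d \<bullet> f x = t" "d \<bullet> f y = t" and z: "z \<in> ext" "d \<bullet> f z < t"
    and D: "D = {e \<in> E - {{x, y}}. \<forall>v\<in>e. d \<bullet> f v = t}"
  shows "(x, y) \<in> (steps D)\<^sup>* \<or> (\<exists>w b. (x, w) \<in> (steps D)\<^sup>* \<and> {w, b} \<in> E \<and> d \<bullet> f w = t \<and> d \<bullet> f b < t)"
proof (rule ccontr)
  assume no: "\<not> ?thesis"
  define W where "W = {w. (x, w) \<in> (steps D)\<^sup>*}"
  have W: "w \<in> V \<and> d \<bullet> f w = t" if "w \<in> W" for w
  proof -
    have "(x, w) \<in> (steps D)\<^sup>*" using that by (simp add: W_def)
    then show ?thesis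
    proof (cases rule: rtranclE)
      case base then show ?thesis using e edge_ends by blast
    next
      case (step u)
      then show ?thesis using edge_ends[of u w] by (auto simp: D)
    qed
  qed
  have nodown: "d \<bullet> f b \<ge> t" if "w \<in> W" "{w, b} \<in> E" for w b
    using no that W[OF that(1)] unfolding W_def by force
  have Wint: "W \<subseteq> V - ext"
  proof
    fix w assume w: "w \<in> W"
    have "w \<notin> ext"
    proof
      assume we: "w \<in> ext"
      have "(- d) \<bullet> f z > (- d) \<bullet> f w" using z W[OF w] by simp
      then obtain b where "{w, b} \<in> FE Fo" "(- d) \<bullet> f b > (- d) \<bullet> f w"
        using higher_neighbour_ext[of "- d", OF _ we z(1)] d by auto
      then show False using nodown[OF w, of b] W[OF w] by (auto simp: bd_edges_def)
    qed
    then show "w \<in> V - ext" using W[OF w] by blast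
  qed
  have "nbrs E W \<subseteq> {y}"
  proof
    fix u assume "u \<in> nbrs E W"
    then obtain w where w: "w \<in> W" "{w, u} \<in> E" "u \<notin> W" by (auto simp: nbrs_def)
    have "(- d) \<bullet> f u = (- d) \<bullet> f w"
      by (rule average[of w]) (use w Wint nodown W in auto)
    then have lu: "d \<bullet> f u = t" using W[OF w(1)] by simp
    have "{w, u} = {x, y}"
    proof (rule ccontr)
      assume "{w, u} \<noteq> {x, y}"
      then have "(w, u) \<in> steps D" using w lu W[OF w(1)] by (auto simp: D)
      then have "u \<in> W" using w(1) unfolding W_def by (auto intro: rtrancl_into_rtrancl)
      then show False using w by simp
    qed
    moreover have "x \<in> W" by (simp add: W_def)
    ultimately show "u \<in> {y}" using w(3) by (auto simp: doubleton_eq_iff)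
  qed
  moreover have "W \<noteq> {}" by (auto simp: W_def)
  ultimately show False using cut_at_least_two[OF Wint] by blast
qed

text \<open>The ends of the edge are joined by a detour at or below the level, which closes the edge
  to a Jordan curve with \<open>F1\<close> and \<open>F2\<close> on different sides. The connected
  set above the level would link both faces without meeting the curve.\<close>

lemma not_both_above:
  assumes d: "d \<noteq> 0" and e: "{u, v} \<in> E" "d \<bullet> f u = t" "d \<bullet> f v = t" and z: "z \<in> ext" "d \<bullet> f z < t"
    and F: "face F1" "face F2" "F1 \<noteq> F2" "{u, v} \<in> FE F1" "{u, v} \<in> FE F2"
    and w: "w1 \<in> FV F1" "d \<bullet> f w1 > t" "w2 \<in> FV F2" "d \<bullet> f w2 > t"
  shows False
proof -
  define D0 where "D0 = {e \<in> E - {{u, v}}. \<forall>x\<in>e. d \<bullet> f x = t}"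
  define D where "D = {e \<in> E - {{u, v}}. \<forall>x\<in>e. d \<bullet> f x \<le> t}"
  have D0D: "D0 \<subseteq> D" by (auto simp: D0_def D_def)
  have up: "(x, w) \<in> (steps D)\<^sup>*" if "(x, w) \<in> (steps D0)\<^sup>*" for x w
    using steps_mono[OF D0D that] .
  have down: "{w, b} \<in> D" if "{w, b} \<in> E" "d \<bullet> f w = t" "d \<bullet> f b < t" for w b
    using that e by (auto simp: D_def doubleton_eq_iff)
  have "(v, u) \<in> (steps D)\<^sup>*"
  proof -
    have Dv: "D0 = {e \<in> E - {{v, u}}. \<forall>x\<in>e. d \<bullet> f x = t}" by (simp add: D0_def insert_commute)
    consider "(u, v) \<in> (steps D0)\<^sup>*" | "(v, u) \<in> (steps D0)\<^sup>*" |
      a b a' b' where "(u, a) \<in> (steps D0)\<^sup>*" "{a, b} \<in> E" "d \<bullet> f a = t" "d \<bullet> f b < t"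
        "(v, a') \<in> (steps D0)\<^sup>*" "{a', b'} \<in> E" "d \<bullet> f a' = t" "d \<bullet> f b' < t"
    proof -
      have e': "{v, u} \<in> E" using e(1) by (simp add: insert_commute)
      show ?thesis using low_detour[OF d e z D0_def] low_detour[OF d e' e(3,2) z Dv] that by blast
    qed
    then show ?thesis
    proof cases
      case 1 then show ?thesis using up steps_rtrancl_sym by metis
    next
      case 2 then show ?thesis using up by metis
    next
      \<comment> \<open>Each end reaches a vertex with a lower neighbour, and the connected set
        below the level joins these neighbours.\<close>
      case 3
      have bl: "b \<in> lower d t" "b' \<in> lower d t" using 3 edge_ends by (auto simp: lower_def)
      have "inner_edges E (lower d t) \<subseteq> D"
        using e by (auto simp: inner_edges_def lower_def D_def)
      moreover have "(b', b) \<in> (steps (inner_edges E (lower d t)))\<^sup>*"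
        using conn_lower[OF d, of t] bl by (simp add: conn_def)
      ultimately have bb: "(b', b) \<in> (steps D)\<^sup>*" by (rule steps_mono)
      have "(v, b') \<in> (steps D)\<^sup>*" using up[OF 3(5)] down[OF 3(6-8)] by (auto intro: rtrancl_into_rtrancl)
      moreover have "(u, b) \<in> (steps D)\<^sup>*" using up[OF 3(1)] down[OF 3(2-4)] by (auto intro: rtrancl_into_rtrancl)
      ultimately show ?thesis using bb steps_rtrancl_sym[of u b] rtrancl_trans by metis
    qed
  qed
  moreover have "D \<subseteq> E - {{u, v}}" by (auto simp: D_def)
  ultimately obtain j where j: "simple_path j" "pathfinish j = pathstart j" "P {u, v} \<subseteq> path_image j"
    "path_image j \<subseteq> P {u, v} \<union> (\<Union>e\<in>D. P e)" "connected (path_image j \<inter> without {u, v})"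
    using cycle_curve[OF e(1)] by metis
  define L where "L = {x \<in> V. d \<bullet> f x \<le> t}"
  have LV: "L \<subseteq> V" by (auto simp: L_def)
  have jL: "path_image j \<subseteq> img L"
  proof -
    have "insert {u, v} D \<subseteq> inner_edges E L"
    proof
      fix e' assume e': "e' \<in> insert {u, v} D"
      then have "e' \<in> E" "\<forall>x\<in>e'. d \<bullet> f x \<le> t" using e by (auto simp: D_def)
      then show "e' \<in> inner_edges E L" using edge_subset[of e'] by (auto simp: inner_edges_def L_def)
    qed
    then have s: "P e' \<subseteq> img L" if "e' \<in> insert {u, v} D" for e' using that unfolding img_def by blast
    have "P {u, v} \<subseteq> img L" by (rule s) simp
    moreover have "(\<Union>e\<in>D. P e) \<subseteq> img L" by (rule UN_least, rule s) simp
    ultimately show ?thesis using j(4) by (meson Un_least order_trans)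
  qed
  have jX: "path_image j \<subseteq> X" using jL img_subset_X[OF LV] by blast
  have disj: "img L \<inter> img (upper d t) = {}"
    by (rule img_disjoint) (auto simp: L_def upper_def)
  have wu: "w1 \<in> upper d t" "w2 \<in> upper d t" using w by (auto simp: upper_def bd_vertices_def)
  define C where "C = insert (pos w1) F1 \<union> img (upper d t) \<union> insert (pos w2) F2"
  have pw: "pos w1 \<in> img (upper d t)" "pos w2 \<in> img (upper d t)" using wu by (auto simp: img_def)
  have "connected C" unfolding C_def
  proof (intro connected_Un)
    show "connected (insert (pos w1) F1)" "connected (insert (pos w2) F2)"
      using connected_insert_closure[OF face_connected[OF F(1)]] connected_insert_closure[OF face_connected[OF F(2)]]
        FV_iff[OF F(1)] FV_iff[OF F(2)] w by blast+
    show "connected (img (upper d t))"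
      using path_connected_img[OF conn_upper[OF d] upper_subset] path_connected_imp_connected by blast
  qed (use pw in auto)
  moreover have "C \<inter> path_image j = {}"
    using jL jX disj pw face_disjoint_X[OF F(1)] face_disjoint_X[OF F(2)] by (auto simp: C_def)
  ultimately have cc: "connected_component (- path_image j) x y" if "x \<in> F1 \<union> F2" "y \<in> F1 \<union> F2" for x y
    using that unfolding connected_component_def C_def by (intro exI[of _ C]) (auto simp: C_def)
  show False
  proof (rule two_faces_of_edge[OF e(1) j(1-3) jX j(5)])
    fix G1 G2
    assume G: "face G1" "face G2" "G1 \<noteq> G2" "\<And>F. face F \<Longrightarrow> ({u, v} \<in> FE F) = (F = G1 \<or> F = G2)"
      and sep: "\<And>x y. x \<in> G1 \<Longrightarrow> y \<in> G2 \<Longrightarrow> \<not> connected_component (- path_image j) x y"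
    have "F1 = G1 \<or> F1 = G2" "F2 = G1 \<or> F2 = G2" using G(4)[OF F(1)] G(4)[OF F(2)] F(4,5) by auto
    then have sub: "G1 \<subseteq> F1 \<union> F2" "G2 \<subseteq> F1 \<union> F2" using F(3) by blast+
    obtain x y where xy: "x \<in> G1" "y \<in> G2" using face_nonempty[OF G(1)] face_nonempty[OF G(2)] by blast
    show False using sep[OF xy] cc[of x y] xy sub by blast
  qed
qed

lemma inner_edge_not_top:
  assumes d: "d \<noteq> 0" and e: "{u, v} \<in> E" "{u, v} \<notin> FE Fo" "d \<bullet> f u = d \<bullet> f v"
  shows "\<exists>z\<in>ext. d \<bullet> f z > d \<bullet> f u"
proof -
  have uv: "u \<in> V" "v \<in> V" "u \<noteq> v" using edge_ends e by auto
  consider "u \<notin> ext" | "v \<notin> ext" | "u \<in> ext" "v \<in> ext" by blast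
  then show ?thesis
  proof cases
    case 1 then show ?thesis using internal_not_top[OF _ d] uv by blast
  next
    case 2 then show ?thesis using internal_not_top[OF _ d, of v] uv e by auto
  next
    case 3
    show ?thesis
    proof (rule ccontr)
      assume "\<not> ?thesis"
      then have top: "top_corner d u" using 3 by (auto simp: top_corner_def not_less)
      show False using top_corners_adjacent[OF d top 3(2)] e uv by auto
    qed
  qed
qed

text \<open>\<open>not_both_above\<close> for \<open>d\<close> and for \<open>- d\<close> leaves
  only opposite sides, because neither face is flat.\<close>

lemma opposite_sides:
  assumes d: "d \<noteq> 0" and e: "{u, v} \<in> E" "d \<bullet> f u = t" "d \<bullet> f v = t"
    and F: "face F1" "face F2" "F1 \<noteq> F2" "{u, v} \<in> FE F1" "{u, v} \<in> FE F2" "F1 \<noteq> Fo" "F2 \<noteq> Fo"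
  shows "(\<forall>w\<in>FV F1. d \<bullet> f w \<ge> t) \<and> (\<forall>w\<in>FV F2. d \<bullet> f w \<le> t) \<or> (\<forall>w\<in>FV F1. d \<bullet> f w \<le> t) \<and> (\<forall>w\<in>FV F2. d \<bullet> f w \<ge> t)"
proof -
  have eo: "{u, v} \<notin> FE Fo" using three_faces_False[OF F(1,2) face_Fo F(4,5) _ F(3,6,7)] by blast
  obtain zu where zu: "zu \<in> ext" "d \<bullet> f zu > t" using inner_edge_not_top[OF d e(1) eo] e by auto
  have "(- d) \<bullet> f u = (- d) \<bullet> f v" "- d \<noteq> 0" using e d by auto
  then obtain zl where zl: "zl \<in> ext" "d \<bullet> f zl < t" using inner_edge_not_top[of "- d", OF _ e(1) eo] e by auto
  have up: "\<not> (d \<bullet> f w1 > t \<and> d \<bullet> f w2 > t)" if "w1 \<in> FV F1" "w2 \<in> FV F2" for w1 w2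
    using not_both_above[OF d e zl F(1-5) that(1) _ that(2)] by blast
  have down: "\<not> (d \<bullet> f w1 < t \<and> d \<bullet> f w2 < t)" if "w1 \<in> FV F1" "w2 \<in> FV F2" for w1 w2
    using not_both_above[of "- d" u v "- t" zu, OF _ e(1) _ _ zu(1) _ F(1-5) that(1) _ that(2)] e zu d by auto
  obtain p1 where p1: "p1 \<in> FV F1" "d \<bullet> f p1 \<noteq> t" using face_not_flat[OF F(1,6) d] by blast
  obtain p2 where p2: "p2 \<in> FV F2" "d \<bullet> f p2 \<noteq> t" using face_not_flat[OF F(2,7) d] by blast
  show ?thesis
  proof (cases "d \<bullet> f p1 > t")
    case True
    then have "d \<bullet> f w \<le> t" if "w \<in> FV F2" for w using up[OF p1(1) that] by auto
    moreover from this have "d \<bullet> f p2 < t" using p2 by force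
    then have "d \<bullet> f w \<ge> t" if "w \<in> FV F1" for w using down[OF that p2(1)] by auto
    ultimately show ?thesis by blast
  next
    case False
    then have "d \<bullet> f p1 < t" using p1 by simp
    then have "d \<bullet> f w \<ge> t" if "w \<in> FV F2" for w using down[OF p1(1) that] by auto
    moreover from this have "d \<bullet> f p2 > t" using p2 by force
    then have "d \<bullet> f w \<le> t" if "w \<in> FV F1" for w using up[OF that p2(1)] by auto
    ultimately show ?thesis by blast
  qed
qed

text \<open>A collapsed edge is level in every direction, so \<open>not_both_above\<close> is
  violated as soon as one direction has a vertex of each face above the edge.\<close>

lemma edge_nondegenerate:
  assumes e: "{u, v} \<in> E"
  shows "f u \<noteq> f v"
proof
  assume eq: "f u = f v"
  have uv: "u \<noteq> v" using edge_ends e by blast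
  obtain F1 F2 where F: "face F1" "face F2" "F1 \<noteq> F2" "\<forall>F. face F \<longrightarrow> ({u, v} \<in> FE F \<longleftrightarrow> F = F1 \<or> F = F2)"
    using edge_two_faces[OF e] by metis
  have eF: "{u, v} \<in> FE F1" "{u, v} \<in> FE F2" using F by auto
  have eo: "{u, v} \<notin> FE Fo"
  proof
    assume "{u, v} \<in> FE Fo"
    then have "u \<in> ext" "v \<in> ext" using FE_subset_FV[OF face_Fo] by (auto simp: ext_eq)
    then show False using inj_ext eq uv by (auto simp: inj_on_def)
  qed
  then have Fne: "F1 \<noteq> Fo" "F2 \<noteq> Fo" using eF by auto
  have "axis 1 1 \<noteq> (0 :: real^2)" by (simp add: axis_eq_0_iff)
  then obtain s where "s \<in> FV F2" "axis 1 1 \<bullet> f s \<noteq> axis 1 1 \<bullet> f u" using face_not_flat[OF F(2) Fne(2)] by metis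
  then have s: "s \<in> FV F2" "f s \<noteq> f u" by auto
  \<comment> \<open>As \<open>n\<close> is orthogonal to \<open>f s - f u\<close>, a vertex
    \<open>q\<close> of \<open>F1\<close> off that line gives a second, independent vector, and some
    \<open>d\<close> is positive on both.\<close>
  obtain n where n: "n \<bullet> (f s - f u) = 0" "n \<noteq> 0" using perpendicular_exists by blast
  obtain q where q: "q \<in> FV F1" "n \<bullet> f q \<noteq> n \<bullet> f u" using face_not_flat[OF F(1) Fne(1) n(2)] by blast
  have "f s - f u \<noteq> 0" "n \<bullet> (f q - f u) \<noteq> 0" using s q by (auto simp: inner_diff_right)
  then obtain d where d: "d \<bullet> (f s - f u) > 0" "d \<bullet> (f q - f u) > 0" using two_positive_direction[OF _ n(1)] by metis
  have d0: "d \<noteq> 0" using d by auto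
  have "(- d) \<bullet> f u = (- d) \<bullet> f v" "- d \<noteq> 0" using eq d0 by auto
  then obtain zl where zl: "zl \<in> ext" "d \<bullet> f zl < d \<bullet> f u" using inner_edge_not_top[of "- d", OF _ e eo] by auto
  show False
    using not_both_above[OF d0 e refl _ zl F(1-3) eF q(1) _ s(1)] d eq by (auto simp: inner_diff_right)
qed

end

section \<open>Convex embeddability implies that the map is an embedding\<close>

lemma cycle_list_edge_mod:
  assumes "cycle_list VS ES ws"
  shows "{ws ! (k mod length ws), ws ! (Suc k mod length ws)} \<in> ES"
proof -
  have "0 < length ws" using assms by (auto simp: cycle_list_def)
  then have k: "k mod length ws < length ws" "(k mod length ws + 1) mod length ws = Suc k mod length ws"
    by (simp_all add: mod_simps)
  have ES: "ES = {{ws ! i, ws ! ((i + 1) mod length ws)} | i. i < length ws}"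
    using assms by (simp add: cycle_list_def)
  show ?thesis unfolding ES mem_Collect_eq
    by (rule exI[of _ "k mod length ws"], unfold k(2)) (intro conjI refl k(1))
qed

lemma cycle_list_edge_inj:
  assumes c: "cycle_list VS ES ws" and k: "k < k'" "k' < length ws"
  shows "{ws ! (k mod length ws), ws ! (Suc k mod length ws)} \<noteq> {ws ! (k' mod length ws), ws ! (Suc k' mod length ws)}"
proof
  let ?n = "length ws"
  assume eq: "{ws ! (k mod ?n), ws ! (Suc k mod ?n)} = {ws ! (k' mod ?n), ws ! (Suc k' mod ?n)}"
  have n: "?n \<ge> 3" and d: "distinct ws" using c by (auto simp: cycle_list_def)
  then have n0: "0 < ?n" by linarith
  have inj: "ws ! (i mod ?n) = ws ! (j mod ?n) \<Longrightarrow> i mod ?n = j mod ?n" for i j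
    using nth_eq_iff_index_eq[OF d, of "i mod ?n" "j mod ?n"] n0 by simp
  have "k mod ?n = k" "k' mod ?n = k'" "Suc k mod ?n = Suc k" using k by auto
  then have "k = k' \<or> k = Suc k' mod ?n \<and> Suc k = k'"
    using eq inj[of k k'] inj[of k "Suc k'"] inj[of "Suc k" k'] by (auto simp: doubleton_eq_iff)
  then have *: "k = Suc k' mod ?n" "Suc k = k'" using k by auto
  show False
  proof (cases "Suc k' < ?n")
    case True then show ?thesis using * by simp
  next
    case False
    then have "Suc k' = ?n" using k by simp
    then show ?thesis using * n by simp
  qed
qed

lemma cycle_list_connected:
  assumes c: "simple_cycle VS ES" and uv: "u \<in> VS" "v \<in> VS"
  shows "(u, v) \<in> (steps ES)\<^sup>*"
proof -
  obtain ws where ws: "cycle_list VS ES ws" "ws ! 0 = u" using simple_cycle_start[OF c uv(1)] .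
  obtain i where i: "i < length ws" "ws ! i = v"
    using ws(1) uv(2) by (metis cycle_list_def in_set_conv_nth)
  have "(ws ! 0, ws ! i) \<in> (steps ES)\<^sup>*"
    by (rule nth_steps) (use cycle_list_edge[OF ws(1)] i in auto)
  then show ?thesis using ws i by simp
qed

lemma rtrancl_switch:
  assumes "(x, y) \<in> r\<^sup>*" "Q x" "\<not> Q y"
  shows "\<exists>u v. (u, v) \<in> r \<and> Q u \<and> \<not> Q v"
  using assms by (induction rule: rtrancl_induct) auto

lemma convex_combination_less:
  fixes a b :: real
  assumes "0 \<le> s" "s \<le> 1" "(1 - s) * a + s * b < t"
  shows "a < t \<or> b < t"
proof (rule ccontr)
  assume "\<not> ?thesis"
  then have "(1 - s) * a \<ge> (1 - s) * t" "s * b \<ge> s * t" using assms by (auto intro: mult_left_mono)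
  then have "(1 - s) * a + s * b \<ge> (1 - s) * t + s * t" by linarith
  also have "(1 - s) * t + s * t = t" by (simp add: algebra_simps)
  finally show False using assms by simp
qed

text \<open>The abstract picture of one level: \<open>U\<close> are the crossing edges with
  coordinate \<open>g\<close>, each member of \<open>Fs\<close> that meets the level spans an
  interval between two of them, and an inner edge has one interval on either side. Two overlapping
  intervals would force another overlap further right, which cannot go on in a finite set; so the
  intervals line up end to end.\<close>

lemma level_chain:
  fixes g :: "'e \<Rightarrow> real" and inc :: "'f \<Rightarrow> 'e set"
  assumes fin: "finite U" and inc: "\<And>F. F \<in> Fs \<Longrightarrow> inc F \<noteq> {} \<Longrightarrow> \<exists>x\<in>U. \<exists>y\<in>U. inc F = {x, y} \<and> g x < g y"
    and B: "B \<subseteq> {b1, b2}"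
    and inner: "\<And>e. e \<in> U \<Longrightarrow> e \<notin> B \<Longrightarrow> \<exists>F1 F2 e1 e2. (\<forall>F. F \<in> Fs \<and> e \<in> inc F \<longleftrightarrow> F = F1 \<or> F = F2)
        \<and> inc F1 = {e1, e} \<and> g e1 < g e \<and> inc F2 = {e, e2} \<and> g e < g e2"
    and outer: "\<And>e. e \<in> U \<Longrightarrow> e \<in> B \<Longrightarrow> \<exists>F1. \<forall>F. F \<in> Fs \<and> e \<in> inc F \<longleftrightarrow> F = F1"
  shows "inj_on g U"
    and "\<And>e e'. e \<in> U \<Longrightarrow> e' \<in> U \<Longrightarrow> g e < g e' \<Longrightarrow>
      (\<exists>F\<in>Fs. e \<in> inc F \<and> e' \<in> inc F) \<or> (\<exists>x\<in>U. g e < g x \<and> g x < g e')"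
proof -
  define right where "right e F x \<longleftrightarrow> F \<in> Fs \<and> inc F = {e, x} \<and> g e < g x" for e F x
  define left where "left e F x \<longleftrightarrow> F \<in> Fs \<and> inc F = {x, e} \<and> g x < g e" for e F x
  have inU: "e \<in> U" if FF: "F \<in> Fs" "e \<in> inc F" for F e
  proof -
    have "inc F \<noteq> {}" using FF(2) by blast
    then obtain x y where "x \<in> U" "y \<in> U" "inc F = {x, y}" using inc[OF FF(1)] by metis
    then show ?thesis using FF(2) by auto
  qed
  have rl: "right e F x \<longleftrightarrow> left x F e" for e F x by (auto simp: right_def left_def)
  have uniq: "F = F'" if "right e F x \<and> right e F' x' \<or> left e F x \<and> left e F' x'" for e F F' x x'
  proof -
    have m: "F \<in> Fs \<and> e \<in> inc F" "F' \<in> Fs \<and> e \<in> inc F'" using that by (auto simp: right_def left_def)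
    have eU: "e \<in> U" using inU m by blast
    show ?thesis
    proof (cases "e \<in> B")
      case True
      then obtain F1 where "\<forall>F. F \<in> Fs \<and> e \<in> inc F \<longleftrightarrow> F = F1" using outer[OF eU] by blast
      then show ?thesis using m by metis
    next
      case False
      then obtain F1 F2 e1 e2 where i: "\<forall>F. F \<in> Fs \<and> e \<in> inc F \<longleftrightarrow> F = F1 \<or> F = F2"
        "inc F1 = {e1, e}" "g e1 < g e" "inc F2 = {e, e2}" "g e < g e2" using inner[OF eU] by metis
      have F: "F = F1 \<or> F = F2" "F' = F1 \<or> F' = F2" using i(1) m by metis+
      have n1: "\<not> right e F1 y" for y using i(2,3) by (auto simp: right_def doubleton_eq_iff)
      have n2: "\<not> left e F2 y" for y using i(4,5) by (auto simp: left_def doubleton_eq_iff)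
      show ?thesis using that F n1 n2 by metis
    qed
  qed
  have one: "(\<exists>F x. right e F x) \<or> (\<exists>F x. left e F x)" if e: "e \<in> U" for e
  proof (cases "e \<in> B")
    case True
    then obtain F1 where "F1 \<in> Fs" "e \<in> inc F1" using outer[OF e] by metis
    then obtain x y where "inc F1 = {x, y}" "g x < g y" using inc[of F1] by blast
    then show ?thesis using \<open>F1 \<in> Fs\<close> \<open>e \<in> inc F1\<close> unfolding right_def left_def by (metis insertE singletonD)
  next
    case False
    then obtain F1 F2 e1 e2 where i: "\<forall>F. F \<in> Fs \<and> e \<in> inc F \<longleftrightarrow> F = F1 \<or> F = F2"
        "inc F2 = {e, e2}" "g e < g e2" using inner[OF e] by metis
    then have "right e F2 e2" using i(1)[THEN spec, of F2] by (auto simp: right_def)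
    then show ?thesis by blast
  qed
  have both: "(\<exists>F x. right e F x) \<and> (\<exists>F x. left e F x)" if e: "e \<in> U" "e \<notin> B" for e
  proof -
    obtain F1 F2 e1 e2 where i: "\<forall>F. F \<in> Fs \<and> e \<in> inc F \<longleftrightarrow> F = F1 \<or> F = F2"
        "inc F1 = {e1, e}" "g e1 < g e" "inc F2 = {e, e2}" "g e < g e2" using inner[OF e] by metis
    have "right e F2 e2" "left e F1 e1"
      using i i(1)[THEN spec, of F1] i(1)[THEN spec, of F2] by (auto simp: right_def left_def)
    then show ?thesis by blast
  qed
  have rU: "x \<in> U" if "right e F x \<or> left e F x" for e F x
    using that inU[of F x] by (auto simp: right_def left_def)
  have main: "inj_on g U \<and> (\<forall>e\<in>U. \<forall>e'\<in>U. g e < g e' \<longrightarrow>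
      (\<exists>F\<in>Fs. e \<in> inc F \<and> e' \<in> inc F) \<or> (\<exists>x\<in>U. g e < g x \<and> g x < g e'))"
  proof (cases "U = {}")
    case False
    obtain M where M: "M \<in> U" "\<And>x. x \<in> U \<Longrightarrow> g x \<le> g M" using finite_maximizer[OF fin False, of g] by blast
    obtain m where m: "m \<in> U" "\<And>x. x \<in> U \<Longrightarrow> g m \<le> g x"
      using finite_maximizer[OF fin False, of "\<lambda>x. - g x"] by auto
    have nM: "\<not> right e F x" if "g e = g M" for e F x
      using rU[of e F x] M(2)[of x] that by (auto simp: right_def)
    have nm: "\<not> left e F x" if "g e = g m" for e F x
      using rU[of e F x] m(2)[of x] that by (auto simp: left_def)
    \<comment> \<open>The extreme edges lack a neighbour on one side and thus belong to
      \<open>B\<close>, which leaves no room for further border edges.\<close>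
    have MB: "M \<in> B" "m \<in> B" using both[OF M(1)] both[OF m(1)] nM[OF refl] nm[OF refl] by blast+
    obtain F x where "left M F x" using one[OF M(1)] nM[OF refl] by blast
    then have "g x < g M" "x \<in> U" using rU by (auto simp: left_def)
    then have mM: "g m < g M" using m(2)[of x] by simp
    then have Bm: "e = m \<or> e = M" if "e \<in> B" for e using B MB that by auto
    have hasr: "\<exists>F x. right e F x" if "e \<in> U" "e \<noteq> M" for e
    proof (cases "e \<in> B")
      case True
      then have "e = m" using Bm that by blast
      then show ?thesis using one[OF that(1)] nm by blast
    qed (use both that in blast)
    have hasl: "\<exists>F x. left e F x" if "e \<in> U" "e \<noteq> m" for e
    proof (cases "e \<in> B")
      case True
      then have "e = M" using Bm that by blast
      then show ?thesis using one[OF that(1)] nM by blast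
    qed (use both that in blast)
    have uM: "e = M" if "e \<in> U" "g e = g M" for e using hasr[OF that(1)] nM[OF that(2)] by blast
    \<comment> \<open>The interval that ends first is replaced by its right neighbour, and both are
      replaced if they end together. The measure counts the edges beyond the earlier right
      end.\<close>
    have no: False
      if "right l F r" "right l' F' r'" "F \<noteq> F'" "max (g l) (g l') < min (g r) (g r')" for l l' r r' F F'
      using that
    proof (induction "card {x\<in>U. min (g r) (g r') < g x}" arbitrary: l l' r r' F F' rule: less_induct)
      case less
      have sub: "card {x\<in>U. b < g x} < card {x\<in>U. a < g x}" if "a < b" "y \<in> U" "g y = b" for a b y
      proof (rule psubset_card_mono)
        have "y \<in> {x\<in>U. a < g x}" "y \<notin> {x\<in>U. b < g x}" using that by auto
        moreover have "{x\<in>U. b < g x} \<subseteq> {x\<in>U. a < g x}" using that by auto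
        ultimately show "{x\<in>U. b < g x} \<subset> {x\<in>U. a < g x}" by blast
      qed (use fin in auto)
      have step: False
        if h: "right l F r" "right l' F' r'" "F \<noteq> F'" "max (g l) (g l') < min (g r) (g r')"
          and mn: "min (g r) (g r') = m0" "m0 = g r"
          and IH: "\<And>l l' r r' F F'. card {x\<in>U. min (g r) (g r') < g x} < card {x\<in>U. m0 < g x} \<Longrightarrow>
              right l F r \<Longrightarrow> right l' F' r' \<Longrightarrow> F \<noteq> F' \<Longrightarrow> max (g l) (g l') < min (g r) (g r') \<Longrightarrow> False"
        for l l' r r' F F' m0
      proof -
        have rrU: "r \<in> U" "r' \<in> U" using rU h by blast+
        have le: "g r \<le> g r'" using mn by auto
        have ne: "r \<noteq> r'" using h(1-3) uniq[of r F l F' l'] rl by blast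
        have "r \<noteq> M"
        proof
          assume "r = M"
          then have "g r' = g M" using le M(2)[OF rrU(2)] by simp
          then show False using uM[OF rrU(2)] ne \<open>r = M\<close> by simp
        qed
        then obtain G s where G: "right r G s" using hasr rrU by blast
        have rs: "g r < g s" "s \<in> U" using G rU by (auto simp: right_def)
        show False
        proof (cases "g r < g r'")
          case True
          have "G \<noteq> F'"
          proof
            assume "G = F'"
            then have "{r, s} = {l', r'}" using G h(2) by (auto simp: right_def)
            then have "r = l'" using ne by (auto simp: doubleton_eq_iff)
            then show False using h(4) by simp
          qed
          moreover have "max (g r) (g l') < min (g s) (g r')" using rs True h(4) by auto
          moreover have "\<exists>y\<in>U. g y = min (g s) (g r')" using rs rrU by (auto simp: min_def)
          then have "card {x\<in>U. min (g s) (g r') < g x} < card {x\<in>U. m0 < g x}"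
            using sub[of m0 "min (g s) (g r')"] rs True mn(2) by auto
          ultimately show False using IH[OF _ G h(2)] by blast
        next
          case False
          then have eq: "g r' = g r" using le by simp
          then have "r' \<noteq> M" using uM[OF rrU(1)] ne by auto
          then obtain G' s' where G': "right r' G' s'" using hasr rrU by blast
          have rs': "g r < g s'" "s' \<in> U" using G' rU[of r' G' s'] eq by (auto simp: right_def)
          have "G \<noteq> G'"
          proof
            assume "G = G'"
            then have "{r, s} = {r', s'}" using G G' by (auto simp: right_def)
            then have "r = s'" using ne by (auto simp: doubleton_eq_iff)
            then show False using rs' by simp
          qed
          moreover have "max (g r) (g r') < min (g s) (g s')" using rs rs' eq by auto
          moreover have "\<exists>y\<in>U. g y = min (g s) (g s')" using rs rs' by (auto simp: min_def)
          then have "card {x\<in>U. min (g s) (g s') < g x} < card {x\<in>U. m0 < g x}"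
            using sub[of m0 "min (g s) (g s')"] rs rs' mn(2) by auto
          ultimately show False using IH[OF _ G G'] by blast
        qed
      qed
      show False
      proof (cases "g r \<le> g r'")
        case True
        show ?thesis
          by (rule step[OF less.prems refl _ less.hyps]) (use True in auto)
      next
        case False
        have sw: "max (g l') (g l) < min (g r') (g r)" using less.prems(4) by (simp add: max.commute min.commute)
        have hy: "min (g r') (g r) = min (g r) (g r')" by (simp add: min.commute)
        show ?thesis
          by (rule step[OF less.prems(2,1) less.prems(3)[symmetric] sw hy _ less.hyps]) (use False in auto)
      qed
    qed
    have "inj_on g U"
    proof (rule inj_onI, rule ccontr)
      fix e e' assume e: "e \<in> U" "e' \<in> U" "g e = g e'" "e \<noteq> e'"
      then have "e \<noteq> M" "e' \<noteq> M" using uM[of e] uM[of e'] by auto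
      then obtain F x F' x' where r: "right e F x" "right e' F' x'" using hasr e by metis
      have "F \<noteq> F'" using r e(3,4) by (auto simp: right_def doubleton_eq_iff)
      then show False using no[OF r] r e(3) by (auto simp: right_def)
    qed
    moreover have "(\<exists>F\<in>Fs. e \<in> inc F \<and> e' \<in> inc F) \<or> (\<exists>x\<in>U. g e < g x \<and> g x < g e')"
      if e: "e \<in> U" "e' \<in> U" "g e < g e'" for e e'
    proof -
      have "e \<noteq> M" "e' \<noteq> m" using M(2)[OF e(2)] m(2)[OF e(1)] e(3) by auto
      then obtain F x F' x' where r: "right e F x" "left e' F' x'" using hasr[OF e(1)] hasl[OF e(2)] by metis
      show ?thesis
      proof (cases "F = F'")
        case True
        then have "e' \<in> inc F" "e \<in> inc F" "F \<in> Fs" using r by (auto simp: right_def left_def)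
        then show ?thesis by blast
      next
        case False
        have "right x' F' e'" using r(2) by (simp add: rl)
        then have "\<not> max (g e) (g x') < min (g x) (g e')" using no[OF r(1) _ False] by blast
        moreover have "g e < g x" "g x' < g e'" using r by (auto simp: right_def left_def)
        ultimately have "g x \<le> g x'" using e(3) by (auto simp: max_def min_def split: if_splits)
        then have "g e < g x" "g x < g e'" using \<open>g e < g x\<close> \<open>g x' < g e'\<close> by auto
        moreover have "x \<in> U" using rU r by blast
        ultimately show ?thesis by blast
      qed
    qed
    ultimately show ?thesis by blast
  qed auto
  then show "inj_on g U" by blast
  fix e e' assume "e \<in> U" "e' \<in> U" "g e < g e'"
  then show "(\<exists>F\<in>Fs. e \<in> inc F \<and> e' \<in> inc F) \<or> (\<exists>x\<in>U. g e < g x \<and> g x < g e')" using main by blast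
qed

lemma orthogonal_decomposition:
  fixes d n z :: "real^2"
  assumes "d \<noteq> 0" "n \<noteq> 0" "n \<bullet> d = 0"
  shows "z = ((d \<bullet> z) / (d \<bullet> d)) *\<^sub>R d + ((n \<bullet> z) / (n \<bullet> n)) *\<^sub>R n"
  by (rule plane_basis) (use assms in \<open>auto simp: inner_commute\<close>)

section \<open>Simplicity of the image polygons\<close>

context tutte
begin

text \<open>Two sides through \<open>p\<close> split the boundary into two runs of vertices. A
  direction in which each run has a vertex above \<open>p\<close> makes the boundary alternate low,
  high, low, high just above \<open>p\<close>, hence cross that level three times.\<close>

lemma polygon_from_start:
  assumes F: "face F" "F \<noteq> Fo" and ws: "cycle_list (FV F) (FE F) ws"
    and q: "\<And>k. q k = f (ws ! (k mod length ws))"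
    and j: "0 < j" "j < length ws"
    and s: "0 \<le> s" "s < 1" "p = (1 - s) *\<^sub>R q 0 + s *\<^sub>R q 1"
    and s': "0 \<le> s'" "s' < 1" "p = (1 - s') *\<^sub>R q j + s' *\<^sub>R q (Suc j)"
  shows False
proof -
  let ?n = "length ws"
  let ?e = "\<lambda>k. {ws ! (k mod ?n), ws ! (Suc k mod ?n)}"
  have n: "?n \<ge> 3" and set: "set ws = FV F" using ws by (auto simp: cycle_list_def)
  have eF: "?e k \<in> FE F" for k by (rule cycle_list_edge_mod[OF ws])
  have eE: "?e k \<in> E" for k using eF[of k] by (simp add: bd_edges_def)
  have qne: "q k \<noteq> q (Suc k)" for k using edge_nondegenerate[OF eE[of k]] by (simp add: q)
  have wsV: "ws ! (k mod ?n) \<in> V" for k using edge_ends[OF eE[of k]] by blast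
  have a: "q 1 - p = (1 - s) *\<^sub>R (q 1 - q 0)" "q (Suc j) - p = (1 - s') *\<^sub>R (q (Suc j) - q j)"
  proof -
    show "q 1 - p = (1 - s) *\<^sub>R (q 1 - q 0)" unfolding s(3) by (simp add: algebra_simps)
    show "q (Suc j) - p = (1 - s') *\<^sub>R (q (Suc j) - q j)" unfolding s'(3) by (simp add: algebra_simps)
  qed
  then have a0: "q 1 - p \<noteq> 0" "q (Suc j) - p \<noteq> 0" using qne[of 0] qne[of j] s(2) s'(2) by auto
  \<comment> \<open>\<open>q 1\<close> and \<open>q (Suc j)\<close> serve as witnesses unless they
    are collinear with \<open>p\<close>. Then \<open>face_not_flat\<close> supplies a vertex off
    that line, which replaces the witness of its own run.\<close>
  obtain d x y where d: "1 \<le> x" "x \<le> j" "Suc j \<le> y" "y \<le> ?n" "d \<bullet> (q x - p) > 0" "d \<bullet> (q y - p) > 0"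
  proof -
    obtain m where m: "m \<bullet> (q 1 - p) = 0" "m \<noteq> 0" using perpendicular_exists by blast
    show ?thesis
    proof (cases "m \<bullet> (q (Suc j) - p) = 0")
      case False
      then obtain d where "d \<bullet> (q 1 - p) > 0" "d \<bullet> (q (Suc j) - p) > 0"
        using two_positive_direction[OF a0(1) m(1)] by metis
      then show ?thesis using that[of 1 "Suc j" d] j by auto
    next
      case True
      obtain v where v: "v \<in> FV F" "m \<bullet> f v \<noteq> m \<bullet> p" using face_not_flat[OF F m(2)] by blast
      obtain k0 where k0: "k0 < ?n" "ws ! k0 = v" using v(1) set by (metis in_set_conv_nth)
      \<comment> \<open>The start vertex counts as the last vertex of the second run.\<close>
      define k where "k = (if k0 = 0 then ?n else k0)"
      have k: "1 \<le> k" "k \<le> ?n" "q k = f v" using k0 n by (auto simp: k_def q)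
      have mk: "m \<bullet> (q k - p) \<noteq> 0" using v(2) k(3) by (simp add: inner_diff_right)
      show ?thesis
      proof (cases "k \<le> j")
        case True
        obtain d where "d \<bullet> (q (Suc j) - p) > 0" "d \<bullet> (q k - p) > 0"
          using two_positive_direction[OF a0(2) \<open>m \<bullet> (q (Suc j) - p) = 0\<close> mk] by metis
        then show ?thesis using that[of k "Suc j" d] True k j by auto
      next
        case False
        obtain d where "d \<bullet> (q 1 - p) > 0" "d \<bullet> (q k - p) > 0"
          using two_positive_direction[OF a0(1) m(1) mk] by metis
        then show ?thesis using that[of 1 k d] False k j by auto
      qed
    qed
  qed
  have d0: "d \<noteq> 0" using d by auto
  have "d \<bullet> p < min (d \<bullet> q x) (d \<bullet> q y)" using d(5,6) by (auto simp: inner_diff_right)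
  moreover have "finite ((\<lambda>v. d \<bullet> f v) ` V)" using finite_V by simp
  ultimately obtain t where t: "d \<bullet> p < t" "t < min (d \<bullet> q x) (d \<bullet> q y)" "t \<notin> (\<lambda>v. d \<bullet> f v) ` V"
    using avoid_finite by metis
  have qt: "d \<bullet> q k \<noteq> t" for k using t(3) wsV[of k] by (auto simp: q)
  \<comment> \<open>\<open>p\<close> lies below the level and is an average of the two ends of its
    side, so one of these ends lies below as well.\<close>
  have low: "\<exists>r. (r = k \<or> r = Suc k) \<and> d \<bullet> q r < t" if "0 \<le> u" "u < 1" "p = (1 - u) *\<^sub>R q k + u *\<^sub>R q (Suc k)" for u k
  proof -
    have "(1 - u) * (d \<bullet> q k) + u * (d \<bullet> q (Suc k)) < t"
      using t(1) that(3) by (simp add: inner_add_right)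
    then have "d \<bullet> q k < t \<or> d \<bullet> q (Suc k) < t" using convex_combination_less[of u] that by auto
    then show ?thesis by blast
  qed
  obtain r1 where r1: "r1 = 0 \<or> r1 = 1" "d \<bullet> q r1 < t" using low[of s 0] s by auto
  obtain r2 where r2: "r2 = j \<or> r2 = Suc j" "d \<bullet> q r2 < t" using low[of s' j] s' by auto
  have xy: "\<not> d \<bullet> q x < t" "\<not> d \<bullet> q y < t" using t(2) by auto
  have "r1 \<noteq> x" "r2 \<noteq> x" "r2 \<noteq> y" using r1(2) r2(2) xy by auto
  then have ord: "r1 < x" "x < r2" "r2 < y" using r1(1) r2(1) d by auto
  obtain k1 where k1: "r1 \<le> k1" "k1 < x" "d \<bullet> q k1 < t" "\<not> d \<bullet> q (Suc k1) < t"
    using nat_last_true[of "\<lambda>i. d \<bullet> q i < t", OF r1(2) xy(1) ord(1)] by blast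
  have nn: "\<not> \<not> d \<bullet> q r2 < t" using r2 by simp
  obtain k2 where k2: "x \<le> k2" "k2 < r2" "\<not> d \<bullet> q k2 < t" "\<not> \<not> d \<bullet> q (Suc k2) < t"
    using nat_last_true[of "\<lambda>i. \<not> d \<bullet> q i < t", OF xy(1) nn ord(2)] by blast
  obtain k3 where k3: "r2 \<le> k3" "k3 < y" "d \<bullet> q k3 < t" "\<not> d \<bullet> q (Suc k3) < t"
    using nat_last_true[of "\<lambda>i. d \<bullet> q i < t", OF r2(2) xy(2) ord(3)] by blast
  have cr: "crosses d t (?e k)" if "d \<bullet> q k < t \<and> \<not> d \<bullet> q (Suc k) < t \<or> \<not> d \<bullet> q k < t \<and> d \<bullet> q (Suc k) < t" for k
    using that
  proof
    assume "d \<bullet> q k < t \<and> \<not> d \<bullet> q (Suc k) < t"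
    then show ?thesis unfolding crosses_def using qt[of "Suc k"]
      by (intro exI[of _ "ws ! (k mod ?n)"] exI[of _ "ws ! (Suc k mod ?n)"]) (auto simp: q)
  next
    assume "\<not> d \<bullet> q k < t \<and> d \<bullet> q (Suc k) < t"
    then show ?thesis unfolding crosses_def using qt[of k]
      by (intro exI[of _ "ws ! (Suc k mod ?n)"] exI[of _ "ws ! (k mod ?n)"]) (auto simp: q)
  qed
  have lt: "k1 < k2" "k1 < k3" "k2 < k3" "k2 < ?n" "k3 < ?n" using k1 k2 k3 d by auto
  show False
    by (rule no_three_crossing[OF d0 F(1) eF[of k1] eF[of k2] eF[of k3]])
      (use cr k1 k2 k3 cycle_list_edge_inj[OF ws lt(1,4)] cycle_list_edge_inj[OF ws lt(2,5)]
        cycle_list_edge_inj[OF ws lt(3,5)] in blast)+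
qed

text \<open>Each vertex belongs to the half-open side that it starts. Uniqueness of the side through
  a point then covers crossing sides, vertices on sides and repeated vertices alike.\<close>

definition on_halfopen :: "real^2 \<Rightarrow> real^2 \<Rightarrow> real^2 \<Rightarrow> bool" where
  "on_halfopen p a b \<longleftrightarrow> (\<exists>s. 0 \<le> s \<and> s < 1 \<and> p = (1 - s) *\<^sub>R a + s *\<^sub>R b)"

lemma on_halfopen_start [simp]: "on_halfopen a a b"
  unfolding on_halfopen_def by (rule exI[of _ 0]) simp

lemma on_halfopen_open_segment: "p \<in> open_segment a b \<Longrightarrow> on_halfopen p a b"
  unfolding on_halfopen_def in_segment by (metis less_eq_real_def)

lemma polygon_simple:
  assumes F: "face F" "F \<noteq> Fo" and ws: "cycle_list (FV F) (FE F) ws"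
    and ij: "i < length ws" "j < length ws"
    and i: "on_halfopen p (f (ws ! i)) (f (ws ! (Suc i mod length ws)))"
    and j: "on_halfopen p (f (ws ! j)) (f (ws ! (Suc j mod length ws)))"
  shows "i = j"
proof -
  have main: False
    if lt: "i < j" "j < length ws" and i: "on_halfopen p (f (ws ! i)) (f (ws ! (Suc i mod length ws)))"
      and j: "on_halfopen p (f (ws ! j)) (f (ws ! (Suc j mod length ws)))" for i j
  proof -
    let ?n = "length ws"
    have n: "0 < ?n" using lt by auto
    define us where "us = rotate i ws"
    have us: "cycle_list (FV F) (FE F) us" "length us = ?n"
      unfolding us_def using cycle_list_rotate[OF ws] by auto
    define q where "q k = f (us ! (k mod length us))" for k
    have qk: "q k = f (ws ! ((i + k) mod ?n))" for k
    proof -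
      have "us ! (k mod ?n) = ws ! ((i + k mod ?n) mod ?n)"
        using nth_rotate[of "k mod ?n" ws i] n by (simp add: us_def)
      then show ?thesis using us(2) by (simp add: q_def mod_simps)
    qed
    obtain s where s: "0 \<le> s" "s < 1" "p = (1 - s) *\<^sub>R q 0 + s *\<^sub>R q 1"
      using i lt unfolding on_halfopen_def by (auto simp: qk)
    obtain s' where s': "0 \<le> s'" "s' < 1" "p = (1 - s') *\<^sub>R q (j - i) + s' *\<^sub>R q (Suc (j - i))"
      using j lt unfolding on_halfopen_def by (auto simp: qk)
    show False
      by (rule polygon_from_start[OF F us(1) q_def _ _ s s']) (use lt us in auto)
  qed
  show ?thesis
  proof (rule ccontr)
    assume "i \<noteq> j"
    then consider "i < j" | "j < i" by linarith
    then show False using main[of i j] main[of j i] ij i j by cases auto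
  qed
qed

lemma face_polygon_simple:
  assumes F: "face F" "F \<noteq> Fo"
  shows "\<lbrakk>{a, b} \<in> FE F; {a', b'} \<in> FE F; p \<in> open_segment (f a) (f b); p \<in> open_segment (f a') (f b')\<rbrakk>
      \<Longrightarrow> {a, b} = {a', b'}"
    and "\<lbrakk>v \<in> FV F; {a, b} \<in> FE F\<rbrakk> \<Longrightarrow> f v \<notin> open_segment (f a) (f b)"
    and "\<lbrakk>v \<in> FV F; w \<in> FV F; f v = f w\<rbrakk> \<Longrightarrow> v = w"
proof -
  obtain ws where ws: "cycle_list (FV F) (FE F) ws" using face_cycle[OF F(1)] by (auto simp: simple_cycle_def)
  have vx: "\<exists>k<length ws. v = ws ! k" if "v \<in> FV F" for v
    using ws that by (metis cycle_list_def in_set_conv_nth)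
  have ed: "\<exists>k<length ws. {a, b} = {ws ! k, ws ! (Suc k mod length ws)}" if "{a, b} \<in> FE F" for a b
    using ws that unfolding cycle_list_def by auto
  have hs: "on_halfopen p (f (ws ! k)) (f (ws ! (Suc k mod length ws)))" "p \<in> open_segment (f (ws ! k)) (f (ws ! (Suc k mod length ws)))"
    if "p \<in> open_segment (f a) (f b)" "{a, b} = {ws ! k, ws ! (Suc k mod length ws)}" for p a b k
  proof -
    have eq: "open_segment (f a) (f b) = open_segment (f (ws ! k)) (f (ws ! (Suc k mod length ws)))"
    proof -
      have "a = ws ! k \<and> b = ws ! (Suc k mod length ws) \<or> a = ws ! (Suc k mod length ws) \<and> b = ws ! k"
        using that(2) by (simp add: doubleton_eq_iff)
      then show ?thesis by (elim disjE) (simp_all add: open_segment_commute)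
    qed
    show "p \<in> open_segment (f (ws ! k)) (f (ws ! (Suc k mod length ws)))" using that(1) unfolding eq .
    then show "on_halfopen p (f (ws ! k)) (f (ws ! (Suc k mod length ws)))" by (rule on_halfopen_open_segment)
  qed
  show "{a, b} = {a', b'}" if h: "{a, b} \<in> FE F" "{a', b'} \<in> FE F" "p \<in> open_segment (f a) (f b)" "p \<in> open_segment (f a') (f b')"
  proof -
    obtain k where k: "k < length ws" "{a, b} = {ws ! k, ws ! (Suc k mod length ws)}" using ed[OF h(1)] by metis
    obtain k' where k': "k' < length ws" "{a', b'} = {ws ! k', ws ! (Suc k' mod length ws)}" using ed[OF h(2)] by metis
    have "k = k'" by (rule polygon_simple[OF F ws k(1) k'(1) hs(1)[OF h(3) k(2)] hs(1)[OF h(4) k'(2)]])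
    then show ?thesis using k k' by simp
  qed
  show "f v \<notin> open_segment (f a) (f b)" if h: "v \<in> FV F" "{a, b} \<in> FE F"
  proof
    assume o: "f v \<in> open_segment (f a) (f b)"
    obtain k where k: "k < length ws" "{a, b} = {ws ! k, ws ! (Suc k mod length ws)}" using ed[OF h(2)] by metis
    obtain k' where k': "k' < length ws" "v = ws ! k'" using vx[OF h(1)] by metis
    have "on_halfopen (f v) (f (ws ! k')) (f (ws ! (Suc k' mod length ws)))" using k' by simp
    then have "k = k'" using polygon_simple[OF F ws k(1) k'(1) hs(1)[OF o k(2)]] by blast
    then show False using hs(2)[OF o k(2)] k' by (simp add: open_segment_def)
  qed
  show "v = w" if h: "v \<in> FV F" "w \<in> FV F" "f v = f w"
  proof -
    obtain k where k: "k < length ws" "v = ws ! k" using vx[OF h(1)] by metis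
    obtain k' where k': "k' < length ws" "w = ws ! k'" using vx[OF h(2)] by metis
    have "on_halfopen (f v) (f (ws ! k)) (f (ws ! (Suc k mod length ws)))" using k by simp
    moreover have "on_halfopen (f v) (f (ws ! k')) (f (ws ! (Suc k' mod length ws)))" using k' h(3) by simp
    ultimately have "k = k'" using polygon_simple[OF F ws k(1) k'(1)] by blast
    then show ?thesis using k k' by simp
  qed
qed

section \<open>Edges crossing a level\<close>

lemma crossing_pair:
  assumes d: "d \<noteq> 0" and F: "face F" and t: "\<And>v. v \<in> V \<Longrightarrow> d \<bullet> f v \<noteq> t" and e: "e \<in> FE F" "crosses d t e"
  shows "\<exists>e'. e' \<noteq> e \<and> FE F \<inter> {e\<in>E. crosses d t e} = {e, e'}"
proof -
  obtain x y where xy: "e = {x, y}" "d \<bullet> f x < t" "t < d \<bullet> f y" using e(2) by (auto simp: crosses_def)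
  \<comment> \<open>Without \<open>e\<close> the boundary still joins the two ends of
    \<open>e\<close> and so crosses the level once more; a third crossing is excluded.\<close>
  have "(x, y) \<in> (steps (FE F - {e}))\<^sup>*" using cycle_minus_edge[OF face_cycle[OF F]] e(1) xy(1) by simp
  then obtain u v where uv: "(u, v) \<in> steps (FE F - {e})" "d \<bullet> f u < t" "\<not> d \<bullet> f v < t"
    using rtrancl_switch[of x y _ "\<lambda>z. d \<bullet> f z < t"] xy(2,3) by (metis not_less_iff_gr_or_eq)
  have uvE: "{u, v} \<in> FE F" "{u, v} \<noteq> e" using uv(1) by auto
  then have "v \<in> V" using edge_ends[of u v] by (auto simp: bd_edges_def)
  then have "crosses d t {u, v}" using uv(2,3) t[of v] unfolding crosses_def by force
  then have "e'' = e \<or> e'' = {u, v}" if "e'' \<in> FE F" "crosses d t e''" for e''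
    using no_three_crossing[OF d F e(1) uvE(1) that(1) e(2) _ that(2)] uvE(2) by metis
  moreover have "e \<in> E" "{u, v} \<in> E" using e uvE by (auto simp: bd_edges_def)
  ultimately have "FE F \<inter> {e\<in>E. crosses d t e} = {e, {u, v}}"
    using e uvE \<open>crosses d t {u, v}\<close> by auto
  then show ?thesis using uvE(2) by (intro exI[of _ "{u, v}"] conjI)
qed

text \<open>Edges are unordered pairs, so the lower end has to be selected; for an edge that crosses
  the level the choice is forced.\<close>

definition lo :: "real^2 \<Rightarrow> real \<Rightarrow> 'v set \<Rightarrow> 'v" where
  "lo d t e = (SOME x. x \<in> e \<and> d \<bullet> f x < t)"

definition hi :: "real^2 \<Rightarrow> real \<Rightarrow> 'v set \<Rightarrow> 'v" where
  "hi d t e = (SOME x. x \<in> e \<and> t < d \<bullet> f x)"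

lemma lo_hi_eq:
  assumes "e = {x, y}" "d \<bullet> f x < t" "t < d \<bullet> f y"
  shows "lo d t e = x" "hi d t e = y"
  unfolding lo_def hi_def using assms by (intro some_equality; auto)+

text \<open>The point where the line through \<open>f x\<close> and \<open>f y\<close> meets the
  level line, by linear interpolation.\<close>

definition at_level :: "real^2 \<Rightarrow> real \<Rightarrow> 'v \<Rightarrow> 'v \<Rightarrow> real^2" where
  "at_level d t x y = f x + ((t - d \<bullet> f x) / (d \<bullet> f y - d \<bullet> f x)) *\<^sub>R (f y - f x)"

lemma at_level_level: "d \<bullet> f x < d \<bullet> f y \<Longrightarrow> d \<bullet> at_level d t x y = t"
  by (simp add: at_level_def inner_add_right inner_diff_right)

lemma at_level_open_segment:
  assumes "d \<bullet> f x < t" "t < d \<bullet> f y"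
  shows "at_level d t x y \<in> open_segment (f x) (f y)"
proof -
  define u where "u = (t - d \<bullet> f x) / (d \<bullet> f y - d \<bullet> f x)"
  have "0 < u" "u < 1" using assms by (auto simp: u_def field_simps)
  moreover have "at_level d t x y = (1 - u) *\<^sub>R f x + u *\<^sub>R f y"
    by (simp add: at_level_def u_def[symmetric] algebra_simps)
  moreover have "f x \<noteq> f y" using assms by auto
  ultimately show ?thesis unfolding in_segment by blast
qed

lemma at_level_bound:
  assumes "d \<bullet> f x < t" "t < d \<bullet> f y" "m \<bullet> f x \<ge> \<tau>" "m \<bullet> f y \<ge> \<tau>"
  shows "m \<bullet> at_level d t x y \<ge> \<tau>"
proof -
  define u where "u = (t - d \<bullet> f x) / (d \<bullet> f y - d \<bullet> f x)"
  have u: "0 \<le> u" "u \<le> 1" using assms by (auto simp: u_def field_simps)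
  have "m \<bullet> at_level d t x y = (1 - u) * (m \<bullet> f x) + u * (m \<bullet> f y)"
    by (simp add: at_level_def u_def[symmetric] inner_add_right inner_diff_right algebra_simps)
  also have "\<dots> \<ge> (1 - u) * \<tau> + u * \<tau>" using u assms by (intro add_mono mult_left_mono) auto
  finally show ?thesis by (simp add: algebra_simps)
qed

text \<open>Verifies the picture of \<open>level_chain\<close> with \<open>g\<close> as coordinate
  along the level: \<open>crossing_pair\<close> gives each bounded face on the level two crossing
  edges, and \<open>opposite_sides\<close> puts the two faces of an inner edge on different sides of
  it.\<close>

lemma level_structure:
  fixes d n t
  defines "U \<equiv> {e\<in>E. crosses d t e}" and "g \<equiv> \<lambda>e. n \<bullet> at_level d t (lo d t e) (hi d t e)"
  assumes d: "d \<noteq> 0" and n: "n \<bullet> d = 0" "n \<noteq> 0" and t: "\<And>v. v \<in> V \<Longrightarrow> d \<bullet> f v \<noteq> t"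
    and z: "zu \<in> ext" "d \<bullet> f zu > t" "zl \<in> ext" "d \<bullet> f zl < t"
  shows "inj_on g U"
    and "\<And>e e'. e \<in> U \<Longrightarrow> e' \<in> U \<Longrightarrow> g e < g e' \<Longrightarrow>
      (\<exists>F. face F \<and> F \<noteq> Fo \<and> e \<in> FE F \<and> e' \<in> FE F) \<or> (\<exists>x\<in>U. g e < g x \<and> g x < g e')"
proof -
  define Fs where "Fs = {F. face F \<and> F \<noteq> Fo}"
  define inc where "inc F = FE F \<inter> U" for F
  define B where "B = FE Fo \<inter> U"
  define pt where "pt e = at_level d t (lo d t e) (hi d t e)" for e
  have gpt: "g e = n \<bullet> pt e" for e by (simp add: g_def pt_def)
  have Ue: "\<exists>x y. e = {x, y} \<and> d \<bullet> f x < t \<and> t < d \<bullet> f y \<and> lo d t e = x \<and> hi d t e = y \<and> {x, y} \<in> E" if "e \<in> U" for e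
  proof -
    obtain x y where "e = {x, y}" "d \<bullet> f x < t" "t < d \<bullet> f y" using \<open>e \<in> U\<close> by (auto simp: U_def crosses_def)
    then show ?thesis using lo_hi_eq[of e x y d t] \<open>e \<in> U\<close> by (auto simp: U_def)
  qed
  have lev: "d \<bullet> pt e = t" if "e \<in> U" for e
    using Ue[OF that] at_level_level[of d] unfolding pt_def by (metis less_trans)
  have diff: "pt e' - pt e = ((g e' - g e) / (n \<bullet> n)) *\<^sub>R n" if "e \<in> U" "e' \<in> U" for e e'
    using orthogonal_decomposition[OF d n(2,1), of "pt e' - pt e"] lev[OF that(1)] lev[OF that(2)]
    by (simp add: inner_diff_right gpt)
  have pair: "\<exists>e'. e' \<noteq> e \<and> inc F = {e, e'}" if "face F" "e \<in> inc F" for F e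
    using crossing_pair[OF d that(1) t, of e] that(2) unfolding inc_def U_def by blast
  \<comment> \<open>Equal coordinates on one level mean equal points, which a simple polygon forbids
    for two of its sides.\<close>
  have gne: "g e \<noteq> g e'" if F: "F \<in> Fs" "e \<in> inc F" "e' \<in> inc F" "e \<noteq> e'" for F e e'
  proof
    assume eq: "g e = g e'"
    have eU: "e \<in> U" "e' \<in> U" using F by (auto simp: inc_def)
    then have pe: "pt e = pt e'" using diff[OF eU] eq by simp
    obtain x y where x: "e = {x, y}" "d \<bullet> f x < t" "t < d \<bullet> f y" "lo d t e = x" "hi d t e = y" using Ue[OF eU(1)] by metis
    obtain x' y' where x': "e' = {x', y'}" "d \<bullet> f x' < t" "t < d \<bullet> f y'" "lo d t e' = x'" "hi d t e' = y'" using Ue[OF eU(2)] by metis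
    have "pt e \<in> open_segment (f x) (f y)" using at_level_open_segment[OF x(2,3)] x(4,5) by (simp add: pt_def)
    moreover have "pt e \<in> open_segment (f x') (f y')" using at_level_open_segment[OF x'(2,3)] x'(4,5) pe by (simp add: pt_def)
    ultimately have "{x, y} = {x', y'}"
      using face_polygon_simple(1)[of F x y x' y'] F x(1) x'(1) by (auto simp: Fs_def inc_def)
    then show False using F(4) x(1) x'(1) by simp
  qed
  have inc2: "\<exists>x\<in>U. \<exists>y\<in>U. inc F = {x, y} \<and> g x < g y" if F: "F \<in> Fs" "inc F \<noteq> {}" for F
  proof -
    obtain e where e: "e \<in> inc F" using F(2) by blast
    obtain e' where e': "e' \<noteq> e" "inc F = {e, e'}" using pair[OF _ e] F(1) by (auto simp: Fs_def)
    have U: "e \<in> U" "e' \<in> U" using e' by (auto simp: inc_def)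
    have "g e \<noteq> g e'" using gne[OF F(1) e, of e'] e' by auto
    then consider "g e < g e'" | "g e' < g e" by linarith
    then show ?thesis
    proof cases
      case 1 then show ?thesis using U e' by blast
    next
      case 2 then show ?thesis using U e' by (metis insert_commute)
    qed
  qed
  have fin: "finite U" using finite_E by (simp add: U_def)
  obtain b1 b2 where b: "B = {b1, b2}"
  proof -
    have "(zl, zu) \<in> (steps (FE Fo))\<^sup>*" using cycle_list_connected[OF Fo_cycle] z by (simp add: ext_eq)
    then obtain u v where uv: "(u, v) \<in> steps (FE Fo)" "d \<bullet> f u < t" "\<not> d \<bullet> f v < t"
      using rtrancl_switch[of zl zu _ "\<lambda>z. d \<bullet> f z < t"] z(2,4) by (metis not_less_iff_gr_or_eq)
    then have e: "{u, v} \<in> FE Fo" by simp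
    then have E: "{u, v} \<in> E" by (simp add: bd_edges_def)
    then have "crosses d t {u, v}" using uv(2,3) t[of v] edge_ends[OF E] unfolding crosses_def by force
    then have "{u, v} \<in> inc Fo" using e E by (simp add: inc_def U_def)
    then obtain e' where "inc Fo = {{u, v}, e'}" using pair[OF face_Fo] by metis
    then show ?thesis using that[of "{u, v}" e'] by (simp add: B_def inc_def)
  qed
  have outer: "\<exists>F1. \<forall>F. F \<in> Fs \<and> e \<in> inc F \<longleftrightarrow> F = F1" if e: "e \<in> U" "e \<in> B" for e
  proof -
    have "e \<in> E" using e by (simp add: U_def)
    then obtain F1 F2 where F: "face F1" "face F2" "F1 \<noteq> F2" "\<forall>F. face F \<longrightarrow> (e \<in> FE F \<longleftrightarrow> F = F1 \<or> F = F2)"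
      using edge_two_faces by metis
    have "e \<in> FE Fo" using e by (simp add: B_def)
    then consider "F1 = Fo" | "F2 = Fo" using F(4)[THEN spec, THEN mp, OF face_Fo] by metis
    then show ?thesis
    proof cases
      case 1 then show ?thesis using F e(1) unfolding Fs_def inc_def by (intro exI[of _ F2]) auto
    next
      case 2 then show ?thesis using F e(1) unfolding Fs_def inc_def by (intro exI[of _ F1]) auto
    qed
  qed
  have inner: "\<exists>F1 F2 e1 e2. (\<forall>F. F \<in> Fs \<and> e \<in> inc F \<longleftrightarrow> F = F1 \<or> F = F2)
        \<and> inc F1 = {e1, e} \<and> g e1 < g e \<and> inc F2 = {e, e2} \<and> g e < g e2" if e: "e \<in> U" "e \<notin> B" for e
  proof -
    have eE: "e \<in> E" using e by (simp add: U_def)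
    obtain F1 F2 where F: "face F1" "face F2" "F1 \<noteq> F2" "\<forall>F. face F \<longrightarrow> (e \<in> FE F \<longleftrightarrow> F = F1 \<or> F = F2)"
      using edge_two_faces[OF eE] by metis
    have eo: "e \<notin> FE Fo" using e by (simp add: B_def)
    have eF: "e \<in> FE F1" "e \<in> FE F2" using F by auto
    have Fo: "F1 \<noteq> Fo" "F2 \<noteq> Fo" using eF eo by auto
    have all: "F \<in> Fs \<and> e \<in> inc F \<longleftrightarrow> F = F1 \<or> F = F2" for F
      using F Fo e(1) F(4)[THEN spec, of F] by (auto simp: Fs_def inc_def)
    have ei: "e \<in> inc F1" "e \<in> inc F2" "F1 \<in> Fs" "F2 \<in> Fs" using all by auto
    obtain e1 where e1: "e1 \<noteq> e" "inc F1 = {e, e1}" using pair[OF F(1) ei(1)] by metis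
    obtain e2 where e2: "e2 \<noteq> e" "inc F2 = {e, e2}" using pair[OF F(2) ei(2)] by metis
    have eU: "e1 \<in> U" "e2 \<in> U" "e1 \<in> FE F1" "e2 \<in> FE F2" using e1 e2 by (auto simp: inc_def)
    have ne: "g e1 \<noteq> g e" "g e2 \<noteq> g e" using gne[OF ei(3,1), of e1] gne[OF ei(4,2), of e2] e1 e2 by auto
    obtain x y where x: "e = {x, y}" "d \<bullet> f x < t" "t < d \<bullet> f y" "lo d t e = x" "hi d t e = y" "{x, y} \<in> E"
      using Ue[OF e(1)] by metis
    \<comment> \<open>The sides of \<open>e\<close> are told apart by a normal \<open>m\<close> of
      its image line. Since \<open>m \<bullet> n\<close> is nonzero, being on different sides means
      being left and right along the level.\<close>
    obtain m where m: "m \<bullet> (f y - f x) = 0" "m \<noteq> 0" using perpendicular_exists by blast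
    define \<tau> where "\<tau> = m \<bullet> f x"
    have my: "m \<bullet> f y = \<tau>" using m by (simp add: \<tau>_def inner_diff_right)
    have mpe: "m \<bullet> pt e = \<tau>" using my x by (simp add: pt_def at_level_def inner_add_right inner_diff_right \<tau>_def)
    have mn: "m \<bullet> n \<noteq> 0"
    proof
      assume "m \<bullet> n = 0"
      then have "m = ((d \<bullet> m) / (d \<bullet> d)) *\<^sub>R d"
        using orthogonal_decomposition[OF d n(2,1), of m] by (simp add: inner_commute)
      then obtain k where k: "m = k *\<^sub>R d" by blast
      then have "k * (d \<bullet> (f y - f x)) = 0" using m(1) by simp
      moreover have "d \<bullet> (f y - f x) > 0" using x by (simp add: inner_diff_right)
      ultimately show False using k m(2) by simp
    qed
    have nn: "n \<bullet> n > 0" using n by simp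
    have sgn: "m \<bullet> pt e' - \<tau> = ((g e' - g e) / (n \<bullet> n)) * (m \<bullet> n)" if "e' \<in> U" for e'
      using arg_cong[OF diff[OF e(1) that], of "\<lambda>v. m \<bullet> v"] mpe by (simp add: inner_diff_right)
    have bnd: "m' \<bullet> pt e' \<ge> \<tau>'" if "e' \<in> U" "e' \<in> FE F'" "face F'" "\<forall>w\<in>FV F'. m' \<bullet> f w \<ge> \<tau>'" for m' \<tau>' e' F'
    proof -
      obtain x' y' where x': "e' = {x', y'}" "d \<bullet> f x' < t" "t < d \<bullet> f y'" "lo d t e' = x'" "hi d t e' = y'"
        using Ue[OF \<open>e' \<in> U\<close>] by metis
      have "x' \<in> FV F'" "y' \<in> FV F'" using FE_subset_FV[OF that(3,2)] x'(1) by auto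
      then show ?thesis using at_level_bound[OF x'(2,3)] that(4) x'(4,5) by (simp add: pt_def)
    qed
    have dir: "(g e1 - g e) * (g e2 - g e) < 0"
    proof -
      have os: "(\<forall>w\<in>FV F1. m \<bullet> f w \<ge> \<tau>) \<and> (\<forall>w\<in>FV F2. m \<bullet> f w \<le> \<tau>) \<or> (\<forall>w\<in>FV F1. m \<bullet> f w \<le> \<tau>) \<and> (\<forall>w\<in>FV F2. m \<bullet> f w \<ge> \<tau>)"
        using opposite_sides[OF m(2) x(6) _ my F(1-3) _ _ Fo] eF x(1) by (simp add: \<tau>_def)
      have le: "m \<bullet> pt e' \<le> \<tau>" if "e' \<in> U" "e' \<in> FE F'" "face F'" "\<forall>w\<in>FV F'. m \<bullet> f w \<le> \<tau>" for e' F'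
        using bnd[OF that(1-3), of "- \<tau>" "- m"] that(4) by simp
      have "(m \<bullet> pt e1 - \<tau>) * (m \<bullet> pt e2 - \<tau>) \<le> 0"
        using os
      proof
        assume o: "(\<forall>w\<in>FV F1. m \<bullet> f w \<ge> \<tau>) \<and> (\<forall>w\<in>FV F2. m \<bullet> f w \<le> \<tau>)"
        then have "m \<bullet> pt e1 - \<tau> \<ge> 0" "m \<bullet> pt e2 - \<tau> \<le> 0"
          using bnd[OF eU(1,3) F(1), of \<tau> m] le[OF eU(2,4) F(2)] by auto
        then show ?thesis by (rule mult_nonneg_nonpos)
      next
        assume o: "(\<forall>w\<in>FV F1. m \<bullet> f w \<le> \<tau>) \<and> (\<forall>w\<in>FV F2. m \<bullet> f w \<ge> \<tau>)"
        then have "m \<bullet> pt e1 - \<tau> \<le> 0" "m \<bullet> pt e2 - \<tau> \<ge> 0"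
          using bnd[OF eU(2,4) F(2), of \<tau> m] le[OF eU(1,3) F(1)] by auto
        then show ?thesis by (rule mult_nonpos_nonneg)
      qed
      \<comment> \<open>Cancelling a positive square turns the statement about sides of the line
        into one about \<open>g\<close>.\<close>
      then have "((g e1 - g e) * (g e2 - g e)) * ((m \<bullet> n) / (n \<bullet> n))\<^sup>2 \<le> 0"
        using sgn[OF eU(1)] sgn[OF eU(2)] by (simp add: power2_eq_square mult_ac)
      moreover have "((m \<bullet> n) / (n \<bullet> n))\<^sup>2 > 0" using mn nn by simp
      ultimately have "(g e1 - g e) * (g e2 - g e) \<le> 0" by (simp add: mult_le_0_iff)
      moreover have "(g e1 - g e) * (g e2 - g e) \<noteq> 0" using ne by simp
      ultimately show ?thesis by linarith
    qed
    then consider "g e1 < g e" "g e < g e2" | "g e2 < g e" "g e < g e1" by (auto simp: mult_less_0_iff)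
    then show ?thesis
    proof cases
      case 1
      have "inc F1 = {e1, e}" using e1(2) by (simp add: insert_commute)
      then show ?thesis using all e2 1 by (intro exI[of _ F1] exI[of _ F2] exI[of _ e1] exI[of _ e2]) simp
    next
      case 2
      have "inc F2 = {e2, e}" using e2(2) by (simp add: insert_commute)
      moreover have "F \<in> Fs \<and> e \<in> inc F \<longleftrightarrow> F = F2 \<or> F = F1" for F using all[of F] by blast
      ultimately show ?thesis using e1 2 by (intro exI[of _ F2] exI[of _ F1] exI[of _ e2] exI[of _ e1]) simp
    qed
  qed
  have Bs: "B \<subseteq> {b1, b2}" using b by simp
  note ch = level_chain[OF fin inc2 Bs inner outer]
  show "inj_on g U" by (rule ch(1))
  show "(\<exists>F. face F \<and> F \<noteq> Fo \<and> e \<in> FE F \<and> e' \<in> FE F) \<or> (\<exists>x\<in>U. g e < g x \<and> g x < g e')"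
    if "e \<in> U" "e' \<in> U" "g e < g e'" for e e'
  proof -
    have "(\<exists>F\<in>Fs. e \<in> inc F \<and> e' \<in> inc F) \<or> (\<exists>x\<in>U. g e < g x \<and> g x < g e')"
      by (rule ch(2)) (assumption | rule that)+
    then show ?thesis unfolding Fs_def inc_def by blast
  qed
qed

lemma at_level_eq_open_segment:
  assumes p: "p \<in> open_segment (f x) (f y)" and lt: "d \<bullet> f x < d \<bullet> f y"
  shows "at_level d (d \<bullet> p) x y = p" "d \<bullet> f x < d \<bullet> p" "d \<bullet> p < d \<bullet> f y"
proof -
  obtain u where u: "0 < u" "u < 1" "p = (1 - u) *\<^sub>R f x + u *\<^sub>R f y" using p unfolding in_segment by blast
  have dp: "d \<bullet> p - d \<bullet> f x = u * (d \<bullet> f y - d \<bullet> f x)" by (simp add: u(3) inner_add_right algebra_simps)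
  have "d \<bullet> f y - d \<bullet> p = (1 - u) * (d \<bullet> f y - d \<bullet> f x)" by (simp add: u(3) inner_add_right algebra_simps)
  then show "d \<bullet> p < d \<bullet> f y" using u lt by (smt (verit) mult_pos_pos)
  show "d \<bullet> f x < d \<bullet> p" using dp u lt by (smt (verit) mult_pos_pos)
  have "(d \<bullet> p - d \<bullet> f x) / (d \<bullet> f y - d \<bullet> f x) = u" using dp lt by simp
  then show "at_level d (d \<bullet> p) x y = p" unfolding at_level_def by (simp add: u(3) algebra_simps)
qed

lemma at_level_lower [simp]: "at_level d (d \<bullet> f x) x y = f x"
  by (simp add: at_level_def)

text \<open>Just above a level, edges that meet on that level are joined by a chain of bounded faces, each
  of which has a simple polygon as its image; hence the edges can only meet in a lower endpoint.\<close>

lemma coincide_lower: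
  assumes d: "d \<noteq> 0" and z: "zu \<in> ext" "d \<bullet> f zu > t0" "zl \<in> ext" "d \<bullet> f zl \<le> t0"
    and e: "{x, y} \<in> E" "d \<bullet> f x \<le> t0" "t0 < d \<bullet> f y"
    and e': "{x', y'} \<in> E" "d \<bullet> f x' \<le> t0" "t0 < d \<bullet> f y'"
    and ne: "{x, y} \<noteq> {x', y'}" and co: "at_level d t0 x y = at_level d t0 x' y'"
  shows "x = x' \<and> d \<bullet> f x = t0"
proof -
  obtain n where n: "n \<bullet> d = 0" "n \<noteq> 0" using perpendicular_exists by blast
  \<comment> \<open>Edges that lead from at most \<open>t0\<close> to above \<open>t0\<close>, as
    ordered pairs; exactly these cross a level slightly above \<open>t0\<close>.\<close>
  define Q where "Q = {q \<in> V \<times> V. {fst q, snd q} \<in> E \<and> d \<bullet> f (fst q) \<le> t0 \<and> t0 < d \<bullet> f (snd q)}"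
  define h where "h t q = n \<bullet> at_level d t (fst q) (snd q)" for t q
  have finQ: "finite Q" unfolding Q_def by (rule finite_subset[of _ "V \<times> V"]) (use finite_V in auto)
  have hlim: "((\<lambda>t. h t q) \<longlongrightarrow> h t0 q) (at_right t0)" if "q \<in> Q" for q
    unfolding h_def at_level_def using that by (intro tendsto_intros) (auto simp: Q_def)
  \<comment> \<open>By continuity, strict order on the level \<open>t0\<close> persists slightly
    above it. An edge that lies above between two edges tied on \<open>t0\<close> is therefore tied
    with them.\<close>
  have ev1: "\<forall>\<^sub>F t in at_right t0. \<forall>q\<in>Q. \<forall>q'\<in>Q. h t0 q < h t0 q' \<longrightarrow> h t q < h t q'"
  proof (intro eventually_ball_finite finQ ballI)
    fix q q' assume q: "q \<in> Q" "q' \<in> Q"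
    show "\<forall>\<^sub>F t in at_right t0. h t0 q < h t0 q' \<longrightarrow> h t q < h t q'"
    proof (cases "h t0 q < h t0 q'")
      case True
      have "((\<lambda>t. h t q' - h t q) \<longlongrightarrow> h t0 q' - h t0 q) (at_right t0)" by (intro tendsto_diff hlim q)
      then have "\<forall>\<^sub>F t in at_right t0. 0 < h t q' - h t q" by (rule order_tendstoD) (use True in simp)
      then show ?thesis by eventually_elim simp
    qed simp
  qed
  have ev2: "\<forall>\<^sub>F t in at_right t0. \<forall>v\<in>V. t0 < d \<bullet> f v \<longrightarrow> t < d \<bullet> f v"
  proof (intro eventually_ball_finite finite_V ballI)
    fix v assume "v \<in> V"
    show "\<forall>\<^sub>F t in at_right t0. t0 < d \<bullet> f v \<longrightarrow> t < d \<bullet> f v"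
    proof (cases "t0 < d \<bullet> f v")
      case True
      then show ?thesis using eventually_at_right_field[of "\<lambda>t. t < d \<bullet> f v" t0] by auto
    qed simp
  qed
  have "\<forall>\<^sub>F t in at_right t0. t0 < t" by (simp add: eventually_at_right_less)
  with ev1 ev2 have "\<forall>\<^sub>F t in at_right t0. t0 < t \<and> (\<forall>v\<in>V. t0 < d \<bullet> f v \<longrightarrow> t < d \<bullet> f v)
      \<and> (\<forall>q\<in>Q. \<forall>q'\<in>Q. h t0 q < h t0 q' \<longrightarrow> h t q < h t q')" by eventually_elim blast
  then obtain t where tt: "t0 < t \<and> (\<forall>v\<in>V. t0 < d \<bullet> f v \<longrightarrow> t < d \<bullet> f v)
      \<and> (\<forall>q\<in>Q. \<forall>q'\<in>Q. h t0 q < h t0 q' \<longrightarrow> h t q < h t q')"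
    using eventually_happens'[OF trivial_limit_at_right_real] by blast
  then have t: "t0 < t" "\<And>v. v \<in> V \<Longrightarrow> t0 < d \<bullet> f v \<Longrightarrow> t < d \<bullet> f v"
      "\<And>q q'. q \<in> Q \<Longrightarrow> q' \<in> Q \<Longrightarrow> h t0 q < h t0 q' \<Longrightarrow> h t q < h t q'" by blast+
  have tV: "d \<bullet> f v \<noteq> t" if "v \<in> V" for v using t(1) t(2)[OF that] by linarith
  have zt: "d \<bullet> f zu > t" "d \<bullet> f zl < t" using z t(1) t(2)[of zu] ext_subset by auto
  define U where "U = {e\<in>E. crosses d t e}"
  define q where "q e = (lo d t e, hi d t e)" for e
  have qe: "q {u, v} = (u, v) \<and> {u, v} \<in> U" if "{u, v} \<in> E" "d \<bullet> f u \<le> t0" "t0 < d \<bullet> f v" for u v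
  proof -
    have "d \<bullet> f u < t" "t < d \<bullet> f v" using that t(1) t(2)[of v] edge_ends[OF that(1)] by auto
    then show ?thesis using lo_hi_eq[OF refl, of d u t v] that(1) by (auto simp: q_def U_def crosses_def)
  qed
  have Ue: "\<exists>u v. a = {u, v} \<and> {u, v} \<in> E \<and> d \<bullet> f u \<le> t0 \<and> t0 < d \<bullet> f v \<and> q a = (u, v) \<and> q a \<in> Q" if a: "a \<in> U" for a
  proof -
    obtain u v where uv: "a = {u, v}" "{u, v} \<in> E" "d \<bullet> f u < t" "t < d \<bullet> f v"
      using a by (auto simp: U_def crosses_def)
    have V: "u \<in> V" "v \<in> V" using edge_ends[OF uv(2)] by auto
    have "\<not> t0 < d \<bullet> f u" using uv(3) t(2)[OF V(1)] by auto
    then have l: "d \<bullet> f u \<le> t0" "t0 < d \<bullet> f v" using uv(4) t(1) by auto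
    moreover have "q a = (u, v)" using qe[OF uv(2) l] uv(1) by simp
    ultimately show ?thesis using uv V by (auto simp: Q_def)
  qed
  have finU: "finite U" using finite_E by (simp add: U_def)
  note ls = level_structure[OF d n tV z(1) zt(1) z(3) zt(2), folded U_def]
  have hq: "n \<bullet> at_level d t (lo d t a) (hi d t a) = h t (q a)" for a by (simp add: h_def q_def)
  have inj: "inj_on (\<lambda>a. h t (q a)) U" using ls(1) unfolding hq .
  have nb: "(\<exists>F. face F \<and> F \<noteq> Fo \<and> a \<in> FE F \<and> b \<in> FE F) \<or> (\<exists>x\<in>U. h t (q a) < h t (q x) \<and> h t (q x) < h t (q b))"
    if "a \<in> U" "b \<in> U" "h t (q a) < h t (q b)" for a b
    using that unfolding hq[symmetric] by - (rule ls(2), assumption+)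
  \<comment> \<open>Induction on the number of crossing edges between the two, all tied with them on
    \<open>t0\<close>. Without such an edge the two share a bounded face, whose simple polygon
    allows them only a common lower vertex.\<close>
  have main: "lo d t a = lo d t b \<and> d \<bullet> f (lo d t a) = t0"
    if "a \<in> U" "b \<in> U" "h t (q a) < h t (q b)" "h t0 (q a) = h t0 (q b)" for a b
    using that
  proof (induction "card {x\<in>U. h t (q a) < h t (q x) \<and> h t (q x) < h t (q b)}" arbitrary: a b rule: less_induct)
    case less
    consider (face) F where "face F" "F \<noteq> Fo" "a \<in> FE F" "b \<in> FE F"
      | (mid) x where "x \<in> U" "h t (q a) < h t (q x)" "h t (q x) < h t (q b)"
      using nb[OF less.prems(1-3)] by blast
    then show ?case
    proof cases
      case mid
      have "h t0 (q x) = h t0 (q a)"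
        using t(3)[of "q x" "q a"] t(3)[of "q b" "q x"] Ue[OF less.prems(1)] Ue[OF less.prems(2)] Ue[OF mid(1)] mid less.prems(4)
        by fastforce
      moreover have "{y\<in>U. h t (q a) < h t (q y) \<and> h t (q y) < h t (q x)} \<subset> {x\<in>U. h t (q a) < h t (q x) \<and> h t (q x) < h t (q b)}"
        "{y\<in>U. h t (q x) < h t (q y) \<and> h t (q y) < h t (q b)} \<subset> {x\<in>U. h t (q a) < h t (q x) \<and> h t (q x) < h t (q b)}"
        using mid by auto
      then have "card {y\<in>U. h t (q a) < h t (q y) \<and> h t (q y) < h t (q x)} < card {x\<in>U. h t (q a) < h t (q x) \<and> h t (q x) < h t (q b)}"
        "card {y\<in>U. h t (q x) < h t (q y) \<and> h t (q y) < h t (q b)} < card {x\<in>U. h t (q a) < h t (q x) \<and> h t (q x) < h t (q b)}"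
        using finU by (auto intro: psubset_card_mono)
      ultimately show ?thesis
        using less.hyps[of a x] less.hyps[of x b] mid less.prems by auto
    next
      case face
      obtain u v where a: "a = {u, v}" "d \<bullet> f u \<le> t0" "t0 < d \<bullet> f v" "q a = (u, v)" using Ue[OF less.prems(1)] by metis
      obtain u' v' where b: "b = {u', v'}" "d \<bullet> f u' \<le> t0" "t0 < d \<bullet> f v'" "q b = (u', v')" using Ue[OF less.prems(2)] by metis
      define p where "p = at_level d t0 u v"
      have pp: "p = at_level d t0 u' v'"
      proof -
        have "n \<bullet> (at_level d t0 u v - at_level d t0 u' v') = 0"
          using less.prems(4) a(4) b(4) by (simp add: h_def inner_diff_right)
        moreover have "d \<bullet> (at_level d t0 u v - at_level d t0 u' v') = 0"
          using at_level_level[of d u v t0] at_level_level[of d u' v' t0] a b by (simp add: inner_diff_right)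
        ultimately have "at_level d t0 u v - at_level d t0 u' v' = 0"
          using orthogonal_decomposition[OF d n(2,1), of "at_level d t0 u v - at_level d t0 u' v'"] by simp
        then show ?thesis by (simp add: p_def)
      qed
      have FVs: "u \<in> FV F" "u' \<in> FV F" using FE_subset_FV[OF face(1,3)] FE_subset_FV[OF face(1,4)] a(1) b(1) by auto
      have ab: "a \<noteq> b" using less.prems(3) by auto
      have pa: "p \<in> open_segment (f u) (f v)" if "d \<bullet> f u \<noteq> t0"
        unfolding p_def by (rule at_level_open_segment) (use a that in auto)
      have pb: "p \<in> open_segment (f u') (f v')" if "d \<bullet> f u' \<noteq> t0"
        unfolding pp by (rule at_level_open_segment) (use b that in auto)
      have pa': "p = f u" if "d \<bullet> f u = t0" using that unfolding p_def by (simp add: at_level_def)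
      have pb': "p = f u'" if "d \<bullet> f u' = t0" using that unfolding pp by (simp add: at_level_def)
      have F1: "{u, v} \<in> FE F" "{u', v'} \<in> FE F" using face a b by auto
      have "d \<bullet> f u = t0"
      proof (rule ccontr)
        assume nu: "d \<bullet> f u \<noteq> t0"
        show False
        proof (cases "d \<bullet> f u' = t0")
          case True
          then show False using face_polygon_simple(2)[OF face(1,2) FVs(2) F1(1)] pa[OF nu] pb'[OF True] by simp
        next
          case False
          then show False using face_polygon_simple(1)[OF face(1,2) F1 pa[OF nu] pb[OF False]] ab a b by simp
        qed
      qed
      moreover have "d \<bullet> f u' = t0"
      proof (rule ccontr)
        assume nu: "d \<bullet> f u' \<noteq> t0"
        show False using face_polygon_simple(2)[OF face(1,2) FVs(1) F1(2)] pb[OF nu] pa'[OF \<open>d \<bullet> f u = t0\<close>] by simp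
      qed
      ultimately have "u = u'" using face_polygon_simple(3)[OF face(1,2) FVs] pa' pb' by simp
      then show ?thesis using \<open>d \<bullet> f u = t0\<close> a(4) b(4) by (simp add: q_def)
    qed
  qed
  have qs: "q {x, y} = (x, y)" "{x, y} \<in> U" "q {x', y'} = (x', y')" "{x', y'} \<in> U" using qe[OF e] qe[OF e'] by auto
  have h0: "h t0 (q {x, y}) = h t0 (q {x', y'})" using co qs by (simp add: h_def)
  have lo: "lo d t {x, y} = x" "lo d t {x', y'} = x'" using qs(1,3) by (auto simp: q_def)
  have "h t (q {x, y}) \<noteq> h t (q {x', y'})" using inj_onD[OF inj _ qs(2,4)] ne by blast
  then consider "h t (q {x, y}) < h t (q {x', y'})" | "h t (q {x', y'}) < h t (q {x, y})" by linarith
  then show ?thesis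
  proof cases
    case 1 then show ?thesis using main[OF qs(2,4) 1 h0] unfolding lo by blast
  next
    case 2 then show ?thesis using main[OF qs(4,2) 2 h0[symmetric]] unfolding lo by blast
  qed
qed

text \<open>A generic direction separates different vertex images and keeps some corner off the
  level of \<open>p\<close>; reversing it if necessary places that corner above.\<close>

lemma good_direction:
  "\<exists>d. d \<noteq> 0 \<and> (\<forall>u\<in>V. \<forall>v\<in>V. d \<bullet> f u = d \<bullet> f v \<longrightarrow> f u = f v) \<and> (\<exists>z\<in>ext. d \<bullet> p < d \<bullet> f z)"
proof -
  define S where "S = (\<lambda>(u, v). f u - f v) ` (V \<times> V) \<union> (\<lambda>z. f z - p) ` V"
  have "finite S" using finite_V by (simp add: S_def)
  then obtain d where d: "d \<noteq> 0" "\<And>a. a \<in> S \<Longrightarrow> a \<noteq> 0 \<Longrightarrow> d \<bullet> a \<noteq> 0" using generic_direction by metis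
  have gen: "f u = f v" if "u \<in> V" "v \<in> V" "d \<bullet> f u = d \<bullet> f v" for u v
    using d(2)[of "f u - f v"] that by (force simp: S_def inner_diff_right)
  obtain z where z: "z \<in> ext" "f z \<noteq> p"
  proof -
    obtain x y a where "x \<in> ext" "y \<in> ext" "x \<noteq> y"
      using ext_neighbours top_corner_ex unfolding top_corner_def by metis
    then show ?thesis using that inj_onD[OF inj_ext, of x y] by metis
  qed
  then have "z \<in> V" using ext_subset by blast
  then have ne: "d \<bullet> f z \<noteq> d \<bullet> p" using d(2)[of "f z - p"] z(2) by (auto simp: S_def inner_diff_right)
  show ?thesis
  proof (cases "d \<bullet> p < d \<bullet> f z")
    case True then show ?thesis using d(1) gen z(1) by blast
  next
    case False
    then have "- d \<bullet> p < - d \<bullet> f z" using ne by simp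
    moreover have "f u = f v" if "u \<in> V" "v \<in> V" "- d \<bullet> f u = - d \<bullet> f v" for u v using gen that by simp
    ultimately show ?thesis using d(1) z(1) by (intro exI[of _ "- d"]) auto
  qed
qed

theorem straight_embedding: "is_straight_embedding V E f"
proof -
  \<comment> \<open>Edges are oriented upward and omit their upper end, so that a vertex is a point
    of any edge rising from it. Every collision then becomes two different edges through one point
    \<open>p\<close>.\<close>
  define thru where "thru d p x y \<longleftrightarrow> {x, y} \<in> E \<and> d \<bullet> f x \<le> d \<bullet> p \<and> d \<bullet> p < d \<bullet> f y \<and> at_level d (d \<bullet> p) x y = p" for d p x y
  have unique: "x = x' \<and> d \<bullet> f x = d \<bullet> p"
    if h: "d \<noteq> 0" "z \<in> ext" "d \<bullet> p < d \<bullet> f z" "thru d p x y" "thru d p x' y'" "{x, y} \<noteq> {x', y'}" for d p z x y x' y'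
  proof -
    obtain a where a: "top_corner (- d) a" using top_corner_ex by blast
    have "x \<in> V" using h(4) edge_ends[of x y] by (auto simp: thru_def)
    then have "- d \<bullet> f x \<le> - d \<bullet> f a" using le_top_corner[of "- d" x a] h(1) a by simp
    then have "d \<bullet> f a \<le> d \<bullet> p" using h(4) by (auto simp: thru_def)
    moreover have "a \<in> ext" using a by (simp add: top_corner_def)
    ultimately show ?thesis using coincide_lower[OF h(1-3), of a x y x' y'] h(4-6) by (auto simp: thru_def)
  qed
  \<comment> \<open>With no two neighbours on one level, every vertex below some corner has a rising
    edge; hence vertex collisions are edge collisions as well.\<close>
  have up: "\<exists>y. thru d (f v) v y"
    if h: "d \<noteq> 0" "\<forall>u\<in>V. \<forall>v\<in>V. d \<bullet> f u = d \<bullet> f v \<longrightarrow> f u = f v" "z \<in> ext" "d \<bullet> f v < d \<bullet> f z" "v \<in> V" for d z v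
  proof -
    have "\<exists>y. {v, y} \<in> E \<and> d \<bullet> f v < d \<bullet> f y"
    proof (cases "v \<in> ext")
      case True
      obtain w where "{v, w} \<in> FE Fo" "d \<bullet> f v < d \<bullet> f w" using higher_neighbour_ext[OF h(1) True h(3)] h(4) by auto
      then show ?thesis by (auto simp: bd_edges_def)
    next
      case False
      obtain e where e: "e \<in> star v" using star_nonempty[OF h(5)] by blast
      obtain u where u: "{v, u} \<in> E" using e star_edge[OF e] by (metis star_doubleton insert_commute)
      have "u \<in> V" using edge_ends[OF u] by simp
      then have "d \<bullet> f u \<noteq> d \<bullet> f v" using h(2,5) edge_nondegenerate[OF u] by metis
      then show ?thesis using higher_neighbour_internal[of v u d] False h(5) u by auto
    qed
    then show ?thesis by (auto simp: thru_def)
  qed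
  have seg: "\<exists>x y. {x, y} = {u, v} \<and> thru d p x y \<and> d \<bullet> f x < d \<bullet> p"
    if h: "\<forall>u\<in>V. \<forall>v\<in>V. d \<bullet> f u = d \<bullet> f v \<longrightarrow> f u = f v" "{u, v} \<in> E" "p \<in> open_segment (f u) (f v)" for d p u v
  proof -
    have "d \<bullet> f u \<noteq> d \<bullet> f v" using h(1) edge_ends[OF h(2)] edge_nondegenerate[OF h(2)] by metis
    then consider "d \<bullet> f u < d \<bullet> f v" | "d \<bullet> f v < d \<bullet> f u" by linarith
    then show ?thesis
    proof cases
      case 1
      then show ?thesis using at_level_eq_open_segment[OF h(3) 1] h(2) unfolding thru_def
        by (intro exI[of _ u] exI[of _ v]) auto
    next
      case 2
      have p: "p \<in> open_segment (f v) (f u)" using h(3) by (simp add: open_segment_commute)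
      show ?thesis using at_level_eq_open_segment[OF p 2] h(2) unfolding thru_def
        by (intro exI[of _ v] exI[of _ u]) (auto simp: insert_commute)
    qed
  qed
  have "u = w" if uw: "u \<in> V" "w \<in> V" "f u = f w" for u w
  proof (rule ccontr)
    assume ne: "u \<noteq> w"
    obtain d z where d: "d \<noteq> 0" "\<forall>u\<in>V. \<forall>v\<in>V. d \<bullet> f u = d \<bullet> f v \<longrightarrow> f u = f v" "z \<in> ext" "d \<bullet> f u < d \<bullet> f z"
      using good_direction[of "f u"] by metis
    obtain y where y: "thru d (f u) u y" using up[OF d uw(1)] by blast
    obtain y' where y': "thru d (f u) w y'" using up[OF d(1-3), of w] d(4) uw by auto
    have "{u, y} \<noteq> {w, y'}" using ne y y' uw(3) by (auto simp: doubleton_eq_iff thru_def)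
    then show False using unique[OF d(1,3,4) y y'] ne by simp
  qed
  moreover have "open_segment (f u) (f v) \<inter> open_segment (f u') (f v') = {}"
    if h: "{u, v} \<in> E" "{u', v'} \<in> E" "{u, v} \<noteq> {u', v'}" for u v u' v'
  proof (rule ccontr)
    assume "\<not> ?thesis"
    then obtain p where p: "p \<in> open_segment (f u) (f v)" "p \<in> open_segment (f u') (f v')" by blast
    obtain d z where d: "d \<noteq> 0" "\<forall>u\<in>V. \<forall>v\<in>V. d \<bullet> f u = d \<bullet> f v \<longrightarrow> f u = f v" "z \<in> ext" "d \<bullet> p < d \<bullet> f z"
      using good_direction[of p] by metis
    obtain x y where x: "{x, y} = {u, v}" "thru d p x y" "d \<bullet> f x < d \<bullet> p" using seg[OF d(2) h(1) p(1)] by metis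
    obtain x' y' where x': "{x', y'} = {u', v'}" "thru d p x' y'" using seg[OF d(2) h(2) p(2)] by metis
    show False using unique[OF d(1,3,4) x(2) x'(2)] x x' h(3) by simp
  qed
  moreover have "f w \<notin> open_segment (f u) (f v)" if h: "{u, v} \<in> E" "w \<in> V" for u v w
  proof
    assume p: "f w \<in> open_segment (f u) (f v)"
    obtain d z where d: "d \<noteq> 0" "\<forall>u\<in>V. \<forall>v\<in>V. d \<bullet> f u = d \<bullet> f v \<longrightarrow> f u = f v" "z \<in> ext" "d \<bullet> f w < d \<bullet> f z"
      using good_direction[of "f w"] by metis
    obtain x y where x: "{x, y} = {u, v}" "thru d (f w) x y" "d \<bullet> f x < d \<bullet> f w" using seg[OF d(2) h(1) p] by metis
    obtain y' where y': "thru d (f w) w y'" using up[OF d h(2)] by blast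
    have "w \<notin> {u, v}" using p by (auto simp: open_segment_def)
    then have "{x, y} \<noteq> {w, y'}" using x(1) by auto
    then show False using unique[OF d(1,3,4) x(2) y'] x(3) by simp
  qed
  ultimately show ?thesis unfolding is_straight_embedding_def inj_on_def by blast
qed

end

section \<open>Existence of convex combination maps\<close>

lemma face_of_supporting:
  fixes S T :: "(real^2) set"
  assumes S: "finite S" "T \<subseteq> S" and T: "\<And>x. x \<in> T \<Longrightarrow> w \<bullet> x = b" and lt: "\<And>x. x \<in> S - T \<Longrightarrow> w \<bullet> x < b"
  shows "convex hull T face_of convex hull S"
proof (rule face_of_convex_hulls[OF S])
  have "affine hull T \<subseteq> {x. w \<bullet> x = b}"
    by (rule hull_minimal) (use T in \<open>auto simp: affine_hyperplane\<close>)
  moreover have "convex hull (S - T) \<subseteq> {x. w \<bullet> x < b}"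
    by (rule hull_minimal) (use lt in \<open>auto simp: convex_halfspace_lt\<close>)
  ultimately show "affine hull T \<inter> convex hull (S - T) = {}" by force
qed

text \<open>By strict convexity, points of a parabola are the corners of a convex polygon in the
  order of their first coordinates.\<close>

definition parabola :: "nat \<Rightarrow> real^2" where
  "parabola i = vector [real i, (real i)\<^sup>2]"

lemma parabola_inner: "vector [a, b] \<bullet> parabola i = a * real i + b * (real i)\<^sup>2"
  by (simp add: parabola_def inner_vec_def sum_2)

lemma parabola_polygon:
  assumes n: "n \<ge> 3"
  shows "convex_polygon_corners (map parabola [0..<n])"
proof -
  let ?S = "parabola ` {0..<n}"
  have inj: "i = j" if "parabola i = parabola j" for i j
  proof -
    have "(parabola i) $ 1 = (parabola j) $ 1" using that by simp
    then show ?thesis by (simp add: parabola_def)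
  qed
  have faceI: "convex hull (parabola ` I) face_of convex hull ?S"
    if I: "I \<subseteq> {0..<n}" and eq: "\<And>i. i \<in> I \<Longrightarrow> a * real i + b' * (real i)\<^sup>2 = b"
      and lt: "\<And>i. i < n \<Longrightarrow> i \<notin> I \<Longrightarrow> a * real i + b' * (real i)\<^sup>2 < b" for I a b' b
  proof (rule face_of_supporting[of _ _ "vector [a, b']" b])
    show "vector [a, b'] \<bullet> x = b" if "x \<in> parabola ` I" for x
      using that eq by (auto simp: parabola_inner)
    show "vector [a, b'] \<bullet> x < b" if x: "x \<in> ?S - parabola ` I" for x
    proof -
      obtain i where "i < n" "x = parabola i" using x by auto
      moreover from this have "i \<notin> I" using x by blast
      ultimately show ?thesis using lt by (simp add: parabola_inner)
    qed
  qed (use I in auto)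
  have extr: "parabola i extreme_point_of convex hull ?S" if "i < n" for i
  proof -
    \<comment> \<open>The functional belongs to the tangent at \<open>i\<close>; the gap is a
      square.\<close>
    have "2 * real i * real j + (- 1) * (real j)\<^sup>2 < (real i)\<^sup>2" if "j \<noteq> i" for j
    proof -
      have "(real i - real j)\<^sup>2 > 0" using that by simp
      then show ?thesis by (simp add: power2_diff)
    qed
    then have "convex hull (parabola ` {i}) face_of convex hull ?S"
      by (intro faceI[of _ "2 * real i" "- 1" "(real i)\<^sup>2"]) (use that in \<open>auto simp: power2_eq_square\<close>)
    then show ?thesis by (simp add: face_of_singleton)
  qed
  have side: "closed_segment (parabola i) (parabola ((i + 1) mod n)) face_of convex hull ?S" if i: "i < n" for i
  proof (cases "Suc i < n")
    case True
    \<comment> \<open>The secant through \<open>i\<close> and \<open>Suc i\<close>, between which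
      there is no further integer.\<close>
    have "(2 * real i + 1) * real j + (- 1) * (real j)\<^sup>2 < real i * (real i + 1)" if "j \<notin> {i, Suc i}" for j
    proof -
      have "j < i \<or> j > Suc i" using that by auto
      then have "(real j - real i) * (real j - real i - 1) > 0" by (auto simp: zero_less_mult_iff)
      then show ?thesis by (simp add: algebra_simps power2_eq_square)
    qed
    then have "convex hull (parabola ` {i, Suc i}) face_of convex hull ?S"
      by (intro faceI[of _ "2 * real i + 1" "- 1" "real i * (real i + 1)"])
        (use True in \<open>auto simp: power2_eq_square algebra_simps\<close>)
    then show ?thesis using True by (simp add: segment_convex_hull)
  next
    case False
    then have i: "i = n - 1" "Suc i = n" using i by auto
    \<comment> \<open>The closing side is the chord from 0 to \<open>n - 1\<close>; all other points
      lie below it.\<close>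
    have "- real (n - 1) * real j + 1 * (real j)\<^sup>2 < 0" if "j < n" "j \<notin> {0, n - 1}" for j
    proof -
      have "0 < real j" "real j < real (n - 1)" using that by auto
      then have "real j * (real j - real (n - 1)) < 0" by (simp add: mult_pos_neg)
      then show ?thesis by (simp add: algebra_simps power2_eq_square)
    qed
    then have "convex hull (parabola ` {0, n - 1}) face_of convex hull ?S"
      by (intro faceI[of _ "- real (n - 1)" 1 0]) (use n in \<open>auto simp: power2_eq_square algebra_simps\<close>)
    then show ?thesis using i by (simp add: segment_convex_hull insert_commute)
  qed
  have "distinct (map parabola [0..<n])" using inj by (simp add: distinct_map inj_on_def)
  moreover have "set (map parabola [0..<n]) = ?S" by simp
  moreover have "map parabola [0..<n] ! ((i + 1) mod n) = parabola ((i + 1) mod n)" if "i < n" for i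
    using that n by simp
  ultimately show ?thesis unfolding convex_polygon_corners_def using n extr side by auto
qed

text \<open>Perron's method: the pointwise supremum of all subharmonic functions with the given boundary
  values is harmonic.\<close>

lemma discrete_dirichlet:
  fixes \<phi> :: "'v \<Rightarrow> real" and N :: "'v \<Rightarrow> 'v set"
  assumes fin: "finite V" and N: "\<And>u. u \<in> V - B \<Longrightarrow> N u \<subseteq> V \<and> N u \<noteq> {}"
  shows "\<exists>h. (\<forall>v\<in>B. h v = \<phi> v) \<and> (\<forall>u\<in>V - B. h u = (\<Sum>v\<in>N u. h v) / card (N u))"
proof -
  define M where "M = (\<Sum>v\<in>V. \<bar>\<phi> v\<bar>)"
  have phi: "\<bar>\<phi> v\<bar> \<le> M" if "v \<in> V" for v
    unfolding M_def using fin that by (intro member_le_sum) auto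
  have M0: "M \<ge> 0" unfolding M_def by (simp add: sum_nonneg)
  define avg where "avg g u = (\<Sum>v\<in>N u. g v) / card (N u)" for g :: "'v \<Rightarrow> real" and u
  have finN: "finite (N u)" "0 < real (card (N u))" if "u \<in> V - B" for u
  proof -
    show "finite (N u)" using N[OF that] fin finite_subset by blast
    then show "0 < real (card (N u))" using N[OF that] by (simp add: card_gt_0_iff)
  qed
  have mono: "avg g u \<le> avg g' u" if "u \<in> V - B" "\<And>v. v \<in> V \<Longrightarrow> g v \<le> g' v" for g g' u
  proof -
    have "(\<Sum>v\<in>N u. g v) \<le> (\<Sum>v\<in>N u. g' v)" using that N by (intro sum_mono) blast
    then show ?thesis using finN[OF that(1)] by (simp add: avg_def divide_right_mono)
  qed
  have const: "avg (\<lambda>v. k) u = k" if "u \<in> V - B" for k u using finN[OF that] N[OF that] by (simp add: avg_def)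
  \<comment> \<open>The bound \<open>M\<close> makes the pointwise supremum finite, and it is
    compatible with the last step below, because an average of values up to \<open>M\<close> is at
    most \<open>M\<close>.\<close>
  define S where "S = {g. (\<forall>v\<in>B. g v = \<phi> v) \<and> (\<forall>v\<in>V. g v \<le> M) \<and> (\<forall>u\<in>V - B. g u \<le> avg g u)}"
  define h where "h v = (if v \<in> V then (SUP g\<in>S. g v) else \<phi> v)" for v
  have S0: "(\<lambda>v. if v \<in> B then \<phi> v else - M) \<in> S"
  proof -
    have "- M \<le> avg (\<lambda>v. if v \<in> B then \<phi> v else - M) u" if "u \<in> V - B" for u
      using mono[OF that, of "\<lambda>v. - M" "\<lambda>v. if v \<in> B then \<phi> v else - M"] const[OF that] phi by (auto simp: abs_le_iff minus_le_iff)
    then show ?thesis unfolding S_def using phi M0 by (auto simp: abs_le_iff)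
  qed
  have up: "g v \<le> h v" if "g \<in> S" "v \<in> V" for g v
    unfolding h_def using that by (auto intro!: cSUP_upper bdd_aboveI[of _ M] simp: S_def)
  have least: "h v \<le> k" if "v \<in> V" "\<And>g. g \<in> S \<Longrightarrow> g v \<le> k" for v k
    unfolding h_def using S0 that by (auto intro!: cSUP_least)
  have hB: "h v = \<phi> v" if "v \<in> B" for v
  proof (cases "v \<in> V")
    case True
    have "h v \<le> \<phi> v" by (rule least[OF True]) (use that in \<open>auto simp: S_def\<close>)
    moreover have "\<phi> v \<le> h v" using up[OF S0 True] that by simp
    ultimately show ?thesis by simp
  qed (simp add: h_def)
  have hM: "h v \<le> M" if "v \<in> V" for v by (rule least[OF that]) (use that in \<open>auto simp: S_def\<close>)
  have sub: "h u \<le> avg h u" if u: "u \<in> V - B" for u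
  proof (rule least)
    fix g assume g: "g \<in> S"
    then have "g u \<le> avg g u" using u by (auto simp: S_def)
    also have "\<dots> \<le> avg h u" by (rule mono[OF u]) (use up g in auto)
    finally show "g u \<le> avg h u" .
  qed (use u in auto)
  have "h u = avg h u" if u: "u \<in> V - B" for u
  proof -
    \<comment> \<open>Raising a single value to its average keeps the function subharmonic, so the
      supremum is no smaller than its average.\<close>
    define h' where "h' = h(u := avg h u)"
    have ge: "h v \<le> h' v" for v using sub[OF u] by (simp add: h'_def)
    have "avg h u \<le> M" using mono[OF u, of h "\<lambda>_. M"] hM const[OF u] by simp
    moreover have "h' v \<le> avg h' v" if "v \<in> V - B" for v
    proof -
      have "h' v \<le> avg h v" using sub[OF that] by (simp add: h'_def)
      also have "\<dots> \<le> avg h' v" by (rule mono[OF that]) (rule ge)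
      finally show ?thesis .
    qed
    ultimately have "h' \<in> S" using hB hM u by (auto simp: S_def h'_def)
    then have "avg h u \<le> h u" using up[of h' u] u by (simp add: h'_def)
    then show ?thesis using sub[OF u] by simp
  qed
  then show ?thesis using hB by (intro exI[of _ h]) (auto simp: avg_def)
qed

context plane_connected
begin

text \<open>With uniform weights, one over the degree, each coordinate is a discrete Dirichlet
  problem whose values are prescribed on the external cycle.\<close>

lemma ex_convex_combination_map: "\<exists>f. convex_combination_map V E pos c f"
proof -
  obtain cs where cs: "cycle_list ext (ext_edges V E pos c) cs" using ext_cycle by (auto simp: simple_cycle_def)
  let ?n = "length cs"
  have n: "?n \<ge> 3" and set: "set cs = ext" and dist: "distinct cs" using cs by (auto simp: cycle_list_def)
  \<comment> \<open>The position of an external vertex in \<open>cs\<close>, which selects its point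
    on the parabola.\<close>
  define idx where "idx = the_inv_into {..<?n} (nth cs)"
  have idx: "idx (cs ! i) = i" if "i < ?n" for i
    unfolding idx_def by (rule the_inv_into_f_f) (use that dist in \<open>auto simp: inj_on_def nth_eq_iff_index_eq\<close>)
  define N where "N u = {v\<in>V. {u, v} \<in> E}" for u
  have N: "N u \<subseteq> V \<and> N u \<noteq> {}" if u: "u \<in> V - ext" for u
  proof -
    have "{u} \<noteq> V"
    proof
      assume "{u} = V"
      then have "ext \<subseteq> {u, u}" using ext_subset by (metis insert_absorb2)
      then show False using ext_not_small by blast
    qed
    then have "nbrs E {u} \<noteq> {}" using nbrs_nonempty[of "{u}"] u by blast
    then obtain y where "{u, y} \<in> E" by (auto simp: nbrs_def)
    then show ?thesis using edge_ends[of u y] by (auto simp: N_def)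
  qed
  have finN: "finite (N u)" for u using finite_V by (simp add: N_def)
  have "\<exists>h. (\<forall>v\<in>ext. h v = real (idx v)) \<and> (\<forall>u\<in>V - ext. h u = (\<Sum>v\<in>N u. h v) / card (N u))"
    by (rule discrete_dirichlet[OF finite_V N])
  then obtain h1 where h1: "\<forall>v\<in>ext. h1 v = real (idx v)" "\<forall>u\<in>V - ext. h1 u = (\<Sum>v\<in>N u. h1 v) / card (N u)"
    by (elim exE conjE) (rule that)
  have "\<exists>h. (\<forall>v\<in>ext. h v = (real (idx v))\<^sup>2) \<and> (\<forall>u\<in>V - ext. h u = (\<Sum>v\<in>N u. h v) / card (N u))"
    by (rule discrete_dirichlet[OF finite_V N])
  then obtain h2 where h2: "\<forall>v\<in>ext. h2 v = (real (idx v))\<^sup>2" "\<forall>u\<in>V - ext. h2 u = (\<Sum>v\<in>N u. h2 v) / card (N u)"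
    by (elim exE conjE) (rule that)
  define f :: "'v \<Rightarrow> real^2" where "f v = vector [h1 v, h2 v]" for v
  define lam where "lam u v = (if {u, v} \<in> E then 1 / real (card (N u)) else 0)" for u v
  have "map f cs = map parabola [0..<?n]"
  proof (rule nth_equalityI)
    fix i assume "i < length (map f cs)"
    then have i: "i < ?n" by simp
    then have "cs ! i \<in> ext" unfolding set[symmetric] by (rule nth_mem)
    then show "map f cs ! i = map parabola [0..<?n] ! i"
      using bspec[OF h1(1)] bspec[OF h2(1)] idx[OF i] i by (simp add: f_def parabola_def)
  qed simp
  then have poly: "convex_polygon_corners (map f cs)" using parabola_polygon[OF n] by simp
  have "(\<forall>v\<in>V. lam u v \<ge> 0) \<and> (\<Sum>v\<in>V. lam u v) = 1 \<and>
          (\<forall>v\<in>V. {u, v} \<in> E \<longrightarrow> lam u v > 0) \<and> (\<forall>v\<in>V. {u, v} \<notin> E \<longrightarrow> lam u v = 0) \<and>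
          f u = (\<Sum>v\<in>V. lam u v *\<^sub>R f v)" if u: "u \<in> V - ext" for u
  proof -
    have pos: "0 < real (card (N u))" using N[OF u] finN by (simp add: card_gt_0_iff)
    have sum: "(\<Sum>v\<in>V. lam u v * g v) = (\<Sum>v\<in>N u. g v) / card (N u)" for g :: "'v \<Rightarrow> real"
    proof -
      have "(\<Sum>v\<in>V. lam u v * g v) = (\<Sum>v\<in>N u. lam u v * g v)"
        by (rule sum.mono_neutral_right) (use finite_V in \<open>auto simp: N_def lam_def\<close>)
      also have "\<dots> = (\<Sum>v\<in>N u. g v / card (N u))" by (rule sum.cong) (auto simp: N_def lam_def)
      finally show ?thesis by (simp add: sum_divide_distrib)
    qed
    have "f u = (\<Sum>v\<in>V. lam u v *\<^sub>R f v)"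
      unfolding vec_eq_iff forall_2 using h1(2) h2(2) u sum[of h1] sum[of h2] by (simp add: f_def)
    moreover have "(\<Sum>v\<in>V. lam u v) = 1" using sum[of "\<lambda>_. 1"] pos by simp
    ultimately show ?thesis using pos by (auto simp: lam_def)
  qed
  then show ?thesis unfolding convex_combination_map_def using cs poly
    by (intro exI[of _ f] conjI exI[of _ cs] exI[of _ lam]) blast+
qed

end

section \<open>Recognising and cutting cycles\<close>

lemma two_regular_cycle:
  assumes fin: "finite VS" "VS \<noteq> {}" and sub: "\<And>e. e \<in> ES \<Longrightarrow> e \<subseteq> VS \<and> e \<noteq> {}"
    and reg: "\<And>v. v \<in> VS \<Longrightarrow> \<exists>x y. x \<noteq> y \<and> x \<noteq> v \<and> y \<noteq> v \<and> (\<forall>e. e \<in> ES \<and> v \<in> e \<longleftrightarrow> e = {v, x} \<or> e = {v, y})"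
    and con: "\<And>u v. u \<in> VS \<Longrightarrow> v \<in> VS \<Longrightarrow> (u, v) \<in> (steps ES)\<^sup>*"
  shows "simple_cycle VS ES"
proof -
  define path where "path xs \<longleftrightarrow> distinct xs \<and> xs \<noteq> [] \<and> set xs \<subseteq> VS \<and> (\<forall>i. Suc i < length xs \<longrightarrow> {xs ! i, xs ! Suc i} \<in> ES)" for xs
  obtain v0 where v0: "v0 \<in> VS" using fin by blast
  have "path [v0]" using v0 by (simp add: path_def)
  moreover have "length xs < Suc (card VS)" if "path xs" for xs
    using that fin card_mono[of VS "set xs"] distinct_card[of xs] by (auto simp: path_def)
  \<comment> \<open>On a longest path both neighbours of the first vertex occur. The farther of the
    two must be the last vertex, since otherwise it would have three neighbours; so the path closes
    up.\<close>
  ultimately obtain xs where xs: "path xs" "\<And>ys. path ys \<Longrightarrow> length ys \<le> length xs"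
    using ex_has_greatest_nat[of path "[v0]" length "Suc (card VS)"] less_imp_le by blast
  let ?n = "length xs"
  have d: "distinct xs" and V: "set xs \<subseteq> VS" and ne: "xs \<noteq> []" and ed: "\<And>i. Suc i < ?n \<Longrightarrow> {xs ! i, xs ! Suc i} \<in> ES"
    using xs(1) by (auto simp: path_def)
  have eq: "xs ! i = xs ! j \<longleftrightarrow> i = j" if "i < ?n" "j < ?n" for i j using nth_eq_iff_index_eq[OF d that] .
  have few: "z1 = z2 \<or> z1 = z3 \<or> z2 = z3" if v: "v \<in> VS" "{v, z1} \<in> ES" "{v, z2} \<in> ES" "{v, z3} \<in> ES" for v z1 z2 z3
  proof -
    obtain x y where xy: "\<forall>e. e \<in> ES \<and> v \<in> e \<longleftrightarrow> e = {v, x} \<or> e = {v, y}" using reg[OF v(1)] by metis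
    have "{v, z} = {v, x} \<or> {v, z} = {v, y}" if "{v, z} \<in> ES" for z using xy[THEN spec, of "{v, z}"] that by blast
    then show ?thesis using v(2-4) by (metis doubleton_eq_iff)
  qed
  have x0: "xs ! 0 \<in> VS" using V ne by auto
  have closed0: "y \<in> set xs" if "{xs ! 0, y} \<in> ES" for y
  proof (rule ccontr)
    assume y: "y \<notin> set xs"
    have "path (y # xs)" unfolding path_def
    proof (intro conjI allI impI)
      fix i assume "Suc i < length (y # xs)"
      then show "{(y # xs) ! i, (y # xs) ! Suc i} \<in> ES" using that ed by (cases i) (auto simp: insert_commute)
    qed (use d V y sub[OF that] in auto)
    then show False using xs(2) by force
  qed
  obtain z1 z2 where z: "z1 \<noteq> z2" "z1 \<noteq> xs ! 0" "z2 \<noteq> xs ! 0" "{xs ! 0, z1} \<in> ES" "{xs ! 0, z2} \<in> ES" using reg[OF x0] by metis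
  obtain i1 where i1: "i1 < ?n" "z1 = xs ! i1" using closed0[OF z(4)] by (metis in_set_conv_nth)
  obtain i2 where i2: "i2 < ?n" "z2 = xs ! i2" using closed0[OF z(5)] by (metis in_set_conv_nth)
  have i12: "i1 \<noteq> 0" "i2 \<noteq> 0" "i1 \<noteq> i2" using z(1-3) i1(2) i2(2) by metis+
  define k where "k = max i1 i2"
  have k: "k \<ge> 2" "k < ?n" "{xs ! 0, xs ! k} \<in> ES" using i12 i1 i2 z unfolding k_def by (auto simp: max_def)
  have last: "Suc k = ?n"
  proof (rule ccontr)
    assume "Suc k \<noteq> ?n"
    then have k': "Suc k < ?n" using k by simp
    have "{xs ! k, xs ! 0} \<in> ES" "{xs ! k, xs ! Suc k} \<in> ES" "{xs ! k, xs ! (k - 1)} \<in> ES"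
      using k ed[OF k'] ed[of "k - 1"] by (auto simp: insert_commute)
    moreover have "xs ! k \<in> VS" using V k by auto
    ultimately have "xs ! 0 = xs ! Suc k \<or> xs ! 0 = xs ! (k - 1) \<or> xs ! Suc k = xs ! (k - 1)" using few by blast
    moreover have "0 < ?n" "k - 1 < ?n" "k - 1 \<noteq> 0" "Suc k \<noteq> k - 1" using k by auto
    ultimately show False using eq[of 0 "Suc k"] eq[of 0 "k - 1"] eq[of "Suc k" "k - 1"] k' by linarith
  qed
  have n3: "?n \<ge> 3" using k last by simp
  have cyc: "{xs ! i, xs ! ((i + 1) mod ?n)} \<in> ES" if "i < ?n" for i
  proof (cases "Suc i < ?n")
    case False
    then have "Suc i = ?n" "i = k" using that last by auto
    then show ?thesis using k by (simp add: insert_commute)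
  qed (use ed in simp)
  have all: "\<exists>i<?n. {xs ! j, y} = {xs ! i, xs ! ((i + 1) mod ?n)}" if j: "j < ?n" and y: "{xs ! j, y} \<in> ES" for j y
  proof -
    define p where "p = (if j = 0 then ?n - 1 else j - 1)"
    have p: "p < ?n" "(p + 1) mod ?n = j" using j n3 by (auto simp: p_def)
    have s: "(j + 1) mod ?n < ?n" using n3 by (intro mod_less_divisor) linarith
    have ps: "p \<noteq> (j + 1) mod ?n"
    proof (cases "Suc j < ?n")
      case True then show ?thesis using n3 by (auto simp: p_def)
    next
      case False
      then have "Suc j = ?n" using j by simp
      then show ?thesis using n3 by (auto simp: p_def)
    qed
    have jp: "{xs ! j, xs ! p} \<in> ES" using cyc[OF p(1)] p(2) by (simp add: insert_commute)
    have "xs ! j \<in> VS" using V j nth_mem by blast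
    then have "y = xs ! p \<or> y = xs ! ((j + 1) mod ?n) \<or> xs ! p = xs ! ((j + 1) mod ?n)"
      using few[OF _ y jp cyc[OF j]] by blast
    then have "y = xs ! p \<or> y = xs ! ((j + 1) mod ?n)" using eq[OF p(1) s] ps by blast
    then show ?thesis
    proof
      assume "y = xs ! p"
      then show ?thesis using p by (intro exI[of _ p]) (auto simp: insert_commute)
    next
      assume "y = xs ! ((j + 1) mod ?n)"
      then show ?thesis using j by blast
    qed
  qed
  have setV: "set xs = VS"
  proof
    show "VS \<subseteq> set xs"
    proof
      fix v assume v: "v \<in> VS"
      show "v \<in> set xs"
      proof (rule ccontr)
        assume "v \<notin> set xs"
        then obtain a b where ab: "{a, b} \<in> ES" "a \<in> set xs" "b \<notin> set xs"
          using rtrancl_switch[OF con[OF x0 v], of "\<lambda>w. w \<in> set xs"] ne by auto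
        obtain j where "j < ?n" "a = xs ! j" using ab(2) by (metis in_set_conv_nth)
        then obtain i where i: "i < ?n" "{a, b} = {xs ! i, xs ! ((i + 1) mod ?n)}" using all ab(1) by blast
        moreover have "(i + 1) mod ?n < ?n" using n3 by (intro mod_less_divisor) linarith
        ultimately have "{a, b} \<subseteq> set xs" by simp
        then show False using ab(3) by simp
      qed
    qed
  qed (rule V)
  have "ES = {{xs ! i, xs ! ((i + 1) mod ?n)} | i. i < ?n}"
  proof
    show "ES \<subseteq> {{xs ! i, xs ! ((i + 1) mod ?n)} | i. i < ?n}"
    proof
      fix e assume e: "e \<in> ES"
      then obtain v where v: "v \<in> e" "v \<in> VS" using sub by blast
      obtain j where j: "j < ?n" "v = xs ! j" using v(2) setV by (metis in_set_conv_nth)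
      obtain y where y: "e = {xs ! j, y}" using reg[OF v(2)] e v(1) j(2) by metis
      then obtain i where i: "i < ?n" "{xs ! j, y} = {xs ! i, xs ! ((i + 1) mod ?n)}" using all[OF j(1), of y] e by blast
      show "e \<in> {{xs ! i, xs ! ((i + 1) mod ?n)} | i. i < ?n}"
        unfolding y i(2) mem_Collect_eq by (rule exI[of _ i]) (intro conjI refl i(1))
    qed
  qed (use cyc in auto)
  then have "cycle_list VS ES xs" unfolding cycle_list_def using d n3 setV by simp
  then show ?thesis by (auto simp: simple_cycle_def)
qed

lemma simple_cycle_edge_subset:
  assumes "simple_cycle VS ES" "e \<in> ES"
  shows "e \<subseteq> VS"
proof -
  obtain vs where vs: "cycle_list VS ES vs" using assms by (auto simp: simple_cycle_def)
  then obtain i where i: "i < length vs" "e = {vs ! i, vs ! ((i + 1) mod length vs)}"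
    using assms unfolding cycle_list_def by blast
  then have "(i + 1) mod length vs < length vs" by (intro mod_less_divisor) linarith
  then have "{vs ! i, vs ! ((i + 1) mod length vs)} \<subseteq> set vs" using i(1) by simp
  moreover have "set vs = VS" using vs by (simp add: cycle_list_def)
  ultimately show ?thesis unfolding i(2) by simp
qed

lemma cycle_list_segment:
  assumes c: "cycle_list VS ES ws" and k: "i \<le> k" "k \<le> j" "i \<le> k'" "k' \<le> j" "j < length ws"
  shows "(ws ! k, ws ! k') \<in> (steps (inner_edges ES (nth ws ` {i..j})))\<^sup>*"
proof -
  have *: "(ws ! k, ws ! k') \<in> (steps (inner_edges ES (nth ws ` {i..j})))\<^sup>*"
    if "i \<le> k" "k \<le> k'" "k' \<le> j" for k k'
  proof (rule nth_steps[OF that(2)])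
    fix l assume "k \<le> l" "l < k'"
    then show "{ws ! l, ws ! Suc l} \<in> inner_edges ES (nth ws ` {i..j})"
      using cycle_list_edge[OF c, of l] that k(5) by (auto simp: inner_edges_def)
  qed
  show ?thesis
  proof (cases "k \<le> k'")
    case True then show ?thesis using * k by simp
  next
    case False
    then have "(ws ! k', ws ! k) \<in> (steps (inner_edges ES (nth ws ` {i..j})))\<^sup>*" using *[of k' k] k by simp
    then show ?thesis by (rule steps_rtrancl_sym)
  qed
qed

lemma cycle_minus_vertex:
  assumes c: "simple_cycle VS ES"
  shows "conn ES (VS - {a})"
proof (cases "a \<in> VS")
  case True
  obtain ws where ws: "cycle_list VS ES ws" "ws ! 0 = a" using simple_cycle_start[OF c True] .
  then have d: "distinct ws" "set ws = VS" "length ws \<ge> 3" by (auto simp: cycle_list_def)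
  have "VS - {a} = nth ws ` {1..length ws - 1}"
  proof -
    have "VS = nth ws ` {0..<length ws}" using d(2) by (auto simp: set_conv_nth)
    also have "{0..<length ws} = insert 0 {1..length ws - 1}" using d(3) by auto
    finally have *: "VS = nth ws ` insert 0 {1..length ws - 1}" .
    have "ws ! k \<noteq> ws ! 0" if "k \<in> {1..length ws - 1}" for k
    proof -
      have "k < length ws" "0 < length ws" "k \<noteq> 0" using that d(3) by auto
      then show ?thesis using nth_eq_iff_index_eq[OF d(1)] by blast
    qed
    then have "nth ws ` insert 0 {1..length ws - 1} - {ws ! 0} = nth ws ` {1..length ws - 1}" by auto
    then show ?thesis unfolding * ws(2)[symmetric] .
  qed
  then show ?thesis unfolding conn_def
    using cycle_list_segment[OF ws(1), of 1 _ "length ws - 1"] d(3) by auto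
next
  case False
  have "inner_edges ES VS = ES"
    using simple_cycle_edge_subset[OF c] by (auto simp: inner_edges_def)
  then show ?thesis using False cycle_list_connected[OF c] by (simp add: conn_def)
qed

lemma cycle_minus_edge_ends:
  assumes c: "simple_cycle VS ES" and e: "{a, b} \<in> ES"
  shows "conn ES (VS - {a, b})"
proof -
  have sub: "VS - {a, b} = nth ws ` I" if "cycle_list VS ES ws" "{0..<length ws} = insert i (insert j I)"
    "{a, b} = {ws ! i, ws ! j}" "i \<notin> I" "j \<notin> I" for ws i j I
  proof -
    have d: "distinct ws" "set ws = VS" using that(1) by (auto simp: cycle_list_def)
    have "VS = nth ws ` {0..<length ws}" using d(2) by (auto simp: set_conv_nth)
    moreover have lt: "k < length ws" if "k \<in> insert i (insert j I)" for k
      using that \<open>{0..<length ws} = _\<close> by (metis atLeastLessThan_iff)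
    have "ws ! k \<notin> {ws ! i, ws ! j}" if "k \<in> I" for k
      using nth_eq_iff_index_eq[OF d(1), of k] lt that \<open>i \<notin> I\<close> \<open>j \<notin> I\<close> by (metis insertE insertI1 insertI2 singletonD)
    then have "nth ws ` (insert i (insert j I)) - {ws ! i, ws ! j} = nth ws ` I" by auto
    ultimately show ?thesis using that(2,3) by simp
  qed
  have "a \<in> VS" using simple_cycle_edge_subset[OF c e] by simp
  then obtain ws where ws: "cycle_list VS ES ws" "ws ! 0 = a" using simple_cycle_start[OF c] by metis
  have n: "length ws \<ge> 3" using ws by (auto simp: cycle_list_def)
  have "{a, b} = {ws ! 0, ws ! 1} \<or> {a, b} = {ws ! 0, ws ! (length ws - 1)}"
    using cycle_list_edges_at_start(1)[OF ws(1), of "{a, b}"] e ws(2) by simp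
  then show ?thesis
  proof
    assume ab: "{a, b} = {ws ! 0, ws ! 1}"
    have "VS - {a, b} = nth ws ` {2..length ws - 1}"
      by (rule sub[OF ws(1) _ ab]) (use n in auto)
    then show ?thesis unfolding conn_def using cycle_list_segment[OF ws(1), of 2 _ "length ws - 1"] n by auto
  next
    assume ab: "{a, b} = {ws ! 0, ws ! (length ws - 1)}"
    have "VS - {a, b} = nth ws ` {1..length ws - 2}"
      by (rule sub[OF ws(1) _ ab]) (use n in auto)
    then show ?thesis unfolding conn_def using cycle_list_segment[OF ws(1), of 1 _ "length ws - 2"] n by auto
  qed
qed

section \<open>Embeddings force convex embeddability\<close>

context convex_combination
begin

text \<open>A maximum over \<open>K\<close> above all values at the attachments would spread by
  averaging to the whole graph, although \<open>K\<close> contains no external vertex.\<close>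

lemma max_principle:
  assumes K: "K \<subseteq> V - ext" and le: "\<And>y. y \<in> nbrs E K \<Longrightarrow> d \<bullet> f y \<le> t" and u: "u \<in> K"
  shows "d \<bullet> f u \<le> t"
proof (rule ccontr)
  assume gt: "\<not> d \<bullet> f u \<le> t"
  have "finite K" using K finite_V finite_subset by blast
  then obtain m where m: "m \<in> K" "\<forall>z\<in>K. d \<bullet> f z \<le> d \<bullet> f m" using finite_maximizer[of K "\<lambda>z. d \<bullet> f z"] u by blast
  then have mt: "t < d \<bullet> f m" using gt u by fastforce
  define S where "S = {x\<in>K. d \<bullet> f x = d \<bullet> f m}"
  have "S = V"
  proof (rule closed_eq_V[of S m])
    fix x y assume x: "x \<in> S" and xy: "{x, y} \<in> E"
    have le': "d \<bullet> f v \<le> d \<bullet> f x" if "{x, v} \<in> E" for v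
    proof (cases "v \<in> K")
      case True then show ?thesis using m(2) x by (simp add: S_def)
    next
      case False
      then have "v \<in> nbrs E K" using that x by (auto simp: nbrs_def S_def)
      then show ?thesis using le mt x by (fastforce simp: S_def)
    qed
    have "x \<in> V - ext" using x K by (auto simp: S_def)
    then have eq: "d \<bullet> f y = d \<bullet> f x" by (rule average[OF _ le' xy])
    have "y \<in> K"
    proof (rule ccontr)
      assume "y \<notin> K"
      then have "y \<in> nbrs E K" using xy x by (auto simp: nbrs_def S_def)
      then show False using le mt eq x by (fastforce simp: S_def)
    qed
    then show "y \<in> S" using eq x by (simp add: S_def)
  qed (use m K in \<open>auto simp: S_def\<close>)
  then have "ext = {}" using K ext_subset by (auto simp: S_def)
  then show False using ext_not_small by simp
qed

end

text \<open>For \<open>x\<close> in \<open>S\<close>, the component of \<open>x\<close> in the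
  subgraph induced by \<open>S\<close>.\<close>

definition reach :: "'v set set \<Rightarrow> 'v set \<Rightarrow> 'v \<Rightarrow> 'v set" where
  "reach E S x = {y\<in>S. (x, y) \<in> (steps (inner_edges E S))\<^sup>*}"

lemma reach_closed:
  assumes "u \<in> reach E S x" "{u, w} \<in> E" "w \<in> S"
  shows "w \<in> reach E S x"
proof -
  have "(u, w) \<in> steps (inner_edges E S)" using assms by (auto simp: reach_def inner_edges_def)
  then show ?thesis using assms by (auto simp: reach_def intro: rtrancl_into_rtrancl)
qed

lemma reach_path:
  assumes "(x, y) \<in> (steps (inner_edges E S))\<^sup>*" "x \<in> S"
  shows "y \<in> S \<and> (x, y) \<in> (steps (inner_edges E (reach E S x)))\<^sup>*"
  using assms(1)
proof induction
  case (step y z)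
  have "{y, z} \<in> E" "y \<in> S" "z \<in> S" using step(2) by (auto simp: inner_edges_def)
  moreover have "(x, z) \<in> (steps (inner_edges E S))\<^sup>*" by (rule rtrancl_into_rtrancl[OF step(1,2)])
  ultimately have "{y, z} \<in> inner_edges E (reach E S x)"
    using step(1) by (auto simp: inner_edges_def reach_def)
  then show ?case using step(3) \<open>z \<in> S\<close> by (auto intro: rtrancl_into_rtrancl)
qed (use assms(2) in simp)

lemma conn_reach: "x \<in> S \<Longrightarrow> conn E (reach E S x)"
  unfolding conn_def
proof (intro ballI)
  fix u v assume x: "x \<in> S" and "u \<in> reach E S x" "v \<in> reach E S x"
  then have "(x, u) \<in> (steps (inner_edges E S))\<^sup>*" "(x, v) \<in> (steps (inner_edges E S))\<^sup>*"
    by (simp_all add: reach_def)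
  then have "(x, u) \<in> (steps (inner_edges E (reach E S x)))\<^sup>*" "(x, v) \<in> (steps (inner_edges E (reach E S x)))\<^sup>*"
    using reach_path[OF _ x] by blast+
  then show "(u, v) \<in> (steps (inner_edges E (reach E S x)))\<^sup>*" using steps_rtrancl_sym rtrancl_trans by metis
qed

lemma reach_disjoint:
  assumes "y \<in> S" "y \<notin> reach E S x"
  shows "reach E S x \<inter> reach E S y = {}"
proof (rule ccontr)
  assume "\<not> ?thesis"
  then obtain z where "(x, z) \<in> (steps (inner_edges E S))\<^sup>*" "(y, z) \<in> (steps (inner_edges E S))\<^sup>*"
    by (auto simp: reach_def)
  then have "(x, y) \<in> (steps (inner_edges E S))\<^sup>*" using steps_rtrancl_sym rtrancl_trans by metis
  then show False using assms by (simp add: reach_def)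
qed

section \<open>Face boundaries in the presence of an embedding\<close>

locale straight_map = convex_combination V E pos c f
  for V :: "'v set" and E :: "'v set set" and pos c f +
  assumes emb: "is_straight_embedding V E f"
begin

lemma inj_f: "u \<in> V \<Longrightarrow> v \<in> V \<Longrightarrow> f u = f v \<longleftrightarrow> u = v"
  and vertex_off: "{u, v} \<in> E \<Longrightarrow> w \<in> V \<Longrightarrow> f w \<notin> open_segment (f u) (f v)"
  using emb unfolding is_straight_embedding_def inj_on_def by blast+

lemma internal_neq_V: "K \<subseteq> V - ext \<Longrightarrow> K \<noteq> V"
  using ext_not_small[of undefined undefined] ext_subset by blast

text \<open>With \<open>a\<close> as only attachment, the maximum principle in the direction
  \<open>f u - f a\<close> gives \<open>f u = f a\<close>, against injectivity.\<close>

lemma internal_nbrs_not_single: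
  assumes K: "K \<subseteq> V - ext" "K \<noteq> {}"
  shows "\<not> nbrs E K \<subseteq> {a}"
proof
  assume sub: "nbrs E K \<subseteq> {a}"
  have "nbrs E K \<noteq> {}" using nbrs_nonempty[of K] K internal_neq_V[OF K(1)] by blast
  then have a: "a \<in> nbrs E K" using sub by blast
  then have aV: "a \<in> V" "a \<notin> K" using nbrs_subset_V by (auto simp: nbrs_def)
  obtain u where u: "u \<in> K" using K by blast
  have "(f u - f a) \<bullet> f u \<le> (f u - f a) \<bullet> f a"
    by (rule max_principle[OF K(1) _ u]) (use sub in auto)
  then have "(f u - f a) \<bullet> (f u - f a) \<le> 0" by (simp add: inner_diff_right)
  then have "f u = f a" by (metis eq_iff_diff_eq_0 inner_eq_zero_iff inner_ge_zero order_antisym)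
  then show False using inj_f[of u a] u K aV by auto
qed

text \<open>The external cycle stays connected when a vertex is removed. Whatever it does not reach
  would be internal with \<open>v\<close> as only attachment.\<close>

lemma conn_minus_vertex: "conn E (V - {v})"
proof -
  let ?S = "V - {v}"
  obtain z where z: "z \<in> ext" "z \<noteq> v" using ext_not_small[of v v] by blast
  have zS: "z \<in> ?S" using z ext_subset by blast
  have ext: "ext - {v} \<subseteq> reach E ?S z"
  proof
    fix w assume w: "w \<in> ext - {v}"
    have "z \<in> FV Fo - {v}" "w \<in> FV Fo - {v}" using z w by (auto simp: ext_eq)
    then have zw: "(z, w) \<in> (steps (inner_edges (FE Fo) (FV Fo - {v})))\<^sup>*"
      using cycle_minus_vertex[OF Fo_cycle, of v] unfolding conn_def by blast
    have "inner_edges (FE Fo) (FV Fo - {v}) \<subseteq> inner_edges E ?S"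
      by (auto simp: inner_edges_def bd_edges_def bd_vertices_def)
    then have "(z, w) \<in> (steps (inner_edges E ?S))\<^sup>*" by (rule steps_mono[OF _ zw])
    then show "w \<in> reach E ?S z" using w ext_subset by (auto simp: reach_def)
  qed
  define K where "K = ?S - reach E ?S z"
  have "nbrs E K \<subseteq> {v}"
  proof
    fix y assume "y \<in> nbrs E K"
    then obtain x where x: "x \<in> K" "{x, y} \<in> E" "y \<notin> K" by (auto simp: nbrs_def)
    show "y \<in> {v}"
    proof (rule ccontr)
      assume "y \<notin> {v}"
      then have "y \<in> reach E ?S z" using x edge_ends[OF x(2)] by (auto simp: K_def)
      then show False using reach_closed[of y E ?S z x] x by (auto simp: K_def insert_commute)
    qed
  qed
  moreover have "K \<subseteq> V - ext" using ext by (auto simp: K_def)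
  ultimately have "K = {}" using internal_nbrs_not_single by blast
  then have "reach E ?S z = ?S" by (auto simp: K_def reach_def)
  then show ?thesis using conn_reach[OF zS, of E] by simp
qed

lemma star_two: "v \<in> V \<Longrightarrow> \<exists>x y. x \<noteq> y \<and> {v, x} \<in> star v \<and> {v, y} \<in> star v"
proof (cases "v \<in> ext")
  case True
  then show ?thesis using ext_neighbours[OF True] by (auto simp: star_doubleton bd_edges_def)
next
  case False
  assume "v \<in> V"
  then have K: "{v} \<subseteq> V - ext" "{v} \<noteq> {}" using False by auto
  obtain x where x: "x \<in> nbrs E {v}" using internal_nbrs_not_single[OF K] by blast
  obtain y where y: "y \<in> nbrs E {v}" "y \<noteq> x" using internal_nbrs_not_single[OF K, of x] by blast
  show ?thesis using x y by (intro exI[of _ x] exI[of _ y]) (auto simp: nbrs_def star_doubleton)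
qed

text \<open>Two boundary edges exist by the local analysis at \<open>v\<close>. A third would
  contradict \<open>not_three_crossing_edges\<close> for the connected pieces \<open>V - {v}\<close>
  and \<open>{v}\<close>.\<close>

lemma face_vertex_degree:
  assumes F: "face F" "v \<in> FV F"
  shows "\<exists>x y. x \<noteq> y \<and> x \<noteq> v \<and> y \<noteq> v \<and> (\<forall>e. e \<in> FE F \<and> v \<in> e \<longleftrightarrow> e = {v, x} \<or> e = {v, y})"
proof -
  have vV: "v \<in> V" using F FV_iff by blast
  obtain s t where st: "s \<noteq> t" "{v, s} \<in> star v" "{v, t} \<in> star v" using star_two[OF vV] by blast
  have "star v \<inter> FE F \<noteq> {}" by (rule face_edge_at_vertex[OF F]) (use st in auto)
  then obtain e1 where e1: "e1 \<in> star v" "e1 \<in> FE F" by blast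
  obtain e' where e': "e' \<in> star v" "e' \<noteq> e1" using st by (metis doubleton_eq_iff)
  obtain e2 where e2: "e2 \<in> star v \<inter> FE F" "e2 \<noteq> e1" using face_second_edge_at_vertex[OF F e1(1) e'] .
  obtain x where x: "e1 = {v, x}" "x \<noteq> v" "x \<in> V" using star_edge[OF e1(1)] by blast
  obtain y where y: "e2 = {v, y}" "y \<noteq> v" "y \<in> V" using star_edge[of e2 v] e2(1) by blast
  have xy: "x \<noteq> y" using x y e2(2) by blast
  have only: "e = {v, x} \<or> e = {v, y}" if e: "e \<in> FE F" "v \<in> e" for e
  proof (rule ccontr)
    assume no: "\<not> ?thesis"
    have "e \<in> star v" using e by (simp add: star_def bd_edges_def)
    then obtain z where z: "e = {v, z}" "z \<noteq> v" "z \<in> V" using star_edge by blast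
    have c1: "conn E {v}" by (simp add: conn_def)
    show False
      by (rule not_three_crossing_edges[OF _ conn_minus_vertex[of v] _ c1, where F=F and ?a1.0=x and ?a2.0=y and ?a3.0=z
            and ?b1.0=v and ?b2.0=v and ?b3.0=v])
        (use x y z e1 e2 e no xy F vV in \<open>auto simp: insert_commute doubleton_eq_iff\<close>)
  qed
  have "e \<in> FE F \<and> v \<in> e \<longleftrightarrow> e = {v, x} \<or> e = {v, y}" for e
    using only[of e] e1 e2 x(1) y(1) by auto
  then show ?thesis using xy x y by blast
qed

lemma connected_X: "connected X"
proof -
  have "{(x, y). {x, y} \<in> E} = steps E" by (simp add: steps_def)
  moreover have inner: "inner_edges E V = E" using edge_subset by (auto simp: inner_edges_def)
  ultimately have "conn E V" using conG by (simp add: conn_def graph_connected_def)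
  then have "path_connected (img V)" by (rule path_connected_img) simp
  moreover have "img V = X" by (simp add: img_def inner graph_image_def)
  ultimately show ?thesis using path_connected_imp_connected by metis
qed

lemma connected_frontier_face: "face F \<Longrightarrow> connected (frontier F)"
  using connected_frontier_component_complement[OF connected_X] face_component by blast

lemma frontier_edges:
  assumes "face F" shows "frontier F = (\<Union>e\<in>FE F. P e)"
proof (rule frontier_eq_edges[OF assms])
  fix v assume "v \<in> FV F"
  then obtain x y where "\<forall>e. e \<in> FE F \<and> v \<in> e \<longleftrightarrow> e = {v, x} \<or> e = {v, y}" using face_vertex_degree[OF assms] by metis
  then show "\<exists>e\<in>FE F. v \<in> e" by metis
qed

text \<open>The frontier of a face is connected because the whole drawing is; two classes of
  boundary vertices would split it into disjoint closed sets.\<close>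

lemma face_vertices_connected:
  assumes F: "face F" and uv: "u \<in> FV F" "v \<in> FV F"
  shows "(u, v) \<in> (steps (FE F))\<^sup>*"
proof (rule ccontr)
  assume no: "(u, v) \<notin> (steps (FE F))\<^sup>*"
  define W where "W = {w. (u, w) \<in> (steps (FE F))\<^sup>*}"
  define E1 where "E1 = {e\<in>FE F. e \<inter> W \<noteq> {}}"
  define E2 where "E2 = FE F - E1"
  have FEE: "FE F \<subseteq> E" by (auto simp: bd_edges_def)
  have E1W: "e \<subseteq> W" if "e \<in> E1" for e
  proof -
    obtain w where w: "w \<in> e" "w \<in> W" "e \<in> FE F" using \<open>e \<in> E1\<close> by (auto simp: E1_def)
    then obtain z where z: "e = {w, z}" using edge_other[of e w] FEE by blast
    then have "(w, z) \<in> steps (FE F)" using w by simp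
    then have "z \<in> W" using w(2) by (auto simp: W_def intro: rtrancl_into_rtrancl)
    then show ?thesis using w z by simp
  qed
  have cl: "closed (\<Union>e\<in>E1. P e)" "closed (\<Union>e\<in>E2. P e)"
    using FEE finite_E compact_P unfolding E1_def E2_def
    by (auto intro!: closed_UN compact_imp_closed intro: finite_subset[of _ E])
  have fr: "frontier F = (\<Union>e\<in>E1. P e) \<union> (\<Union>e\<in>E2. P e)"
    unfolding frontier_edges[OF F] by (auto simp: E1_def E2_def)
  have dis: "(\<Union>e\<in>E1. P e) \<inter> (\<Union>e\<in>E2. P e) = {}"
  proof -
    have "P e1 \<inter> P e2 = {}" if e: "e1 \<in> E1" "e2 \<in> E2" for e1 e2
    proof -
      have "e1 \<inter> e2 = {}" using E1W[OF e(1)] e(2) by (auto simp: E1_def E2_def)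
      moreover have "e1 \<in> E" "e2 \<in> E" "e1 \<noteq> e2" using e FEE by (auto simp: E1_def E2_def)
      ultimately show ?thesis using edges_meet[of e1 e2] by auto
    qed
    then show ?thesis by blast
  qed
  have ed: "\<exists>e\<in>FE F. w \<in> e" if w: "w \<in> FV F" for w
  proof -
    obtain x y where "\<forall>e. e \<in> FE F \<and> w \<in> e \<longleftrightarrow> e = {w, x} \<or> e = {w, y}" using face_vertex_degree[OF F w] by metis
    then show ?thesis by metis
  qed
  have "u \<in> W" "v \<notin> W" using no by (auto simp: W_def)
  obtain e1 where e1: "e1 \<in> FE F" "u \<in> e1" using ed[OF uv(1)] by blast
  then have "e1 \<in> E1" using \<open>u \<in> W\<close> by (auto simp: E1_def)
  moreover obtain e2 where e2: "e2 \<in> FE F" "v \<in> e2" using ed[OF uv(2)] by blast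
  then have "e2 \<in> E2" using \<open>v \<notin> W\<close> E1W[of e2] by (auto simp: E2_def)
  moreover have "P e1 \<noteq> {}" "P e2 \<noteq> {}" by auto
  ultimately have ne: "(\<Union>e\<in>E1. P e) \<noteq> {}" "(\<Union>e\<in>E2. P e) \<noteq> {}" by blast+
  show False
    using connected_closedD[OF connected_frontier_face[OF F] _ _ cl] dis ne unfolding fr
    by (simp add: Int_Un_distrib)
qed

sublocale simple_faces
proof
  fix F assume F: "face F"
  show "simple_cycle (FV F) (FE F)"
  proof (rule two_regular_cycle)
    show "finite (FV F)" using finite_V by (simp add: bd_vertices_def)
    have sub: "e \<subseteq> FV F \<and> e \<noteq> {}" if "e \<in> FE F" for e
      using FE_subset_FV[OF F that] edgeE[of e] that by (auto simp: bd_edges_def)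
    then show "\<And>e. e \<in> FE F \<Longrightarrow> e \<subseteq> FV F \<and> e \<noteq> {}" .
    obtain z where "z \<in> V" using ext_subset ext_not_small[of undefined undefined] by blast
    then have "F \<noteq> UNIV" using face_disjoint_X[OF F] pos_in_X by blast
    then have "frontier F \<noteq> {}" using face_nonempty[OF F] frontier_eq_empty by blast
    then obtain e where "e \<in> FE F" using frontier_edges[OF F] by blast
    then show "FV F \<noteq> {}" using sub by blast
  qed (use face_vertex_degree[OF F] face_vertices_connected[OF F] in blast)+
qed

text \<open>A loop through \<open>F\<close> and \<open>F'\<close> that meets the graph in \<open>a\<close> and \<open>b\<close> only separates the two
  boundary arcs of \<open>F\<close> between \<open>a\<close> and \<open>b\<close>.\<close>

lemma no_link_across:
  assumes F: "face F" "face F'" "F \<noteq> F'" and ab: "a \<in> FV F" "a \<in> FV F'" "b \<in> FV F" "b \<in> FV F'" "a \<noteq> b"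
    and nab: "{a, b} \<notin> FE F" and xy: "star a \<inter> FE F = {{a, x}, {a, y}}"
    and A: "compact A" "connected A" "A \<inter> F = {}" "A \<inter> F' = {}" "pos a \<notin> A" "pos b \<notin> A" "pos x \<in> A" "pos y \<in> A"
  shows False
proof -
  \<comment> \<open>\<open>P1\<close> consists of the two edges at \<open>a\<close> and
    \<open>P2\<close> of the rest of the boundary. They meet at most at \<open>x\<close> and
    \<open>y\<close>, where \<open>A\<close> passes; \<open>a\<close> and \<open>b\<close> are the
    two crossing points for \<open>not_crossing_cycle\<close>.\<close>
  define P1 where "P1 = P {a, x} \<union> P {a, y}"
  define P2 where "P2 = (\<Union>e\<in>FE F - star a. P e)"
  have FEE: "FE F \<subseteq> E" by (auto simp: bd_edges_def)
  have ed: "{a, x} \<in> FE F" "{a, y} \<in> FE F" "{a, x} \<in> star a" "{a, y} \<in> star a" using xy by (metis IntE insertCI)+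
  then have E: "{a, x} \<in> E" "{a, y} \<in> E" using FEE by auto
  have V: "a \<in> V" "b \<in> V" using ab FV_iff[OF F(1)] by auto
  have fr: "frontier F = P1 \<union> P2"
  proof -
    have "FE F = {{a, x}, {a, y}} \<union> (FE F - star a)" using xy by (metis Int_commute Un_Diff_Int Un_commute)
    then have "(\<Union>e\<in>FE F. P e) = (\<Union>e\<in>{{a, x}, {a, y}} \<union> (FE F - star a). P e)" by (rule arg_cong)
    then show ?thesis unfolding frontier_face_edges[OF F(1)] P1_def P2_def by (simp add: Un_assoc)
  qed
  have cut: "P {a, z} \<inter> P2 \<subseteq> {pos z}" if "{a, z} \<in> E" for z
  proof
    fix p assume p: "p \<in> P {a, z} \<inter> P2"
    then obtain e where e: "e \<in> FE F" "e \<notin> star a" "p \<in> P e" by (auto simp: P2_def)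
    then have "a \<notin> e" "e \<in> E" using FEE by (auto simp: star_def)
    then have "P {a, z} \<inter> P e \<subseteq> pos ` ({a, z} \<inter> e)" using edges_meet[OF that, of e] by auto
    then show "p \<in> {pos z}" using p e(3) \<open>a \<notin> e\<close> by auto
  qed
  have P12: "P1 \<inter> P2 \<subseteq> A" using cut[OF E(1)] cut[OF E(2)] A(7,8) by (auto simp: P1_def)
  have cP: "compact P1" "compact P2"
    using compact_P E FEE finite_E unfolding P1_def P2_def
    by (auto intro!: compact_UN intro: finite_subset[of _ E])
  have PX: "P1 \<union> P2 \<subseteq> X" using fr frontier_face_subset[OF F(1)] by simp
  have dis: "F \<inter> (A \<union> P1 \<union> P2) = {}" "F' \<inter> (A \<union> P1 \<union> P2) = {}"
    using PX A(3,4) face_disjoint_X[OF F(1)] face_disjoint_X[OF F(2)] by blast+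
  have "pos a \<notin> P2" using pos_on_edge[OF _ V(1)] FEE by (auto simp: P2_def star_def)
  moreover have "pos b \<notin> P1"
    using pos_on_edge[OF E(1) V(2)] pos_on_edge[OF E(2) V(2)] nab ed ab(5) by (auto simp: P1_def)
  moreover have "pos a \<in> closure F \<inter> closure F'" "pos b \<in> closure F \<inter> closure F'"
    using ab FV_iff[OF F(1)] FV_iff[OF F(2)] by auto
  moreover obtain z w where zw: "z \<in> F" "w \<in> F'" using face_nonempty F by blast
  ultimately have "connected_component (- (A \<union> P1 \<union> P2)) z w"
    by (intro not_crossing_cycle[OF A(1,2) cP P12 face_connected[OF F(1)] dis(1) face_connected[OF F(2)] dis(2), of "pos a" "pos b"])
      (use A in auto)
  then obtain C where C: "connected C" "C \<subseteq> - (A \<union> P1 \<union> P2)" "z \<in> C" "w \<in> C"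
    unfolding connected_component_def by blast
  \<comment> \<open>The connection found would lead from \<open>F\<close> to another face without
    meeting the frontier of \<open>F\<close>.\<close>
  have "w \<notin> F" using face_eq[OF F(1,2)] F(3) zw by blast
  then have "C \<inter> frontier F \<noteq> {}" using connected_Int_frontier[OF C(1), of F] C(3,4) zw by blast
  then show False using C(2) fr by blast
qed

text \<open>A whole external edge might end at \<open>a\<close> or \<open>b\<close>; the bridge
  below may use only its part up to an inner point.\<close>

lemma half_edge:
  assumes e: "{u, w} \<in> E" and q: "q \<in> op {u, w}"
  shows "\<exists>B. compact B \<and> connected B \<and> pos u \<in> B \<and> q \<in> B \<and> B \<subseteq> P {u, w} \<and> pos w \<notin> B"
proof -
  obtain g where g: "arc g" "path_image g = P {u, w}" "pathstart g = pos u" "pathfinish g = pos w" using edge_arc[OF e] .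
  have "q \<in> path_image g" "q \<noteq> pos w" using q g(2) by (auto simp: op_def)
  then obtain s where s: "0 \<le> s" "s \<le> 1" "q = g s" by (auto simp: path_image_def)
  have s1: "s < 1" using s \<open>q \<noteq> pos w\<close> g(4) by (cases "s = 1") (auto simp: pathfinish_def)
  have "pos w \<notin> g ` {0..s}"
  proof
    assume "pos w \<in> g ` {0..s}"
    then obtain r where "0 \<le> r" "r \<le> s" "g r = g 1" using g(4) by (auto simp: pathfinish_def)
    moreover have "inj_on g {0..1}" using g(1) by (simp add: arc_def)
    ultimately have "r = 1" using s1 by (auto dest: inj_onD)
    then show False using \<open>r \<le> s\<close> s1 by simp
  qed
  moreover have "pos u \<in> g ` {0..s}"
    by (rule image_eqI[of _ _ 0]) (use g(3) s in \<open>auto simp: pathstart_def\<close>)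
  moreover have "g ` {0..s} \<subseteq> P {u, w}" using g(2) s by (auto simp: path_image_def)
  ultimately show ?thesis
    using arc_subset_connected[OF g(1), of 0 s] s by (intro exI[of _ "g ` {0..s}"]) auto
qed

text \<open>An arc through the external face joins inner points of two external edges, one at each
  piece; half edges and the drawings of the pieces complete it to a connected set.\<close>

lemma outer_bridge:
  assumes K: "K1 \<subseteq> V" "K2 \<subseteq> V" "conn E K1" "conn E K2" and ab: "a \<in> V - (K1 \<union> K2)" "b \<in> V - (K1 \<union> K2)"
    and u: "u1 \<in> K1" "u1 \<in> ext" "u2 \<in> K2" "u2 \<in> ext" and sep: "\<And>p q. p \<in> K1 \<Longrightarrow> q \<in> K2 \<Longrightarrow> {p, q} \<notin> E" "K1 \<inter> K2 = {}"
  shows "\<exists>A. compact A \<and> connected A \<and> pos ` (K1 \<union> K2) \<subseteq> A \<and> A \<subseteq> X \<union> Fo \<and> pos a \<notin> A \<and> pos b \<notin> A"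
proof -
  obtain w1 where w1: "{u1, w1} \<in> FE Fo" using ext_neighbours[OF u(2)] by blast
  obtain w2 where w2: "{u2, w2} \<in> FE Fo" using ext_neighbours[OF u(4)] by blast
  have e: "{u1, w1} \<in> E" "{u2, w2} \<in> E" using w1 w2 by (auto simp: bd_edges_def)
  have ne: "{u1, w1} \<noteq> {u2, w2}" using sep u e by (auto simp: doubleton_eq_iff)
  \<comment> \<open>Accessible points are dense in the frontier, so every nonempty relatively open
    part of it, such as an open external edge, contains one.\<close>
  have opn: "openin (top_of_set (frontier Fo)) (op e)" if "e \<in> FE Fo" for e
  proof -
    have eE: "e \<in> E" using that by (auto simp: bd_edges_def)
    have "op e \<subseteq> frontier Fo" using that by (auto simp: bd_edges_def op_def)
    moreover have "frontier Fo \<subseteq> without e \<union> op e"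
      using frontier_face_subset[OF face_Fo] without_Un[OF eE] P_split[OF eE] P_without[OF eE] by blast
    ultimately have "op e = frontier Fo \<inter> - without e" using op_without[OF eE] by blast
    moreover have "open (- without e)" using compact_imp_closed[OF compact_without] by (rule open_Compl)
    ultimately show ?thesis unfolding openin_open by blast
  qed
  have opne: "op {u1, w1} \<noteq> op {u2, w2}"
    using op_disjoint[OF e ne] op_nonempty[OF e(1)] P_split[OF e(2)] by blast
  obtain g where g: "arc g" "pathstart g \<in> op {u1, w1}" "pathfinish g \<in> op {u2, w2}" "g ` {0<..<1} \<subseteq> Fo"
    using dense_accessible_frontier_point_pairs[OF face_open[OF face_Fo] face_connected[OF face_Fo]
        opn[OF w1] opn[OF w2] op_nonempty[OF e(1)] op_nonempty[OF e(2)] opne] .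
  have gim: "path_image g \<subseteq> Fo \<union> op {u1, w1} \<union> op {u2, w2}"
    using g(2-4) arc_image_interior[OF g(1)] by auto
  obtain B1 where B1: "compact B1" "connected B1" "pos u1 \<in> B1" "pathstart g \<in> B1" "B1 \<subseteq> P {u1, w1}" "pos w1 \<notin> B1"
    using half_edge[OF e(1) g(2)] by blast
  obtain B2 where B2: "compact B2" "connected B2" "pos u2 \<in> B2" "pathfinish g \<in> B2" "B2 \<subseteq> P {u2, w2}" "pos w2 \<notin> B2"
    using half_edge[OF e(2) g(3)] by blast
  define A where "A = img K1 \<union> B1 \<union> path_image g \<union> (B2 \<union> img K2)"
  have pu: "pos u1 \<in> img K1" "pos u2 \<in> img K2" using u by (auto simp: img_def)
  have ci: "connected (img K1)" "connected (img K2)" using path_connected_img K path_connected_imp_connected by blast+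
  have "connected (img K1 \<union> B1)" by (rule connected_Un[OF ci(1) B1(2)]) (use pu B1 in auto)
  then have c1: "connected (img K1 \<union> B1 \<union> path_image g)"
    by (rule connected_Un) (use g(1) B1(4) in \<open>auto intro: connected_path_image arc_imp_path\<close>)
  have c2: "connected (B2 \<union> img K2)" by (rule connected_Un[OF B2(2) ci(2)]) (use pu B2 in auto)
  have "connected A" unfolding A_def by (rule connected_Un[OF c1 c2]) (use B2(4) in auto)
  moreover have "compact A" unfolding A_def
    using compact_img K B1(1) B2(1) g(1) by (intro compact_Un) (auto intro: compact_arc_image)
  moreover have "pos ` (K1 \<union> K2) \<subseteq> A" by (auto simp: A_def img_def)
  moreover have "A \<subseteq> X \<union> Fo"
    using img_subset_X[OF K(1)] img_subset_X[OF K(2)] P_subset_X[OF e(1)] P_subset_X[OF e(2)] B1(5) B2(5) gim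
    unfolding A_def op_def by blast
  moreover have "pos v \<notin> A" if v: "v \<in> V - (K1 \<union> K2)" for v
  proof -
    have "pos v \<notin> img K1" "pos v \<notin> img K2" using pos_in_img K v by auto
    moreover have "pos v \<notin> B1" using pos_on_edge[OF e(1), of v] B1(5,6) v u by auto
    moreover have "pos v \<notin> B2" using pos_on_edge[OF e(2), of v] B2(5,6) v u by auto
    moreover have "pos v \<notin> path_image g"
      using gim op_not_pos[OF e(1), of v] op_not_pos[OF e(2), of v] face_disjoint_X[OF face_Fo] pos_in_X[of v] v by blast
    ultimately show ?thesis by (simp add: A_def)
  qed
  ultimately show ?thesis using ab by blast
qed

section \<open>Internal pieces attached at two vertices\<close>

definition pendant :: "'v \<Rightarrow> 'v \<Rightarrow> 'v set \<Rightarrow> bool" where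
  "pendant a b K \<longleftrightarrow> K \<subseteq> V - ext \<and> K \<noteq> {} \<and> conn E K \<and> nbrs E K \<subseteq> {a, b} \<and> a \<in> V - K \<and> b \<in> V - K \<and> a \<noteq> b"

lemma reach_facts:
  assumes "x \<in> V - {a, b}"
  defines "K \<equiv> reach E (V - {a, b}) x"
  shows "x \<in> K" "K \<subseteq> V - {a, b}" "conn E K" "nbrs E K \<subseteq> {a, b}" "path_connected (img K)"
proof -
  show "x \<in> K" "K \<subseteq> V - {a, b}" using assms by (auto simp: reach_def)
  show "conn E K" unfolding K_def by (rule conn_reach) (use assms in simp)
  then show "path_connected (img K)" using \<open>K \<subseteq> V - {a, b}\<close> path_connected_img by blast
  show "nbrs E K \<subseteq> {a, b}"
  proof
    fix y assume "y \<in> nbrs E K"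
    then obtain z where z: "z \<in> K" "{z, y} \<in> E" "y \<notin> K" by (auto simp: nbrs_def)
    then show "y \<in> {a, b}" using reach_closed[of z E "V - {a, b}" x y] edge_ends[OF z(2)] by (auto simp: K_def)
  qed
qed

text \<open>If \<open>x\<close> and \<open>y\<close> were in one component off \<open>a\<close> and
  \<open>b\<close>, its drawing would link the two arcs against \<open>no_link_across\<close>. A
  component without external vertices is the desired piece.\<close>

lemma two_sides:
  assumes F: "face F" "face F'" "F \<noteq> F'" and ab: "a \<in> FV F" "a \<in> FV F'" "b \<in> FV F" "b \<in> FV F'" "a \<noteq> b"
    and nab: "{a, b} \<notin> FE F"
  shows "(\<exists>K. pendant a b K \<and> K \<inter> FV F \<noteq> {}) \<or>
    (\<exists>x y. x \<in> V - {a, b} \<and> y \<in> V - {a, b} \<and> star a \<inter> FE F = {{a, x}, {a, y}} \<and> y \<notin> reach E (V - {a, b}) x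
      \<and> reach E (V - {a, b}) x \<inter> ext \<noteq> {} \<and> reach E (V - {a, b}) y \<inter> ext \<noteq> {})"
proof -
  have V: "a \<in> V" "b \<in> V" using ab FV_iff[OF F(1)] by auto
  obtain x y where xy: "x \<noteq> y" "x \<noteq> a" "y \<noteq> a" "x \<in> FV F" "y \<in> FV F" "star a \<inter> FE F = {{a, x}, {a, y}}"
    using face_two_edges[OF F(1) ab(1)] by metis
  have ed: "{a, x} \<in> FE F" "{a, y} \<in> FE F" using xy(6) by (metis IntE insertCI)+
  then have "x \<noteq> b" "y \<noteq> b" using nab by auto
  then have S: "x \<in> V - {a, b}" "y \<in> V - {a, b}" using xy FV_iff[OF F(1)] by auto
  note kx = reach_facts[OF S(1)] note ky = reach_facts[OF S(2)]
  show ?thesis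
  proof (cases "reach E (V - {a, b}) x \<inter> ext = {} \<or> reach E (V - {a, b}) y \<inter> ext = {}")
    case True
    then show ?thesis
    proof
      assume "reach E (V - {a, b}) x \<inter> ext = {}"
      then have "pendant a b (reach E (V - {a, b}) x)" using kx V ab(5) unfolding pendant_def by blast
      then show ?thesis using kx(1) xy(4) by blast
    next
      assume "reach E (V - {a, b}) y \<inter> ext = {}"
      then have "pendant a b (reach E (V - {a, b}) y)" using ky V ab(5) unfolding pendant_def by blast
      then show ?thesis using ky(1) xy(5) by blast
    qed
  next
    case False
    have "y \<notin> reach E (V - {a, b}) x"
    proof
      assume y: "y \<in> reach E (V - {a, b}) x"
      let ?K = "reach E (V - {a, b}) x"
      have KV: "?K \<subseteq> V" using kx(2) by blast
      have IX: "img ?K \<subseteq> X" by (rule img_subset_X[OF KV])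
      show False
      proof (rule no_link_across[OF F ab nab xy(6), of "img ?K"])
        show "compact (img ?K)" by (rule compact_img[OF KV])
        show "connected (img ?K)" using kx(5) path_connected_imp_connected by blast
        show "img ?K \<inter> F = {}" "img ?K \<inter> F' = {}" using IX face_disjoint_X F by blast+
        show "pos a \<notin> img ?K" "pos b \<notin> img ?K" using pos_in_img[OF _ KV] V kx(2) by blast+
        show "pos x \<in> img ?K" "pos y \<in> img ?K" using kx(1) y by (auto simp: img_def)
      qed
    qed
    then show ?thesis using False S xy(6) by blast
  qed
qed

text \<open>Should both components contain external vertices, \<open>outer_bridge\<close> links them
  through the external face, which is neither of the given faces, and \<open>no_link_across\<close>
  applies again.\<close>

lemma common_vertices_pendant:
  assumes F: "face F" "face F'" "F \<noteq> F'" "F \<noteq> Fo" "F' \<noteq> Fo"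
    and ab: "a \<in> FV F" "a \<in> FV F'" "b \<in> FV F" "b \<in> FV F'" "a \<noteq> b" and nab: "{a, b} \<notin> FE F"
  shows "\<exists>K. pendant a b K \<and> K \<inter> FV F \<noteq> {}"
proof (rule ccontr)
  assume "\<not> ?thesis"
  then obtain x y where xy: "x \<in> V - {a, b}" "y \<in> V - {a, b}" "star a \<inter> FE F = {{a, x}, {a, y}}"
      "y \<notin> reach E (V - {a, b}) x" "reach E (V - {a, b}) x \<inter> ext \<noteq> {}" "reach E (V - {a, b}) y \<inter> ext \<noteq> {}"
    using two_sides[OF F(1-3) ab nab] by metis
  let ?K1 = "reach E (V - {a, b}) x" and ?K2 = "reach E (V - {a, b}) y"
  note kx = reach_facts[OF xy(1)] note ky = reach_facts[OF xy(2)]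
  obtain u1 u2 where u: "u1 \<in> ?K1" "u1 \<in> ext" "u2 \<in> ?K2" "u2 \<in> ext" using xy(5,6) by blast
  have dis: "?K1 \<inter> ?K2 = {}" by (rule reach_disjoint[OF xy(2,4)])
  have V: "a \<in> V" "b \<in> V" using ab FV_iff[OF F(1)] by auto
  have "{p, q} \<notin> E" if "p \<in> ?K1" "q \<in> ?K2" for p q
    using reach_closed[OF that(1), of q] that(2) ky(2) dis by blast
  then obtain A where A: "compact A" "connected A" "pos ` (?K1 \<union> ?K2) \<subseteq> A" "A \<subseteq> X \<union> Fo" "pos a \<notin> A" "pos b \<notin> A"
    using outer_bridge[of ?K1 ?K2 a b u1 u2] kx ky V u dis by blast
  have "A \<inter> F = {}" "A \<inter> F' = {}"
    using A(4) face_disjoint_X F face_eq[OF _ face_Fo] by blast+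
  moreover have "pos x \<in> A" "pos y \<in> A" using A(3) kx(1) ky(1) by auto
  ultimately show False using no_link_across[OF F(1-3) ab nab xy(3) A(1,2)] A(5,6) by blast
qed

text \<open>A line separating \<open>f u\<close> from the segment would violate the maximum
  principle in its normal direction.\<close>

lemma pendant_on_segment:
  assumes K: "pendant a b K" and u: "u \<in> K"
  shows "f u \<in> open_segment (f a) (f b)"
proof -
  have k: "K \<subseteq> V - ext" "nbrs E K \<subseteq> {a, b}" "a \<in> V" "b \<in> V" "a \<notin> K" "b \<notin> K" using K by (auto simp: pendant_def)
  have uV: "u \<in> V" using u k by auto
  have "f u \<in> closed_segment (f a) (f b)"
  proof (rule ccontr)
    assume "f u \<notin> closed_segment (f a) (f b)"
    then obtain d t where d: "d \<bullet> f u < t" "\<forall>x\<in>closed_segment (f a) (f b). d \<bullet> x > t"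
      using separating_hyperplane_closed_point[of "closed_segment (f a) (f b)" "f u"] by auto
    have "t < d \<bullet> f a" "t < d \<bullet> f b" using d(2) by auto
    then have "- d \<bullet> f y \<le> - t" if "y \<in> nbrs E K" for y using that k(2) by auto
    then have "- d \<bullet> f u \<le> - t" by (rule max_principle[OF k(1) _ u])
    then show False using d(1) by simp
  qed
  moreover have "f u \<noteq> f a" "f u \<noteq> f b" using inj_f[OF uV] k u by auto
  ultimately show ?thesis by (simp add: open_segment_def)
qed

text \<open>Of two edges leaving \<open>p\<close> in the same direction, the nearer end would lie
  inside the other edge or coincide with its end.\<close>

lemma no_two_on_ray:
  assumes e: "{p, q} \<in> E" "{p, r} \<in> E" "q \<noteq> r" and s: "f r - f p = s *\<^sub>R (f q - f p)"
  shows "s \<le> 0"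
proof (rule ccontr)
  assume "\<not> s \<le> 0"
  then have s0: "s > 0" by simp
  have V: "p \<in> V" "q \<in> V" "r \<in> V" "p \<noteq> q" "p \<noteq> r" using edge_ends[OF e(1)] edge_ends[OF e(2)] by auto
  have r: "f r = (1 - s) *\<^sub>R f p + s *\<^sub>R f q" using s by (simp add: algebra_simps)
  consider "s < 1" | "s = 1" | "s > 1" by linarith
  then show False
  proof cases
    case 1
    then have "f r \<in> open_segment (f p) (f q)" unfolding in_segment using s0 r V inj_f by blast
    then show False using vertex_off[OF e(1) V(3)] by simp
  next
    case 2
    then show False using r V inj_f[of r q] e(3) by simp
  next
    case 3
    have "f q = (1 - 1 / s) *\<^sub>R f p + (1 / s) *\<^sub>R f r" using s0 unfolding r by (simp add: algebra_simps)
    moreover have "0 < 1 / s" "1 / s < 1" using 3 by auto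
    ultimately have "f q \<in> open_segment (f p) (f r)" unfolding in_segment using V inj_f by blast
    then show False using vertex_off[OF e(2) V(2)] by simp
  qed
qed

lemma pendant_coordinate:
  assumes K: "pendant a b K"
  shows "\<exists>\<sigma>. \<sigma> a = 0 \<and> (\<forall>v\<in>insert a (insert b K). f v = f a + \<sigma> v *\<^sub>R (f b - f a)) \<and> (\<forall>v\<in>K. 0 < \<sigma> v)"
proof -
  have "\<exists>s>0. f v = f a + s *\<^sub>R (f b - f a)" if "v \<in> insert b K" for v
  proof (cases "v = b")
    case False
    then have "f v \<in> open_segment (f a) (f b)" using pendant_on_segment[OF K, of v] \<open>v \<in> insert b K\<close> by simp
    then obtain s where "0 < s" "f v = (1 - s) *\<^sub>R f a + s *\<^sub>R f b" by (auto simp: in_segment)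
    then show ?thesis by (intro exI[of _ s]) (simp add: algebra_simps)
  qed (intro exI[of _ 1], simp)
  then obtain \<sigma> where \<sigma>: "\<And>v. v \<in> insert b K \<Longrightarrow> \<sigma> v > 0 \<and> f v = f a + \<sigma> v *\<^sub>R (f b - f a)" by metis
  have "a \<notin> insert b K" using K by (auto simp: pendant_def)
  have "f v = f a + (\<sigma>(a := 0)) v *\<^sub>R (f b - f a)" if "v \<in> insert a (insert b K)" for v
  proof (cases "v = a")
    case False
    then have "v \<in> insert b K" "(\<sigma>(a := 0)) v = \<sigma> v" using that by auto
    then show ?thesis using \<sigma> by metis
  qed simp
  moreover have "0 < (\<sigma>(a := 0)) v" if "v \<in> K" for v
  proof -
    have "v \<noteq> a" "0 < \<sigma> v" using that \<sigma>[of v] \<open>a \<notin> insert b K\<close> by blast+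
    then show ?thesis by simp
  qed
  ultimately show ?thesis by (intro exI[of _ "\<sigma>(a := 0)"] conjI ballI fun_upd_same)
qed

text \<open>All neighbours of \<open>u\<close> are mapped to the line through \<open>f a\<close> and
  \<open>f b\<close>, at most one on either side of \<open>f u\<close>.\<close>

lemma pendant_degree:
  assumes K: "pendant a b K" and u: "u \<in> K" and z: "{u, z1} \<in> E" "{u, z2} \<in> E" "{u, z3} \<in> E"
    and ne: "z1 \<noteq> z2" "z1 \<noteq> z3" "z2 \<noteq> z3"
  shows False
proof -
  obtain \<sigma> where \<sigma>: "\<forall>v\<in>insert a (insert b K). f v = f a + \<sigma> v *\<^sub>R (f b - f a)" using pendant_coordinate[OF K] by blast
  have mem: "z \<in> insert a (insert b K)" if "{u, z} \<in> E" for z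
    using that K u unfolding pendant_def nbrs_def by blast
  have dif: "f z - f u = (\<sigma> z - \<sigma> u) *\<^sub>R (f b - f a)" if "{u, z} \<in> E" for z
  proof -
    have eq: "f z = f a + \<sigma> z *\<^sub>R (f b - f a)" "f u = f a + \<sigma> u *\<^sub>R (f b - f a)" using \<sigma> mem[OF that] u by blast+
    show ?thesis by (subst eq(1), subst eq(2)) (simp add: algebra_simps)
  qed
  have nz: "\<sigma> z - \<sigma> u \<noteq> 0" if "{u, z} \<in> E" for z
  proof
    assume "\<sigma> z - \<sigma> u = 0"
    then have "f z = f u" using dif[OF that] by simp
    then show False using edge_ends[OF that] inj_f by metis
  qed
  have opp: "(\<sigma> z - \<sigma> u) * (\<sigma> z' - \<sigma> u) < 0" if "{u, z} \<in> E" "{u, z'} \<in> E" "z \<noteq> z'" for z z'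
  proof -
    have "f z' - f u = ((\<sigma> z' - \<sigma> u) / (\<sigma> z - \<sigma> u)) *\<^sub>R (f z - f u)"
      unfolding dif[OF that(1)] dif[OF that(2)] using nz[OF that(1)] by simp
    then have "(\<sigma> z' - \<sigma> u) / (\<sigma> z - \<sigma> u) \<le> 0" by (rule no_two_on_ray[OF that])
    then show ?thesis using nz[OF that(1)] nz[OF that(2)] by (auto simp: divide_le_0_iff mult_less_0_iff)
  qed
  show False using opp[OF z(1,2) ne(1)] opp[OF z(1,3) ne(2)] opp[OF z(2,3) ne(3)] by (auto simp: mult_less_0_iff)
qed

lemma pendant_attached:
  assumes "pendant a b K"
  shows "\<exists>k\<in>K. {a, k} \<in> E" "\<exists>k\<in>K. {k, b} \<in> E"
proof -
  have k: "K \<subseteq> V - ext" "K \<noteq> {}" "nbrs E K \<subseteq> {a, b}" using assms by (auto simp: pendant_def)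
  have "a \<in> nbrs E K" "b \<in> nbrs E K"
    using internal_nbrs_not_single[OF k(1,2), of b] internal_nbrs_not_single[OF k(1,2), of a] k(3) by blast+
  then show "\<exists>k\<in>K. {a, k} \<in> E" "\<exists>k\<in>K. {k, b} \<in> E" by (auto simp: nbrs_def insert_commute)
qed

text \<open>Both pieces contain the end of an edge from \<open>a\<close> in the direction of
  \<open>f b\<close>, and there is only one such edge. From its end, connectedness of
  \<open>K\<close> carries the inclusion further.\<close>

lemma pendant_subset:
  assumes K: "pendant a b K" "pendant a b K'"
  shows "K \<subseteq> K'"
proof
  fix v assume v: "v \<in> K"
  obtain k where k: "k \<in> K" "{a, k} \<in> E" using pendant_attached(1)[OF K(1)] by blast
  obtain k' where k': "k' \<in> K'" "{a, k'} \<in> E" using pendant_attached(1)[OF K(2)] by blast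
  have "k = k'"
  proof (rule ccontr)
    assume ne: "k \<noteq> k'"
    obtain s where s: "s > 0" "f k = f a + s *\<^sub>R (f b - f a)" using pendant_coordinate[OF K(1)] k(1) by blast
    obtain s' where s': "s' > 0" "f k' = f a + s' *\<^sub>R (f b - f a)" using pendant_coordinate[OF K(2)] k'(1) by blast
    have "f k' - f a = (s' / s) *\<^sub>R (f k - f a)" using s s' by simp
    then have "s' / s \<le> 0" by (rule no_two_on_ray[OF k(2) k'(2) ne])
    then show False using s s' by (simp add: divide_le_0_iff)
  qed
  show "v \<in> K'"
  proof (rule ccontr)
    assume "v \<notin> K'"
    moreover have "(k, v) \<in> (steps (inner_edges E K))\<^sup>*" using K(1) k(1) v by (simp add: pendant_def conn_def)
    moreover have "k \<in> K'" using k'(1) \<open>k = k'\<close> by simp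
    ultimately obtain p q where pq: "(p, q) \<in> steps (inner_edges E K)" "p \<in> K'" "q \<notin> K'"
      using rtrancl_switch[of k v _ "\<lambda>w. w \<in> K'"] by blast
    then have "q \<in> nbrs E K'" "q \<in> K" by (auto simp: nbrs_def inner_edges_def)
    then show False using K by (auto simp: pendant_def)
  qed
qed

text \<open>A face uses two edges at each of its boundary vertices, which inside \<open>K\<close>
  are all edges by \<open>pendant_degree\<close>. Connectedness of \<open>K\<close> passes this from
  vertex to vertex.\<close>

lemma pendant_star:
  assumes K: "pendant a b K" and F: "face F" and meets: "K \<inter> FV F \<noteq> {}" and u: "u \<in> K"
  shows "star u \<subseteq> FE F"
proof -
  have all: "star w \<subseteq> FE F" if w: "w \<in> K" "w \<in> FV F" for w
  proof
    fix e assume e: "e \<in> star w"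
    obtain x y where xy: "x \<noteq> y" "star w \<inter> FE F = {{w, x}, {w, y}}"
      using face_two_edges[OF F w(2)] by (elim exE conjE) (rule that)
    have ed: "{w, x} \<in> FE F" "{w, y} \<in> FE F" using xy(2) by (metis IntE insertCI)+
    then have E: "{w, x} \<in> E" "{w, y} \<in> E" by (auto simp: bd_edges_def)
    obtain z where z: "e = {w, z}" using star_edge[OF e] by blast
    have "{w, z} \<in> E" using e z by (simp add: star_def)
    then have "z = x \<or> z = y" using pendant_degree[OF K w(1) E(1) E(2), of z] xy(1) by blast
    then show "e \<in> FE F" using ed z by blast
  qed
  obtain u0 where u0: "u0 \<in> K" "u0 \<in> FV F" using meets by blast
  have "(u0, u) \<in> (steps (inner_edges E K))\<^sup>*" using K u0 u by (simp add: pendant_def conn_def)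
  then have "u \<in> K \<and> u \<in> FV F"
  proof induction
    case (step y z)
    have "{y, z} \<in> star y" "z \<in> K" using step(2) by (auto simp: star_def inner_edges_def)
    then have "{y, z} \<in> FE F" using all[of y] step(3) by blast
    then show ?case using FE_subset_FV[OF F] \<open>z \<in> K\<close> by blast
  qed (use u0 in simp)
  then show ?thesis using all by blast
qed

lemma common_boundary_connected:
  assumes F: "face F" "face F'" "F \<noteq> F'" "F \<noteq> Fo" "F' \<noteq> Fo"
    and ab: "a \<in> FV F" "a \<in> FV F'" "b \<in> FV F" "b \<in> FV F'"
  shows "(a, b) \<in> (steps (FE F \<inter> FE F'))\<^sup>*"
proof (cases "a = b \<or> {a, b} \<in> FE F \<inter> FE F'")
  case True
  then show ?thesis by auto
next
  case False
  then have ne: "a \<noteq> b" by blast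
  note p1 = common_vertices_pendant[OF F ab ne]
  note p2 = common_vertices_pendant[OF F(2,1) F(3)[symmetric] F(5,4) ab(2,1,4,3) ne]
  \<comment> \<open>An edge between \<open>a\<close> and \<open>b\<close> would have the images of
    the piece inside its segment.\<close>
  have no: False if h: "{a, b} \<in> E" "pendant a b K" for K
  proof -
    obtain u where u: "u \<in> K" "u \<in> V" using h(2) unfolding pendant_def by blast
    show False using pendant_on_segment[OF h(2) u(1)] vertex_off[OF h(1) u(2)] by simp
  qed
  have nE: "{a, b} \<notin> FE F" "{a, b} \<notin> FE F'"
    using no p1 p2 False by (auto simp: bd_edges_def)
  obtain K where K: "pendant a b K" "K \<inter> FV F \<noteq> {}" using p1[OF nE(1)] by blast
  obtain K' where K': "pendant a b K'" "K' \<inter> FV F' \<noteq> {}" using p2[OF nE(2)] by blast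
  \<comment> \<open>Both faces yield the same piece, so all edges at its vertices lie on both
    boundaries.\<close>
  have "K = K'" using pendant_subset[OF K(1) K'(1)] pendant_subset[OF K'(1) K(1)] by (rule subset_antisym)
  then have star: "star u \<subseteq> FE F \<inter> FE F'" if "u \<in> K" for u
    using pendant_star[OF K(1) F(1) K(2) that] pendant_star[OF K'(1) F(2) K'(2)] that by blast
  obtain k where k: "k \<in> K" "{a, k} \<in> E" using pendant_attached(1)[OF K(1)] by blast
  obtain l where l: "l \<in> K" "{l, b} \<in> E" using pendant_attached(2)[OF K(1)] by blast
  have "(a, k) \<in> steps (FE F \<inter> FE F')" using star[OF k(1)] k(2) by (auto simp: star_def)
  moreover have "inner_edges E K \<subseteq> FE F \<inter> FE F'"
  proof
    fix e assume e: "e \<in> inner_edges E K"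
    then obtain u where "u \<in> e" "e \<in> E" "u \<in> K" using edgeE[of e] by (auto simp: inner_edges_def)
    then show "e \<in> FE F \<inter> FE F'" using star[of u] by (auto simp: star_def)
  qed
  then have "(k, l) \<in> (steps (FE F \<inter> FE F'))\<^sup>*"
    using steps_mono[of "inner_edges E K"] K(1) k(1) l(1) by (simp add: pendant_def conn_def)
  moreover have "(l, b) \<in> steps (FE F \<inter> FE F')" using star[OF l(1)] l(2) by (auto simp: star_def)
  ultimately show ?thesis
    by (meson converse_rtrancl_into_rtrancl rtrancl_into_rtrancl)
qed

lemma connected_common_frontier:
  assumes F: "face F" "face F'" "F \<noteq> Fo" "F' \<noteq> Fo"
  shows "connected (frontier F \<inter> frontier F')"
proof (cases "F = F'")
  case True
  then show ?thesis using connected_frontier_face[OF F(1)] by simp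
next
  case False
  let ?S = "frontier F \<inter> frontier F'"
  have edge: "connected_component ?S p q" if "e \<in> FE F \<inter> FE F'" "p \<in> P e" "q \<in> P e" for e p q
    unfolding connected_component_def using that connected_P[of e]
    by (intro exI[of _ "P e"]) (auto simp: bd_edges_def)
  have vert: "connected_component ?S (pos a) (pos b)"
    if h: "a \<in> FV F" "a \<in> FV F'" and r: "(a, b) \<in> (steps (FE F \<inter> FE F'))\<^sup>*" for a b
    using r
  proof induction
    case base
    then show ?case using h by (simp add: bd_vertices_def connected_component_refl)
  next
    case (step y z)
    then have e: "{y, z} \<in> FE F \<inter> FE F'" by simp
    then have "{y, z} \<in> E" by (simp add: bd_edges_def)
    then show ?case using edge[OF e, of "pos y" "pos z"] pos_in_edge step(3) connected_component_trans by blast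
  qed
  have near: "\<exists>v. v \<in> FV F \<and> v \<in> FV F' \<and> connected_component ?S p (pos v)" if p: "p \<in> ?S" for p
  proof -
    have "p \<in> X" using p frontier_face_subset[OF F(1)] by blast
    then consider v where "v \<in> V" "p = pos v" | e where "e \<in> E" "p \<in> op e" by (rule X_cases)
    then show ?thesis
    proof cases
      case 1
      then have "v \<in> FV F" "v \<in> FV F'" using p by (auto simp: bd_vertices_def)
      then show ?thesis using 1 p by (intro exI[of _ v]) (simp add: connected_component_refl)
    next
      case 2
      have "p \<in> closure F" "p \<in> closure F'" using p by (auto simp: frontier_def)
      then have e: "e \<in> FE F \<inter> FE F'" using FE_if_touch F 2 by blast
      obtain u v where uv: "e = {u, v}" using edgeE[OF 2(1)] by metis
      have "u \<in> FV F" "u \<in> FV F'" using FE_subset_FV F e uv by blast+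
      moreover have "connected_component ?S p (pos u)"
        using edge[OF e, of p "pos u"] P_split[OF 2(1)] 2 pos_in_edge[OF 2(1), of u] uv by blast
      ultimately show ?thesis by blast
    qed
  qed
  show ?thesis unfolding connected_iff_connected_component
  proof (intro ballI)
    fix p q assume "p \<in> ?S" "q \<in> ?S"
    then obtain a b where a: "a \<in> FV F" "a \<in> FV F'" "connected_component ?S p (pos a)"
      and b: "b \<in> FV F" "b \<in> FV F'" "connected_component ?S q (pos b)" using near by meson
    have "connected_component ?S (pos a) (pos b)"
      by (rule vert[OF a(1,2) common_boundary_connected[OF F(1,2) False F(3,4) a(1,2) b(1,2)]])
    then show "connected_component ?S p q"
      using a(3) b(3) connected_component_trans connected_component_sym by metis
  qed
qed

text \<open>\<open>two_sides\<close> with the external face as second face. The external cycle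
  without \<open>a\<close> and \<open>b\<close> stays connected, so there cannot be two components
  with external vertices, and an attached piece would lie inside the edge.\<close>

lemma no_inverted_edge:
  assumes e: "{a, b} \<in> FE Fo" and F: "face F" "F \<noteq> Fo" "a \<in> FV F" "b \<in> FV F"
  shows "{a, b} \<in> FE F"
proof (rule ccontr)
  assume nab: "{a, b} \<notin> FE F"
  have eE: "{a, b} \<in> E" using e by (simp add: bd_edges_def)
  have ab: "a \<noteq> b" "a \<in> FV Fo" "b \<in> FV Fo" using edge_ends[OF eE] FE_subset_FV[OF face_Fo e] by auto
  have no: False if h: "pendant a b K" for K
  proof -
    obtain u where u: "u \<in> K" "u \<in> V" using h unfolding pendant_def by blast
    show False using pendant_on_segment[OF h u(1)] vertex_off[OF eE u(2)] by simp
  qed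
  then obtain x y where xy: "y \<in> V - {a, b}" "y \<notin> reach E (V - {a, b}) x"
      "reach E (V - {a, b}) x \<inter> ext \<noteq> {}" "reach E (V - {a, b}) y \<inter> ext \<noteq> {}"
    using two_sides[OF F(1) face_Fo F(2,3) ab(2) F(4) ab(3,1) nab] by blast
  obtain u v where uv: "u \<in> reach E (V - {a, b}) x" "u \<in> ext" "v \<in> reach E (V - {a, b}) y" "v \<in> ext"
    using xy(3,4) by blast
  have "u \<in> FV Fo - {a, b}" "v \<in> FV Fo - {a, b}" using uv by (auto simp: reach_def ext_eq)
  then have "(u, v) \<in> (steps (inner_edges (FE Fo) (FV Fo - {a, b})))\<^sup>*"
    using cycle_minus_edge_ends[OF Fo_cycle e] unfolding conn_def by blast
  then have "(u, v) \<in> (steps (inner_edges E (V - {a, b})))\<^sup>*"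
    by (rule steps_mono[rotated]) (auto simp: inner_edges_def bd_edges_def bd_vertices_def)
  then have "(x, v) \<in> (steps (inner_edges E (V - {a, b})))\<^sup>*"
    using uv(1) rtrancl_trans unfolding reach_def by fast
  then have "v \<in> reach E (V - {a, b}) x" using uv(3) by (simp add: reach_def)
  then show False using reach_disjoint[OF xy(1,2)] uv(3) by blast
qed

theorem convex_embeddable: "convex_embeddable V E pos c"
proof -
  have "V \<noteq> {}" using ext_subset ext_not_small[of undefined undefined] by blast
  moreover have "\<not> has_inverted_subgraph V E pos c"
  proof
    assume "has_inverted_subgraph V E pos c"
    then obtain F e where h: "face F" "bounded F" "e \<in> FE Fo" "e \<subseteq> FV F" "e \<notin> FE F"
      unfolding has_inverted_subgraph_def ext_edges_eq by blast
    have "e \<in> E" using h(3) by (simp add: bd_edges_def)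
    then obtain a b where "e = {a, b}" using edgeE by metis
    then show False using no_inverted_edge[of a b F] h bounded_iff[OF h(1)] by auto
  qed
  ultimately show ?thesis
    unfolding convex_embeddable_def using face_cycle connected_common_frontier bounded_iff by blast
qed

end

theorem theorem2p1:
  fixes V :: "'v set" and E :: "'v set set"
    and pos :: "'v \<Rightarrow> real^2" and c :: "'v set \<Rightarrow> real \<Rightarrow> real^2"
  assumes "plane_graph V E pos c"
    and "graph_connected V E"
    and "simple_cycle (ext_vertices V E pos c) (ext_edges V E pos c)"
  shows "(convex_embeddable V E pos c \<longleftrightarrow>
           (\<forall>f. convex_combination_map V E pos c f \<longrightarrow> is_straight_embedding V E f))
       \<and> ((\<forall>f. convex_combination_map V E pos c f \<longrightarrow> is_straight_embedding V E f) \<longleftrightarrow>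
           (\<exists>f. convex_combination_map V E pos c f \<and> is_straight_embedding V E f))"
proof -
  interpret plane_connected V E pos c
    by unfold_locales (use assms in auto)
  have ab: "is_straight_embedding V E f" if "convex_embeddable V E pos c" "convex_combination_map V E pos c f" for f
  proof -
    interpret tutte V E pos c f by unfold_locales (use that in auto)
    show ?thesis by (rule straight_embedding)
  qed
  have ca: "convex_embeddable V E pos c" if "convex_combination_map V E pos c f" "is_straight_embedding V E f" for f
  proof -
    interpret straight_map V E pos c f by unfold_locales (use that in auto)
    show ?thesis by (rule convex_embeddable)
  qed
  \<comment> \<open>Existence of a convex combination map leads from (b) to (c); conversely (c)
    yields convex embeddability, which gives (b) back.\<close>
  show ?thesis using ab ca ex_convex_combination_map by blast
qed

end
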